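(* Let $k\ge1$ be any fixed number. (1) For every $2\mathrm{NPDA}(k)$ machine $\mathcal M$, there is a deterministic context-free language $L$ and a linear-time reduction from the $\mathcal M$-language recognition problem to the $(L,k)$-intersection reachability problem for DFAs. (2) For every context-free language $L$, there is a linear-time reduction from the $(L,k)$-intersection reachability problem for NFAs (respectively, for DFAs) to the $\mathrm{PDA}\cap\mathrm{NFA}^{k-1}$ non-emptiness problem (respectively, the $\mathrm{PDA}\cap\mathrm{DFA}^{k-1}$ non-emptiness problem). Moreover, the reduction produces a DPDA if $L$ is a deterministic context-free language and the first given NFA is a DFA. (3) There is a fixed $2\mathrm{NPDA}(k)$ machine $\mathcal M_k$ such that the $\mathrm{PDA}\cap\mathrm{NFA}^{k-1}$ non-emptiness problem has a linear-time reduction to $\mathcal L(\mathcal M_k)$.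
   Context: PDA: $P=(Q,\Sigma,\Gamma,\delta,q_0,F)$ with finite $\delta\subseteq Q\times(\Sigma\cup\{\varepsilon\})\times\Gamma\times Q\times\Gamma^*$. A configuration is $(p,\gamma)$, $\gamma\in\Gamma^*$ with top on the right; transition $(p,a,\alpha,q,\beta)$ allows the step $(p,\gamma\alpha)\to(q,\gamma\beta)$ reading $a$. $\Gamma$ contains an end-of-stack symbol $Z_0$ such that in each transition $\beta$ contains $Z_0$ iff $\alpha=Z_0$ and $\beta=Z_0\gamma$ with $\gamma\in(\Gamma\setminus\{Z_0\})^*$. A word is accepted if some sequence of steps from $(q_0,Z_0)$ reading it (with $\varepsilon$-transitions allowed in between) ends in a state of $F$ with empty stack (only the marker $Z_0$ left). A PDA is deterministic (DPDA) if $\delta$ is a partial function of (state, letter or $\varepsilon$, top symbol) and for each state $q$ either $\delta(q,a,\alpha)$ is defined for all $a\in\Sigma,\alpha\in\Gamma$ and $\delta(q,\varepsilon,\cdot)$ is undefined, or $\delta(q,\varepsilon,\alpha)$ is defined for all $\alpha$ and $\delta(q,a,\cdot)$ is undefined for all $a\in\Sigma$. NFAs are PDAs without $\varepsilon$-transitions and without stack operations; DFAs are NFAs whose transition relation is a function. A (deterministic) context-free language, CFL (DCFL), is the language of a PDA (DPDA). $2\mathrm{NPDA}(k)$: a tuple $(Q,\Sigma,\Gamma,\delta,q_0,F)$ with $\delta\subseteq Q\times\Sigma^k\times\Gamma\times Q\times\Gamma^*\times\{-1,0,+1\}^k$, where $\Sigma$ contains end markers $\lhd,\rhd$ and $\Gamma$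 contains $Z_0$. The input $w\in(\Sigma\setminus\{\lhd,\rhd\})^*$ is placed on a read-only tape as $\lhd w\rhd$ and scanned by $k$ heads. A transition $(q,(a_1,\dots,a_k),\alpha,q',\gamma',(d_1,\dots,d_k))$ applies in state $q$ when head $i$ reads $a_i$ for all $i$ and the top of the stack is $\alpha$; it moves to $q'$, replaces $\alpha$ by $\gamma'$, and moves head $i$ by $d_i$. It is required that $d_i\ne-1$ if $a_i=\lhd$ and $d_i\neq+1$ if $a_i=\rhd$; if $\alpha=Z_0$ then $\gamma'\in Z_0(\Gamma\setminus\{Z_0\})^*$; and $Z_0$ occurs in $\gamma'$ only if $\alpha=Z_0$. Initially the state is $q_0$, all heads are on $\lhd$ and the stack is $Z_0$; $w$ is accepted if some run reaches a state of $F$ with all heads on $\rhd$ and stack $Z_0$. $\mathcal L(\mathcal M)$ is the set of accepted words. Problems. $\mathcal M$-language recognition (fixed $2\mathrm{NPDA}(k)$ $\mathcal M$): given a word $w$, is $w\in\mathcal L(\mathcal M)$? $(L,k)$-intersection reachability for NFAs (fixed CFL $L$): given $k$ NFAs $A_1,\dots,A_k$ over the same alphabet as $L$, does $\mathcal L(A_1)\cap\dots\cap\mathcal L(A_k)$ contain a word from $L$? "For DFAs": all $A_i$ are DFAs. $\mathrm{PDA}\cap\mathrm{NFA}^{k-1}$ non-emptiness (fixed stack alphabet $\Gamma$): given a PDA $P$ and $k-1$ NFAs $A_1,\dots,A_{k-1}$ over a common input alphabet $\Sigma$, is $\mathcal L(P)\cap\mathcal L(A_1)\cap\dots\cap\mathcal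 L(A_{k-1})\ne\emptyset$? $\mathrm{PDA}\cap\mathrm{DFA}^{k-1}$ is the special case where all NFAs are DFAs. The stack alphabet in the non-emptiness problem has constant size; in (2) the stack alphabet of the produced PDA depends only on $L$. A linear-time reduction from problem $\Pi_1$ to $\Pi_2$ is a linear-time algorithm mapping each instance $x$ of $\Pi_1$ to an instance $f(x)$ of $\Pi_2$ such that $x$ is a yes-instance iff $f(x)$ is. Automata given as inputs are encoded as words over a fixed alphabet; a reduction to $\mathcal L(\mathcal M_k)$ is one to the $\mathcal M_k$-language recognition problem. *)

theory Defs
  imports Main
begin

section \<open>Pushdown automata\<close>

text \<open>Stacks are lists with the top at the \<^emph>\<open>end\<close>. The bottom marker is a component of the record.\<close>

record ('q, 'a, 'g) pda =
  pda_states :: "'q set"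
  pda_alphabet :: "'a set"
  pda_stack :: "'g set"
  pda_bottom :: 'g
  pda_trans :: "('q \<times> 'a option \<times> 'g \<times> 'q \<times> 'g list) set"
  pda_init :: 'q
  pda_final :: "'q set"

definition bottom_respecting :: "'g set \<Rightarrow> 'g \<Rightarrow> 'g \<Rightarrow> 'g list \<Rightarrow> bool" where
  "bottom_respecting \<Gamma> Z \<alpha> \<beta> \<longleftrightarrow>
     (if \<alpha> = Z then \<exists>\<gamma>\<in>lists (\<Gamma> - {Z}). \<beta> = Z # \<gamma> else \<beta> \<in> lists (\<Gamma> - {Z}))"

definition is_pda :: "('q, 'a, 'g) pda \<Rightarrow> bool" where
  "is_pda P \<longleftrightarrow>
     finite (pda_states P) \<and> finite (pda_alphabet P) \<and> finite (pda_stack P) \<and>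
     finite (pda_trans P) \<and> pda_bottom P \<in> pda_stack P \<and>
     pda_init P \<in> pda_states P \<and> pda_final P \<subseteq> pda_states P \<and>
     (\<forall>(p, a, \<alpha>, q, \<beta>) \<in> pda_trans P.
        p \<in> pda_states P \<and> q \<in> pda_states P \<and> set_option a \<subseteq> pda_alphabet P \<and>
        \<alpha> \<in> pda_stack P \<and> bottom_respecting (pda_stack P) (pda_bottom P) \<alpha> \<beta>)"

text \<open>\<open>pda_run P c w c'\<close>: some sequence of steps from \<open>c\<close> to \<open>c'\<close> reads exactly \<open>w\<close>.\<close>

inductive pda_run :: "('q, 'a, 'g) pda \<Rightarrow> 'q \<times> 'g list \<Rightarrow> 'a list \<Rightarrow> 'q \<times> 'g list \<Rightarrow> bool"
  for P where
  refl: "pda_run P c [] c"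
| eps: "(p, None, \<alpha>, q, \<beta>) \<in> pda_trans P \<Longrightarrow> pda_run P (q, \<gamma> @ \<beta>) w c \<Longrightarrow>
        pda_run P (p, \<gamma> @ [\<alpha>]) w c"
| read: "(p, Some a, \<alpha>, q, \<beta>) \<in> pda_trans P \<Longrightarrow> pda_run P (q, \<gamma> @ \<beta>) w c \<Longrightarrow>
        pda_run P (p, \<gamma> @ [\<alpha>]) (a # w) c"

definition pda_lang :: "('q, 'a, 'g) pda \<Rightarrow> 'a list set" where
  "pda_lang P = {w. \<exists>f\<in>pda_final P. pda_run P (pda_init P, [pda_bottom P]) w (f, [pda_bottom P])}"

definition is_dpda :: "('q, 'a, 'g) pda \<Rightarrow> bool" where
  "is_dpda P \<longleftrightarrow> is_pda P \<and>
     (\<forall>p a \<alpha> q \<beta> q' \<beta>'. (p, a, \<alpha>, q, \<beta>) \<in> pda_trans P \<and> (p, a, \<alpha>, q', \<beta>') \<in> pda_trans P \<longrightarrow>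
        q = q' \<and> \<beta> = \<beta>') \<and>
     (\<forall>p\<in>pda_states P.
        (\<forall>a\<in>pda_alphabet P. \<forall>\<alpha>\<in>pda_stack P. \<exists>q \<beta>. (p, Some a, \<alpha>, q, \<beta>) \<in> pda_trans P) \<and>
        (\<forall>\<alpha> q \<beta>. (p, None, \<alpha>, q, \<beta>) \<notin> pda_trans P)
      \<or>
        (\<forall>\<alpha>\<in>pda_stack P. \<exists>q \<beta>. (p, None, \<alpha>, q, \<beta>) \<in> pda_trans P) \<and>
        (\<forall>a \<alpha> q \<beta>. (p, Some a, \<alpha>, q, \<beta>) \<notin> pda_trans P))"

text \<open>As all components are finite, states and stack symbols may be taken to be natural numbers.\<close>

definition is_cfl :: "'a set \<Rightarrow> 'a list set \<Rightarrow> bool" where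
  "is_cfl \<Sigma> L \<longleftrightarrow> (\<exists>P :: (nat, 'a, nat) pda. is_pda P \<and> pda_alphabet P = \<Sigma> \<and> pda_lang P = L)"

definition is_dcfl :: "'a set \<Rightarrow> 'a list set \<Rightarrow> bool" where
  "is_dcfl \<Sigma> L \<longleftrightarrow> (\<exists>P :: (nat, 'a, nat) pda. is_dpda P \<and> pda_alphabet P = \<Sigma> \<and> pda_lang P = L)"


section \<open>Finite automata\<close>

record ('q, 'a) nfa =
  nfa_states :: "'q set"
  nfa_alphabet :: "'a set"
  nfa_trans :: "('q \<times> 'a \<times> 'q) set"
  nfa_init :: 'q
  nfa_final :: "'q set"

definition is_nfa :: "('q, 'a) nfa \<Rightarrow> bool" where
  "is_nfa A \<longleftrightarrow>
     finite (nfa_states A) \<and> finite (nfa_alphabet A) \<and>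
     nfa_trans A \<subseteq> nfa_states A \<times> nfa_alphabet A \<times> nfa_states A \<and>
     nfa_init A \<in> nfa_states A \<and> nfa_final A \<subseteq> nfa_states A"

definition is_dfa :: "('q, 'a) nfa \<Rightarrow> bool" where
  "is_dfa A \<longleftrightarrow> is_nfa A \<and>
     (\<forall>p\<in>nfa_states A. \<forall>a\<in>nfa_alphabet A. \<exists>!q. (p, a, q) \<in> nfa_trans A)"

inductive nfa_run :: "('q, 'a) nfa \<Rightarrow> 'q \<Rightarrow> 'a list \<Rightarrow> 'q \<Rightarrow> bool" for A where
  refl: "nfa_run A p [] p"
| read: "(p, a, q) \<in> nfa_trans A \<Longrightarrow> nfa_run A q w r \<Longrightarrow> nfa_run A p (a # w) r"

definition nfa_lang :: "('q, 'a) nfa \<Rightarrow> 'a list set" where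
  "nfa_lang A = {w. \<exists>f\<in>nfa_final A. nfa_run A (nfa_init A) w f}"


section \<open>Two-way multi-head pushdown automata\<close>

record ('q, 'a, 'g) npda2 =
  npda2_states :: "'q set"
  npda2_alphabet :: "'a set"
  npda2_left :: 'a
  npda2_right :: 'a
  npda2_stack :: "'g set"
  npda2_bottom :: 'g
  npda2_trans :: "('q \<times> 'a list \<times> 'g \<times> 'q \<times> 'g list \<times> int list) set"
  npda2_init :: 'q
  npda2_final :: "'q set"

definition is_npda2 :: "nat \<Rightarrow> ('q, 'a, 'g) npda2 \<Rightarrow> bool" where
  "is_npda2 k M \<longleftrightarrow>
     finite (npda2_states M) \<and> finite (npda2_alphabet M) \<and> finite (npda2_stack M) \<and>
     finite (npda2_trans M) \<and>
     npda2_left M \<in> npda2_alphabet M \<and> npda2_right M \<in> npda2_alphabet M \<and>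
     npda2_left M \<noteq> npda2_right M \<and> npda2_bottom M \<in> npda2_stack M \<and>
     npda2_init M \<in> npda2_states M \<and> npda2_final M \<subseteq> npda2_states M \<and>
     (\<forall>(q, as, \<alpha>, q', \<gamma>, ds) \<in> npda2_trans M.
        q \<in> npda2_states M \<and> q' \<in> npda2_states M \<and>
        length as = k \<and> set as \<subseteq> npda2_alphabet M \<and>
        \<alpha> \<in> npda2_stack M \<and> bottom_respecting (npda2_stack M) (npda2_bottom M) \<alpha> \<gamma> \<and>
        length ds = k \<and> set ds \<subseteq> {-1, 0, 1} \<and>
        (\<forall>i<k. (as ! i = npda2_left M \<longrightarrow> ds ! i \<noteq> -1) \<and> (as ! i = npda2_right M \<longrightarrow> ds ! i \<noteq> 1)))"

definition npda2_input_letters :: "('q, 'a, 'g) npda2 \<Rightarrow> 'a set" where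
  "npda2_input_letters M = npda2_alphabet M - {npda2_left M, npda2_right M}"

definition npda2_tape :: "('q, 'a, 'g) npda2 \<Rightarrow> 'a list \<Rightarrow> 'a list" where
  "npda2_tape M w = npda2_left M # w @ [npda2_right M]"

text \<open>Head positions are indices into the tape. They stay within the tape because of the conditions
  on moves at the end markers, so no truncation occurs in \<open>nat\<close>.\<close>

definition move_head :: "nat \<Rightarrow> int \<Rightarrow> nat" where
  "move_head h d = nat (int h + d)"

inductive npda2_step ::
    "('q, 'a, 'g) npda2 \<Rightarrow> 'a list \<Rightarrow> 'q \<times> nat list \<times> 'g list \<Rightarrow> 'q \<times> nat list \<times> 'g list \<Rightarrow> bool"
  for M w where
  "(q, map (\<lambda>h. npda2_tape M w ! h) hs, \<alpha>, q', \<gamma>', ds) \<in> npda2_trans M \<Longrightarrow>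
   npda2_step M w (q, hs, \<gamma> @ [\<alpha>]) (q', map2 move_head hs ds, \<gamma> @ \<gamma>')"

definition npda2_lang :: "nat \<Rightarrow> ('q, 'a, 'g) npda2 \<Rightarrow> 'a list set" where
  "npda2_lang k M = {w \<in> lists (npda2_input_letters M). \<exists>f\<in>npda2_final M.
     (npda2_step M w)\<^sup>*\<^sup>* (npda2_init M, replicate k 0, [npda2_bottom M])
                       (f, replicate k (length w + 1), [npda2_bottom M])}"


section \<open>Linear-time algorithms\<close>

text \<open>The machine model is the deterministic multitape Turing machine computing a function on words:
  a read-only two-way input tape delimited by end markers, finitely many read-write work tapes that
  are infinite in both directions, with blank \<open>0\<close>, and a write-only output.
  It halts when the transition function is undefined.\<close>

datatype 'a cell = Left_End | Letter 'a | Right_End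

record ('a, 'b) tm =
  tm_states :: "nat set"
  tm_symbols :: "nat set"
  tm_tapes :: nat
  tm_init :: nat
  tm_delta :: "nat \<Rightarrow> 'a cell \<Rightarrow> nat list \<Rightarrow> (nat \<times> int \<times> (nat \<times> int) list \<times> 'b list) option"

text \<open>On finite \<open>A\<close> only finitely many arguments of \<open>tm_delta\<close> are relevant, so the length of the
  word that is output in one step is bounded.\<close>

definition is_tm :: "'a set \<Rightarrow> ('a, 'b) tm \<Rightarrow> bool" where
  "is_tm A M \<longleftrightarrow>
     finite A \<and> finite (tm_states M) \<and> finite (tm_symbols M) \<and> 0 \<in> tm_symbols M \<and>
     tm_init M \<in> tm_states M \<and>
     (\<forall>q\<in>tm_states M. \<forall>x\<in>{Left_End, Right_End} \<union> Letter ` A. \<forall>us\<in>lists (tm_symbols M).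
        \<forall>q' d acts out. length us = tm_tapes M \<and> tm_delta M q x us = Some (q', d, acts, out) \<longrightarrow>
          q' \<in> tm_states M \<and> d \<in> {-1, 0, 1} \<and>
          (x = Left_End \<longrightarrow> d \<noteq> -1) \<and> (x = Right_End \<longrightarrow> d \<noteq> 1) \<and>
          length acts = tm_tapes M \<and> set acts \<subseteq> tm_symbols M \<times> {-1, 0, 1})"

definition tm_input :: "'a list \<Rightarrow> 'a cell list" where
  "tm_input w = Left_End # map Letter w @ [Right_End]"

text \<open>A configuration consists of the state, the input head position, content and head position of
  every work tape, and the output produced so far.\<close>

type_synonym 'b tm_config = "nat \<times> nat \<times> ((int \<Rightarrow> nat) \<times> int) list \<times> 'b list"

definition tm_next :: "('a, 'b) tm \<Rightarrow> 'a list \<Rightarrow> 'b tm_config \<Rightarrow> (nat \<times> int \<times> (nat \<times> int) list \<times> 'b list) option" where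
  "tm_next M w = (\<lambda>(q, h, ts, out). tm_delta M q (tm_input w ! h) (map (\<lambda>(T, i). T i) ts))"

inductive tm_step :: "('a, 'b) tm \<Rightarrow> 'a list \<Rightarrow> 'b tm_config \<Rightarrow> 'b tm_config \<Rightarrow> bool" for M w where
  "tm_next M w (q, h, ts, out) = Some (q', d, acts, out') \<Longrightarrow>
   tm_step M w (q, h, ts, out)
     (q', move_head h d, map2 (\<lambda>(T, i) (s, e). (T(i := s), i + e)) ts acts, out @ out')"

definition tm_computes :: "('a, 'b) tm \<Rightarrow> 'a list \<Rightarrow> nat \<Rightarrow> 'b list \<Rightarrow> bool" where
  "tm_computes M w t v \<longleftrightarrow> (\<exists>q h ts.
     (tm_step M w ^^ t) (tm_init M, 0, replicate (tm_tapes M) (\<lambda>_. 0, 0), []) (q, h, ts, v) \<and>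
     tm_next M w (q, h, ts, v) = None)"


section \<open>Problems and reductions\<close>

text \<open>\<open>encodes \<Pi> w x\<close>: the word \<open>w\<close> encodes \<open>x\<close>, and \<open>x\<close> is an instance of \<open>\<Pi>\<close>.\<close>

record ('i, 'a) problem =
  letters :: "'a set"
  encodes :: "'a list \<Rightarrow> 'i \<Rightarrow> bool"
  yes_instance :: "'i \<Rightarrow> bool"

text \<open>The parameter \<open>R\<close> allows one to impose further conditions that relate an instance and the
  instance produced from it.\<close>

definition linear_time_reduction ::
    "('i \<Rightarrow> 'j \<Rightarrow> bool) \<Rightarrow> ('i, 'a) problem \<Rightarrow> ('j, 'b) problem \<Rightarrow> bool" where
  "linear_time_reduction R \<Pi>\<^sub>1 \<Pi>\<^sub>2 \<longleftrightarrow> (\<exists>M c. is_tm (letters \<Pi>\<^sub>1) M \<and>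
     (\<forall>w x. encodes \<Pi>\<^sub>1 w x \<longrightarrow> (\<exists>t v y.
        tm_computes M w t v \<and> t \<le> c * (length w + 1) \<and> encodes \<Pi>\<^sub>2 v y \<and>
        (yes_instance \<Pi>\<^sub>1 x \<longleftrightarrow> yes_instance \<Pi>\<^sub>2 y) \<and> R x y)))"

abbreviation linear_time_reducible :: "('i, 'a) problem \<Rightarrow> ('j, 'b) problem \<Rightarrow> bool" where
  "linear_time_reducible \<equiv> linear_time_reduction (\<lambda>_ _. True)"


section \<open>Encoding of automata\<close>

text \<open>Letters and stack symbols are natural numbers, written in binary. An automaton is written as
  the sequence of its states, each with a label, flags, and its outgoing transitions.
  The target of a transition is referred to in one of two ways: by its label, provided that no other
  state of the automaton has the same label, or relative to the source state, by the distance in the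
  sequence, in unary. Labels alone give the usual encoding of size \<open>O(m log n)\<close>.
  The relative references are needed because with labels only, every encoding of \<open>n\<close> states, all of
  them targets of transitions, has length at least of order \<open>n log n\<close>; so no automaton with a state
  for each position of a word could be output in time linear in the length of the word.\<close>

datatype sym = Bit bool | Semi | Comma | Eps | State | Init | Final | Trans | Fwd | Bwd | Label | Auto

fun code_nat :: "nat \<Rightarrow> sym list" where
  "code_nat n = (if n = 0 then [] else Bit (odd n) # code_nat (n div 2))"

declare code_nat.simps [simp del]

definition code_nats :: "nat list \<Rightarrow> sym list" where
  "code_nats ns = concat (map (\<lambda>n. code_nat n @ [Semi]) ns)"

text \<open>\<open>code_ref ls i j r\<close>: in an automaton with the list \<open>ls\<close> of labels, \<open>r\<close> is a reference from the
  \<open>i\<close>-th to the \<open>j\<close>-th state.\<close>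

inductive code_ref :: "bool list list \<Rightarrow> nat \<Rightarrow> nat \<Rightarrow> sym list \<Rightarrow> bool" for ls where
  fwd: "code_ref ls i (i + d) (replicate d Fwd)"
| bwd: "code_ref ls (j + d) j (replicate d Bwd)"
| label: "j < length ls \<Longrightarrow> (\<forall>j'<length ls. ls ! j' = ls ! j \<longrightarrow> j' = j) \<Longrightarrow>
          code_ref ls i j (Label # map Bit (ls ! j))"

text \<open>\<open>out p\<close> is the set of transitions from \<open>p\<close>, each given by the code of its actions and its target.
  The order of the states and of the transitions is arbitrary.\<close>

definition code_state ::
    "'q list \<Rightarrow> bool list list \<Rightarrow> 'q \<Rightarrow> 'q set \<Rightarrow> ('q \<Rightarrow> (sym list \<times> 'q) set) \<Rightarrow> nat \<Rightarrow> sym list \<Rightarrow> bool" where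
  "code_state qs ls q0 F out i b \<longleftrightarrow> (\<exists>ts :: (sym list \<times> nat \<times> sym list) list.
     (\<forall>(u, j, r) \<in> set ts. j < length qs \<and> code_ref ls i j r) \<and>
     {(u, qs ! j) | u j r. (u, j, r) \<in> set ts} = out (qs ! i) \<and>
     b = [State] @ map Bit (ls ! i) @ (if qs ! i = q0 then [Init] else []) @
         (if qs ! i \<in> F then [Final] else []) @ concat (map (\<lambda>(u, j, r). u @ r) ts))"

definition code_automaton ::
    "'q set \<Rightarrow> 'q \<Rightarrow> 'q set \<Rightarrow> ('q \<Rightarrow> (sym list \<times> 'q) set) \<Rightarrow> sym list \<Rightarrow> bool" where
  "code_automaton Q q0 F out w \<longleftrightarrow> (\<exists>qs ls bs.
     distinct qs \<and> set qs = Q \<and> length ls = length qs \<and> length bs = length qs \<and>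
     (\<forall>i<length qs. code_state qs ls q0 F out i (bs ! i)) \<and> w = concat bs)"

definition code_nfa :: "('q, nat) nfa \<Rightarrow> sym list \<Rightarrow> bool" where
  "code_nfa A = code_automaton (nfa_states A) (nfa_init A) (nfa_final A)
     (\<lambda>p. {([Trans] @ code_nat a @ [Comma], q) | a q. (p, a, q) \<in> nfa_trans A})"

definition code_pda :: "('q, nat, nat) pda \<Rightarrow> sym list \<Rightarrow> bool" where
  "code_pda P = code_automaton (pda_states P) (pda_init P) (pda_final P)
     (\<lambda>p. {([Trans] @ (case a of None \<Rightarrow> [Eps] | Some b \<Rightarrow> code_nat b) @ [Comma] @
            code_nat \<alpha> @ [Comma] @ code_nats \<beta> @ [Comma], q) | a \<alpha> q \<beta>.
          (p, a, \<alpha>, q, \<beta>) \<in> pda_trans P})"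

definition code_nfas :: "('q, nat) nfa list \<Rightarrow> sym list \<Rightarrow> bool" where
  "code_nfas As w \<longleftrightarrow> (\<exists>ws. list_all2 code_nfa As ws \<and> w = concat (map (\<lambda>u. Auto # u) ws))"


section \<open>The problems\<close>

definition recognition_problem :: "nat \<Rightarrow> ('q, 'a, 'g) npda2 \<Rightarrow> ('a list, 'a) problem" where
  "recognition_problem k M =
     \<lparr>letters = npda2_input_letters M,
      encodes = (\<lambda>w x. x \<in> lists (npda2_input_letters M) \<and> w = x),
      yes_instance = (\<lambda>x. x \<in> npda2_lang k M)\<rparr>"

text \<open>In the following two problems, \<open>D\<close> is \<^const>\<open>is_nfa\<close> or \<^const>\<open>is_dfa\<close>.\<close>

definition intersection_problem ::
    "((nat, nat) nfa \<Rightarrow> bool) \<Rightarrow> nat set \<Rightarrow> nat list set \<Rightarrow> nat \<Rightarrow> ((nat, nat) nfa list, sym) problem" where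
  "intersection_problem D \<Sigma> L k =
     \<lparr>letters = UNIV,
      encodes = (\<lambda>w As. length As = k \<and> (\<forall>A\<in>set As. D A \<and> nfa_alphabet A = \<Sigma>) \<and> code_nfas As w),
      yes_instance = (\<lambda>As. \<exists>u\<in>L. \<forall>A\<in>set As. u \<in> nfa_lang A)\<rparr>"

text \<open>Here \<open>k\<close> is the total number of automata, and the input alphabet is part of the instance.\<close>

definition nonemptiness_problem ::
    "((nat, nat) nfa \<Rightarrow> bool) \<Rightarrow> nat set \<Rightarrow> nat \<Rightarrow> nat \<Rightarrow>
     ((nat, nat, nat) pda \<times> (nat, nat) nfa list, sym) problem" where
  "nonemptiness_problem D \<Gamma> Z k =
     \<lparr>letters = UNIV,
      encodes = (\<lambda>w (P, As).
        is_pda P \<and> pda_stack P = \<Gamma> \<and> pda_bottom P = Z \<and> length As = k - 1 \<and>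
        (\<forall>A\<in>set As. D A \<and> nfa_alphabet A = pda_alphabet P) \<and>
        (\<exists>as v u. set as = pda_alphabet P \<and> code_pda P v \<and> code_nfas As u \<and>
           w = code_nats as @ Auto # v @ u)),
      yes_instance = (\<lambda>(P, As). \<exists>u\<in>pda_lang P. \<forall>A\<in>set As. u \<in> nfa_lang A)\<rparr>"

end

theory Submission
  imports Defs "HOL-Library.Countable" "HOL-Library.Nat_Bijection"
begin

text \<open>
  (1) A run of the machine is a sequence of transitions. That such a sequence is consistent for the states
  and the stack is checked by a fixed DPDA over the alphabet of transitions; that it is consistent for
  the \<open>i\<close>-th head is checked by a DFA whose states are the positions on the tape.

  (2) The PDA for \<open>L\<close> is multiplied with the first NFA. As the PDA is fixed, each state of the NFA gives
  rise to boundedly many product states, and the part of the encoding that belongs to them is produced by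
  boundedly many left-to-right passes of a finite transducer over the code of the state.

  (3) The machine \<open>M\<^sub>k\<close> simulates the given automata jointly, one head per automaton, with the head at the
  current state in the encoding, and with the stack of the given PDA. In each step, every head guesses a
  transition; the letters are compared by moving all heads simultaneously, and references to states are
  resolved with the help of the stack. The machine is written as a regular program whose semantics
  is compositional.

  Turing machines without work tapes, that is, two-way transducers, suffice for all the reductions.
\<close>

section \<open>Two-way transducers\<close>

text \<open>Linear time shapes the constructions. In (1) a DFA has one state per tape cell, so its
  states cannot all carry distinct labels; heads move by at most one cell, hence unary distances do,
  and only the sink, which may be far away, needs a label. In (2) one NFA transition contributes to
  several product states, but the code of a product state has to be contiguous; this is why the code
  of an NFA state is reread for every PDA state and every PDA transition. Unary distances grow by
  the constant number of PDA states and labels by a constant prefix. In (3) the machine is fixed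
  whereas letters, labels and distances are unbounded, so none of them fits into the finite control.
  The only other memory is the single stack, which also holds the stack of the PDA. Hence whatever a
  head does on its own, apart from the genuine stack operation, has to leave the stack as it was;
  then the heads can work one after the other. A wrong guess is never repaired, it blocks the run.
  Therefore programs are described by equivalences: every run that is not blocked has the intended
  effect.\<close>

inductive transducer_run ::
    "('s \<Rightarrow> 'a cell \<Rightarrow> ('s \<times> int \<times> 'b list) option) \<Rightarrow> 'a list \<Rightarrow> 's \<times> nat \<Rightarrow> nat \<Rightarrow> 'b list \<Rightarrow> 's \<times> nat \<Rightarrow> bool"
  for f w where
  stop: "transducer_run f w c 0 [] c"
| step: "f s (tm_input w ! h) = Some (s', d, u) \<Longrightarrow>
    transducer_run f w (s', move_head h d) t v c \<Longrightarrow> transducer_run f w (s, h) (Suc t) (u @ v) c"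

lemma transducer_run_trans:
  "transducer_run f w c t v c' \<Longrightarrow> transducer_run f w c' t' v' c'' \<Longrightarrow>
   transducer_run f w c (t + t') (v @ v') c''"
  by (induction rule: transducer_run.induct) (auto intro: transducer_run.step)

lemma transducer_run_single:
  "f s (tm_input w ! h) = Some (s', d, u) \<Longrightarrow> transducer_run f w (s, h) 1 u (s', move_head h d)"
  using transducer_run.step[of f s w h s' d u 0 "[]"] by (auto intro: transducer_run.stop)

text \<open>Machine states are natural numbers, so a finite set of states of a countable type is
  carried over by \<open>to_nat\<close>. Without work tapes all tape lists are empty, and the
  transducer is simulated step by step, with the same time and output.\<close>

lemma transducer_tm:
  fixes f :: "'s :: countable \<Rightarrow> 'a cell \<Rightarrow> ('s \<times> int \<times> 'b list) option"
  assumes A: "finite A" and S: "finite S" "s0 \<in> S"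
    and closed: "\<And>s x s' d u. s \<in> S \<Longrightarrow> x \<in> {Left_End, Right_End} \<union> Letter ` A \<Longrightarrow> f s x = Some (s', d, u) \<Longrightarrow>
      s' \<in> S \<and> d \<in> {-1, 0, 1} \<and> (x = Left_End \<longrightarrow> d \<noteq> -1) \<and> (x = Right_End \<longrightarrow> d \<noteq> 1)"
  shows "\<exists>M. is_tm A M \<and> (\<forall>w t v s h. transducer_run f w (s0, 0) t v (s, h) \<longrightarrow>
    f s (tm_input w ! h) = None \<longrightarrow> tm_computes M w t v)"
proof -
  define M :: "('a, 'b) tm" where
    "M = \<lparr>tm_states = to_nat ` S, tm_symbols = {0}, tm_tapes = 0, tm_init = to_nat s0,
      tm_delta = (\<lambda>q x us. map_option (\<lambda>(s', d, u). (to_nat s', d, [], u)) (f (from_nat q) x))\<rparr>"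
  have tm: "is_tm A M"
  proof -
    have "q' \<in> tm_states M \<and> d \<in> {-1, 0, 1} \<and> (x = Left_End \<longrightarrow> d \<noteq> -1) \<and> (x = Right_End \<longrightarrow> d \<noteq> 1) \<and>
        length acts = tm_tapes M \<and> set acts \<subseteq> tm_symbols M \<times> {-1, 0, 1}"
      if q: "q \<in> tm_states M" and x: "x \<in> {Left_End, Right_End} \<union> Letter ` A" and delta: "tm_delta M q x us = Some (q', d, acts, out)"
      for q x us q' d acts out
    proof -
      obtain s where sS: "s \<in> S" "q = to_nat s" using q by (auto simp: M_def)
      then obtain s' where s: "s \<in> S" "f s x = Some (s', d, out)" "q' = to_nat s'" "acts = []"
        using delta by (auto simp: M_def)
      show ?thesis using closed[OF s(1) x s(2)] s by (auto simp: M_def)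
    qed
    then show ?thesis
      unfolding is_tm_def
      by (intro conjI ballI allI impI; (elim conjE)?; (blast | simp add: M_def A S))
  qed
  \<comment> \<open>A machine configuration carries all the output so far, a transducer run only the
    new one; so the earlier output \<open>o'\<close> has to be arbitrary in the induction.\<close>
  have run: "(tm_step M w ^^ t) (to_nat (fst c), snd c, [], o') (to_nat (fst c'), snd c', [], o' @ v)"
    if "transducer_run f w c t v c'" for w c t v c' o'
    using that
  proof (induction arbitrary: o' rule: transducer_run.induct)
    case (step s h s' d u t v c)
    have "tm_step M w (to_nat s, h, [], o') (to_nat s', move_head h d, [], o' @ u)"
      using tm_step.intros[of M w "to_nat s" h "[]" o' "to_nat s'" d "[]" u] step.hyps(1)
      by (auto simp: tm_next_def M_def)
    from relpowp_Suc_I2[of "tm_step M w", OF this] step.IH[of "o' @ u"] show ?case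
      by (metis append.assoc fst_conv snd_conv)
  qed auto
  have "tm_computes M w t v" if "transducer_run f w (s0, 0) t v (s, h)" "f s (tm_input w ! h) = None" for w t v s h
    unfolding tm_computes_def
    using run[OF that(1), of "[]"] that(2)
    by (intro exI[of _ "to_nat s"] exI[of _ h] exI[of _ "[]"]) (auto simp: tm_next_def M_def)
  with tm show ?thesis by blast
qed

section \<open>Rescanning a tape block by block\<close>

lemma move_head_0 [simp]: "move_head h 0 = h"
  and move_head_1 [simp]: "move_head h 1 = Suc h"
  and move_head_neg1 [simp]: "move_head h (-1) = h - 1"
  by (auto simp: move_head_def nat_add_distrib)

text \<open>The run of a Mealy machine: last state and total output.\<close>

fun scan :: "('s \<Rightarrow> 'x \<Rightarrow> 's \<times> 'b list) \<Rightarrow> 's \<Rightarrow> 'x list \<Rightarrow> 's \<times> 'b list" where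
  "scan g s [] = (s, [])"
| "scan g s (x # xs) = (fst (scan g (fst (g s x)) xs), snd (g s x) @ snd (scan g (fst (g s x)) xs))"

text \<open>A subsequential transducer: \<open>e\<close> adds output that can only be decided when
  the block is over, for instance when a reference turns out to be empty.\<close>

definition pass_out :: "('s \<Rightarrow> 'x \<Rightarrow> 's \<times> 'b list) \<Rightarrow> ('s \<Rightarrow> 'b list) \<Rightarrow> 's \<Rightarrow> 'x list \<Rightarrow> 'b list" where
  "pass_out g e s xs = snd (scan g s xs) @ e (fst (scan g s xs))"

lemma pass_out_Nil [simp]: "pass_out g e s [] = e s"
  by (simp add: pass_out_def)

lemma pass_out_Cons: "pass_out g e s (x # xs) = snd (g s x) @ pass_out g e (fst (g s x)) xs"
  by (simp add: pass_out_def)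

text \<open>\<open>B\<close> contains the cells that begin a block, so that both ends of a block can
  be found: it is over at the next cell in \<open>B\<close>, and the way back ends at the nearest
  cell in \<open>B\<close> on the left. The mode depends only on the first cells of the blocks met
  so far. The maps \<open>init\<close>, \<open>g\<close> and \<open>e\<close> describe the
  \<open>j\<close>-th pass over a block.\<close>

locale rescanner =
  fixes A :: "'a set" and B :: "'a cell set" and passes :: nat
    and modes :: "'m :: countable set" and m0 :: 'm and upd :: "'m \<Rightarrow> 'a cell \<Rightarrow> 'm"
    and S :: "'s :: countable set" and init :: "nat \<Rightarrow> 'm \<Rightarrow> 's"
    and g :: "nat \<Rightarrow> 's \<Rightarrow> 'a cell \<Rightarrow> 's \<times> 'b list" and e :: "nat \<Rightarrow> 's \<Rightarrow> 'b list"
  assumes fin: "finite A" "finite modes" "finite S"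
    and B: "Left_End \<in> B" "Right_End \<notin> B"
    and passes: "passes > 0"
    and modes: "m0 \<in> modes" "\<And>m x. m \<in> modes \<Longrightarrow> upd m x \<in> modes"
    and S: "\<And>j m. m \<in> modes \<Longrightarrow> init j m \<in> S" "\<And>j s x. s \<in> S \<Longrightarrow> fst (g j s x) \<in> S"
begin

definition block_out :: "'m \<Rightarrow> 'a cell list \<Rightarrow> 'b list" where
  "block_out m b = concat (map (\<lambda>j. pass_out (g j) (e j) (init j m) b) [0..<passes])"

fun rescan :: "'m \<Rightarrow> 'a cell list list \<Rightarrow> 'b list" where
  "rescan m [] = []"
| "rescan m (b # bs) = block_out (upd m (hd b)) b @ rescan (upd m (hd b)) bs"

definition is_block :: "'a cell list \<Rightarrow> bool" where
  "is_block b \<longleftrightarrow> (\<exists>x ys. b = x # ys \<and> x \<in> B \<and> set ys \<inter> B = {})"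

text \<open>In a state \<open>(m, j, ph, s)\<close>, the phase \<open>ph\<close> is 0 at the beginning of the \<open>j\<close>-th pass over a block,
  1 inside the block, 2 when the machine halts, and 3 while it returns to the beginning of the block.\<close>

definition delta :: "'m \<times> nat \<times> nat \<times> 's \<Rightarrow> 'a cell \<Rightarrow> (('m \<times> nat \<times> nat \<times> 's) \<times> int \<times> 'b list) option" where
  "delta = (\<lambda>(m, j, ph, s) x.
     if ph = 0 then
       (if x = Right_End then None
        else Some ((m, j, 1, fst (g j (init j m) x)), 1, snd (g j (init j m) x)))
     else if ph = 1 then
       (if x \<in> B then
          (if Suc j < passes then Some ((m, Suc j, 3, s), if x = Left_End then 0 else -1, e j s)
           else Some ((upd m x, 0, 0, s), 0, e j s))
        else if x = Right_End then
          Some (if Suc j < passes then (m, Suc j, 3, s) else (m, j, 2, s), 0, snd (g j s x) @ e j (fst (g j s x)))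
        else Some ((m, j, 1, fst (g j s x)), 1, snd (g j s x)))
     else if ph = 3 then
       (if x \<in> B then Some ((m, j, 0, s), 0, []) else Some ((m, j, 3, s), -1, []))
     else None)"

definition all_states :: "('m \<times> nat \<times> nat \<times> 's) set" where
  "all_states = modes \<times> {..passes} \<times> {..3} \<times> S"

lemma finite_all_states: "finite all_states"
  using fin by (auto simp: all_states_def)

text \<open>\<open>is_tm\<close> constrains every transition, also those that no run uses. A run
  never meets \<open>Left_End\<close> inside a block, but \<open>delta\<close> has to stay put
  there; the way back stops at \<open>Left_End\<close> because it lies in \<open>B\<close>.\<close>

lemma delta_closed:
  assumes "s \<in> all_states" "delta s x = Some (s', d, u)"
  shows "s' \<in> all_states \<and> d \<in> {-1, 0, 1} \<and> (x = Left_End \<longrightarrow> d \<noteq> -1) \<and> (x = Right_End \<longrightarrow> d \<noteq> 1)"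
  using assms B modes S passes by (auto simp: delta_def all_states_def split: if_splits)

lemma scan_run:
  assumes "tm_input w = pre @ zs @ post" "set zs \<inter> B = {}" "Right_End \<notin> set zs"
  shows "transducer_run delta w ((m, j, 1, s), length pre) (length zs) (snd (scan (g j) s zs))
    ((m, j, 1, fst (scan (g j) s zs)), length pre + length zs)"
  using assms
proof (induction zs arbitrary: pre s)
  case (Cons z zs)
  have "delta (m, j, 1, s) (tm_input w ! length pre) = Some ((m, j, 1, fst (g j s z)), 1, snd (g j s z))"
    using Cons.prems by (auto simp: delta_def)
  moreover have "transducer_run delta w ((m, j, 1, fst (g j s z)), length (pre @ [z])) (length zs)
      (snd (scan (g j) (fst (g j s z)) zs))
      ((m, j, 1, fst (scan (g j) (fst (g j s z)) zs)), length (pre @ [z]) + length zs)"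
    by (rule Cons.IH) (use Cons.prems in auto)
  ultimately show ?case using transducer_run.step[of delta "(m, j, 1, s)" w "length pre"] by fastforce
qed (auto intro: transducer_run.stop)

text \<open>There are \<open>i\<close> moves to the left and one stationary step that changes the
  phase.\<close>

lemma rewind_run:
  assumes "tm_input w = pre @ x # ys @ post" "x \<in> B" "set ys \<inter> B = {}" "i \<le> length ys"
  shows "transducer_run delta w ((m, j, 3, s), length pre + i) (Suc i) [] ((m, j, 0, s), length pre)"
  using assms(4)
proof (induction i)
  case 0
  have "delta (m, j, 3, s) (tm_input w ! length pre) = Some ((m, j, 0, s), 0, [])"
    using assms by (simp add: delta_def)
  then show ?case using transducer_run_single[of delta "(m, j, 3, s)" w "length pre"] by fastforce
next
  case (Suc i)
  have "tm_input w ! (length pre + Suc i) = ys ! i"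
    using assms Suc by (simp add: nth_append)
  moreover have "ys ! i \<notin> B" using assms(3) Suc.prems nth_mem[of i ys] by (simp add: disjoint_iff)
  ultimately have "delta (m, j, 3, s) (tm_input w ! (length pre + Suc i)) = Some ((m, j, 3, s), -1, [])"
    by (simp add: delta_def)
  from transducer_run.step[of delta, OF this] Suc show ?case by fastforce
qed

lemma first_scan_run:
  assumes "tm_input w = pre @ x # ys @ post" "x \<in> B" "set ys \<inter> B = {}" "Right_End \<notin> set ys"
  shows "transducer_run delta w ((m, j, 0, s), length pre) (Suc (length ys)) (snd (scan (g j) (init j m) (x # ys)))
    ((m, j, 1, fst (scan (g j) (init j m) (x # ys))), length pre + Suc (length ys))"
proof -
  have "delta (m, j, 0, s) (tm_input w ! length pre)
      = Some ((m, j, 1, fst (g j (init j m) x)), 1, snd (g j (init j m) x))"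
    using assms B by (auto simp: delta_def)
  from transducer_run.step[of delta, OF this]
    scan_run[of w "pre @ [x]" ys post m j "fst (g j (init j m) x)"] assms
  show ?thesis by fastforce
qed

text \<open>The time is \<open>Suc (length ys)\<close> for the scan, one step back from
  \<open>y\<close>, and \<open>Suc (length ys)\<close> for the rewinding. The step back writes the
  final output of the pass.\<close>

lemma inner_pass:
  assumes "tm_input w = pre @ x # ys @ y # post" "x \<in> B" "set ys \<inter> B = {}" "Right_End \<notin> set ys"
    "y \<in> B" "y \<noteq> Left_End" "Suc j < passes"
  shows "\<exists>t s'. t \<le> 2 * length ys + 3 \<and> transducer_run delta w ((m, j, 0, s), length pre) t
    (pass_out (g j) (e j) (init j m) (x # ys)) ((m, Suc j, 0, s'), length pre)"
proof -
  let ?s = "fst (scan (g j) (init j m) (x # ys))"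
  have "delta (m, j, 1, ?s) (tm_input w ! (length pre + Suc (length ys))) = Some ((m, Suc j, 3, ?s), -1, e j ?s)"
    using assms by (simp add: delta_def nth_append)
  from transducer_run.step[of delta, OF this]
    rewind_run[of w pre x ys "y # post" "length ys" m "Suc j" ?s] assms(1-3)
  have "transducer_run delta w ((m, j, 1, ?s), length pre + Suc (length ys)) (Suc (Suc (length ys))) (e j ?s)
    ((m, Suc j, 0, ?s), length pre)" by fastforce
  from transducer_run_trans[OF first_scan_run this] assms show ?thesis
    unfolding pass_out_def
    by (intro exI[of _ "Suc (length ys) + Suc (Suc (length ys))"] exI[of _ ?s]) simp
qed

text \<open>There is no way back here: the head already stands on the first cell of the next block,
  which also updates the mode.\<close>

lemma inner_last_pass:
  assumes "tm_input w = pre @ x # ys @ y # post" "x \<in> B" "set ys \<inter> B = {}" "Right_End \<notin> set ys"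
    "y \<in> B" "\<not> Suc j < passes"
  shows "\<exists>t s'. t \<le> 2 * length ys + 3 \<and> transducer_run delta w ((m, j, 0, s), length pre) t
    (pass_out (g j) (e j) (init j m) (x # ys)) ((upd m y, 0, 0, s'), length (pre @ x # ys))"
proof -
  let ?s = "fst (scan (g j) (init j m) (x # ys))"
  have "delta (m, j, 1, ?s) (tm_input w ! (length pre + Suc (length ys))) = Some ((upd m y, 0, 0, ?s), 0, e j ?s)"
    using assms by (simp add: delta_def nth_append)
  from transducer_run_trans[OF first_scan_run transducer_run_single[of delta, OF this]] assms show ?thesis
    unfolding pass_out_def
    by (intro exI[of _ "Suc (length ys) + 1"] exI[of _ ?s]) simp
qed

lemma scan_snoc:
  "scan h s (xs @ [x]) = (fst (h (fst (scan h s xs)) x), snd (scan h s xs) @ snd (h (fst (scan h s xs)) x))"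
  by (induction xs arbitrary: s) auto

text \<open>No cell of \<open>B\<close> ends the last block, \<open>Right_End\<close> does. It
  counts as a cell of the block, and its output and the final output of the pass are written in the
  same step.\<close>

lemma final_scan:
  assumes "tm_input w = pre @ x # ys @ [Right_End]" "x \<in> B" "set ys \<inter> B = {}" "Right_End \<notin> set ys"
  shows "\<exists>s'. transducer_run delta w ((m, j, 0, s), length pre) (length ys + 2)
    (pass_out (g j) (e j) (init j m) (x # ys @ [Right_End]))
    (if Suc j < passes then (m, Suc j, 3, s') else (m, j, 2, s'), length pre + Suc (length ys))"
proof -
  let ?s = "fst (scan (g j) (init j m) (x # ys))"
  have "delta (m, j, 1, ?s) (tm_input w ! (length pre + Suc (length ys)))
      = Some (if Suc j < passes then (m, Suc j, 3, ?s) else (m, j, 2, ?s), 0, snd (g j ?s Right_End) @ e j (fst (g j ?s Right_End)))"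
    using assms B by (simp add: delta_def nth_append)
  from transducer_run_trans[OF first_scan_run transducer_run_single[of delta, OF this]] assms show ?thesis
    unfolding pass_out_def
    by (intro exI[of _ ?s]) (simp add: scan_snoc)
qed

lemma final_pass:
  assumes "tm_input w = pre @ x # ys @ [Right_End]" "x \<in> B" "set ys \<inter> B = {}" "Right_End \<notin> set ys"
    "Suc j < passes"
  shows "\<exists>t s'. t \<le> 2 * length (ys @ [Right_End]) + 3 \<and> transducer_run delta w ((m, j, 0, s), length pre) t
    (pass_out (g j) (e j) (init j m) (x # ys @ [Right_End])) ((m, Suc j, 0, s'), length pre)"
proof -
  obtain s' where "transducer_run delta w ((m, j, 0, s), length pre) (length ys + 2)
    (pass_out (g j) (e j) (init j m) (x # ys @ [Right_End]))
    ((m, Suc j, 3, s'), length pre + Suc (length ys))"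
    using final_scan[OF assms(1-4), of m j s] assms(5) by auto
  moreover have "transducer_run delta w ((m, Suc j, 3, s'), length pre + Suc (length ys)) (Suc (Suc (length ys))) []
     ((m, Suc j, 0, s'), length pre)"
    using rewind_run[of w pre x "ys @ [Right_End]" "[]" "Suc (length ys)" m "Suc j" s'] assms B by simp
  ultimately show ?thesis
    by (intro exI[of _ "length ys + 2 + Suc (Suc (length ys))"] exI[of _ s'])
      (auto dest: transducer_run_trans)
qed

lemma passes_run:
  assumes "\<And>j s. Suc j < passes \<Longrightarrow> \<exists>t s'. t \<le> c \<and> transducer_run delta w ((m, j, 0, s), h) t
    (pass_out (g j) (e j) (init j m) b) ((m, Suc j, 0, s'), h)" "j < passes"
  shows "\<exists>t s'. t \<le> j * c \<and> transducer_run delta w ((m, 0, 0, s), h) t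
    (concat (map (\<lambda>j. pass_out (g j) (e j) (init j m) b) [0..<j])) ((m, j, 0, s'), h)"
  using assms(2)
proof (induction j)
  case 0
  show ?case by (auto intro: transducer_run.stop)
next
  case (Suc j)
  then obtain t s' where t: "t \<le> j * c" "transducer_run delta w ((m, 0, 0, s), h) t
    (concat (map (\<lambda>j. pass_out (g j) (e j) (init j m) b) [0..<j])) ((m, j, 0, s'), h)" by auto
  obtain t' s'' where t': "t' \<le> c" "transducer_run delta w ((m, j, 0, s'), h) t'
    (pass_out (g j) (e j) (init j m) b) ((m, Suc j, 0, s''), h)" using assms(1)[of j s'] Suc.prems by auto
  from transducer_run_trans[OF t(2) t'(2)] t(1) t'(1) show ?case
    by (intro exI[of _ "t + t'"] exI[of _ s'']) auto
qed

lemma block_out_last: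
  "block_out m b = concat (map (\<lambda>j. pass_out (g j) (e j) (init j m) b) [0..<passes - 1])
    @ pass_out (g (passes - 1)) (e (passes - 1)) (init (passes - 1) m) b"
proof -
  have "[0..<passes] = [0..<passes - 1] @ [passes - 1]"
    using passes upt_Suc_append[of 0 "passes - 1"] by simp
  then show ?thesis by (simp add: block_out_def)
qed

lemma inner_block:
  assumes w: "tm_input w = pre @ x # ys @ y # post" "x \<in> B" "set ys \<inter> B = {}" "Right_End \<notin> set ys"
    "y \<in> B" "y \<noteq> Left_End"
  shows "\<exists>t s'. t \<le> passes * (2 * length ys + 3) \<and> transducer_run delta w ((m, 0, 0, s), length pre) t
    (block_out m (x # ys)) ((upd m y, 0, 0, s'), length (pre @ x # ys))"
proof -
  obtain t s' where t: "t \<le> (passes - 1) * (2 * length ys + 3)" "transducer_run delta w ((m, 0, 0, s), length pre) t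
    (concat (map (\<lambda>j. pass_out (g j) (e j) (init j m) (x # ys)) [0..<passes - 1])) ((m, passes - 1, 0, s'), length pre)"
    using passes_run[of "2 * length ys + 3" w m "length pre" "x # ys" "passes - 1" s] inner_pass[OF w] passes by auto
  obtain t' s'' where t': "t' \<le> 2 * length ys + 3" "transducer_run delta w ((m, passes - 1, 0, s'), length pre) t'
    (pass_out (g (passes - 1)) (e (passes - 1)) (init (passes - 1) m) (x # ys))
    ((upd m y, 0, 0, s''), length (pre @ x # ys))"
    using inner_last_pass[OF w(1-5), of "passes - 1" m s'] passes by auto
  have "t + t' \<le> (passes - 1) * (2 * length ys + 3) + (2 * length ys + 3)" using t t' by simp
  also have "\<dots> = passes * (2 * length ys + 3)" using passes by (cases passes) auto
  finally show ?thesis using transducer_run_trans[OF t(2) t'(2)] unfolding block_out_last by blast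
qed

lemma final_block:
  assumes w: "tm_input w = pre @ x # ys @ [Right_End]" "x \<in> B" "set ys \<inter> B = {}" "Right_End \<notin> set ys"
  shows "\<exists>t s' h. t \<le> passes * (2 * length (ys @ [Right_End]) + 3) \<and> transducer_run delta w ((m, 0, 0, s), length pre) t
    (block_out m (x # ys @ [Right_End])) ((m, passes - 1, 2, s'), h)"
proof -
  let ?l = "2 * length (ys @ [Right_End]) + 3"
  obtain t s' where t: "t \<le> (passes - 1) * ?l" "transducer_run delta w ((m, 0, 0, s), length pre) t
    (concat (map (\<lambda>j. pass_out (g j) (e j) (init j m) (x # ys @ [Right_End])) [0..<passes - 1])) ((m, passes - 1, 0, s'), length pre)"
    using passes_run[of ?l w m "length pre" "x # ys @ [Right_End]" "passes - 1" s] final_pass[OF w] passes by auto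
  obtain s'' where t': "transducer_run delta w ((m, passes - 1, 0, s'), length pre) (length ys + 2)
    (pass_out (g (passes - 1)) (e (passes - 1)) (init (passes - 1) m) (x # ys @ [Right_End]))
    ((m, passes - 1, 2, s''), length pre + Suc (length ys))"
    using final_scan[OF w, of m "passes - 1" s'] passes by auto
  have "t + (length ys + 2) \<le> (passes - 1) * ?l + ?l" using t by simp
  also have "\<dots> = passes * ?l" using passes by (cases passes) auto
  finally show ?thesis using transducer_run_trans[OF t(2) t'] unfolding block_out_last by blast
qed

lemma Left_End_notin_tl_tm_input: "Left_End \<notin> set (tl (tm_input w))"
  by (auto simp: tm_input_def)

lemma Right_End_notin_butlast_tm_input: "Right_End \<notin> set (butlast (tm_input w))"
  by (auto simp: tm_input_def butlast_append)

text \<open>For a block \<open>x # ys\<close> the cost \<open>2 * length ys + 3\<close> of a pass is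
  at most 5 times the length of the block, so the costs of all blocks add up to a linear
  bound.\<close>

lemma blocks_run:
  assumes "tm_input w = pre @ concat (b # bs)" "\<forall>b\<in>set (b # bs). is_block b"
  shows "\<exists>t m' s' h j. t \<le> passes * (5 * length (concat (b # bs))) \<and>
    transducer_run delta w ((upd m (hd b), 0, 0, s), length pre) t (rescan m (b # bs)) ((m', j, 2, s'), h)"
  using assms
proof (induction bs arbitrary: pre b m s)
  case Nil
  obtain x ys where b: "b = x # ys" "x \<in> B" "set ys \<inter> B = {}" using Nil.prems by (auto simp: is_block_def)
  have l: "last (tm_input w) = last b" using Nil.prems(1) b by simp
  \<comment> \<open>The last cell is \<open>Right_End\<close>, which is not in \<open>B\<close> and
    so is not the first cell of a block.\<close>
  have "ys \<noteq> []" using l b B by (auto simp: tm_input_def)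
  then have ys: "ys = butlast ys @ [Right_End]"
    using l b append_butlast_last_id[of ys] by (auto simp: tm_input_def)
  define zs where "zs = butlast ys"
  have zs: "ys = zs @ [Right_End]" using ys by (simp add: zs_def)
  have "butlast (tm_input w) = pre @ x # zs" using Nil.prems b zs by (simp add: butlast_append)
  then have "Right_End \<notin> set zs" using Right_End_notin_butlast_tm_input[of w] by auto
  then obtain t s' h where "t \<le> passes * (2 * length ys + 3)"
    "transducer_run delta w ((upd m x, 0, 0, s), length pre) t (block_out (upd m x) b) ((upd m x, passes - 1, 2, s'), h)"
    using final_block[of w pre x zs "upd m x" s] Nil.prems b zs by auto
  moreover have "passes * (2 * length ys + 3) \<le> passes * (5 * length (concat [b]))" using b by simp
  ultimately have "t \<le> passes * (5 * length (concat [b]))"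
    "transducer_run delta w ((upd m (hd b), 0, 0, s), length pre) t (rescan m [b]) ((upd m x, passes - 1, 2, s'), h)"
    using b by (auto intro: order_trans simp del: mult_le_cancel1 nat_mult_le_cancel_disj)
  then show ?case by blast
next
  case (Cons b' bs)
  obtain x ys where b: "b = x # ys" "x \<in> B" "set ys \<inter> B = {}" using Cons.prems by (auto simp: is_block_def)
  obtain y zs where b': "b' = y # zs" "y \<in> B" using Cons.prems by (auto simp: is_block_def)
  have w: "tm_input w = pre @ x # ys @ y # zs @ concat bs" using Cons.prems b b' by simp
  \<comment> \<open>Only the first cell of the tape is \<open>Left_End\<close>, so the next block
    does not begin with it, and the head can step back from there.\<close>
  have "tl (tm_input w) = tl (pre @ [x]) @ ys @ y # zs @ concat bs" using w by (cases pre) auto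
  then have y: "y \<noteq> Left_End" using Left_End_notin_tl_tm_input[of w] by auto
  have "butlast (tm_input w) = pre @ x # ys @ butlast (y # zs @ concat bs)" using w by (simp add: butlast_append)
  then have R: "Right_End \<notin> set ys" using Right_End_notin_butlast_tm_input[of w] by auto
  obtain t s' where t: "t \<le> passes * (2 * length ys + 3)" "transducer_run delta w ((upd m x, 0, 0, s), length pre) t
    (block_out (upd m x) b) ((upd (upd m x) y, 0, 0, s'), length (pre @ b))"
    using inner_block[OF w b(2,3) R b'(2) y, of "upd m x" s] b by auto
  obtain t' m' s'' h j where t': "t' \<le> passes * (5 * length (concat (b' # bs)))"
    "transducer_run delta w ((upd (upd m x) y, 0, 0, s'), length (pre @ b)) t' (rescan (upd m x) (b' # bs)) ((m', j, 2, s''), h)"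
    using Cons.IH[of "pre @ b" b' "upd m x" s'] Cons.prems b' by auto
  have "t + t' \<le> passes * (2 * length ys + 3 + 5 * length (concat (b' # bs)))"
    using t(1) t'(1) by (simp add: algebra_simps)
  also have "\<dots> \<le> passes * (5 * length (concat (b # b' # bs)))" using b by simp
  finally show ?case using transducer_run_trans[OF t(2) t'(2)] b by force
qed

lemma rescan_tm:
  "\<exists>M c. is_tm A M \<and> (\<forall>w bs. tm_input w = concat bs \<longrightarrow> (\<forall>b\<in>set bs. is_block b) \<longrightarrow>
    (\<exists>t. tm_computes M w t (rescan m0 bs) \<and> t \<le> c * (length w + 1)))"
proof -
  let ?s0 = "(upd m0 Left_End, 0, 0, init 0 m0)"
  have "?s0 \<in> all_states" using modes S by (auto simp: all_states_def)
  then obtain M where M: "is_tm A M" "\<And>w t v s h. transducer_run delta w (?s0, 0) t v (s, h) \<Longrightarrow>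
     delta s (tm_input w ! h) = None \<Longrightarrow> tm_computes M w t v"
    using transducer_tm[OF fin(1) finite_all_states, of ?s0 delta] delta_closed by blast
  have "\<exists>t. tm_computes M w t (rescan m0 bs) \<and> t \<le> (10 * passes) * (length w + 1)"
    if w: "tm_input w = concat bs" and bs: "\<forall>b\<in>set bs. is_block b" for w bs
  proof -
    obtain b bs' where b: "bs = b # bs'" using w by (cases bs) (auto simp: tm_input_def)
    then have hd: "hd b = Left_End" using w bs by (auto simp: tm_input_def is_block_def)
    obtain t m' s' h j where t: "t \<le> passes * (5 * length (concat (b # bs')))"
      "transducer_run delta w (?s0, 0) t (rescan m0 (b # bs')) ((m', j, 2, s'), h)"
      using blocks_run[of w "[]" b bs' m0 "init 0 m0"] w bs b hd by auto
    have "delta (m', j, 2, s') (tm_input w ! h) = None" by (simp add: delta_def)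
    then have "tm_computes M w t (rescan m0 bs)" using M(2) t b by blast
    moreover have "t \<le> (10 * passes) * (length w + 1)"
    proof -
      \<comment> \<open>The two end markers belong to the blocks; then
        \<open>5 * (n + 2) \<le> 10 * (n + 1)\<close> explains the constant.\<close>
      have "length (concat (b # bs')) = length w + 2" using b w[symmetric] by (simp add: tm_input_def)
      then have "t \<le> passes * (5 * (length w + 2))" using t(1) by simp
      also have "\<dots> \<le> (10 * passes) * (length w + 1)" by (simp add: algebra_simps)
      finally show ?thesis .
    qed
    ultimately show ?thesis by blast
  qed
  with M(1) show ?thesis by blast
qed

end

section \<open>Two-way machines and intersections of finite automata\<close>

lemma bottom_respecting_image:
  assumes "inj_on f \<Gamma>" "Z \<in> \<Gamma>" "\<alpha> \<in> \<Gamma>" "bottom_respecting \<Gamma> Z \<alpha> \<beta>"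
  shows "bottom_respecting (f ` \<Gamma>) (f Z) (f \<alpha>) (map f \<beta>)"
proof -
  have "f g \<noteq> f Z" if "g \<in> \<Gamma>" "g \<noteq> Z" for g
    using assms(1,2) that by (auto dest: inj_onD)
  then show ?thesis
    using assms by (auto simp: bottom_respecting_def in_lists_conv_set split: if_splits)
qed

lemma bottom_respecting_lists: "bottom_respecting \<Gamma> Z \<alpha> \<beta> \<Longrightarrow> Z \<in> \<Gamma> \<Longrightarrow> \<beta> \<in> lists \<Gamma>"
  by (auto simp: bottom_respecting_def split: if_splits)

lemma length_tm_input: "length (tm_input w) = length w + 2"
  by (simp add: tm_input_def)

lemma pass_out_concat: "pass_out (\<lambda>s x. (s, f x)) e s xs = concat (map f xs) @ e s"
  by (induction xs) (auto simp: pass_out_Cons)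

text \<open>The letters of the deterministic context-free language are the indices of the transitions of
  the given machine. The PDA checks states and stack, and the \<open>i\<close>-th DFA simulates the \<open>i\<close>-th head.\<close>

locale npda2_traces =
  fixes k :: nat and M :: "('q, 'a, 'g) npda2"
    and trs :: "('q \<times> 'a list \<times> 'g \<times> 'q \<times> 'g list \<times> int list) list"
    and fq :: "'q \<Rightarrow> nat" and fg :: "'g \<Rightarrow> nat"
  assumes M: "is_npda2 k M" and k: "k \<ge> 1" and trs: "set trs = npda2_trans M"
    and fq: "inj_on fq (npda2_states M)" and fg: "inj_on fg (npda2_stack M)"
begin

text \<open>The shift leaves 0 for a rejecting sink, which makes the transition function total, as
  \<open>is_dpda\<close> demands.\<close>

definition pstate :: "'q \<Rightarrow> nat" where
  "pstate q = Suc (fq q)"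

definition pstates :: "nat set" where
  "pstates = insert 0 (pstate ` npda2_states M)"

text \<open>An inapplicable letter leads to the sink and puts the top symbol back, so that the
  transition treats the bottom marker correctly.\<close>

definition pnext :: "nat \<Rightarrow> nat \<Rightarrow> nat \<Rightarrow> nat \<times> nat list" where
  "pnext p c a = (case trs ! c of (q, as, \<alpha>, q', \<gamma>, ds) \<Rightarrow>
     if p = pstate q \<and> a = fg \<alpha> then (pstate q', map fg \<gamma>) else (0, [a]))"

definition trace_pda :: "(nat, nat, nat) pda" where
  "trace_pda = \<lparr>pda_states = pstates, pda_alphabet = {..<length trs}, pda_stack = fg ` npda2_stack M,
     pda_bottom = fg (npda2_bottom M),
     pda_trans = (\<lambda>(p, c, a). (p, Some c, a, pnext p c a)) ` (pstates \<times> {..<length trs} \<times> fg ` npda2_stack M),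
     pda_init = pstate (npda2_init M), pda_final = pstate ` npda2_final M\<rparr>"

text \<open>The tape has the positions up to \<open>length w + 1\<close>; the next number is the
  sink. The test on \<open>h\<close> makes the sink absorbing.\<close>

definition hnext :: "nat \<Rightarrow> 'a list \<Rightarrow> nat \<Rightarrow> nat \<Rightarrow> nat" where
  "hnext i w h c = (case trs ! c of (q, as, \<alpha>, q', \<gamma>, ds) \<Rightarrow>
     if h \<le> length w + 1 \<and> npda2_tape M w ! h = as ! i then move_head h (ds ! i) else length w + 2)"

definition head_dfa :: "nat \<Rightarrow> 'a list \<Rightarrow> (nat, nat) nfa" where
  "head_dfa i w = \<lparr>nfa_states = {..length w + 2}, nfa_alphabet = {..<length trs},
     nfa_trans = (\<lambda>(h, c). (h, c, hnext i w h c)) ` ({..length w + 2} \<times> {..<length trs}),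
     nfa_init = 0, nfa_final = {length w + 1}\<rparr>"

lemma trace_pda_trans_iff:
  "(p, a', a, r) \<in> pda_trans trace_pda \<longleftrightarrow>
    (\<exists>c. a' = Some c \<and> c < length trs \<and> p \<in> pstates \<and> a \<in> fg ` npda2_stack M \<and> r = pnext p c a)"
  unfolding trace_pda_def by (cases r) (auto simp: image_def)

lemma head_dfa_trans_iff:
  "(h, c, h') \<in> nfa_trans (head_dfa i w) \<longleftrightarrow> h \<le> length w + 2 \<and> c < length trs \<and> h' = hnext i w h c"
  by (auto simp: head_dfa_def image_def)

lemma transD:
  assumes "c < length trs" "trs ! c = (q, as, \<alpha>, q', \<gamma>, ds)"
  shows "(q, as, \<alpha>, q', \<gamma>, ds) \<in> npda2_trans M" "q \<in> npda2_states M" "q' \<in> npda2_states M"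
    "length as = k" "length ds = k" "\<alpha> \<in> npda2_stack M"
    "bottom_respecting (npda2_stack M) (npda2_bottom M) \<alpha> \<gamma>" "set ds \<subseteq> {-1, 0, 1}"
    "\<And>i. i < k \<Longrightarrow> as ! i = npda2_left M \<Longrightarrow> ds ! i \<noteq> -1"
    "\<And>i. i < k \<Longrightarrow> as ! i = npda2_right M \<Longrightarrow> ds ! i \<noteq> 1"
proof -
  show *: "(q, as, \<alpha>, q', \<gamma>, ds) \<in> npda2_trans M" using assms trs nth_mem by metis
  show "q \<in> npda2_states M" "q' \<in> npda2_states M"
    "length as = k" "length ds = k" "\<alpha> \<in> npda2_stack M"
    "bottom_respecting (npda2_stack M) (npda2_bottom M) \<alpha> \<gamma>" "set ds \<subseteq> {-1, 0, 1}"
    "\<And>i. i < k \<Longrightarrow> as ! i = npda2_left M \<Longrightarrow> ds ! i \<noteq> -1"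
    "\<And>i. i < k \<Longrightarrow> as ! i = npda2_right M \<Longrightarrow> ds ! i \<noteq> 1"
    using M * unfolding is_npda2_def by fastforce+
qed

lemma ds_cases:
  assumes "c < length trs" "trs ! c = (q, as, \<alpha>, q', \<gamma>, ds)" "i < k"
  shows "ds ! i = -1 \<or> ds ! i = 0 \<or> ds ! i = 1"
  using transD(5,8)[OF assms(1,2)] assms(3) nth_mem[of i ds] by (metis insert_iff singletonD subsetD)

lemma pnext_closed:
  assumes "p \<in> pstates" "c < length trs" "a \<in> fg ` npda2_stack M"
  shows "fst (pnext p c a) \<in> pstates"
    "bottom_respecting (fg ` npda2_stack M) (fg (npda2_bottom M)) a (snd (pnext p c a))"
proof -
  obtain q as \<alpha> q' \<gamma> ds where t: "trs ! c = (q, as, \<alpha>, q', \<gamma>, ds)" by (cases "trs ! c") auto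
  have Z: "npda2_bottom M \<in> npda2_stack M" using M by (simp add: is_npda2_def)
  show "fst (pnext p c a) \<in> pstates" using transD[OF assms(2) t] by (auto simp: pnext_def t pstates_def)
  show "bottom_respecting (fg ` npda2_stack M) (fg (npda2_bottom M)) a (snd (pnext p c a))"
    using bottom_respecting_image[OF fg Z transD(6,7)[OF assms(2) t]] assms(3)
    by (auto simp: pnext_def t bottom_respecting_def)
qed

text \<open>Every state reads a letter, and \<open>pnext\<close> is total, so the first alternative
  of determinism holds everywhere.\<close>

lemma is_dpda_trace_pda: "is_dpda trace_pda"
proof -
  have fin: "finite (npda2_states M)" "finite (npda2_stack M)" "npda2_bottom M \<in> npda2_stack M"
    "npda2_init M \<in> npda2_states M" "npda2_final M \<subseteq> npda2_states M"
    using M by (auto simp: is_npda2_def)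
  have "is_pda trace_pda"
    unfolding is_pda_def
  proof (intro conjI)
    show "\<forall>(p, a, \<alpha>, q, \<beta>)\<in>pda_trans trace_pda. p \<in> pda_states trace_pda \<and> q \<in> pda_states trace_pda \<and>
      set_option a \<subseteq> pda_alphabet trace_pda \<and> \<alpha> \<in> pda_stack trace_pda \<and>
      bottom_respecting (pda_stack trace_pda) (pda_bottom trace_pda) \<alpha> \<beta>"
    proof clarify
      fix p a \<alpha> q \<beta> assume "(p, a, \<alpha>, q, \<beta>) \<in> pda_trans trace_pda"
      then obtain c where "p \<in> pstates" "c < length trs" "\<alpha> \<in> fg ` npda2_stack M" "a = Some c" "(q, \<beta>) = pnext p c \<alpha>"
        unfolding trace_pda_def by auto
      with pnext_closed[of p c \<alpha>] show "p \<in> pda_states trace_pda \<and> q \<in> pda_states trace_pda \<and>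
        set_option a \<subseteq> pda_alphabet trace_pda \<and> \<alpha> \<in> pda_stack trace_pda \<and>
        bottom_respecting (pda_stack trace_pda) (pda_bottom trace_pda) \<alpha> \<beta>"
        by (auto simp: trace_pda_def dest: arg_cong[where f = fst] arg_cong[where f = snd])
    qed
  qed (use fin in \<open>auto simp: trace_pda_def pstates_def\<close>)
  moreover have "(p, Some c, a, pnext p c a) \<in> pda_trans trace_pda"
    if "p \<in> pda_states trace_pda" "c \<in> pda_alphabet trace_pda" "a \<in> pda_stack trace_pda" for p c a
    using that unfolding trace_pda_trans_iff by (auto simp: trace_pda_def)
  then have "\<exists>q \<beta>. (p, Some c, a, q, \<beta>) \<in> pda_trans trace_pda"
    if "p \<in> pda_states trace_pda" "c \<in> pda_alphabet trace_pda" "a \<in> pda_stack trace_pda" for p c a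
    using that by (metis prod.collapse)
  moreover have "(p, None, a, q, \<beta>) \<notin> pda_trans trace_pda" for p a q \<beta>
    by (auto simp: trace_pda_def)
  moreover have "q = q' \<and> \<beta> = \<beta>'"
    if "(p, c, a, q, \<beta>) \<in> pda_trans trace_pda" "(p, c, a, q', \<beta>') \<in> pda_trans trace_pda" for p c a q \<beta> q' \<beta>'
    using that unfolding trace_pda_trans_iff by (metis Pair_inject option.inject)
  ultimately show ?thesis unfolding is_dpda_def by blast
qed

lemma hnext_le:
  assumes "c < length trs" "i < k" shows "hnext i w h c \<le> length w + 2"
proof -
  obtain q as \<alpha> q' \<gamma> ds where t: "trs ! c = (q, as, \<alpha>, q', \<gamma>, ds)" by (cases "trs ! c") auto
  show ?thesis using ds_cases[OF assms(1) t assms(2)] by (auto simp: hnext_def t)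
qed

lemma is_dfa_head_dfa: "i < k \<Longrightarrow> is_dfa (head_dfa i w)"
  using hnext_le by (auto simp: is_dfa_def is_nfa_def head_dfa_def)

text \<open>Used in contraposition: a run that ends outside the sink applied a matching transition
  at every letter.\<close>

lemma pda_run_sink: "pda_run trace_pda c u c' \<Longrightarrow> fst c = 0 \<Longrightarrow> fst c' = 0"
  by (induction rule: pda_run.induct)
    (auto simp: trace_pda_def pnext_def pstate_def split: prod.splits if_splits)

lemma nfa_run_sink: "nfa_run (head_dfa i w) h u h' \<Longrightarrow> h = length w + 2 \<Longrightarrow> h' = length w + 2"
  by (induction rule: nfa_run.induct)
    (auto simp: head_dfa_def hnext_def split: prod.splits if_splits)

definition valid :: "'a list \<Rightarrow> 'q \<times> nat list \<times> 'g list \<Rightarrow> bool" where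
  "valid w = (\<lambda>(q, hs, st). q \<in> npda2_states M \<and> length hs = k \<and> (\<forall>i<k. hs ! i \<le> length w + 1) \<and>
     st \<in> lists (npda2_stack M))"

text \<open>The conditions on moves at the end markers keep the heads on the tape, hence the DFAs
  out of their sinks. The letter is the same for the PDA and for all DFAs: the index of the
  transition.\<close>

lemma npda2_step_trace:
  assumes "npda2_step M w (q, hs, st) (q', hs', st')" "valid w (q, hs, st)"
  shows "valid w (q', hs', st') \<and> (\<exists>c<length trs. (\<exists>\<gamma> \<alpha> \<gamma>'. st = \<gamma> @ [\<alpha>] \<and> st' = \<gamma> @ \<gamma>' \<and>
    (pstate q, Some c, fg \<alpha>, pstate q', map fg \<gamma>') \<in> pda_trans trace_pda) \<and>
    (\<forall>i<k. (hs ! i, c, hs' ! i) \<in> nfa_trans (head_dfa i w)))"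
  using assms(1)
proof cases
  case (1 \<alpha> \<gamma>' ds \<gamma>)
  then obtain c where c: "c < length trs" "trs ! c = (q, map (\<lambda>h. npda2_tape M w ! h) hs, \<alpha>, q', \<gamma>', ds)"
    using trs by (metis in_set_conv_nth)
  note D = transD[OF c]
  have Z: "npda2_bottom M \<in> npda2_stack M" using M by (simp add: is_npda2_def)
  have v: "hs ! i \<le> length w + 1" if "i < k" for i using assms(2) that by (simp add: valid_def)
  have hs': "hs' ! i = hnext i w (hs ! i) c" if "i < k" for i
    using that D(4,5) v[OF that] by (simp add: 1 hnext_def c)
  have "hs' ! i \<le> length w + 1" if i: "i < k" for i
  proof (cases "hs ! i = length w + 1")
    case True
    then have "npda2_tape M w ! (hs ! i) = npda2_right M" by (simp add: npda2_tape_def nth_append)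
    then have "ds ! i \<noteq> 1" using D(10)[of i] D(4) i by simp
    with ds_cases[OF c i] show ?thesis using i D(4,5) True by (auto simp: 1)
  next
    case False
    with ds_cases[OF c i] v[OF i] show ?thesis using i D(4,5) by (auto simp: 1)
  qed
  then have "valid w (q', hs', st')"
    using assms(2) D(3,4,5) bottom_respecting_lists[OF D(7) Z] by (auto simp: valid_def 1)
  moreover have "pnext (pstate q) c (fg \<alpha>) = (pstate q', map fg \<gamma>')" by (simp add: pnext_def c)
  then have "(pstate q, Some c, fg \<alpha>, pstate q', map fg \<gamma>') \<in> pda_trans trace_pda"
    using D(2,6) c by (simp add: trace_pda_trans_iff pstates_def)
  moreover have "\<forall>i<k. (hs ! i, c, hs' ! i) \<in> nfa_trans (head_dfa i w)"
    using hs' v c by (simp add: head_dfa_trans_iff le_SucI)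
  ultimately show ?thesis using 1 c(1) by blast
qed

lemma npda2_run_trace:
  assumes "(npda2_step M w)\<^sup>*\<^sup>* (q, hs, st) (q', hs', st')" "valid w (q, hs, st)"
  shows "\<exists>u. pda_run trace_pda (pstate q, map fg st) u (pstate q', map fg st') \<and>
    (\<forall>i<k. nfa_run (head_dfa i w) (hs ! i) u (hs' ! i))"
  using assms
proof (induction "(q, hs, st)" arbitrary: q hs st rule: converse_rtranclp_induct)
  case base
  show ?case by (auto intro: pda_run.refl nfa_run.refl)
next
  case (step c1)
  obtain q1 hs1 st1 where c1: "c1 = (q1, hs1, st1)" by (cases c1)
  obtain c \<gamma> \<alpha> \<gamma>' where *: "valid w (q1, hs1, st1)" "st = \<gamma> @ [\<alpha>]" "st1 = \<gamma> @ \<gamma>'"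
    "(pstate q, Some c, fg \<alpha>, pstate q1, map fg \<gamma>') \<in> pda_trans trace_pda"
    "\<forall>i<k. (hs ! i, c, hs1 ! i) \<in> nfa_trans (head_dfa i w)"
    using npda2_step_trace step.hyps(1) step.prems unfolding c1 by blast
  obtain u where u: "pda_run trace_pda (pstate q1, map fg st1) u (pstate q', map fg st')"
    "\<forall>i<k. nfa_run (head_dfa i w) (hs1 ! i) u (hs' ! i)"
    using step.hyps(3)[OF c1 *(1)] by blast
  have "pda_run trace_pda (pstate q, map fg st) (c # u) (pstate q', map fg st')"
    using pda_run.read[OF *(4), of "map fg \<gamma>"] u(1) *(2,3) by simp
  moreover have "\<forall>i<k. nfa_run (head_dfa i w) (hs ! i) (c # u) (hs' ! i)"
    using *(5) u(2) by (auto intro: nfa_run.read)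
  ultimately show ?case by blast
qed

text \<open>As sinks are absorbing and none is reached at the end, every letter matches the state,
  the stack top and all scanned cells, and so is a legal step. The bound on \<open>H i\<close> says
  that the \<open>i\<close>-th DFA is not in its sink.\<close>

lemma trace_npda2_run:
  assumes "pda_run trace_pda (pstate q, map fg st) u (pstate q', S)" "q' \<in> npda2_states M"
    "\<forall>i<k. nfa_run (head_dfa i w) (hs ! i) u (H i) \<and> H i \<le> length w + 1" "valid w (q, hs, st)"
  shows "\<exists>st'. (npda2_step M w)\<^sup>*\<^sup>* (q, hs, st) (q', map H [0..<k], st') \<and> map fg st' = S \<and>
    st' \<in> lists (npda2_stack M)"
  using assms
proof (induction u arbitrary: q hs st)
  case Nil
  have "(pstate q, map fg st) = (pstate q', S)"
    using Nil.prems(1) by cases (auto simp: trace_pda_def)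
  then have "q = q'" "map fg st = S" using fq Nil.prems(2,4) by (auto simp: pstate_def valid_def dest: inj_onD)
  moreover have "hs ! i = H i" if "i < k" for i
  proof -
    have "nfa_run (head_dfa i w) (hs ! i) [] (H i)" using Nil.prems(3) that by blast
    then show ?thesis by cases simp
  qed
  then have "hs = map H [0..<k]" using Nil.prems(4) by (intro nth_equalityI) (auto simp: valid_def)
  ultimately show ?case using Nil.prems(4) by (auto simp: valid_def)
next
  case (Cons c u)
  from Cons.prems(1) obtain a p1 b G where r: "(pstate q, Some c, a, p1, b) \<in> pda_trans trace_pda"
    "pda_run trace_pda (p1, G @ b) u (pstate q', S)" "map fg st = G @ [a]"
    by cases (auto simp: trace_pda_def)
  have c: "c < length trs" and p1: "(p1, b) = pnext (pstate q) c a" using r(1) by (auto simp: trace_pda_def)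
  obtain q0 as \<alpha> q1 \<gamma> ds where t: "trs ! c = (q0, as, \<alpha>, q1, \<gamma>, ds)" by (cases "trs ! c") auto
  note D = transD[OF c t]
  have Z: "npda2_bottom M \<in> npda2_stack M" using M by (simp add: is_npda2_def)
  have "p1 \<noteq> 0" using pda_run_sink[OF r(2)] by (auto simp: pstate_def)
  then have *: "pstate q = pstate q0" "a = fg \<alpha>" "p1 = pstate q1" "b = map fg \<gamma>"
    using p1 by (auto simp: pnext_def t split: if_splits)
  have v: "length hs = k" "\<forall>i<k. hs ! i \<le> length w + 1" "q \<in> npda2_states M" "st \<in> lists (npda2_stack M)"
    using Cons.prems(4) by (auto simp: valid_def)
  have q: "q = q0" using *(1) fq v(3) D(2) by (auto simp: pstate_def dest: inj_onD)
  obtain st0 \<alpha>' where st: "st = st0 @ [\<alpha>']" "G = map fg st0" "fg \<alpha>' = a"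
    using r(3) by (auto simp: map_eq_append_conv)
  have \<alpha>: "\<alpha>' = \<alpha>" using fg D(6) v(4) st *(2) by (auto dest: inj_onD)
  have n: "nfa_run (head_dfa i w) (hnext i w (hs ! i) c) u (H i)" if "i < k" for i
  proof -
    have "nfa_run (head_dfa i w) (hs ! i) (c # u) (H i)" using Cons.prems(3) that by blast
    then show ?thesis by cases (auto simp: head_dfa_def)
  qed
  have ne: "hnext i w (hs ! i) c \<noteq> length w + 2" if "i < k" for i
  proof
    assume "hnext i w (hs ! i) c = length w + 2"
    then have "H i = length w + 2" using nfa_run_sink n[OF that] by blast
    moreover have "H i \<le> length w + 1" using Cons.prems(3) that by blast
    ultimately show False by simp
  qed
  have tape: "npda2_tape M w ! (hs ! i) = as ! i" "hnext i w (hs ! i) c = move_head (hs ! i) (ds ! i)" if "i < k" for i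
    using ne[OF that] by (auto simp: hnext_def t split: if_splits)
  have as: "map (\<lambda>h. npda2_tape M w ! h) hs = as"
    using v(1) D(4) tape(1) by (intro nth_equalityI) auto
  let ?hs = "map2 move_head hs ds"
  have step: "npda2_step M w (q, hs, st) (q1, ?hs, st0 @ \<gamma>)"
    unfolding st(1) \<alpha> using D(1) by (intro npda2_step.intros) (simp add: as q)
  have hs': "?hs ! i = hnext i w (hs ! i) c" if "i < k" for i
    using that v(1) D(5) tape(2) by simp
  have "?hs ! i \<le> length w + 1" if "i < k" for i
    using hnext_le[OF c that, of w "hs ! i"] ne[OF that] hs'[OF that] by simp
  then have "valid w (q1, ?hs, st0 @ \<gamma>)"
    using D(3,5) v(1,4) st bottom_respecting_lists[OF D(7) Z] by (auto simp: valid_def)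
  then obtain st' where "(npda2_step M w)\<^sup>*\<^sup>* (q1, ?hs, st0 @ \<gamma>) (q', map H [0..<k], st')" "map fg st' = S"
    "st' \<in> lists (npda2_stack M)"
    using Cons.IH[of q1 "st0 @ \<gamma>" ?hs] r(2) st(2) *(3,4) Cons.prems(2,3) n hs' by auto
  with step show ?case using converse_rtranclp_into_rtranclp[of "npda2_step M w", OF step] by blast
qed

lemma npda2_lang_iff:
  assumes "w \<in> lists (npda2_input_letters M)"
  shows "w \<in> npda2_lang k M \<longleftrightarrow> (\<exists>u\<in>pda_lang trace_pda. \<forall>i<k. u \<in> nfa_lang (head_dfa i w))"
proof -
  let ?Z = "npda2_bottom M" and ?q0 = "npda2_init M"
  have MM: "?Z \<in> npda2_stack M" "?q0 \<in> npda2_states M" "npda2_final M \<subseteq> npda2_states M"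
    using M by (auto simp: is_npda2_def)
  have v: "valid w (?q0, replicate k 0, [?Z])" using MM by (auto simp: valid_def)
  show ?thesis
  proof
    assume "w \<in> npda2_lang k M"
    then obtain f where f: "f \<in> npda2_final M"
      "(npda2_step M w)\<^sup>*\<^sup>* (?q0, replicate k 0, [?Z]) (f, replicate k (length w + 1), [?Z])"
      by (auto simp: npda2_lang_def)
    obtain u where "pda_run trace_pda (pstate ?q0, map fg [?Z]) u (pstate f, map fg [?Z])"
      "\<forall>i<k. nfa_run (head_dfa i w) (replicate k 0 ! i) u (replicate k (length w + 1) ! i)"
      using npda2_run_trace[OF f(2) v] by blast
    then show "\<exists>u\<in>pda_lang trace_pda. \<forall>i<k. u \<in> nfa_lang (head_dfa i w)"
      using f(1) by (intro bexI[of _ u]) (auto simp: pda_lang_def nfa_lang_def trace_pda_def head_dfa_def)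
  next
    assume "\<exists>u\<in>pda_lang trace_pda. \<forall>i<k. u \<in> nfa_lang (head_dfa i w)"
    then obtain u f where u: "f \<in> npda2_final M" "pda_run trace_pda (pstate ?q0, map fg [?Z]) u (pstate f, [fg ?Z])"
      "\<forall>i<k. nfa_run (head_dfa i w) 0 u (length w + 1)"
      by (auto simp: pda_lang_def nfa_lang_def trace_pda_def head_dfa_def)
    obtain st' where "(npda2_step M w)\<^sup>*\<^sup>* (?q0, replicate k 0, [?Z]) (f, map (\<lambda>_. length w + 1) [0..<k], st')"
      "map fg st' = [fg ?Z]" "st' \<in> lists (npda2_stack M)"
      using trace_npda2_run[of ?q0 "[?Z]" u f "[fg ?Z]" w "replicate k 0" "\<lambda>_. length w + 1"] u MM v
      by (auto simp: subset_iff)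
    moreover from this(2,3) have "st' = [?Z]" using fg MM(1) by (auto dest: inj_onD)
    ultimately show "w \<in> npda2_lang k M"
      using u(1) assms unfolding npda2_lang_def by (auto simp: map_replicate_const)
  qed
qed

section \<open>Writing the DFAs of the heads, one scan per head\<close>

fun cell_letter :: "'a cell \<Rightarrow> 'a" where
  "cell_letter Left_End = npda2_left M"
| "cell_letter (Letter a) = a"
| "cell_letter Right_End = npda2_right M"

lemma npda2_tape_conv: "npda2_tape M w = map cell_letter (tm_input w)"
  by (simp add: npda2_tape_def tm_input_def comp_def)

text \<open>The sink is the only state with a nonempty label, and is referred to by it. The distance to any
  other target is at most one.\<close>

definition head_ref :: "nat \<Rightarrow> 'a cell \<Rightarrow> nat \<Rightarrow> sym list" where
  "head_ref i x c = (case trs ! c of (q, as, \<alpha>, q', \<gamma>, ds) \<Rightarrow>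
     if cell_letter x = as ! i then (if ds ! i = 1 then [Fwd] else if ds ! i = 0 then [] else [Bwd])
     else [Label, Bit True])"

definition position_block :: "nat \<Rightarrow> 'a cell \<Rightarrow> sym list" where
  "position_block i x = [State] @ (if x = Left_End then [Init] else []) @ (if x = Right_End then [Final] else []) @
     concat (map (\<lambda>c. ([Trans] @ code_nat c @ [Comma]) @ head_ref i x c) [0..<length trs])"

text \<open>All transitions of the sink are loops, so every reference is the empty word, i.e.
  distance 0.\<close>

definition sink_block :: "sym list" where
  "sink_block = [State, Bit True] @ concat (map (\<lambda>c. [Trans] @ code_nat c @ [Comma]) [0..<length trs])"

text \<open>The label of the sink is unique because all other labels are empty. A reference
  backwards has a target, since the left marker forbids the move from position 0.\<close>

lemma code_ref_head_ref:
  assumes "h \<le> length w + 1" "c < length trs" "i < k"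
  shows "code_ref (replicate (length w + 2) [] @ [[True]]) h (hnext i w h c) (head_ref i (tm_input w ! h) c)"
proof -
  obtain q as \<alpha> q' \<gamma> ds where t: "trs ! c = (q, as, \<alpha>, q', \<gamma>, ds)" by (cases "trs ! c") auto
  have x: "npda2_tape M w ! h = cell_letter (tm_input w ! h)"
    using assms(1) by (simp add: npda2_tape_conv length_tm_input)
  show ?thesis
  proof (cases "cell_letter (tm_input w ! h) = as ! i")
    case True
    have "ds ! i \<noteq> -1" if "h = 0"
      using transD(9)[OF assms(2) t assms(3)] True that by (simp add: tm_input_def)
    then have "h > 0" if "ds ! i = -1" using that by blast
    then show ?thesis
      using True ds_cases[OF assms(2) t assms(3)] assms(1) x code_ref.fwd[of _ h 1] code_ref.fwd[of _ h 0]
        code_ref.bwd[of _ "h - 1" 1]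
      by (auto simp: head_ref_def hnext_def t)
  next
    case False
    have "code_ref (replicate (length w + 2) [] @ [[True]]) h (length w + 2) (Label # map Bit [True])"
      using code_ref.label[of "length w + 2" "replicate (length w + 2) [] @ [[True]]" h]
      by (simp add: nth_append del: replicate_Suc)
    then show ?thesis using False x by (simp add: head_ref_def hnext_def t)
  qed
qed

text \<open>The states are listed in the order of the tape with the sink at the end, so the code is
  a cell-wise image of the tape followed by a constant.\<close>

lemma code_nfa_head_dfa:
  assumes "i < k"
  shows "code_nfa (head_dfa i w) (concat (map (position_block i) (tm_input w)) @ sink_block)"
proof -
  let ?n = "length w" and ?A = "head_dfa i w"
  let ?qs = "[0..<?n + 3]" and ?ls = "replicate (?n + 2) [] @ [[True]]"
  let ?bs = "map (position_block i) (tm_input w) @ [sink_block]"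
  let ?u = "\<lambda>c. [Trans] @ code_nat c @ [Comma]"
  let ?out = "\<lambda>p. {(?u a, q) | a q. (p, a, q) \<in> nfa_trans ?A}"
  have len: "length (tm_input w) = ?n + 2" by (simp add: tm_input_def)
  have state: "code_state ?qs ?ls (nfa_init ?A) (nfa_final ?A) ?out h (?bs ! h)" if h: "h < length ?qs" for h
  proof -
    let ?r = "\<lambda>c. if h = ?n + 2 then [] else head_ref i (tm_input w ! h) c"
    let ?ts = "map (\<lambda>c. (?u c, hnext i w h c, ?r c)) [0..<length trs]"
    have qs: "?qs ! j = j" if "j \<le> ?n + 2" for j using that nth_upt[of 0 j "?n + 3"] by simp
    have h': "h \<le> ?n + 2" using h by simp
    have 1: "hnext i w h c < length ?qs" if "c < length trs" for c
      using hnext_le[OF that assms, of w h] by simp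
    have 2: "code_ref ?ls h (hnext i w h c) (?r c)" if "c < length trs" for c
    proof (cases "h = ?n + 2")
      case True
      then show ?thesis using code_ref.fwd[of _ h 0] by (auto simp: hnext_def split: prod.splits)
    next
      case False
      then show ?thesis using code_ref_head_ref[OF _ that assms, of h w] h' by simp
    qed
    have 3: "{(u, ?qs ! j) |u j r. (u, j, r) \<in> set ?ts} = ?out (?qs ! h)"
    proof -
      have "{(u, ?qs ! j) |u j r. (u, j, r) \<in> set ?ts} = (\<lambda>c. (?u c, ?qs ! hnext i w h c)) ` {..<length trs}"
        by (auto simp: image_def) (metis atLeastLessThan_iff le0)+
      also have "\<dots> = (\<lambda>c. (?u c, hnext i w h c)) ` {..<length trs}"
        by (intro image_cong HOL.refl) (simp only: Pair_inject lessThan_iff qs hnext_le[OF _ assms] simp_thms)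
      also have "\<dots> = ?out (?qs ! h)"
        using h' unfolding qs[OF h'] head_dfa_trans_iff by auto
      finally show ?thesis .
    qed
    have "tm_input w ! h = Left_End \<longleftrightarrow> h = 0" "tm_input w ! h = Right_End \<longleftrightarrow> h = ?n + 1" if "h < ?n + 2"
      using that by (auto simp: tm_input_def nth_append nth_Cons split: nat.splits)
    moreover have ls: "?ls ! h = (if h = ?n + 2 then [True] else [])"
      using h' by (auto simp: nth_append simp del: replicate_Suc)
    ultimately have 4: "?bs ! h = [State] @ map Bit (?ls ! h) @ (if ?qs ! h = nfa_init ?A then [Init] else []) @
         (if ?qs ! h \<in> nfa_final ?A then [Final] else []) @ concat (map (\<lambda>(u, j, r). u @ r) ?ts)"
      using h' len qs[OF h'] ls
      by (cases "h = ?n + 2")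
        (auto simp: head_dfa_def nth_append position_block_def sink_block_def comp_def simp del: upt_Suc replicate_Suc)
    show ?thesis
      unfolding code_state_def using 1 2 3 4 by (intro exI[of _ ?ts]) (auto simp del: upt_Suc)
  qed
  show ?thesis
    unfolding code_nfa_def code_automaton_def
    by (rule exI[of _ ?qs], rule exI[of _ ?ls], rule exI[of _ ?bs])
      (use state len in \<open>auto simp: head_dfa_def simp del: upt_Suc\<close>)
qed

lemma list_all2_map_same: "list_all2 P (map f xs) (map g xs) \<longleftrightarrow> (\<forall>x\<in>set xs. P (f x) (g x))"
  by (simp add: list_all2_map1 list_all2_map2 list_all2_same)

text \<open>The whole tape is a single block, scanned \<open>k\<close> times; pass \<open>i\<close>
  writes the \<open>i\<close>-th DFA, its sink being the final output of the pass.\<close>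

lemma reduction:
  "linear_time_reducible (recognition_problem k M) (intersection_problem is_dfa {..<length trs} (pda_lang trace_pda) k)"
proof -
  let ?g = "\<lambda>i (s::unit) x. (s, (if x = Left_End then [Auto] else []) @ position_block i x)"
  have "finite (npda2_input_letters M)" using M by (auto simp: npda2_input_letters_def is_npda2_def)
  then interpret rescanner "npda2_input_letters M" "{Left_End}" k "{()}" "()" "\<lambda>_ _. ()" "{()}" "\<lambda>_ _. ()" ?g "\<lambda>_ _. sink_block"
    by unfold_locales (use k in auto)
  obtain T c where T: "is_tm (npda2_input_letters M) T" "\<And>w bs. tm_input w = concat bs \<Longrightarrow> \<forall>b\<in>set bs. is_block b \<Longrightarrow>
      \<exists>t. tm_computes T w t (rescan () bs) \<and> t \<le> c * (length w + 1)"
    using rescan_tm by blast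
  define code where "code w = concat (map (\<lambda>i. Auto # concat (map (position_block i) (tm_input w)) @ sink_block) [0..<k])" for w
  have res: "rescan () [tm_input w] = code w" for w
    unfolding rescan.simps block_out_def pass_out_concat code_def
    by (auto simp: tm_input_def comp_def intro!: arg_cong[where f = concat])
  have blk: "is_block (tm_input w)" for w by (auto simp: is_block_def tm_input_def)
  have enc: "code_nfas (map (\<lambda>i. head_dfa i w) [0..<k]) (code w)" for w
    unfolding code_nfas_def code_def
    by (rule exI[of _ "map (\<lambda>i. concat (map (position_block i) (tm_input w)) @ sink_block) [0..<k]"])
      (auto simp: list_all2_map_same code_nfa_head_dfa comp_def)
  show ?thesis
    unfolding linear_time_reduction_def
  proof (rule exI[of _ T], rule exI[of _ c], intro conjI allI impI)
    show "is_tm (letters (recognition_problem k M)) T" using T(1) by (simp add: recognition_problem_def)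
  next
    fix w x assume "encodes (recognition_problem k M) w x"
    then have w: "x = w" "w \<in> lists (npda2_input_letters M)" by (auto simp: recognition_problem_def)
    obtain t where t: "tm_computes T w t (code w)" "t \<le> c * (length w + 1)"
      using T(2)[of w "[tm_input w]"] blk res by auto
    let ?y = "map (\<lambda>i. head_dfa i w) [0..<k]"
    show "\<exists>t v y. tm_computes T w t v \<and> t \<le> c * (length w + 1) \<and>
       encodes (intersection_problem is_dfa {..<length trs} (pda_lang trace_pda) k) v y \<and>
       yes_instance (recognition_problem k M) x =
       yes_instance (intersection_problem is_dfa {..<length trs} (pda_lang trace_pda) k) y \<and> True"
    proof (rule exI[of _ t], rule exI[of _ "code w"], rule exI[of _ ?y], intro conjI)
      show "encodes (intersection_problem is_dfa {..<length trs} (pda_lang trace_pda) k) (code w) ?y"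
        using enc is_dfa_head_dfa by (auto simp: intersection_problem_def) (simp_all add: head_dfa_def)
      show "yes_instance (recognition_problem k M) x =
       yes_instance (intersection_problem is_dfa {..<length trs} (pda_lang trace_pda) k) ?y"
        using npda2_lang_iff[OF w(2)]
        by (simp add: intersection_problem_def recognition_problem_def w(1) ball_simps(9))
          (auto simp: Ball_def)
    qed (use t in auto)
  qed
qed

end

lemma recognition_reducible_to_dfa_intersection:
  fixes M :: "('q, 'a, 'g) npda2"
  assumes "is_npda2 k M" "k \<ge> 1"
  shows "\<exists>\<Sigma> L. is_dcfl \<Sigma> L \<and> linear_time_reducible (recognition_problem k M) (intersection_problem is_dfa \<Sigma> L k)"
proof -
  have fin: "finite (npda2_trans M)" "finite (npda2_states M)" "finite (npda2_stack M)"
    using assms by (auto simp: is_npda2_def)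
  obtain trs where "set trs = npda2_trans M" using fin(1) finite_list by blast
  moreover obtain fq :: "'q \<Rightarrow> nat" where "inj_on fq (npda2_states M)"
    using finite_imp_inj_to_nat_seg[OF fin(2)] by blast
  moreover obtain fg :: "'g \<Rightarrow> nat" where "inj_on fg (npda2_stack M)"
    using finite_imp_inj_to_nat_seg[OF fin(3)] by blast
  ultimately interpret npda2_traces k M trs fq fg
    using assms by unfold_locales
  have "is_dcfl {..<length trs} (pda_lang trace_pda)"
    unfolding is_dcfl_def using is_dpda_trace_pda by (intro exI[of _ trace_pda]) (simp add: trace_pda_def)
  with reduction show ?thesis by blast
qed

section \<open>The product of a pushdown automaton and a finite automaton\<close>

definition product_pda :: "(nat, nat, nat) pda \<Rightarrow> (nat, nat) nfa \<Rightarrow> (nat, nat, nat) pda" where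
  "product_pda P A = \<lparr>pda_states = prod_encode ` (nfa_states A \<times> pda_states P),
     pda_alphabet = pda_alphabet P, pda_stack = pda_stack P, pda_bottom = pda_bottom P,
     pda_trans =
       {(prod_encode (s, p), None, \<alpha>, prod_encode (s, p'), \<beta>) | s p \<alpha> p' \<beta>.
          s \<in> nfa_states A \<and> (p, None, \<alpha>, p', \<beta>) \<in> pda_trans P} \<union>
       {(prod_encode (s, p), Some a, \<alpha>, prod_encode (s', p'), \<beta>) | s p a \<alpha> s' p' \<beta>.
          (s, a, s') \<in> nfa_trans A \<and> (p, Some a, \<alpha>, p', \<beta>) \<in> pda_trans P},
     pda_init = prod_encode (nfa_init A, pda_init P),
     pda_final = prod_encode ` (nfa_final A \<times> pda_final P)\<rparr>"

lemma product_pda_simps [simp]: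
  "pda_states (product_pda P A) = prod_encode ` (nfa_states A \<times> pda_states P)"
  "pda_alphabet (product_pda P A) = pda_alphabet P" "pda_stack (product_pda P A) = pda_stack P"
  "pda_bottom (product_pda P A) = pda_bottom P"
  "pda_init (product_pda P A) = prod_encode (nfa_init A, pda_init P)"
  "pda_final (product_pda P A) = prod_encode ` (nfa_final A \<times> pda_final P)"
  by (simp_all add: product_pda_def)

lemma product_pda_eps_iff:
  "(prod_encode (s, p), None, \<alpha>, q, \<beta>) \<in> pda_trans (product_pda P A) \<longleftrightarrow>
    s \<in> nfa_states A \<and> (\<exists>p'. q = prod_encode (s, p') \<and> (p, None, \<alpha>, p', \<beta>) \<in> pda_trans P)"
  by (auto simp: product_pda_def)

lemma product_pda_read_iff:
  "(prod_encode (s, p), Some a, \<alpha>, q, \<beta>) \<in> pda_trans (product_pda P A) \<longleftrightarrow>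
    (\<exists>s' p'. q = prod_encode (s', p') \<and> (s, a, s') \<in> nfa_trans A \<and> (p, Some a, \<alpha>, p', \<beta>) \<in> pda_trans P)"
  by (auto simp: product_pda_def)

lemma finite_product_trans:
  assumes "finite (pda_trans P)" "finite (nfa_trans A)" "finite (nfa_states A)"
  shows "finite (pda_trans (product_pda P A))"
proof -
  have "pda_trans (product_pda P A) \<subseteq>
    (\<lambda>(s, p, a, \<alpha>, p', \<beta>). (prod_encode (s, p), a, \<alpha>, prod_encode (s, p'), \<beta>)) ` (nfa_states A \<times> pda_trans P) \<union>
    (\<lambda>((s, a, s'), p, b, \<alpha>, p', \<beta>). (prod_encode (s, p), b, \<alpha>, prod_encode (s', p'), \<beta>)) ` (nfa_trans A \<times> pda_trans P)"
    unfolding product_pda_def by (force simp: image_def)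
  then show ?thesis using assms by (auto intro: finite_subset)
qed

lemma nfa_transD:
  "is_nfa A \<Longrightarrow> (s, a, s') \<in> nfa_trans A \<Longrightarrow> s \<in> nfa_states A \<and> a \<in> nfa_alphabet A \<and> s' \<in> nfa_states A"
  by (auto simp: is_nfa_def)

lemma pda_transD:
  "is_pda P \<Longrightarrow> (p, a, \<alpha>, q, \<beta>) \<in> pda_trans P \<Longrightarrow> p \<in> pda_states P \<and> q \<in> pda_states P \<and>
    set_option a \<subseteq> pda_alphabet P \<and> \<alpha> \<in> pda_stack P \<and> bottom_respecting (pda_stack P) (pda_bottom P) \<alpha> \<beta>"
  unfolding is_pda_def by blast

lemma is_nfa_finite_trans: "is_nfa A \<Longrightarrow> finite (nfa_trans A)"
  by (auto simp: is_nfa_def intro: finite_subset)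

lemma is_pda_product:
  assumes P: "is_pda P" and A: "is_nfa A"
  shows "is_pda (product_pda P A)"
proof -
  have "p \<in> pda_states (product_pda P A) \<and> q \<in> pda_states (product_pda P A) \<and>
      set_option a \<subseteq> pda_alphabet P \<and> \<alpha> \<in> pda_stack P \<and> bottom_respecting (pda_stack P) (pda_bottom P) \<alpha> \<beta>"
    if "(p, a, \<alpha>, q, \<beta>) \<in> pda_trans (product_pda P A)" for p a \<alpha> q \<beta>
    using that unfolding product_pda_def by (auto dest!: nfa_transD[OF A] pda_transD[OF P])
  moreover have "finite (pda_trans (product_pda P A))"
    using assms is_nfa_finite_trans[OF A] by (intro finite_product_trans) (auto simp: is_pda_def is_nfa_def)
  moreover have "pda_init P \<in> pda_states P" "pda_final P \<subseteq> pda_states P" "nfa_init A \<in> nfa_states A"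
    "nfa_final A \<subseteq> nfa_states A" "finite (pda_states P)" "finite (nfa_states A)" "finite (pda_alphabet P)"
    "finite (pda_stack P)" "pda_bottom P \<in> pda_stack P"
    using assms unfolding is_pda_def is_nfa_def by blast+
  moreover from this have "finite (prod_encode ` (nfa_states A \<times> pda_states P))"
    "prod_encode (nfa_init A, pda_init P) \<in> prod_encode ` (nfa_states A \<times> pda_states P)"
    "prod_encode ` (nfa_final A \<times> pda_final P) \<subseteq> prod_encode ` (nfa_states A \<times> pda_states P)" by auto
  ultimately show ?thesis
    unfolding is_pda_def product_pda_simps by (intro conjI ballI; (clarify)?) blast+
qed

text \<open>Whether a product state reads or makes a silent step is decided by its PDA component. A
  reading state needs a successor of the other component for every letter, which is totality of the
  DFA over the same alphabet; a silent step leaves that component alone.\<close>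

lemma is_dpda_product:
  assumes P: "is_dpda P" and A: "is_dfa A" and alph: "nfa_alphabet A = pda_alphabet P"
  shows "is_dpda (product_pda P A)"
proof -
  have PP: "is_pda P" and AA: "is_nfa A" using assms by (auto simp: is_dpda_def is_dfa_def)
  have det: "q = q' \<and> \<beta> = \<beta>'" if "(p, a, \<alpha>, q, \<beta>) \<in> pda_trans P" "(p, a, \<alpha>, q', \<beta>') \<in> pda_trans P" for p a \<alpha> q \<beta> q' \<beta>'
    using P that unfolding is_dpda_def by blast
  have dfa: "s' = s''" if "(s, a, s') \<in> nfa_trans A" "(s, a, s'') \<in> nfa_trans A" for s a s' s''
    using A that nfa_transD[OF AA that(1)] unfolding is_dfa_def by blast
  have "q = q' \<and> \<beta> = \<beta>'"
    if "(p, a, \<alpha>, q, \<beta>) \<in> pda_trans (product_pda P A)" "(p, a, \<alpha>, q', \<beta>') \<in> pda_trans (product_pda P A)" for p a \<alpha> q \<beta> q' \<beta>'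
    using that by (auto simp: product_pda_def dest: det dfa)
  moreover have
     "(\<forall>a\<in>pda_alphabet P. \<forall>\<alpha>\<in>pda_stack P. \<exists>q \<beta>. (x, Some a, \<alpha>, q, \<beta>) \<in> pda_trans (product_pda P A)) \<and>
        (\<forall>\<alpha> q \<beta>. (x, None, \<alpha>, q, \<beta>) \<notin> pda_trans (product_pda P A)) \<or>
      (\<forall>\<alpha>\<in>pda_stack P. \<exists>q \<beta>. (x, None, \<alpha>, q, \<beta>) \<in> pda_trans (product_pda P A)) \<and>
        (\<forall>a \<alpha> q \<beta>. (x, Some a, \<alpha>, q, \<beta>) \<notin> pda_trans (product_pda P A))"
    if x0: "x \<in> pda_states (product_pda P A)" for x
  proof -
    obtain s p where x: "x = prod_encode (s, p)" "s \<in> nfa_states A" "p \<in> pda_states P" using x0 by auto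
    consider "\<forall>a\<in>pda_alphabet P. \<forall>\<alpha>\<in>pda_stack P. \<exists>q \<beta>. (p, Some a, \<alpha>, q, \<beta>) \<in> pda_trans P"
        "\<forall>\<alpha> q \<beta>. (p, None, \<alpha>, q, \<beta>) \<notin> pda_trans P"
      | "\<forall>\<alpha>\<in>pda_stack P. \<exists>q \<beta>. (p, None, \<alpha>, q, \<beta>) \<in> pda_trans P"
        "\<forall>a \<alpha> q \<beta>. (p, Some a, \<alpha>, q, \<beta>) \<notin> pda_trans P"
      using P x(3) unfolding is_dpda_def by blast
    then show ?thesis
    proof cases
      case 1
      moreover have "\<exists>s'. (s, a, s') \<in> nfa_trans A" if "a \<in> pda_alphabet P" for a
        using A x(2) that alph unfolding is_dfa_def by blast
      ultimately have "\<exists>q \<beta>. (x, Some a, \<alpha>, q, \<beta>) \<in> pda_trans (product_pda P A)"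
        if "a \<in> pda_alphabet P" "\<alpha> \<in> pda_stack P" for a \<alpha>
        using that unfolding x(1) product_pda_read_iff by metis
      moreover have "(x, None, \<alpha>, q, \<beta>) \<notin> pda_trans (product_pda P A)" for \<alpha> q \<beta>
        using 1(2) unfolding x(1) product_pda_eps_iff by blast
      ultimately show ?thesis by (intro disjI1) blast
    next
      case 2
      then have "\<exists>q \<beta>. (x, None, \<alpha>, q, \<beta>) \<in> pda_trans (product_pda P A)" if "\<alpha> \<in> pda_stack P" for \<alpha>
        using that x(2) unfolding x(1) product_pda_eps_iff by metis
      moreover have "(x, Some a, \<alpha>, q, \<beta>) \<notin> pda_trans (product_pda P A)" for a \<alpha> q \<beta>
        using 2(2) unfolding x(1) product_pda_read_iff by blast
      ultimately show ?thesis by (intro disjI2) blast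
    qed
  qed
  ultimately show ?thesis
    unfolding is_dpda_def product_pda_simps(2,3) using is_pda_product[OF PP AA]
    by (intro conjI allI impI ballI) blast+
qed

lemma product_runD:
  assumes "pda_run (product_pda P A) c u c'" "fst c = prod_encode (s, p)" "is_nfa A"
  shows "\<exists>s' p'. fst c' = prod_encode (s', p') \<and> pda_run P (p, snd c) u (p', snd c') \<and> nfa_run A s u s'"
  using assms(1,2)
proof (induction arbitrary: s p rule: pda_run.induct)
  case (refl c)
  then show ?case using pda_run.refl[of P "(p, snd c)"] nfa_run.refl[of A s] by blast
next
  case (eps x \<alpha> q \<beta> \<gamma> w c)
  then obtain p1 where q: "q = prod_encode (s, p1)" "(p, None, \<alpha>, p1, \<beta>) \<in> pda_trans P"
    by (auto simp: product_pda_eps_iff)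
  obtain s' p' where "fst c = prod_encode (s', p')" "pda_run P (p1, \<gamma> @ \<beta>) w (p', snd c)" "nfa_run A s w s'"
    using eps.IH[of s p1] q by auto
  with q show ?case by (auto intro: pda_run.eps)
next
  case (read x a \<alpha> q \<beta> \<gamma> w c)
  then obtain s1 p1 where q: "q = prod_encode (s1, p1)" "(s, a, s1) \<in> nfa_trans A" "(p, Some a, \<alpha>, p1, \<beta>) \<in> pda_trans P"
    by (auto simp: product_pda_read_iff)
  obtain s' p' where "fst c = prod_encode (s', p')" "pda_run P (p1, \<gamma> @ \<beta>) w (p', snd c)" "nfa_run A s1 w s'"
    using read.IH[of s1 p1] q by auto
  with q show ?case by (auto intro: pda_run.read nfa_run.read)
qed

text \<open>Membership of \<open>s\<close> in the set of states matters for silent steps, where no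
  transition of \<open>A\<close> is there to imply it.\<close>

lemma product_runI:
  assumes "pda_run P c u c'" "nfa_run A s u s'" "s \<in> nfa_states A" "is_nfa A"
  shows "pda_run (product_pda P A) (prod_encode (s, fst c), snd c) u (prod_encode (s', fst c'), snd c')"
  using assms(1-3)
proof (induction arbitrary: s rule: pda_run.induct)
  case (refl c)
  from refl.prems(1) show ?case by cases (auto intro: pda_run.refl)
next
  case (eps p \<alpha> q \<beta> \<gamma> w c)
  then have "(prod_encode (s, p), None, \<alpha>, prod_encode (s, q), \<beta>) \<in> pda_trans (product_pda P A)"
    by (auto simp: product_pda_eps_iff)
  with eps show ?case by (auto intro: pda_run.eps)
next
  case (read p a \<alpha> q \<beta> \<gamma> w c)
  from read.prems(1) obtain s1 where s1: "(s, a, s1) \<in> nfa_trans A" "nfa_run A s1 w s'" by cases auto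
  then have "(prod_encode (s, p), Some a, \<alpha>, prod_encode (s1, q), \<beta>) \<in> pda_trans (product_pda P A)"
    using read.hyps by (auto simp: product_pda_read_iff)
  moreover have "s1 \<in> nfa_states A" using s1(1) nfa_transD[OF assms(4)] by blast
  ultimately show ?case using read.IH[OF s1(2)] by (auto intro: pda_run.read)
qed

lemma product_pda_lang:
  assumes "is_nfa A"
  shows "pda_lang (product_pda P A) = pda_lang P \<inter> nfa_lang A"
proof (intro equalityI subsetI)
  fix u assume "u \<in> pda_lang (product_pda P A)"
  then obtain s f where f: "s \<in> nfa_final A" "f \<in> pda_final P"
    "pda_run (product_pda P A) (prod_encode (nfa_init A, pda_init P), [pda_bottom P]) u (prod_encode (s, f), [pda_bottom P])"
    by (auto simp: pda_lang_def)
  from product_runD[OF f(3) _ assms, of "nfa_init A" "pda_init P"] f(1,2)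
  show "u \<in> pda_lang P \<inter> nfa_lang A" by (auto simp: pda_lang_def nfa_lang_def)
next
  fix u assume "u \<in> pda_lang P \<inter> nfa_lang A"
  then obtain s f where f: "s \<in> nfa_final A" "f \<in> pda_final P"
    "pda_run P (pda_init P, [pda_bottom P]) u (f, [pda_bottom P])" "nfa_run A (nfa_init A) u s"
    by (auto simp: pda_lang_def nfa_lang_def)
  moreover have "nfa_init A \<in> nfa_states A" using assms by (auto simp: is_nfa_def)
  ultimately have "pda_run (product_pda P A) (prod_encode (nfa_init A, pda_init P), [pda_bottom P]) u (prod_encode (s, f), [pda_bottom P])"
    using product_runI[OF f(3,4) _ assms] by auto
  then show "u \<in> pda_lang (product_pda P A)" using f(1,2) by (auto simp: pda_lang_def)
qed

section \<open>The shape of encodings\<close>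

lemma set_code_nat: "set (code_nat a) \<subseteq> range Bit"
  by (induction a rule: code_nat.induct) (subst code_nat.simps, auto)

text \<open>The code is binary with the least significant bit first, and 0 has the empty code; so
  the first bit and the rest determine parity and half.\<close>

lemma code_nat_inject: "code_nat a = code_nat b \<longleftrightarrow> a = b"
proof
  show "code_nat a = code_nat b \<Longrightarrow> a = b"
  proof (induction a arbitrary: b rule: code_nat.induct)
    case (1 a)
    then have "a = 0 \<longleftrightarrow> b = 0" by (subst (asm) (1 2) code_nat.simps) (auto split: if_splits)
    moreover have "odd a = odd b \<and> code_nat (a div 2) = code_nat (b div 2)" if "a \<noteq> 0" "b \<noteq> 0"
      using 1(2) that by (subst (asm) (1 2) code_nat.simps) auto
    ultimately show ?case using 1(1)[of "b div 2"] by (metis even_two_times_div_two odd_two_times_div_two_succ)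
  qed
qed simp

lemma set_code_ref: "code_ref ls i j r \<Longrightarrow> set r \<subseteq> {Fwd, Bwd, Label} \<union> range Bit"
  by (induction rule: code_ref.induct) auto

text \<open>This is the form of the code of one state. It makes the beginnings of states
  recognisable without parsing what is inside.\<close>

definition is_segment :: "sym list \<Rightarrow> bool" where
  "is_segment b \<longleftrightarrow> (\<exists>ys. b = State # ys \<and> State \<notin> set ys \<and> Auto \<notin> set ys)"

lemma code_state_segment:
  assumes "code_state qs ls q0 F out i b" "i < length qs"
    "\<And>p u q. p \<in> set qs \<Longrightarrow> (u, q) \<in> out p \<Longrightarrow> State \<notin> set u \<and> Auto \<notin> set u"
  shows "is_segment b"
proof -
  from assms(1) obtain ts where ts: "\<forall>(u, j, r) \<in> set ts. j < length qs \<and> code_ref ls i j r"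
     "{(u, qs ! j) | u j r. (u, j, r) \<in> set ts} = out (qs ! i)"
     "b = [State] @ map Bit (ls ! i) @ (if qs ! i = q0 then [Init] else []) @
         (if qs ! i \<in> F then [Final] else []) @ concat (map (\<lambda>(u, j, r). u @ r) ts)"
    unfolding code_state_def by blast
  have "State \<notin> set (u @ r) \<and> Auto \<notin> set (u @ r)" if "(u, j, r) \<in> set ts" for u j r
  proof -
    have "(u, qs ! j) \<in> out (qs ! i)" using ts(2) that by blast
    then have "State \<notin> set u \<and> Auto \<notin> set u" using assms(2,3) by (meson nth_mem)
    moreover have "code_ref ls i j r" using ts(1) that by blast
    ultimately show ?thesis using set_code_ref[of ls i j r] by auto
  qed
  then show ?thesis unfolding is_segment_def ts(3) by fastforce
qed

lemma code_nfa_segments: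
  assumes "code_nfa A w"
  shows "\<exists>bs. w = concat bs \<and> (\<forall>b\<in>set bs. is_segment b)"
proof -
  let ?out = "\<lambda>p. {([Trans] @ code_nat a @ [Comma], q) | a q. (p, a, q) \<in> nfa_trans A}"
  have "State \<notin> set u \<and> Auto \<notin> set u" if "(u, q) \<in> ?out p" for p u q
  proof -
    from that obtain a where "u = [Trans] @ code_nat a @ [Comma]" by blast
    with set_code_nat[of a] show ?thesis by auto
  qed
  with assms show ?thesis
    unfolding code_nfa_def code_automaton_def by (metis (no_types, lifting) code_state_segment in_set_conv_nth)
qed

text \<open>Row-major numbering of pairs, as used for the states of the product.\<close>

lemma concat_map_mult:
  "concat (map (\<lambda>x. f (x div m) (x mod m)) [0..<n * m]) = concat (map (\<lambda>i. concat (map (f i) [0..<m])) [0..<n])"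
  if "m > 0" for m n :: nat
proof (induction n)
  case (Suc n)
  have "[0..<Suc n * m] = [0..<n * m] @ map (\<lambda>j. n * m + j) [0..<m]"
    using upt_add_eq_append[of 0 "n * m" m] map_add_upt[of "n * m" m] by (simp add: add.commute)
  moreover have "map (\<lambda>x. f (x div m) (x mod m)) (map (\<lambda>j. n * m + j) [0..<m]) = map (f n) [0..<m]"
    using that by (auto intro!: map_cong)
  ultimately show ?case using Suc by (simp only: map_append concat_append) simp
qed simp

section \<open>Transducing an encoding into an encoding of the product\<close>

lemma finite_UNIV_sym: "finite (UNIV :: sym set)"
proof -
  have "x \<in> {Bit True, Bit False, Semi, Comma, Eps, State, Init, Final, Trans, Fwd, Bwd, Label, Auto}" for x
    by (cases x) auto
  then have "(UNIV :: sym set) \<subseteq> {Bit True, Bit False, Semi, Comma, Eps, State, Init, Final, Trans, Fwd, Bwd, Label, Auto}"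
    by blast
  then show ?thesis by (rule finite_subset) simp
qed

instance sym :: countable
  by countable_datatype

text \<open>\<open>Head j\<close> produces the label, the flags and the \<open>\<epsilon>\<close>-transitions of the product state with second
  component \<open>j\<close>; \<open>Move j a \<alpha> j' \<beta>\<close> produces its transitions due to a single transition of the PDA.\<close>

datatype pass_kind = Head nat | Move nat nat nat nat "nat list"

text \<open>\<open>Off\<close> ignores the rest, \<open>Copy\<close> transcribes,
  \<open>Prefix\<close> is going to write the alphabet, \<open>Wait\<close> expects a state,
  \<open>Flags\<close> is inside label and flags, \<open>Idle\<close> skips, \<open>Acc\<close>
  collects the bits of a letter, \<open>Ref0\<close> and \<open>RefN\<close> are at the beginning
  and inside of a reference to be translated.\<close>

datatype pass_state = Off | Copy | Prefix | Wait | Flags | Idle | Acc "sym list" | Ref0 | RefN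

instance pass_state :: countable
  by countable_datatype

text \<open>A prefix code. The label of a product state is the mark of its second component followed by the
  label of its first one, so unique labels remain unique.\<close>

definition state_mark :: "nat \<Rightarrow> bool list" where
  "state_mark j = replicate j True @ [False]"

lemma state_mark_append_inject: "state_mark i @ xs = state_mark j @ ys \<longleftrightarrow> i = j \<and> xs = ys"
proof (induction i arbitrary: j)
  case 0
  show ?case by (cases j) (auto simp: state_mark_def)
next
  case (Suc i)
  then show ?case by (cases j) (auto simp: state_mark_def)
qed

text \<open>The case of two product states with the same first component, and so the translation of
  an empty reference.\<close>

definition shift_ref :: "nat \<Rightarrow> nat \<Rightarrow> sym list" where
  "shift_ref j j' = (if j \<le> j' then replicate (j' - j) Fwd else replicate (j - j') Bwd)"

text \<open>The product state with components number \<open>i\<close> and \<open>j\<close> has number \<open>i * m + j\<close>, so a distance \<open>d\<close> to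
  the right becomes \<open>d * m + j' - j\<close>.\<close>

fun product_ref :: "nat \<Rightarrow> nat \<Rightarrow> nat \<Rightarrow> sym list \<Rightarrow> sym list" where
  "product_ref m j j' [] = shift_ref j j'"
| "product_ref m j j' (Label # l) = Label # map Bit (state_mark j') @ l"
| "product_ref m j j' (x # r) =
     (if x = Fwd then replicate (Suc (length r) * m + j' - j) Fwd else replicate (Suc (length r) * m + j - j') Bwd)"

definition product_labels :: "nat \<Rightarrow> bool list list \<Rightarrow> bool list list" where
  "product_labels m ls = map (\<lambda>x. state_mark (x mod m) @ ls ! (x div m)) [0..<length ls * m]"

lemma mult_add_less: "i < n \<Longrightarrow> j < m \<Longrightarrow> i * m + j < n * (m::nat)"
proof -
  assume "i < n" "j < m"
  then have "i * m + j < Suc i * m" by simp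
  also have "\<dots> \<le> n * m" using \<open>i < n\<close> by (intro mult_le_mono1) simp
  finally show ?thesis .
qed

text \<open>At distance 0 the direction depends on the second components. A positive distance
  outweighs their difference, which is less than \<open>m\<close>, so the direction is kept. For
  labels, the prefix code recovers the second component and the old label, whose uniqueness yields
  the first one.\<close>

lemma code_ref_product:
  assumes "code_ref ls i i' r" "j < m" "j' < m"
  shows "code_ref (product_labels m ls) (i * m + j) (i' * m + j') (product_ref m j j' r)"
  using assms(1)
proof cases
  case (fwd d)
  show ?thesis
  proof (cases d)
    case 0
    then show ?thesis
      using fwd code_ref.fwd[of _ "i * m + j" "j' - j"] code_ref.bwd[of _ "i * m + j'" "j - j'"]
      by (auto simp: shift_ref_def)
  next
    case (Suc d')
    then have "product_ref m j j' r = replicate (d * m + j' - j) Fwd" using fwd by simp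
    moreover have "d * m + j' \<ge> j" using Suc assms(2) by simp
    then have "i * m + j + (d * m + j' - j) = i' * m + j'" using fwd by (simp add: algebra_simps)
    ultimately show ?thesis using code_ref.fwd[of _ "i * m + j" "d * m + j' - j"] by simp
  qed
next
  case (bwd d)
  show ?thesis
  proof (cases d)
    case 0
    then show ?thesis
      using bwd code_ref.fwd[of _ "i * m + j" "j' - j"] code_ref.bwd[of _ "i * m + j'" "j - j'"]
      by (auto simp: shift_ref_def)
  next
    case (Suc d')
    then have "product_ref m j j' r = replicate (d * m + j - j') Bwd" using bwd by simp
    moreover have "d * m + j \<ge> j'" using Suc assms(3) by simp
    then have "i' * m + j' + (d * m + j - j') = i * m + j" using bwd by (simp add: algebra_simps)
    ultimately show ?thesis using code_ref.bwd[of _ "i' * m + j'" "d * m + j - j'"] by simp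
  qed
next
  case label
  let ?ls = "product_labels m ls"
  have m: "m > 0" using assms(2) by simp
  have nth: "?ls ! x = state_mark (x mod m) @ ls ! (x div m)" if "x < length ?ls" for x
    using that by (simp add: product_labels_def)
  have l: "i' * m + j' < length ?ls" using mult_add_less label assms(3) by (simp add: product_labels_def)
  have lab: "?ls ! (i' * m + j') = state_mark j' @ ls ! i'" using nth[OF l] assms(3) by simp
  have "x = i' * m + j'" if "x < length ?ls" "?ls ! x = ?ls ! (i' * m + j')" for x
  proof -
    have "x mod m = j'" "ls ! (x div m) = ls ! i'"
      using that nth lab by (auto simp: state_mark_append_inject)
    moreover have "x div m < length ls" using that(1) m by (simp add: product_labels_def less_mult_imp_div_less)
    ultimately have "x div m = i'" "x mod m = j'" using label by blast+
    then show ?thesis by (metis div_mult_mod_eq)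
  qed
  then have "code_ref ?ls (i * m + j) (i' * m + j') (Label # map Bit (state_mark j' @ ls ! i'))"
    using code_ref.label[OF l, of "i * m + j"] lab by simp
  then show ?thesis using label by simp
qed

text \<open>The number of the target is kept in the triples for the semantics; only action and
  reference are written.\<close>

definition put :: "(sym list \<times> nat \<times> sym list) list \<Rightarrow> sym list" where
  "put ts = concat (map (\<lambda>(u, j, r). u @ r) ts)"

lemma put_simps [simp]: "put [] = []" "put ((u, j, r) # ts) = u @ r @ put ts" "put (ts @ ts') = put ts @ put ts'"
  by (simp_all add: put_def)

lemma put_concat: "put (concat tss) = concat (map put tss)"
  by (induction tss) auto

locale product_coding =
  fixes P :: "(nat, nat, nat) pda" and ps :: "nat list" and idx :: "nat \<Rightarrow> nat"
    and trs :: "(nat \<times> nat option \<times> nat \<times> nat \<times> nat list) list" and as :: "nat list"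
  assumes P: "is_pda P" and ps: "distinct ps" "set ps = pda_states P"
    and idx: "\<And>q. q \<in> pda_states P \<Longrightarrow> idx q < length ps \<and> ps ! idx q = q"
    and trs: "set trs = pda_trans P" and as: "set as = pda_alphabet P"
begin

abbreviation m :: nat where "m \<equiv> length ps"

definition action :: "nat option \<Rightarrow> nat \<Rightarrow> nat list \<Rightarrow> sym list" where
  "action a \<alpha> \<beta> = [Trans] @ (case a of None \<Rightarrow> [Eps] | Some b \<Rightarrow> code_nat b) @ [Comma] @
     code_nat \<alpha> @ [Comma] @ code_nats \<beta> @ [Comma]"

definition eps_trans :: "nat \<Rightarrow> (nat \<times> nat \<times> nat list) list" where
  "eps_trans j = [(\<alpha>, idx q, \<beta>). (p, a, \<alpha>, q, \<beta>) \<leftarrow> trs, p = ps ! j \<and> a = None]"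

definition moves :: "nat \<Rightarrow> (nat \<times> nat \<times> nat \<times> nat list) list" where
  "moves j = [(the a, \<alpha>, idx q, \<beta>). (p, a, \<alpha>, q, \<beta>) \<leftarrow> trs, p = ps ! j \<and> a \<noteq> None]"

lemma m_pos: "m > 0"
  using P ps by (auto simp: is_pda_def)

lemma eps_trans_iff:
  "j < m \<Longrightarrow> (\<alpha>, j', \<beta>) \<in> set (eps_trans j) \<longleftrightarrow> j' < m \<and> (ps ! j, None, \<alpha>, ps ! j', \<beta>) \<in> pda_trans P"
proof -
  have *: "idx (ps ! j') = j'" if "j' < m" for j'
    using idx[of "ps ! j'"] that ps nth_eq_iff_index_eq[OF ps(1)] by (metis nth_mem)
  assume j: "j < m"
  have "(\<alpha>, j', \<beta>) \<in> set (eps_trans j) \<longleftrightarrow> (\<exists>q. j' = idx q \<and> (ps ! j, None, \<alpha>, q, \<beta>) \<in> pda_trans P)"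
    unfolding eps_trans_def trs[symmetric] by (force split: if_splits)
  also have "\<dots> \<longleftrightarrow> j' < m \<and> (ps ! j, None, \<alpha>, ps ! j', \<beta>) \<in> pda_trans P"
    using idx * pda_transD[OF P] by metis
  finally show ?thesis .
qed

lemma moves_iff:
  "j < m \<Longrightarrow> (a, \<alpha>, j', \<beta>) \<in> set (moves j) \<longleftrightarrow> j' < m \<and> (ps ! j, Some a, \<alpha>, ps ! j', \<beta>) \<in> pda_trans P"
proof -
  have *: "idx (ps ! j') = j'" if "j' < m" for j'
    using idx[of "ps ! j'"] that ps nth_eq_iff_index_eq[OF ps(1)] by (metis nth_mem)
  assume j: "j < m"
  have "(a, \<alpha>, j', \<beta>) \<in> set (moves j) \<longleftrightarrow> (\<exists>q. j' = idx q \<and> (ps ! j, Some a, \<alpha>, q, \<beta>) \<in> pda_trans P)"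
    unfolding moves_def trs[symmetric] by (force split: if_splits)
  also have "\<dots> \<longleftrightarrow> j' < m \<and> (ps ! j, Some a, \<alpha>, ps ! j', \<beta>) \<in> pda_trans P"
    using idx * pda_transD[OF P] by metis
  finally show ?thesis .
qed

text \<open>A silent step stays within the row of product states of one NFA state, so its reference
  does not depend on the NFA at all.\<close>

definition eps_code :: "nat \<Rightarrow> sym list" where
  "eps_code j = concat (map (\<lambda>(\<alpha>, j', \<beta>). action None \<alpha> \<beta> @ shift_ref j j') (eps_trans j))"

text \<open>A product state is initial or final iff both components are; so a flag of the NFA state
  can be kept or dropped at once, depending only on \<open>j\<close>.\<close>

fun flag_pass :: "nat \<Rightarrow> pass_state \<Rightarrow> sym \<Rightarrow> pass_state \<times> sym list" where
  "flag_pass j Wait y = (if y = State then (Flags, State # map Bit (state_mark j)) else (Off, []))"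
| "flag_pass j Flags y = (case y of Bit b \<Rightarrow> (Flags, [Bit b])
     | Init \<Rightarrow> (Flags, if ps ! j = pda_init P then [Init] else [])
     | Final \<Rightarrow> (Flags, if ps ! j \<in> pda_final P then [Final] else [])
     | _ \<Rightarrow> (Idle, []))"
| "flag_pass j s y = (s, if s = Copy then [y] else [])"

text \<open>The bits of a letter are collected in \<open>Acc\<close>, truncated so that only finitely many states are
  reachable. In \<open>Ref0\<close> the reference has not started; if it is empty, it is produced afterwards.\<close>

fun move_pass :: "nat \<Rightarrow> nat \<Rightarrow> nat \<Rightarrow> nat \<Rightarrow> nat list \<Rightarrow> pass_state \<Rightarrow> sym \<Rightarrow> pass_state \<times> sym list" where
  "move_pass j a \<alpha> j' \<beta> Wait y = (if y = State then Idle else Off, [])"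
| "move_pass j a \<alpha> j' \<beta> Idle y = (if y = Trans then Acc [] else Idle, [])"
| "move_pass j a \<alpha> j' \<beta> (Acc v) y =
     (if y = Comma then (if v = code_nat a then (Ref0, action (Some a) \<alpha> \<beta>) else (Idle, []))
      else (Acc (take (Suc (length (code_nat a))) (v @ [y])), []))"
| "move_pass j a \<alpha> j' \<beta> Ref0 y = (case y of Trans \<Rightarrow> (Acc [], shift_ref j j')
     | Fwd \<Rightarrow> (RefN, replicate (m + j' - j) Fwd)
     | Bwd \<Rightarrow> (RefN, replicate (m + j - j') Bwd)
     | Label \<Rightarrow> (RefN, Label # map Bit (state_mark j'))
     | _ \<Rightarrow> (Idle, []))"
| "move_pass j a \<alpha> j' \<beta> RefN y = (case y of Trans \<Rightarrow> (Acc [], [])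
     | Fwd \<Rightarrow> (RefN, replicate m Fwd) | Bwd \<Rightarrow> (RefN, replicate m Bwd) | _ \<Rightarrow> (RefN, [y]))"
| "move_pass j a \<alpha> j' \<beta> s y = (s, [])"

fun pass_step :: "pass_kind \<Rightarrow> pass_state \<Rightarrow> sym \<Rightarrow> pass_state \<times> sym list" where
  "pass_step (Head j) s y = flag_pass j s y"
| "pass_step (Move j a \<alpha> j' \<beta>) s y = move_pass j a \<alpha> j' \<beta> s y"

fun pass_end :: "pass_kind \<Rightarrow> pass_state \<Rightarrow> sym list" where
  "pass_end (Head j) s = (if s \<in> {Flags, Idle} then eps_code j else [])"
| "pass_end (Move j a \<alpha> j' \<beta>) s = (if s = Ref0 then shift_ref j j' else [])"

lemma pass_end_simps [simp]:
  "pass_end (Head j) Flags = eps_code j" "pass_end (Head j) Idle = eps_code j" "pass_end (Head j) Copy = []"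
  "pass_end pk Off = []" "pass_end pk Prefix = []" "pass_end pk Wait = []"
  "pass_end (Move j a \<alpha> j' \<beta>) Ref0 = shift_ref j j'" "pass_end (Move j a \<alpha> j' \<beta>) Idle = []"
  "pass_end (Move j a \<alpha> j' \<beta>) RefN = []"
  by (cases pk; simp)+

declare pass_end.simps [simp del]

fun cell_step :: "pass_kind \<Rightarrow> pass_state \<Rightarrow> sym cell \<Rightarrow> pass_state \<times> sym list" where
  "cell_step pk s (Letter y) = pass_step pk s y"
| "cell_step pk s Left_End = (if s = Prefix then (Off, code_nats as @ [Auto]) else (s, []))"
| "cell_step pk s Right_End = (s, [])"

text \<open>All passes for one PDA state are consecutive, which makes the code of each product state
  contiguous and yields the row-major order of states.\<close>

definition pass_list :: "pass_kind list" where
  "pass_list = concat (map (\<lambda>j. Head j # map (\<lambda>(a, \<alpha>, j', \<beta>). Move j a \<alpha> j' \<beta>) (moves j)) [0..<m])"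

text \<open>The specification of what a \<open>Move\<close> pass makes of one NFA transition: at
  most one product transition.\<close>

definition transition :: "nat \<Rightarrow> nat \<Rightarrow> nat \<times> nat \<times> nat \<times> nat list \<Rightarrow> sym list \<times> nat \<times> sym list \<Rightarrow> (sym list \<times> nat \<times> sym list) list" where
  "transition i j = (\<lambda>(a, \<alpha>, j', \<beta>) (u, i', r). if u = [Trans] @ code_nat a @ [Comma]
     then [(action (Some a) \<alpha> \<beta>, i' * m + j', product_ref m j j' r)] else [])"

abbreviation "mout j a \<alpha> j' \<beta> \<equiv> pass_out (move_pass j a \<alpha> j' \<beta>) (pass_end (Move j a \<alpha> j' \<beta>))"

text \<open>Keeping one symbol beyond the length of \<open>c\<close> is enough to detect that a word
  is too long, so \<open>Acc\<close> may forget the rest.\<close>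

lemma take_Suc_eq: "length c = n \<Longrightarrow> take (Suc n) xs = c \<longleftrightarrow> xs = c"
  by (auto simp: take_all_iff) (metis Suc_n_not_le_n le_cases length_take min.absorb2 take_all_iff)

lemma mout_Acc:
  assumes "Comma \<notin> set v"
  shows "mout j a \<alpha> j' \<beta> (Acc (take (Suc (length (code_nat a))) w)) (v @ Comma # rest) =
    (if w @ v = code_nat a then action (Some a) \<alpha> \<beta> @ mout j a \<alpha> j' \<beta> Ref0 rest else mout j a \<alpha> j' \<beta> Idle rest)"
  using assms
proof (induction v arbitrary: w)
  case Nil
  show ?case by (simp add: pass_out_Cons take_Suc_eq)
next
  case (Cons y v)
  have "take (Suc (length (code_nat a))) (take (Suc (length (code_nat a))) w @ [y]) = take (Suc (length (code_nat a))) (w @ [y])"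
    by (auto simp: min_def take_Cons' not_le)
  moreover have "y \<noteq> Comma" "Comma \<notin> set v" using Cons.prems by auto
  ultimately show ?case using Cons.IH[of "w @ [y]"] by (simp add: pass_out_Cons del: take_append)
qed

lemma mout_Idle: "Trans \<notin> set r \<Longrightarrow> mout j a \<alpha> j' \<beta> Idle (r @ rest) = mout j a \<alpha> j' \<beta> Idle rest"
  by (induction r) (auto simp: pass_out_Cons)

lemma mout_RefN_Fwd: "mout j a \<alpha> j' \<beta> RefN (replicate d Fwd @ rest) = replicate (d * m) Fwd @ mout j a \<alpha> j' \<beta> RefN rest"
  by (induction d) (auto simp: pass_out_Cons replicate_add)

lemma mout_RefN_Bwd: "mout j a \<alpha> j' \<beta> RefN (replicate d Bwd @ rest) = replicate (d * m) Bwd @ mout j a \<alpha> j' \<beta> RefN rest"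
  by (induction d) (auto simp: pass_out_Cons replicate_add)

lemma mout_RefN_Bit: "mout j a \<alpha> j' \<beta> RefN (map Bit l @ rest) = map Bit l @ mout j a \<alpha> j' \<beta> RefN rest"
  by (induction l) (auto simp: pass_out_Cons)

text \<open>A transition may begin in any of the three states. What is still owed for the preceding
  one is exactly \<open>pass_end\<close>: in \<open>Ref0\<close> its reference was empty, and the
  translation is written at the next \<open>Trans\<close> or at the end.\<close>

lemma mout_transitions:
  assumes "\<forall>(u, i', r)\<in>set ts. (\<exists>a'. u = [Trans] @ code_nat a' @ [Comma]) \<and> code_ref ls i i' r"
    and "j < m" "j' < m"
  shows "s \<in> {Idle, Ref0, RefN} \<Longrightarrow> mout j a \<alpha> j' \<beta> s (put ts) =
    pass_end (Move j a \<alpha> j' \<beta>) s @ put (concat (map (transition i j (a, \<alpha>, j', \<beta>)) ts))"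
  using assms(1)
proof (induction ts arbitrary: s)
  case (Cons t ts)
  obtain u i' r where t: "t = (u, i', r)" by (cases t)
  then obtain a' where u: "u = [Trans] @ code_nat a' @ [Comma]" and r: "code_ref ls i i' r"
    using Cons.prems(2) by auto
  let ?rest = "put ts" and ?out = "put (concat (map (transition i j (a, \<alpha>, j', \<beta>)) ts))"
  have "\<forall>(u, i', r)\<in>set ts. (\<exists>a'. u = [Trans] @ code_nat a' @ [Comma]) \<and> code_ref ls i i' r"
    using Cons.prems(2) by simp
  note IH = Cons.IH[OF _ this]
  have "mout j a \<alpha> j' \<beta> s (put (t # ts)) = pass_end (Move j a \<alpha> j' \<beta>) s @
    mout j a \<alpha> j' \<beta> (Acc []) (code_nat a' @ Comma # r @ ?rest)"
    using Cons.prems(1) by (auto simp: t u pass_out_Cons)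
  also have "mout j a \<alpha> j' \<beta> (Acc []) (code_nat a' @ Comma # r @ ?rest) =
    (if code_nat a' = code_nat a then action (Some a) \<alpha> \<beta> @ mout j a \<alpha> j' \<beta> Ref0 (r @ ?rest) else mout j a \<alpha> j' \<beta> Idle (r @ ?rest))"
  proof -
    have "Comma \<notin> set (code_nat a')" using set_code_nat[of a'] by auto
    from mout_Acc[OF this, of j a \<alpha> j' \<beta> "[]"] show ?thesis by simp
  qed
  also have "mout j a \<alpha> j' \<beta> Idle (r @ ?rest) = ?out"
  proof -
    have "Trans \<notin> set r" using set_code_ref[OF r] by auto
    from mout_Idle[OF this] IH[of Idle] show ?thesis by simp
  qed
  also have "mout j a \<alpha> j' \<beta> Ref0 (r @ ?rest) = product_ref m j j' r @ ?out"
    using r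
  proof cases
    case (fwd d)
    \<comment> \<open>The first symbol of a distance is translated with the correction for the
      second components, all others by \<open>m\<close> symbols; as \<open>j < m\<close>, the
      subtraction is not truncated.\<close>
    have "replicate (m + j' - j) Fwd @ replicate (d' * m) Fwd = replicate (m + d' * m + j' - j) Fwd" for d'
      using assms(2) by (simp add: replicate_add[symmetric])
    then show ?thesis
      using fwd IH[of Ref0] IH[of RefN] by (cases d) (auto simp: pass_out_Cons mout_RefN_Fwd simp flip: append_assoc)
  next
    case (bwd d)
    have "replicate (m + j - j') Bwd @ replicate (d' * m) Bwd = replicate (m + d' * m + j - j') Bwd" for d'
      using assms(3) by (simp add: replicate_add[symmetric])
    then show ?thesis
      using bwd IH[of Ref0] IH[of RefN] by (cases d) (auto simp: pass_out_Cons mout_RefN_Bwd simp flip: append_assoc)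
  next
    case label
    then show ?thesis using IH[of RefN] by (simp add: pass_out_Cons mout_RefN_Bit)
  qed
  finally show ?case by (simp add: t u transition_def)
qed auto

abbreviation "fout j \<equiv> pass_out (flag_pass j) (pass_end (Head j))"

lemma fout_Idle: "fout j Idle xs = eps_code j"
  by (induction xs) (auto simp: pass_out_Cons)

lemma fout_Bits: "fout j Flags (map Bit l @ rest) = map Bit l @ fout j Flags rest"
  by (induction l) (auto simp: pass_out_Cons)

lemma fout_state:
  assumes "\<forall>(u, i', r)\<in>set ts. \<exists>a'. u = [Trans] @ code_nat a' @ [Comma]"
  shows "fout j Wait ([State] @ map Bit l @ (if c then [Init] else []) @ (if d then [Final] else []) @ put ts) =
    [State] @ map Bit (state_mark j @ l) @ (if c \<and> ps ! j = pda_init P then [Init] else []) @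
      (if d \<and> ps ! j \<in> pda_final P then [Final] else []) @ eps_code j"
proof -
  have "fout j Flags (put ts) = eps_code j"
    using assms by (cases ts) (auto simp: pass_out_Cons fout_Idle)
  then show ?thesis by (auto simp: pass_out_Cons fout_Bits)
qed

lemma mout_state:
  assumes "\<forall>(u, i', r)\<in>set ts. (\<exists>a'. u = [Trans] @ code_nat a' @ [Comma]) \<and> code_ref ls i i' r"
    and "j < m" "j' < m"
  shows "mout j a \<alpha> j' \<beta> Wait ([State] @ map Bit l @ (if c then [Init] else []) @ (if d then [Final] else []) @ put ts) =
    put (concat (map (transition i j (a, \<alpha>, j', \<beta>)) ts))"
proof -
  let ?v = "map Bit l @ (if c then [Init] else []) @ (if d then [Final] else [])"
  have "Trans \<notin> set ?v" by auto
  from mout_Idle[OF this, of j a \<alpha> j' \<beta> "put ts"] mout_transitions[OF assms, of Idle a \<alpha> \<beta>]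
  show ?thesis by (simp add: pass_out_Cons)
qed

definition kind_out :: "pass_kind \<Rightarrow> sym list \<Rightarrow> sym list" where
  "kind_out pk b = pass_out (pass_step pk) (pass_end pk) Wait b"

definition state_out :: "sym list \<Rightarrow> nat \<Rightarrow> sym list" where
  "state_out b j = concat (map (\<lambda>pk. kind_out pk b) (Head j # map (\<lambda>(a, \<alpha>, j', \<beta>). Move j a \<alpha> j' \<beta>) (moves j)))"

lemma pass_step_Head: "pass_step (Head j) = flag_pass j"
  and pass_step_Move: "pass_step (Move j a \<alpha> j' \<beta>) = move_pass j a \<alpha> j' \<beta>"
  by (auto intro!: ext)

text \<open>The transitions of the product state are listed in the order in which the passes write
  them: silent ones from the \<open>Head\<close> pass, then, for each PDA move, the NFA transitions
  with the same letter.\<close>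

lemma code_state_product:
  assumes A: "is_nfa A" and qs: "distinct qs" "set qs = nfa_states A"
    and code: "code_state qs ls (nfa_init A) (nfa_final A) (\<lambda>p. {([Trans] @ code_nat a @ [Comma], q) | a q. (p, a, q) \<in> nfa_trans A}) i b"
    and i: "i < length qs" "length ls = length qs" and j: "j < m"
  shows "code_state (map (\<lambda>x. prod_encode (qs ! (x div m), ps ! (x mod m))) [0..<length qs * m]) (product_labels m ls)
    (pda_init (product_pda P A)) (pda_final (product_pda P A))
    (\<lambda>p. {([Trans] @ (case a of None \<Rightarrow> [Eps] | Some b \<Rightarrow> code_nat b) @ [Comma] @
            code_nat \<alpha> @ [Comma] @ code_nats \<beta> @ [Comma], q) | a \<alpha> q \<beta>.
          (p, a, \<alpha>, q, \<beta>) \<in> pda_trans (product_pda P A)})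
    (i * m + j) (state_out b j)"
proof -
  let ?qs = "map (\<lambda>x. prod_encode (qs ! (x div m), ps ! (x mod m))) [0..<length qs * m]"
  let ?out = "\<lambda>p. {([Trans] @ code_nat a @ [Comma], q) | a q. (p, a, q) \<in> nfa_trans A}"
  have Q: "?qs ! (i * m + j) = prod_encode (qs ! i, ps ! j)" if "i < length qs" "j < m" for i j
    using mult_add_less[OF that] that m_pos by simp
  obtain ts where ts: "\<forall>(u, i', r) \<in> set ts. i' < length qs \<and> code_ref ls i i' r"
     "{(u, qs ! i') | u i' r. (u, i', r) \<in> set ts} = ?out (qs ! i)"
     "b = [State] @ map Bit (ls ! i) @ (if qs ! i = nfa_init A then [Init] else []) @
         (if qs ! i \<in> nfa_final A then [Final] else []) @ put ts"
    using code unfolding code_state_def put_def by blast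
  have ts1: "\<exists>a'. u = [Trans] @ code_nat a' @ [Comma] \<and> (qs ! i, a', qs ! i') \<in> nfa_trans A" if "(u, i', r) \<in> set ts" for u i' r
  proof -
    have "(u, qs ! i') \<in> ?out (qs ! i)" using that ts(2) by blast
    then show ?thesis by blast
  qed
  have ts2: "\<forall>(u, i', r)\<in>set ts. (\<exists>a'. u = [Trans] @ code_nat a' @ [Comma]) \<and> code_ref ls i i' r"
    using ts(1) ts1 by blast
  let ?te = "map (\<lambda>(\<alpha>, j', \<beta>). (action None \<alpha> \<beta>, i * m + j', shift_ref j j')) (eps_trans j)"
  let ?tm = "concat (map (\<lambda>mv. concat (map (transition i j mv) ts)) (moves j))"
  have mv: "kind_out (Move j a \<alpha> j' \<beta>) b = put (concat (map (transition i j (a, \<alpha>, j', \<beta>)) ts))"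
    if "(a, \<alpha>, j', \<beta>) \<in> set (moves j)" for a \<alpha> j' \<beta>
    unfolding kind_out_def ts(3) pass_step_Move
    using mout_state[OF ts2 j, of j' a \<alpha> \<beta>] that moves_iff[OF j] by blast
  have h1: "concat (map (\<lambda>pk. kind_out pk b) (map (\<lambda>(a, \<alpha>, j', \<beta>). Move j a \<alpha> j' \<beta>) (moves j))) = put ?tm"
    unfolding put_concat map_map using mv by (intro arg_cong[where f = concat] map_cong) auto
  have h2: "eps_code j = put ?te"
    unfolding eps_code_def put_def by (intro arg_cong[where f = concat]) auto
  have h3: "kind_out (Head j) b = [State] @ map Bit (state_mark j @ ls ! i) @ (if qs ! i = nfa_init A \<and> ps ! j = pda_init P then [Init] else []) @
      (if qs ! i \<in> nfa_final A \<and> ps ! j \<in> pda_final P then [Final] else []) @ eps_code j"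
    unfolding kind_out_def ts(3) pass_step_Head using ts2 by (intro fout_state) blast
  have h4: "product_labels m ls ! (i * m + j) = state_mark j @ ls ! i"
    using mult_add_less[OF i(1) j] i(2) j m_pos by (simp add: product_labels_def)
  have h5: "prod_encode (qs ! i, ps ! j) = pda_init (product_pda P A) \<longleftrightarrow> qs ! i = nfa_init A \<and> ps ! j = pda_init P"
    "prod_encode (qs ! i, ps ! j) \<in> pda_final (product_pda P A) \<longleftrightarrow> qs ! i \<in> nfa_final A \<and> ps ! j \<in> pda_final P"
    by auto
  have h6: "state_out b j = kind_out (Head j) b @ put ?tm"
    unfolding state_out_def h1[symmetric] by simp
  have out: "state_out b j = [State] @ map Bit (product_labels m ls ! (i * m + j)) @
      (if ?qs ! (i * m + j) = pda_init (product_pda P A) then [Init] else []) @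
      (if ?qs ! (i * m + j) \<in> pda_final (product_pda P A) then [Final] else []) @ concat (map (\<lambda>(u, j, r). u @ r) (?te @ ?tm))"
    unfolding Q[OF i(1) j] put_def[symmetric] h6 h3 h4 h5 h2 put_simps append_assoc by (rule HOL.refl)
  have tm: "(u, x, r') \<in> set ?tm \<longleftrightarrow> (\<exists>a \<alpha> j' \<beta> i' r. (a, \<alpha>, j', \<beta>) \<in> set (moves j) \<and>
      ([Trans] @ code_nat a @ [Comma], i', r) \<in> set ts \<and> u = action (Some a) \<alpha> \<beta> \<and> x = i' * m + j' \<and> r' = product_ref m j j' r)" for u x r'
  proof
    assume "(u, x, r') \<in> set ?tm"
    then obtain mv t where mt: "mv \<in> set (moves j)" "t \<in> set ts" "(u, x, r') \<in> set (transition i j mv t)" by auto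
    obtain a \<alpha> j' \<beta> where mv: "mv = (a, \<alpha>, j', \<beta>)" by (cases mv)
    obtain u' i' r where t: "t = (u', i', r)" by (cases t)
    have "u' = [Trans] @ code_nat a @ [Comma]" "u = action (Some a) \<alpha> \<beta>" "x = i' * m + j'" "r' = product_ref m j j' r"
      using mt(3) by (auto simp: transition_def mv t split: if_splits)
    then show "\<exists>a \<alpha> j' \<beta> i' r. (a, \<alpha>, j', \<beta>) \<in> set (moves j) \<and>
      ([Trans] @ code_nat a @ [Comma], i', r) \<in> set ts \<and> u = action (Some a) \<alpha> \<beta> \<and> x = i' * m + j' \<and> r' = product_ref m j j' r"
      using mt(1,2) unfolding mv t by blast
  next
    assume "\<exists>a \<alpha> j' \<beta> i' r. (a, \<alpha>, j', \<beta>) \<in> set (moves j) \<and>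
      ([Trans] @ code_nat a @ [Comma], i', r) \<in> set ts \<and> u = action (Some a) \<alpha> \<beta> \<and> x = i' * m + j' \<and> r' = product_ref m j j' r"
    then obtain a \<alpha> j' \<beta> i' r where *: "(a, \<alpha>, j', \<beta>) \<in> set (moves j)" "([Trans] @ code_nat a @ [Comma], i', r) \<in> set ts"
      "(u, x, r') = (action (Some a) \<alpha> \<beta>, i' * m + j', product_ref m j j' r)" by auto
    then have "(u, x, r') \<in> set (transition i j (a, \<alpha>, j', \<beta>) ([Trans] @ code_nat a @ [Comma], i', r))"
      by (simp add: transition_def)
    then show "(u, x, r') \<in> set ?tm" using *(1,2) by (auto intro!: bexI)
  qed
  have te: "(u, x, r) \<in> set ?te \<longleftrightarrow> (\<exists>\<alpha> j' \<beta>. (\<alpha>, j', \<beta>) \<in> set (eps_trans j) \<and> u = action None \<alpha> \<beta> \<and>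
      x = i * m + j' \<and> r = shift_ref j j')" for u x r
    by (auto simp: image_iff Bex_def)
  have refs: "\<forall>(u, x, r)\<in>set (?te @ ?tm). x < length ?qs \<and> code_ref (product_labels m ls) (i * m + j) x r"
  proof clarify
    fix u x r assume "(u, x, r) \<in> set (?te @ ?tm)"
    then consider \<alpha> j' \<beta> where "(\<alpha>, j', \<beta>) \<in> set (eps_trans j)" "x = i * m + j'" "r = shift_ref j j'"
      | a \<alpha> j' \<beta> i' r' where "(a, \<alpha>, j', \<beta>) \<in> set (moves j)" "([Trans] @ code_nat a @ [Comma], i', r') \<in> set ts"
        "x = i' * m + j'" "r = product_ref m j j' r'"
      unfolding set_append Un_iff tm te by blast
    then show "x < length ?qs \<and> code_ref (product_labels m ls) (i * m + j) x r"
    proof cases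
      case 1
      then show ?thesis using mult_add_less[OF i(1), of j' m] code_ref_product[OF code_ref.fwd[of ls i 0] j, of j'] eps_trans_iff[OF j] by simp
    next
      case 2
      then have "i' < length qs" "code_ref ls i i' r'" using ts(1) by blast+
      with 2 show ?thesis using mult_add_less[of i' "length qs" j' m] code_ref_product[OF _ j, of ls i i' r' j'] moves_iff[OF j] by simp
    qed
  qed
  let ?out' = "\<lambda>p. {([Trans] @ (case a of None \<Rightarrow> [Eps] | Some b \<Rightarrow> code_nat b) @ [Comma] @
            code_nat \<alpha> @ [Comma] @ code_nats \<beta> @ [Comma], q) | a \<alpha> q \<beta>.
          (p, a, \<alpha>, q, \<beta>) \<in> pda_trans (product_pda P A)}"
  have out_eq: "?out' p = {(action a \<alpha> \<beta>, q) | a \<alpha> q \<beta>. (p, a, \<alpha>, q, \<beta>) \<in> pda_trans (product_pda P A)}" for p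
    by (simp add: action_def)
  have "{(u, ?qs ! x) | u x r. (u, x, r) \<in> set (?te @ ?tm)} = ?out' (?qs ! (i * m + j))"
    unfolding out_eq Q[OF i(1) j]
  proof (intro equalityI subsetI)
    fix z assume "z \<in> {(u, ?qs ! x) | u x r. (u, x, r) \<in> set (?te @ ?tm)}"
    then obtain u x r where z: "z = (u, ?qs ! x)" and "(u, x, r) \<in> set (?te @ ?tm)" by blast
    then consider \<alpha> j' \<beta> where "(\<alpha>, j', \<beta>) \<in> set (eps_trans j)" "x = i * m + j'" "u = action None \<alpha> \<beta>"
      | a \<alpha> j' \<beta> i' r' where "(a, \<alpha>, j', \<beta>) \<in> set (moves j)" "([Trans] @ code_nat a @ [Comma], i', r') \<in> set ts"
        "x = i' * m + j'" "u = action (Some a) \<alpha> \<beta>"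
      unfolding set_append Un_iff tm te by blast
    then show "z \<in> {(action a \<alpha> \<beta>, q) | a \<alpha> q \<beta>. (prod_encode (qs ! i, ps ! j), a, \<alpha>, q, \<beta>) \<in> pda_trans (product_pda P A)}"
    proof cases
      case 1
      then have j': "j' < m" and "(ps ! j, None, \<alpha>, ps ! j', \<beta>) \<in> pda_trans P" using eps_trans_iff[OF j] by blast+
      then have "(prod_encode (qs ! i, ps ! j), None, \<alpha>, prod_encode (qs ! i, ps ! j'), \<beta>) \<in> pda_trans (product_pda P A)"
        unfolding product_pda_eps_iff using nth_mem[OF i(1)] qs(2) by blast
      moreover have "z = (action None \<alpha> \<beta>, prod_encode (qs ! i, ps ! j'))" using z 1 Q[OF i(1) j'] by simp
      ultimately show ?thesis by blast
    next
      case 2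
      then have j': "j' < m" and t: "(ps ! j, Some a, \<alpha>, ps ! j', \<beta>) \<in> pda_trans P" using moves_iff[OF j] by blast+
      have i': "i' < length qs" using 2 ts(1) by blast
      \<comment> \<open>The pass compares codes of letters; their injectivity turns this into
        equality of letters.\<close>
      have "(qs ! i, a, qs ! i') \<in> nfa_trans A" using ts1[OF 2(2)] by (simp add: code_nat_inject)
      with t have "(prod_encode (qs ! i, ps ! j), Some a, \<alpha>, prod_encode (qs ! i', ps ! j'), \<beta>) \<in> pda_trans (product_pda P A)"
        unfolding product_pda_read_iff by blast
      moreover have "z = (action (Some a) \<alpha> \<beta>, prod_encode (qs ! i', ps ! j'))" using z 2 Q[OF i' j'] by simp
      ultimately show ?thesis by blast
    qed
  next
    fix z assume "z \<in> {(action a \<alpha> \<beta>, q) | a \<alpha> q \<beta>. (prod_encode (qs ! i, ps ! j), a, \<alpha>, q, \<beta>) \<in> pda_trans (product_pda P A)}"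
    then obtain a \<alpha> q \<beta> where z: "z = (action a \<alpha> \<beta>, q)" and t: "(prod_encode (qs ! i, ps ! j), a, \<alpha>, q, \<beta>) \<in> pda_trans (product_pda P A)" by blast
    show "z \<in> {(u, ?qs ! x) | u x r. (u, x, r) \<in> set (?te @ ?tm)}"
    proof (cases a)
      case None
      then obtain p' where p': "q = prod_encode (qs ! i, p')" "(ps ! j, None, \<alpha>, p', \<beta>) \<in> pda_trans P"
        using t by (auto simp: product_pda_eps_iff)
      then obtain j' where j': "j' < m" "p' = ps ! j'" using pda_transD[OF P p'(2)] ps by (metis in_set_conv_nth)
      then have "(\<alpha>, j', \<beta>) \<in> set (eps_trans j)" using p' eps_trans_iff[OF j] by simp
      then have "(action None \<alpha> \<beta>, i * m + j', shift_ref j j') \<in> set (?te @ ?tm)" by force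
      moreover have "z = (action None \<alpha> \<beta>, ?qs ! (i * m + j'))" using z None p'(1) j' Q[OF i(1) j'(1)] by simp
      ultimately show ?thesis by blast
    next
      case (Some c)
      then obtain s' p' where p': "q = prod_encode (s', p')" "(qs ! i, c, s') \<in> nfa_trans A" "(ps ! j, Some c, \<alpha>, p', \<beta>) \<in> pda_trans P"
        using t by (auto simp: product_pda_read_iff)
      then obtain j' where j': "j' < m" "p' = ps ! j'" using pda_transD[OF P p'(3)] ps by (metis in_set_conv_nth)
      then have mem: "(c, \<alpha>, j', \<beta>) \<in> set (moves j)" using p' moves_iff[OF j] by simp
      have "([Trans] @ code_nat c @ [Comma], s') \<in> ?out (qs ! i)" using p'(2) by blast
      then obtain i' r where i': "s' = qs ! i'" "([Trans] @ code_nat c @ [Comma], i', r) \<in> set ts"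
        unfolding ts(2)[symmetric] by blast
      then have "i' < length qs" using ts(1) by blast
      moreover have "(action (Some c) \<alpha> \<beta>, i' * m + j', product_ref m j j' r) \<in> set (?te @ ?tm)"
        unfolding set_append Un_iff tm using mem i'(2) by blast
      moreover from calculation(1) have "z = (action (Some c) \<alpha> \<beta>, ?qs ! (i' * m + j'))"
        using z Some p'(1) j' i'(1) Q[OF _ j'(1), of i'] by simp
      ultimately show ?thesis by blast
    qed
  qed
  from conjI[OF refs conjI[OF this out]] show ?thesis
    unfolding code_state_def by (rule exI)
qed

end

section \<open>Organising the passes over a list of encoded NFAs\<close>

context product_coding
begin

text \<open>The default makes closedness of the set of pass states hold for all numbers of passes,
  as the locale \<open>rescanner\<close> requires.\<close>

definition kind :: "nat \<Rightarrow> pass_kind" where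
  "kind j = (if j < length pass_list then pass_list ! j else Head 0)"

text \<open>Outside the first automaton only pass 0 writes; otherwise the alphabet and the remaining
  automata would be repeated.\<close>

definition start_state :: "nat \<Rightarrow> nat \<Rightarrow> pass_state" where
  "start_state j md = (if md = 1 then Wait else if j = 0 then (if md = 0 then Prefix else Copy) else Off)"

text \<open>The mode is 0 before the first automaton, 1 inside of it, and 2 behind it.\<close>

definition next_mode :: "nat \<Rightarrow> sym cell \<Rightarrow> nat" where
  "next_mode md x = (if x = Letter Auto then (if md = 0 then 1 else 2) else md)"

text \<open>The sum is a crude common bound for the lengths of all letter codes; the successor is
  the extra symbol kept by \<open>Acc\<close>.\<close>

definition acc_bound :: nat where
  "acc_bound = Suc (sum_list (map (\<lambda>a. length (code_nat a)) as))"

definition pass_states :: "pass_state set" where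
  "pass_states = {Off, Copy, Prefix, Wait, Flags, Idle, Ref0, RefN} \<union> Acc ` {v. length v \<le> acc_bound}"

lemma pass_list_Cons: "\<exists>pks. pass_list = Head 0 # pks"
proof -
  obtain n where "m = Suc n" using m_pos by (cases m) auto
  then have "[0..<m] = 0 # [1..<m]" by (simp add: upt_rec)
  then show ?thesis by (simp add: pass_list_def)
qed

lemma kind_0 [simp]: "kind 0 = Head 0"
  using pass_list_Cons by (auto simp: kind_def)

lemma kind_Move: "kind i = Move j a \<alpha> j' \<beta> \<Longrightarrow> a \<in> set as"
proof -
  assume "kind i = Move j a \<alpha> j' \<beta>"
  then have "Move j a \<alpha> j' \<beta> \<in> set pass_list" by (auto simp: kind_def split: if_splits) (metis nth_mem)
  then have "j < m \<and> (a, \<alpha>, j', \<beta>) \<in> set (moves j)" by (auto simp: pass_list_def)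
  then have "(ps ! j, Some a, \<alpha>, ps ! j', \<beta>) \<in> pda_trans P" using moves_iff by blast
  from pda_transD[OF P this] show ?thesis by (simp add: as)
qed

lemma finite_pass_states: "finite pass_states"
proof -
  have "finite {v :: sym list. length v \<le> acc_bound}"
    using finite_lists_length_le[OF finite_UNIV_sym, of acc_bound] by simp
  then show ?thesis by (simp add: pass_states_def)
qed

lemma cell_step_closed:
  assumes "s \<in> pass_states"
  shows "fst (cell_step (kind i) s x) \<in> pass_states"
proof (cases x)
  case (Letter y)
  show ?thesis
  proof (cases "kind i")
    case (Head j)
    then show ?thesis using assms Letter
      by (cases s) (auto simp: pass_states_def split: sym.splits)
  next
    case (Move j a \<alpha> j' \<beta>)
    have "length (code_nat a) \<le> sum_list (map (\<lambda>a. length (code_nat a)) as)"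
      using kind_Move[OF Move] by (intro member_le_sum_list) auto
    then have "Acc (take (Suc (length (code_nat a))) v) \<in> pass_states" for v
      by (auto simp: pass_states_def acc_bound_def)
    moreover have "Acc [] \<in> pass_states" by (simp add: pass_states_def)
    ultimately show ?thesis using assms Letter Move
      by (cases s) (auto simp: pass_states_def split: sym.splits simp del: take_append)
  qed
qed (use assms in \<open>auto simp: pass_states_def\<close>)

lemma start_state_closed: "start_state j md \<in> pass_states"
  by (simp add: start_state_def pass_states_def)

text \<open>The blocks are the left marker, each \<open>Auto\<close>, and the code of each
  state.\<close>

sublocale rescanner UNIV "{Left_End, Letter State, Letter Auto}" "length pass_list" "{..2}" 0 next_mode
  pass_states start_state "\<lambda>j. cell_step (kind j)" "\<lambda>j. pass_end (kind j)"
proof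
  show "length pass_list > 0" using pass_list_Cons by auto
qed (use finite_UNIV_sym finite_pass_states cell_step_closed start_state_closed in \<open>auto simp: next_mode_def\<close>)

lemma pass_out_Right_End:
  "pass_out (cell_step pk) e s (b @ [Right_End]) = pass_out (cell_step pk) e s b"
  by (induction b arbitrary: s) (auto simp: pass_out_Cons)

lemma pass_out_Letters:
  "pass_out (cell_step pk) e s (map Letter b) = pass_out (pass_step pk) e s b"
  by (induction b arbitrary: s) (auto simp: pass_out_Cons)

lemma pass_step_Off: "pass_step pk Off y = (Off, [])"
  by (cases pk) auto

lemma pass_out_Off: "pass_out (pass_step pk) (pass_end pk) Off b = []"
  by (induction b) (auto simp: pass_out_Cons pass_step_Off)

lemma pass_out_Copy: "pass_out (pass_step (Head 0)) (pass_end (Head 0)) Copy b = b"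
  by (induction b) (auto simp: pass_out_Cons)

lemma pass_out_Wait_Auto: "pass_out (pass_step pk) (pass_end pk) Wait [Auto] = []"
  by (cases pk) (auto simp: pass_out_Cons)

lemma upt_pass_list: "[0..<length pass_list] = 0 # [1..<length pass_list]"
  using pass_list_Cons by (auto simp: upt_rec)

lemma block_out_Right_End: "block_out md (b @ [Right_End]) = block_out md b"
  by (simp add: block_out_def pass_out_Right_End)

lemma block_out_prefix: "block_out 0 [Left_End] = code_nats as @ [Auto]"
proof -
  have "concat (map (\<lambda>j. pass_out (cell_step (kind j)) (pass_end (kind j)) (start_state j 0) [Left_End]) [1..<length pass_list]) = []"
    by (auto simp: start_state_def pass_out_Cons)
  moreover have "pass_out (cell_step (kind 0)) (pass_end (kind 0)) (start_state 0 0) [Left_End] = code_nats as @ [Auto]"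
    by (simp add: start_state_def pass_out_Cons)
  ultimately show ?thesis unfolding block_out_def upt_pass_list by simp
qed

text \<open>The \<open>Auto\<close> in front of the PDA was already written together with the
  alphabet at the left marker, so every pass is silent here.\<close>

lemma block_out_Auto: "block_out 1 [Letter Auto] = []"
  using pass_out_Letters[of _ _ _ "[Auto]"] by (auto simp: block_out_def start_state_def pass_out_Wait_Auto)

lemma block_out_copy: "block_out 2 (map Letter b) = b"
proof -
  have "concat (map (\<lambda>j. pass_out (cell_step (kind j)) (pass_end (kind j)) (start_state j 2) (map Letter b)) [1..<length pass_list]) = []"
    by (auto simp: start_state_def pass_out_Letters pass_out_Off)
  moreover have "pass_out (cell_step (kind 0)) (pass_end (kind 0)) (start_state 0 2) (map Letter b) = b"
    using pass_out_Copy by (simp add: start_state_def pass_out_Letters)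
  ultimately show ?thesis unfolding block_out_def upt_pass_list by simp
qed

lemma block_out_state: "block_out 1 (map Letter b) = concat (map (state_out b) [0..<m])"
proof -
  have "block_out 1 (map Letter b) = concat (map (\<lambda>j. kind_out (pass_list ! j) b) [0..<length pass_list])"
    unfolding block_out_def
    by (intro arg_cong[where f = concat] map_cong HOL.refl)
      (simp add: start_state_def kind_out_def kind_def pass_out_Letters)
  also have "map (\<lambda>j. kind_out (pass_list ! j) b) [0..<length pass_list] = map (\<lambda>pk. kind_out pk b) (map ((!) pass_list) [0..<length pass_list])"
    by (simp add: comp_def)
  also have "concat \<dots> = concat (map (state_out b) [0..<m])"
  proof -
    have *: "concat (map f (concat xss)) = concat (map (\<lambda>xs. concat (map f xs)) xss)"
      for f :: "pass_kind \<Rightarrow> sym list" and xss by (induction xss) auto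
    show ?thesis
      unfolding map_nth pass_list_def * map_map by (intro arg_cong[where f = concat] map_cong) (auto simp: state_out_def)
  qed
  finally show ?thesis .
qed

lemma rescan_Right_End:
  assumes "bs \<noteq> []" "\<forall>b\<in>set bs. b \<noteq> []"
  shows "rescan md (butlast bs @ [last bs @ [Right_End]]) = rescan md bs"
  using assms by (induction bs arbitrary: md) (auto simp: block_out_Right_End)

lemma rescan_copy:
  assumes "\<forall>c\<in>set cs. c \<noteq> []"
  shows "rescan 2 (map (map Letter) cs) = concat cs"
  using assms
proof (induction cs)
  case (Cons c cs)
  have "next_mode 2 x = 2" for x by (simp add: next_mode_def)
  then show ?case using Cons block_out_copy by simp
qed simp

text \<open>The mode changes to copying only at the next \<open>Auto\<close>; hence the condition on
  the first block.\<close>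

lemma rescan_copy_Auto:
  assumes "\<forall>c\<in>set cs. c \<noteq> []" "cs \<noteq> [] \<Longrightarrow> hd cs = [Auto]"
  shows "rescan 1 (map (map Letter) cs) = concat cs"
proof (cases cs)
  case (Cons c cs')
  have "next_mode 1 (Letter Auto) = 2" by (simp add: next_mode_def)
  then show ?thesis using Cons assms rescan_copy[of cs'] block_out_copy[of "[Auto]"] by simp
qed simp

lemma rescan_states:
  assumes "\<forall>b\<in>set bs. is_segment b"
  shows "rescan 1 (map (map Letter) bs @ rest) = concat (map (\<lambda>b. concat (map (state_out b) [0..<m])) bs) @ rescan 1 rest"
  using assms
proof (induction bs)
  case (Cons b bs)
  obtain ys where "b = State # ys" using Cons.prems by (auto simp: is_segment_def)
  then have "next_mode 1 (hd (map Letter b)) = 1" by (simp add: next_mode_def)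
  then show ?case using Cons block_out_state[of b] by simp
qed simp

lemma code_pda_product:
  assumes A: "is_nfa A" and qs: "distinct qs" "set qs = nfa_states A" "length ls = length qs" "length bs = length qs"
    and code: "\<forall>i<length qs. code_state qs ls (nfa_init A) (nfa_final A)
      (\<lambda>p. {([Trans] @ code_nat a @ [Comma], q) | a q. (p, a, q) \<in> nfa_trans A}) i (bs ! i)"
  shows "code_pda (product_pda P A) (concat (map (\<lambda>b. concat (map (state_out b) [0..<m])) bs))"
proof -
  let ?n = "length qs"
  let ?qs = "map (\<lambda>x. prod_encode (qs ! (x div m), ps ! (x mod m))) [0..<?n * m]"
  let ?bs = "map (\<lambda>x. state_out (bs ! (x div m)) (x mod m)) [0..<?n * m]"
  have lt: "x div m < ?n \<and> x mod m < m" if "x < ?n * m" for x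
    using that m_pos by (simp add: less_mult_imp_div_less)
  have "inj_on (\<lambda>x. prod_encode (qs ! (x div m), ps ! (x mod m))) {0..<?n * m}"
  proof (rule inj_onI)
    fix x y assume "x \<in> {0..<?n * m}" "y \<in> {0..<?n * m}"
      and "prod_encode (qs ! (x div m), ps ! (x mod m)) = prod_encode (qs ! (y div m), ps ! (y mod m))"
    then have "x div m = y div m" "x mod m = y mod m"
      using lt[of x] lt[of y] qs(1) ps(1) by (auto simp: nth_eq_iff_index_eq)
    then show "x = y" by (metis div_mult_mod_eq)
  qed
  then have 1: "distinct ?qs" by (simp add: distinct_map)
  have 2: "set ?qs = pda_states (product_pda P A)"
  proof (intro equalityI subsetI)
    fix z assume "z \<in> set ?qs"
    then obtain x where "x < ?n * m" "z = prod_encode (qs ! (x div m), ps ! (x mod m))" by auto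
    then show "z \<in> pda_states (product_pda P A)" using lt[of x] qs(2) ps(2) by (auto intro!: imageI simp flip: qs(2) ps(2))
  next
    fix z assume "z \<in> pda_states (product_pda P A)"
    then obtain i j where ij: "i < ?n" "j < m" "z = prod_encode (qs ! i, ps ! j)"
      unfolding product_pda_simps qs(2)[symmetric] ps(2)[symmetric] by (auto simp: in_set_conv_nth)
    then have "z = (\<lambda>x. prod_encode (qs ! (x div m), ps ! (x mod m))) (i * m + j)" using m_pos by simp
    then show "z \<in> set ?qs" using mult_add_less[OF ij(1,2)] by (simp only: set_map set_upt) (intro rev_image_eqI[of "i * m + j"], auto)
  qed
  have 3: "code_state ?qs (product_labels m ls) (pda_init (product_pda P A)) (pda_final (product_pda P A))
    (\<lambda>p. {([Trans] @ (case a of None \<Rightarrow> [Eps] | Some b \<Rightarrow> code_nat b) @ [Comma] @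
            code_nat \<alpha> @ [Comma] @ code_nats \<beta> @ [Comma], q) | a \<alpha> q \<beta>.
          (p, a, \<alpha>, q, \<beta>) \<in> pda_trans (product_pda P A)}) x (?bs ! x)" if x: "x < length ?qs" for x
  proof -
    have x: "x < ?n * m" using x by simp
    show ?thesis
      using code_state_product[OF A qs(1,2) _ _ qs(3), of "x div m" "bs ! (x div m)" "x mod m"] code lt[OF x] x by simp
  qed
  have "concat (map (\<lambda>b. concat (map (state_out b) [0..<m])) bs) = concat (map (\<lambda>i. concat (map (state_out (bs ! i)) [0..<m])) [0..<?n])"
    using map_nth[of bs] qs(4) by (metis (no_types, lifting) map_map comp_apply map_cong)
  also have "\<dots> = concat ?bs"
    using concat_map_mult[OF m_pos, of "\<lambda>i. state_out (bs ! i)" ?n] by simp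
  finally have 4: "concat (map (\<lambda>b. concat (map (state_out b) [0..<m])) bs) = concat ?bs" .
  show ?thesis
    unfolding code_pda_def code_automaton_def
  proof (rule exI[of _ ?qs], rule exI[of _ "product_labels m ls"], rule exI[of _ ?bs], intro conjI)
    show "length (product_labels m ls) = length ?qs" using qs by (simp add: product_labels_def)
  qed (use 1 2 3 4 in \<open>simp_all del: product_pda_simps\<close>)
qed

lemma code_nfas_blocks:
  assumes "code_nfas As w"
  shows "\<exists>cs. w = concat cs \<and> (\<forall>c\<in>set cs. c = [Auto] \<or> is_segment c) \<and> (cs \<noteq> [] \<longrightarrow> hd cs = [Auto])"
proof -
  obtain ws where ws: "list_all2 code_nfa As ws" "w = concat (map (\<lambda>u. Auto # u) ws)"
    using assms by (auto simp: code_nfas_def)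
  from ws(1) have "\<exists>cs. concat (map (\<lambda>u. Auto # u) ws) = concat cs \<and> (\<forall>c\<in>set cs. c = [Auto] \<or> is_segment c) \<and> (cs \<noteq> [] \<longrightarrow> hd cs = [Auto])"
  proof (induction rule: list_all2_induct)
    case Nil
    show ?case by (intro exI[of _ "[]"]) simp
  next
    case (Cons A As u ws)
    obtain cs where "concat (map (\<lambda>u. Auto # u) ws) = concat cs" "\<forall>c\<in>set cs. c = [Auto] \<or> is_segment c"
      using Cons.IH by blast
    moreover obtain bs where "u = concat bs" "\<forall>b\<in>set bs. is_segment b" using code_nfa_segments[OF Cons.hyps(1)] by blast
    ultimately show ?case by (intro exI[of _ "[Auto] # bs @ cs"]) auto
  qed
  with ws(2) show ?thesis by blast
qed

lemma is_block_segment: "c = [Auto] \<or> is_segment c \<Longrightarrow> is_block (map Letter c)"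
  by (auto simp: is_block_def is_segment_def)

text \<open>The first automaton of the instance is absorbed into the PDA and the others are copied,
  so one automaton fewer is left. Determinism carries over because, by \<open>R\<close>, the fixed
  PDA is a DPDA whenever its language is deterministic.\<close>

lemma reduction:
  assumes D: "\<And>A. D A \<Longrightarrow> is_nfa A" and k: "k \<ge> 1"
    and R: "is_dcfl (pda_alphabet P) (pda_lang P) \<Longrightarrow> is_dpda P"
  shows "linear_time_reduction (\<lambda>As (Q, Bs). is_dcfl (pda_alphabet P) (pda_lang P) \<and> is_dfa (hd As) \<longrightarrow> is_dpda Q)
    (intersection_problem D (pda_alphabet P) (pda_lang P) k) (nonemptiness_problem D (pda_stack P) (pda_bottom P) k)"
proof -
  let ?\<Pi>1 = "intersection_problem D (pda_alphabet P) (pda_lang P) k"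
  let ?\<Pi>2 = "nonemptiness_problem D (pda_stack P) (pda_bottom P) k"
  obtain T c where T: "is_tm UNIV T" "\<And>w bs. tm_input w = concat bs \<Longrightarrow> \<forall>b\<in>set bs. is_block b \<Longrightarrow>
      \<exists>t. tm_computes T w t (rescan 0 bs) \<and> t \<le> c * (length w + 1)"
    using rescan_tm by blast
  have "\<exists>t v y. tm_computes T w t v \<and> t \<le> c * (length w + 1) \<and> encodes ?\<Pi>2 v y \<and>
      (yes_instance ?\<Pi>1 As \<longleftrightarrow> yes_instance ?\<Pi>2 y) \<and>
      (case y of (Q, Bs) \<Rightarrow> is_dcfl (pda_alphabet P) (pda_lang P) \<and> is_dfa (hd As) \<longrightarrow> is_dpda Q)"
    if enc: "encodes ?\<Pi>1 w As" for w As
  proof -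
    have "length As = k" "code_nfas As w" and AD: "\<forall>A\<in>set As. D A \<and> nfa_alphabet A = pda_alphabet P"
      using enc by (auto simp: intersection_problem_def)
    then obtain A Bs where As: "As = A # Bs" using k by (cases As) auto
    obtain ws where ws: "list_all2 code_nfa As ws" "w = concat (map (\<lambda>u. Auto # u) ws)"
      using \<open>code_nfas As w\<close> by (auto simp: code_nfas_def)
    then obtain v us where v: "ws = v # us" "code_nfa A v" "list_all2 code_nfa Bs us" unfolding As by (auto simp: list_all2_Cons1)
    let ?u = "concat (map (\<lambda>u. Auto # u) us)"
    have u: "code_nfas Bs ?u" using v(3) unfolding code_nfas_def by blast
    obtain cs where cs: "?u = concat cs" "\<forall>c\<in>set cs. c = [Auto] \<or> is_segment c" "cs \<noteq> [] \<longrightarrow> hd cs = [Auto]"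
      using code_nfas_blocks[OF u] by blast
    have A: "is_nfa A" "nfa_alphabet A = pda_alphabet P" using AD As D by auto
    obtain qs ls bs where bs: "distinct qs" "set qs = nfa_states A" "length ls = length qs" "length bs = length qs"
      "\<forall>i<length qs. code_state qs ls (nfa_init A) (nfa_final A)
        (\<lambda>p. {([Trans] @ code_nat a @ [Comma], q) | a q. (p, a, q) \<in> nfa_trans A}) i (bs ! i)" "v = concat bs"
      using v(2) unfolding code_nfa_def code_automaton_def by blast
    have out: "State \<notin> set u \<and> Auto \<notin> set u"
      if "(u, q) \<in> {([Trans] @ code_nat a @ [Comma], q) | a q. (p, a, q) \<in> nfa_trans A}" for u p q
    proof -
      from that obtain a where "u = [Trans] @ code_nat a @ [Comma]" by blast
      with set_code_nat[of a] show ?thesis by auto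
    qed
    have seg: "\<forall>b\<in>set bs. is_segment b"
    proof
      fix b assume "b \<in> set bs"
      then obtain i where i: "i < length qs" "b = bs ! i" using bs(4) by (auto simp: in_set_conv_nth)
      show "is_segment b" unfolding i(2) by (rule code_state_segment[OF bs(5)[rule_format, OF i(1)] i(1) out])
    qed
    let ?v = "concat (map (\<lambda>b. concat (map (state_out b) [0..<m])) bs)"
    let ?bl = "[Left_End] # [Letter Auto] # map (map Letter) bs @ map (map Letter) cs"
    have ne: "\<forall>c\<in>set cs. c \<noteq> []" using cs(2) by (auto simp: is_segment_def)
    have bl: "\<forall>b\<in>set ?bl. is_block b"
      using seg cs(2) is_block_segment is_block_segment[of "[Auto]"] by (auto simp: is_block_def)
    then have bl_ne: "\<forall>b\<in>set ?bl. b \<noteq> []" by (auto simp: is_block_def)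
    \<comment> \<open>The right marker begins no block; it is attached to the last one, where no
      pass reacts to it.\<close>
    let ?bl' = "butlast ?bl @ [last ?bl @ [Right_End]]"
    have "concat ?bl' = concat (butlast ?bl @ [last ?bl]) @ [Right_End]" by (simp del: append_butlast_last_id)
    also have "butlast ?bl @ [last ?bl] = ?bl" by (rule append_butlast_last_id) simp
    also have "concat ?bl @ [Right_End] = tm_input w"
      unfolding ws(2) v(1) by (simp add: tm_input_def cs(1) bs(6) map_concat comp_def)
    finally have w: "tm_input w = concat ?bl'" by simp
    have "is_block (b @ [Right_End])" if "is_block b" for b using that by (auto simp: is_block_def)
    moreover have "is_block (last ?bl)" using bl last_in_set[of ?bl] by blast
    ultimately have "is_block (last ?bl @ [Right_End])" by blast
    then have bl': "\<forall>b\<in>set ?bl'. is_block b" using bl in_set_butlastD[of _ ?bl] by (auto simp del: butlast.simps last.simps)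
    have "rescan 0 ?bl' = rescan 0 ?bl" by (rule rescan_Right_End[OF _ bl_ne]) simp
    also have "\<dots> = code_nats as @ Auto # ?v @ ?u"
    proof -
      have "next_mode 0 Left_End = 0" "next_mode 0 (Letter Auto) = 1" by (auto simp: next_mode_def)
      moreover have "rescan 1 (map (map Letter) bs @ map (map Letter) cs) = ?v @ ?u"
        using rescan_states[OF seg] rescan_copy_Auto[OF ne] cs(1,3) by simp
      ultimately show ?thesis using block_out_prefix block_out_Auto by simp
    qed
    finally obtain t where t: "tm_computes T w t (code_nats as @ Auto # ?v @ ?u)" "t \<le> c * (length w + 1)"
      using T(2)[OF w bl'] by auto
    have "encodes ?\<Pi>2 (code_nats as @ Auto # ?v @ ?u) (product_pda P A, Bs)"
      using is_pda_product[OF P A(1)] AD As \<open>length As = k\<close> u as code_pda_product[OF A(1) bs(1-5)]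
      by (auto simp: nonemptiness_problem_def)
    moreover have "yes_instance ?\<Pi>1 As \<longleftrightarrow> yes_instance ?\<Pi>2 (product_pda P A, Bs)"
      using product_pda_lang[OF A(1), of P] by (auto simp: nonemptiness_problem_def intersection_problem_def As)
    moreover have "is_dcfl (pda_alphabet P) (pda_lang P) \<and> is_dfa (hd As) \<longrightarrow> is_dpda (product_pda P A)"
      using R is_dpda_product[of P A] A(2) As by simp
    ultimately show ?thesis using t by blast
  qed
  moreover have "letters ?\<Pi>1 = UNIV" by (simp add: intersection_problem_def)
  ultimately show ?thesis unfolding linear_time_reduction_def using T(1) by metis
qed

end

text \<open>As \<open>L\<close> is fixed, its PDA is chosen once, and as a DPDA if there is one;
  nothing has to be decided at run time. The product has the stack alphabet of this PDA, which
  depends on \<open>L\<close> only.\<close>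

lemma cfl_intersection_reducible:
  assumes "is_cfl \<Sigma> L" "k \<ge> 1"
  shows "\<exists>\<Gamma> Z. finite \<Gamma> \<and> Z \<in> \<Gamma> \<and>
    linear_time_reduction (\<lambda>As (P, Bs). is_dcfl \<Sigma> L \<and> is_dfa (hd As) \<longrightarrow> is_dpda P)
      (intersection_problem is_nfa \<Sigma> L k) (nonemptiness_problem is_nfa \<Gamma> Z k) \<and>
    linear_time_reduction (\<lambda>As (P, Bs). is_dcfl \<Sigma> L \<and> is_dfa (hd As) \<longrightarrow> is_dpda P)
      (intersection_problem is_dfa \<Sigma> L k) (nonemptiness_problem is_dfa \<Gamma> Z k)"
proof -
  obtain P :: "(nat, nat, nat) pda" where PP: "is_pda P" "pda_alphabet P = \<Sigma>" "pda_lang P = L" "is_dcfl \<Sigma> L \<Longrightarrow> is_dpda P"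
  proof (cases "is_dcfl \<Sigma> L")
    case True
    then obtain P :: "(nat, nat, nat) pda" where "is_dpda P" "pda_alphabet P = \<Sigma>" "pda_lang P = L"
      unfolding is_dcfl_def by blast
    with that show thesis by (auto simp: is_dpda_def)
  next
    case False
    with assms(1) that show thesis unfolding is_cfl_def by blast
  qed
  have finP: "finite (pda_states P)" "finite (pda_trans P)" "finite (pda_alphabet P)" "finite (pda_stack P)"
    "pda_bottom P \<in> pda_stack P"
    using PP(1) by (auto simp: is_pda_def)
  obtain ps where ps: "set ps = pda_states P" "distinct ps" using finite_distinct_list[OF finP(1)] by blast
  obtain trs where trs: "set trs = pda_trans P" using finite_list[OF finP(2)] by blast
  obtain as where as: "set as = pda_alphabet P" using finite_list[OF finP(3)] by blast
  have "\<forall>q. \<exists>i. q \<in> pda_states P \<longrightarrow> i < length ps \<and> ps ! i = q" using ps(1) by (metis in_set_conv_nth)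
  then obtain idx where "\<forall>q. q \<in> pda_states P \<longrightarrow> idx q < length ps \<and> ps ! idx q = q" by metis
  then interpret product_coding P ps idx trs as
    using PP(1) ps trs as by unfold_locales auto
  have R: "is_dcfl (pda_alphabet P) (pda_lang P) \<Longrightarrow> is_dpda P" using PP by simp
  have "is_nfa A" if "is_dfa A" for A :: "(nat, nat) nfa" using that by (simp add: is_dfa_def)
  from reduction[of is_nfa, OF _ assms(2) R] reduction[of is_dfa, OF this assms(2) R] finP(4,5)
  show ?thesis unfolding PP(2,3) by blast
qed

section \<open>Regular programs for two-way machines\<close>

text \<open>Regular programs as in dynamic logic. Tests are atoms that change nothing.\<close>

datatype 'x prog = Atom 'x | Seq "'x prog" "'x prog" | Alt "'x prog" "'x prog" | Star "'x prog"

primrec sem :: "('x \<Rightarrow> ('c \<times> 'c) set) \<Rightarrow> 'x prog \<Rightarrow> ('c \<times> 'c) set" where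
  "sem I (Atom x) = I x"
| "sem I (Seq p q) = sem I p O sem I q"
| "sem I (Alt p q) = sem I p \<union> sem I q"
| "sem I (Star p) = (sem I p)\<^sup>*"

text \<open>The states of the compiled machine are continuations, i.e. lists of programs still to be executed.\<close>

fun succs :: "'x prog list \<Rightarrow> 'x prog list list" where
  "succs (Seq p q # c) = [p # q # c]"
| "succs (Alt p q # c) = [p # c, q # c]"
| "succs (Star p # c) = [c, p # Star p # c]"
| "succs _ = []"

inductive cstep :: "('x \<Rightarrow> ('c \<times> 'c) set) \<Rightarrow> 'x prog list \<times> 'c \<Rightarrow> 'x prog list \<times> 'c \<Rightarrow> bool" for I where
  silent: "c' \<in> set (succs c) \<Longrightarrow> cstep I (c, s) (c', s)"
| atom: "(s, s') \<in> I x \<Longrightarrow> cstep I (Atom x # c, s) (c, s')"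

definition sem_list :: "('x \<Rightarrow> ('c \<times> 'c) set) \<Rightarrow> 'x prog list \<Rightarrow> ('c \<times> 'c) set" where
  "sem_list I c = foldr (\<lambda>p R. sem I p O R) c Id"

lemma sem_list_simps [simp]: "sem_list I [] = Id" "sem_list I (p # c) = sem I p O sem_list I c"
  by (simp_all add: sem_list_def)

text \<open>The meaning of what remains to be executed is pulled back along one step, which suits an
  induction from the end of a run.\<close>

lemma cstep_sound:
  "cstep I s s' \<Longrightarrow> (snd s', t) \<in> sem_list I (fst s') \<Longrightarrow> (snd s, t) \<in> sem_list I (fst s)"
proof (induction rule: cstep.induct)
  case (silent c' c s)
  then show ?case
    by (induction c rule: succs.induct) (auto, meson converse_rtrancl_into_rtrancl relcompI)
qed auto

lemma csteps_sound: "(cstep I)\<^sup>*\<^sup>* (c, s) ([], t) \<Longrightarrow> (s, t) \<in> sem_list I c"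
proof (induction "(c, s)" arbitrary: c s rule: converse_rtranclp_induct)
  case (step s')
  then show ?case using cstep_sound[OF step.hyps(1), of t] by (cases s') auto
qed auto

lemma csteps_complete: "(s, t) \<in> sem I p \<Longrightarrow> (cstep I)\<^sup>*\<^sup>* (p # c, s) (c, t)"
proof (induction p arbitrary: s t c)
  case (Seq p q)
  then obtain u where "(s, u) \<in> sem I p" "(u, t) \<in> sem I q" by auto
  with Seq.IH have "(cstep I)\<^sup>*\<^sup>* (p # q # c, s) (c, t)" by (meson rtranclp_trans)
  moreover have "cstep I (Seq p q # c, s) (p # q # c, s)" by (auto intro: cstep.silent)
  ultimately show ?case by (rule converse_rtranclp_into_rtranclp[rotated])
next
  case (Alt p q)
  have "cstep I (Alt p q # c, s) (p # c, s)" "cstep I (Alt p q # c, s) (q # c, s)" by (auto intro: cstep.silent)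
  with Alt show ?case by (auto intro: converse_rtranclp_into_rtranclp)
next
  case (Star p)
  have 1: "cstep I (Star p # c, s) (c, s)" "cstep I (Star p # c, s) (p # Star p # c, s)" for s
    by (auto intro: cstep.silent)
  from Star.prems have "(s, t) \<in> (sem I p)\<^sup>*" by simp
  then show ?case
  proof (induction rule: converse_rtrancl_induct)
    case base
    show ?case using 1(1) by blast
  next
    case (step s u)
    have "(cstep I)\<^sup>*\<^sup>* (p # Star p # c, s) (Star p # c, u)" using Star.IH step.hyps(1) by blast
    with step.IH have "(cstep I)\<^sup>*\<^sup>* (p # Star p # c, s) (c, t)" by (rule rtranclp_trans[rotated])
    with 1(2) show ?case by (rule converse_rtranclp_into_rtranclp)
  qed
qed (auto intro: cstep.atom)

text \<open>Each subprogram with what follows it; unfolding a star puts the star itself into the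
  continuation. So finitely many lists suffice as states, as with partial derivatives of regular
  expressions.\<close>

primrec continuations :: "'x prog \<Rightarrow> 'x prog list \<Rightarrow> 'x prog list set" where
  "continuations (Atom x) c = {Atom x # c}"
| "continuations (Seq p q) c = {Seq p q # c} \<union> continuations p (q # c) \<union> continuations q c"
| "continuations (Alt p q) c = {Alt p q # c} \<union> continuations p c \<union> continuations q c"
| "continuations (Star p) c = {Star p # c} \<union> continuations p (Star p # c)"

lemma continuations_self: "p # c \<in> continuations p c"
  by (cases p) auto

lemma finite_continuations: "finite (continuations p c)"
  by (induction p arbitrary: c) auto

lemma continuations_succs: "d \<in> continuations p c \<Longrightarrow> d' \<in> set (succs d) \<Longrightarrow> d' \<in> insert c (continuations p c)"
  by (induction p arbitrary: c) (use continuations_self in \<open>(auto; blast)+\<close>)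

lemma continuations_atom: "Atom x # d \<in> continuations p c \<Longrightarrow> d \<in> insert c (continuations p c)"
  by (induction p arbitrary: c) (use continuations_self in \<open>(auto; blast)+\<close>)

lemma continuations_atoms: "d \<in> continuations p c \<Longrightarrow> q \<in> set d \<Longrightarrow> q \<in> set c \<or> set_prog q \<subseteq> set_prog p"
  by (induction p arbitrary: c) fastforce+

section \<open>Compiling a program into a two-way machine\<close>

type_synonym action = "sym cell list \<times> nat \<times> nat list \<times> int list"

definition act :: "sym cell list \<Rightarrow> action set \<Rightarrow> ((nat list \<times> nat list) \<times> (nat list \<times> nat list)) set" where
  "act T X = {((hs, \<gamma> @ [\<alpha>]), (map2 move_head hs ds, \<gamma> @ \<gamma>')) | hs \<alpha> \<gamma> \<gamma>' ds. (map ((!) T) hs, \<alpha>, \<gamma>', ds) \<in> X}"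

definition move_ok :: "sym cell \<Rightarrow> int \<Rightarrow> bool" where
  "move_ok a d \<longleftrightarrow> d \<in> {-1, 0, 1} \<and> (a = Left_End \<longrightarrow> d \<noteq> -1) \<and> (a = Right_End \<longrightarrow> d \<noteq> 1)"

definition action_ok :: "nat \<Rightarrow> nat set \<Rightarrow> nat \<Rightarrow> action \<Rightarrow> bool" where
  "action_ok k \<Gamma> Z = (\<lambda>(as, \<alpha>, \<gamma>, ds). length as = k \<and> \<alpha> \<in> \<Gamma> \<and> bottom_respecting \<Gamma> Z \<alpha> \<gamma> \<and> length ds = k \<and>
     (\<forall>i<k. move_ok (as ! i) (ds ! i)))"

fun cell_code :: "sym cell \<Rightarrow> nat" where
  "cell_code Left_End = 0"
| "cell_code Right_End = 1"
| "cell_code (Letter y) = Suc (Suc (to_nat y))"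

lemma inj_cell_code: "inj cell_code"
proof (rule injI)
  show "cell_code x = cell_code y \<Longrightarrow> x = y" for x y by (cases x; cases y) auto
qed

lemma finite_UNIV_cell: "finite (UNIV :: sym cell set)"
proof -
  have "x \<in> {Left_End, Right_End} \<union> range Letter" for x :: "sym cell" by (cases x) auto
  then have "(UNIV :: sym cell set) \<subseteq> {Left_End, Right_End} \<union> range Letter" by blast
  then show ?thesis using finite_UNIV_sym by (auto intro: finite_subset)
qed

definition input_code :: "sym list \<Rightarrow> nat list" where
  "input_code w = map (\<lambda>y. cell_code (Letter y)) w"

locale program_machine =
  fixes k :: nat and \<Gamma> :: "nat set" and Z :: nat and p :: "action set prog" and enc :: "action set prog list \<Rightarrow> nat"
  assumes \<Gamma>: "finite \<Gamma>" "Z \<in> \<Gamma>"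
    and ok: "\<And>X. X \<in> set_prog p \<Longrightarrow> finite X \<and> (\<forall>x\<in>X. action_ok k \<Gamma> Z x)"
    and enc: "inj_on enc (insert [] (continuations p []))"
begin

definition conts :: "action set prog list set" where
  "conts = insert [] (continuations p [])"



text \<open>Every transition of a two-way machine reads all heads and the stack top; so a silent
  step is spelled out for all cells and tops, moving nothing and putting the top back.\<close>

definition silent_trans :: "(nat \<times> nat list \<times> nat \<times> nat \<times> nat list \<times> int list) set" where
  "silent_trans = (\<lambda>((c, c'), as, \<alpha>). (enc c, map cell_code as, \<alpha>, enc c', [\<alpha>], replicate k 0)) `
     ((SIGMA c:conts. set (succs c)) \<times> {as. length as = k} \<times> \<Gamma>)"

definition atom_trans :: "(nat \<times> nat list \<times> nat \<times> nat \<times> nat list \<times> int list) set" where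
  "atom_trans = (\<Union>c\<in>conts. case c of Atom X # d \<Rightarrow>
     (\<lambda>(as, \<alpha>, \<gamma>, ds). (enc c, map cell_code as, \<alpha>, enc d, \<gamma>, ds)) ` X | _ \<Rightarrow> {})"

definition machine :: "(nat, nat, nat) npda2" where
  "machine = \<lparr>npda2_states = enc ` conts, npda2_alphabet = range cell_code, npda2_left = cell_code Left_End,
     npda2_right = cell_code Right_End, npda2_stack = \<Gamma>, npda2_bottom = Z,
     npda2_trans = silent_trans \<union> atom_trans, npda2_init = enc [p], npda2_final = {enc []}\<rparr>"

lemma finite_conts: "finite conts"
  using finite_continuations by (simp add: conts_def)

lemma conts_succs: "c \<in> conts \<Longrightarrow> c' \<in> set (succs c) \<Longrightarrow> c' \<in> conts"
  using continuations_succs by (auto simp: conts_def)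

lemma conts_atom: "Atom X # d \<in> conts \<Longrightarrow> d \<in> conts \<and> X \<in> set_prog p"
  using continuations_atom[of X d p "[]"] continuations_atoms[of "Atom X # d" p "[]" "Atom X"]
  by (auto simp: conts_def)

lemma enc_eq: "c \<in> conts \<Longrightarrow> d \<in> conts \<Longrightarrow> enc c = enc d \<longleftrightarrow> c = d"
  using enc unfolding conts_def by (rule inj_on_eq_iff)

lemma silent_trans_iff:
  "(q, as', \<alpha>, q', \<gamma>, ds) \<in> silent_trans \<longleftrightarrow> (\<exists>c c' as. c \<in> conts \<and> c' \<in> set (succs c) \<and> length as = k \<and> \<alpha> \<in> \<Gamma> \<and>
    q = enc c \<and> as' = map cell_code as \<and> q' = enc c' \<and> \<gamma> = [\<alpha>] \<and> ds = replicate k 0)"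
  unfolding silent_trans_def image_def by force

lemma atom_trans_iff:
  "(q, as', \<alpha>, q', \<gamma>, ds) \<in> atom_trans \<longleftrightarrow> (\<exists>X c as. Atom X # c \<in> conts \<and> (as, \<alpha>, \<gamma>, ds) \<in> X \<and>
    q = enc (Atom X # c) \<and> as' = map cell_code as \<and> q' = enc c)"
proof
  assume "(q, as', \<alpha>, q', \<gamma>, ds) \<in> atom_trans"
  then obtain c where c: "c \<in> conts" "(q, as', \<alpha>, q', \<gamma>, ds) \<in> (case c of Atom X # d \<Rightarrow>
     (\<lambda>(as, \<alpha>, \<gamma>, ds). (enc c, map cell_code as, \<alpha>, enc d, \<gamma>, ds)) ` X | _ \<Rightarrow> {})"
    unfolding atom_trans_def by blast
  then obtain X d where "c = Atom X # d" by (auto split: list.splits prog.splits)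
  with c show "\<exists>X c as. Atom X # c \<in> conts \<and> (as, \<alpha>, \<gamma>, ds) \<in> X \<and> q = enc (Atom X # c) \<and> as' = map cell_code as \<and> q' = enc c"
    by auto
next
  assume "\<exists>X c as. Atom X # c \<in> conts \<and> (as, \<alpha>, \<gamma>, ds) \<in> X \<and> q = enc (Atom X # c) \<and> as' = map cell_code as \<and> q' = enc c"
  then show "(q, as', \<alpha>, q', \<gamma>, ds) \<in> atom_trans"
    unfolding atom_trans_def by force
qed

lemma finite_trans: "finite (silent_trans \<union> atom_trans)"
proof -
  have "finite {as :: sym cell list. length as = k}"
    using finite_lists_length_eq[OF finite_UNIV_cell, of k] by simp
  then have "finite silent_trans"
    unfolding silent_trans_def using finite_conts \<Gamma> by (intro finite_imageI finite_cartesian_product finite_SigmaI) auto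
  moreover have "finite atom_trans"
    unfolding atom_trans_def using finite_conts
  proof (rule finite_UN_I)
    fix c assume c: "c \<in> conts"
    show "finite (case c of Atom X # d \<Rightarrow> (\<lambda>(as, \<alpha>, \<gamma>, ds). (enc c, map cell_code as, \<alpha>, enc d, \<gamma>, ds)) ` X | _ \<Rightarrow> {})"
      using c conts_atom ok by (auto split: list.splits prog.splits)
  qed
  ultimately show ?thesis by simp
qed

lemma cell_code_eq [simp]: "cell_code x = cell_code y \<longleftrightarrow> x = y"
  using inj_cell_code by (auto dest: injD)

lemma is_npda2_machine: "is_npda2 k machine"
proof -
  have "q \<in> enc ` conts \<and> q' \<in> enc ` conts \<and> length as' = k \<and> set as' \<subseteq> range cell_code \<and> \<alpha> \<in> \<Gamma> \<and>
      bottom_respecting \<Gamma> Z \<alpha> \<gamma> \<and> length ds = k \<and> set ds \<subseteq> {-1, 0, 1} \<and>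
      (\<forall>i<k. (as' ! i = cell_code Left_End \<longrightarrow> ds ! i \<noteq> -1) \<and> (as' ! i = cell_code Right_End \<longrightarrow> ds ! i \<noteq> 1))"
    if "(q, as', \<alpha>, q', \<gamma>, ds) \<in> silent_trans \<union> atom_trans" for q as' \<alpha> q' \<gamma> ds
    using that
  proof
    assume "(q, as', \<alpha>, q', \<gamma>, ds) \<in> silent_trans"
    then show ?thesis
      using conts_succs by (auto simp: silent_trans_iff bottom_respecting_def)
  next
    assume "(q, as', \<alpha>, q', \<gamma>, ds) \<in> atom_trans"
    then obtain X c as where *: "Atom X # c \<in> conts" "(as, \<alpha>, \<gamma>, ds) \<in> X" "q = enc (Atom X # c)"
      "as' = map cell_code as" "q' = enc c" by (auto simp: atom_trans_iff)
    then have "action_ok k \<Gamma> Z (as, \<alpha>, \<gamma>, ds)" using ok conts_atom by blast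
    then have ao: "length as = k" "\<alpha> \<in> \<Gamma>" "bottom_respecting \<Gamma> Z \<alpha> \<gamma>" "length ds = k" "\<forall>i<k. move_ok (as ! i) (ds ! i)"
      by (auto simp: action_ok_def)
    then have "set ds \<subseteq> {-1, 0, 1}" by (auto simp: move_ok_def in_set_conv_nth)
    moreover have "\<forall>i<k. (as' ! i = cell_code Left_End \<longrightarrow> ds ! i \<noteq> -1) \<and> (as' ! i = cell_code Right_End \<longrightarrow> ds ! i \<noteq> 1)"
      using ao *(4) by (simp add: move_ok_def del: cell_code.simps)
    ultimately show ?thesis using ao * conts_atom[OF *(1)] by auto
  qed
  moreover have "[p] \<in> conts" "[] \<in> conts" using continuations_self[of p "[]"] by (auto simp: conts_def)
  moreover have "finite (range cell_code)" using finite_UNIV_cell by simp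
  ultimately show ?thesis
    unfolding is_npda2_def using finite_conts finite_trans \<Gamma> by (auto simp: machine_def simp del: cell_code.simps) fastforce+
qed

lemma npda2_input_letters_machine: "npda2_input_letters machine = range (\<lambda>y. cell_code (Letter y))"
proof -
  have "x \<in> range (\<lambda>y. cell_code (Letter y))" if "x \<in> range cell_code" "x \<notin> {cell_code Left_End, cell_code Right_End}" for x
  proof -
    from that(1) obtain c where "x = cell_code c" by auto
    with that(2) show ?thesis by (cases c) (auto simp del: cell_code.simps)
  qed
  then show ?thesis by (auto simp: npda2_input_letters_def machine_def simp del: cell_code.simps)
qed

lemma npda2_tape_machine: "npda2_tape machine (input_code w) = map cell_code (tm_input w)"
  by (simp add: npda2_tape_def machine_def input_code_def tm_input_def)

text \<open>The stack is never empty, hence there always is a top symbol and silent steps are never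
  blocked; head positions stay on the tape.\<close>

definition valid :: "sym list \<Rightarrow> nat list \<times> nat list \<Rightarrow> bool" where
  "valid w = (\<lambda>(hs, st). length hs = k \<and> (\<forall>i<k. hs ! i < length (tm_input w)) \<and> (\<exists>\<gamma>\<in>lists (\<Gamma> - {Z}). st = Z # \<gamma>))"

lemma valid_act:
  assumes "valid w (hs, \<gamma> @ [\<alpha>])" "action_ok k \<Gamma> Z (map ((!) (tm_input w)) hs, \<alpha>, \<gamma>', ds)"
  shows "valid w (map2 move_head hs ds, \<gamma> @ \<gamma>')"
proof -
  have v: "length hs = k" "\<forall>i<k. hs ! i < length w + 2" using assms(1) by (auto simp: valid_def length_tm_input)
  have ok: "length ds = k" "\<forall>i<k. move_ok (tm_input w ! (hs ! i)) (ds ! i)" "bottom_respecting \<Gamma> Z \<alpha> \<gamma>'"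
    using assms(2) v(1) by (auto simp: action_ok_def)
  have "move_head (hs ! i) (ds ! i) < length w + 2" if "i < k" for i
  proof (cases "hs ! i = length w + 1")
    case True
    then have "tm_input w ! (hs ! i) = Right_End" by (simp add: tm_input_def nth_append)
    then have "ds ! i = 0 \<or> ds ! i = -1" using ok(2) that by (auto simp: move_ok_def)
    then show ?thesis using v(2) that by fastforce
  next
    case False
    moreover have "ds ! i = 0 \<or> ds ! i = -1 \<or> ds ! i = 1" using ok(2) that by (auto simp: move_ok_def)
    ultimately show ?thesis using v(2) that by fastforce
  qed
  moreover obtain \<delta> where \<delta>: "\<delta> \<in> lists (\<Gamma> - {Z})" "\<gamma> @ [\<alpha>] = Z # \<delta>" using assms(1) by (auto simp: valid_def)
  have "\<exists>\<delta>\<in>lists (\<Gamma> - {Z}). \<gamma> @ \<gamma>' = Z # \<delta>"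
  proof (cases \<gamma>)
    case Nil
    then show ?thesis using \<delta> ok(3) by (auto simp: bottom_respecting_def)
  next
    case (Cons x xs)
    then have "\<delta> = xs @ [\<alpha>]" "x = Z" using \<delta>(2) by auto
    then show ?thesis using Cons \<delta>(1) ok(3) by (intro bexI[of _ "xs @ \<gamma>'"]) (auto simp: bottom_respecting_def split: if_splits)
  qed
  ultimately show ?thesis using v(1) ok(1) by (auto simp: valid_def length_tm_input)
qed

lemma map_tape:
  assumes "valid w (hs, st)"
  shows "map (\<lambda>h. npda2_tape machine (input_code w) ! h) hs = map cell_code (map ((!) (tm_input w)) hs)"
  using assms by (auto simp: valid_def npda2_tape_machine in_set_conv_nth)

lemma map2_move_head_0: "length hs = k \<Longrightarrow> map2 move_head hs (replicate k 0) = hs"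
  by (intro nth_equalityI) auto

text \<open>Together with \<open>machine_step\<close> this is a bisimulation between the machine and
  \<open>cstep\<close> on valid configurations: as \<open>enc\<close> is injective, the state
  determines the continuation.\<close>

lemma step_machine:
  assumes v: "valid w (hs, st)" and c: "c \<in> conts"
    and "npda2_step machine (input_code w) (enc c, hs, st) (q', hs', st')"
  shows "\<exists>c'\<in>conts. q' = enc c' \<and> valid w (hs', st') \<and> cstep (act (tm_input w)) (c, hs, st) (c', hs', st')"
  using assms(3)
proof cases
  case (1 \<alpha> \<gamma>' ds \<gamma>)
  have as: "map cell_code xs = map (\<lambda>h. npda2_tape machine (input_code w) ! h) hs \<Longrightarrow> xs = map ((!) (tm_input w)) hs" for xs
    unfolding map_tape[OF v] using inj_map_eq_map[OF inj_cell_code] by blast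
  have "(enc c, map (\<lambda>h. npda2_tape machine (input_code w) ! h) hs, \<alpha>, q', \<gamma>', ds) \<in> silent_trans \<union> atom_trans"
    using 1 by (simp add: machine_def)
  then show ?thesis
  proof
    assume "(enc c, map (\<lambda>h. npda2_tape machine (input_code w) ! h) hs, \<alpha>, q', \<gamma>', ds) \<in> silent_trans"
    then obtain d c' where *: "d \<in> conts" "c' \<in> set (succs d)" "enc c = enc d" "q' = enc c'" "\<gamma>' = [\<alpha>]" "ds = replicate k 0"
      by (auto simp: silent_trans_iff)
    then have "d = c" using enc_eq c by blast
    moreover have "hs' = hs" "st' = st" using v * 1 by (auto simp: map2_move_head_0 valid_def)
    ultimately show ?thesis using * conts_succs v by (auto intro: cstep.silent)
  next
    assume "(enc c, map (\<lambda>h. npda2_tape machine (input_code w) ! h) hs, \<alpha>, q', \<gamma>', ds) \<in> atom_trans"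
    then obtain X d as where *: "Atom X # d \<in> conts" "(as, \<alpha>, \<gamma>', ds) \<in> X" "enc c = enc (Atom X # d)" "q' = enc d"
      "map cell_code as = map (\<lambda>h. npda2_tape machine (input_code w) ! h) hs"
      by (auto simp: atom_trans_iff)
    then have cX: "c = Atom X # d" and as': "as = map ((!) (tm_input w)) hs" using enc_eq c as by blast+
    have "valid w (hs', st')"
      unfolding 1 using valid_act[of w hs \<gamma> \<alpha> \<gamma>' ds] v * as' ok conts_atom 1 by blast
    moreover have "((hs, st), (hs', st')) \<in> act (tm_input w) X"
      using *(2) 1 unfolding act_def as' by blast
    ultimately show ?thesis using * conts_atom cX by (auto intro: cstep.atom)
  qed
qed

lemma machine_step:
  assumes v: "valid w (hs, st)" and c: "c \<in> conts" and "cstep (act (tm_input w)) (c, hs, st) (c', hs', st')"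
  shows "c' \<in> conts \<and> valid w (hs', st') \<and> npda2_step machine (input_code w) (enc c, hs, st) (enc c', hs', st')"
  using assms(3)
proof cases
  case silent
  obtain \<gamma> \<alpha> where st: "st = \<gamma> @ [\<alpha>]" "\<alpha> \<in> \<Gamma>"
  proof -
    obtain \<delta> where \<delta>: "\<delta> \<in> lists (\<Gamma> - {Z})" "st = Z # \<delta>" using v by (auto simp: valid_def)
    then have "last st \<in> \<Gamma>" using \<Gamma>(2) last_in_set[of \<delta>] by (auto simp: in_lists_conv_set)
    with that[of "butlast st" "last st"] \<delta>(2) show thesis by simp
  qed
  have l: "length hs = k" using v by (simp add: valid_def)
  have "(enc c, map (\<lambda>h. npda2_tape machine (input_code w) ! h) hs, \<alpha>, enc c', [\<alpha>], replicate k 0) \<in> npda2_trans machine"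
  proof -
    have "length (map ((!) (tm_input w)) hs) = k" using l by simp
    with c silent st(2) have "(enc c, map cell_code (map ((!) (tm_input w)) hs), \<alpha>, enc c', [\<alpha>], replicate k 0) \<in> silent_trans"
      unfolding silent_trans_iff by blast
    then show ?thesis unfolding map_tape[OF v] by (simp add: machine_def)
  qed
  from npda2_step.intros[OF this, of \<gamma>] show ?thesis
    using silent v c conts_succs st l by (simp add: map2_move_head_0)
next
  case (atom X)
  then obtain \<gamma> \<alpha> \<gamma>' ds where *: "st = \<gamma> @ [\<alpha>]" "hs' = map2 move_head hs ds" "st' = \<gamma> @ \<gamma>'"
    "(map ((!) (tm_input w)) hs, \<alpha>, \<gamma>', ds) \<in> X" by (auto simp: act_def)
  have X: "c' \<in> conts" "X \<in> set_prog p" using conts_atom c atom by blast+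
  have "(enc c, map (\<lambda>h. npda2_tape machine (input_code w) ! h) hs, \<alpha>, enc c', \<gamma>', ds) \<in> npda2_trans machine"
  proof -
    have "(enc c, map cell_code (map ((!) (tm_input w)) hs), \<alpha>, enc c', \<gamma>', ds) \<in> atom_trans"
      using *(4) c atom(1) unfolding atom_trans_iff by blast
    then show ?thesis unfolding map_tape[OF v] by (simp add: machine_def)
  qed
  from npda2_step.intros[OF this, of \<gamma>] show ?thesis
    using * X valid_act[of w hs \<gamma> \<alpha> \<gamma>' ds] v ok by auto
qed

lemma machine_lang_iff:
  assumes k: "k > 0"
  shows "input_code w \<in> npda2_lang k machine \<longleftrightarrow>
    ((replicate k 0, [Z]), (replicate k (length w + 1), [Z])) \<in> sem (act (tm_input w)) p"
proof -
  let ?s = "(replicate k 0, [Z])" and ?t = "(replicate k (length w + 1), [Z])"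
  have v: "valid w ?s" by (auto simp: valid_def length_tm_input)
  have p: "[p] \<in> conts" and n: "[] \<in> conts" using continuations_self[of p "[]"] by (auto simp: conts_def)
  have 1: "(cstep (act (tm_input w)))\<^sup>*\<^sup>* (c, hs, st) ([], t)"
    if "(npda2_step machine (input_code w))\<^sup>*\<^sup>* (enc c, hs, st) (enc [], t)" "valid w (hs, st)" "c \<in> conts" for c hs st t
    using that
  proof (induction "(enc c, hs, st)" arbitrary: c hs st rule: converse_rtranclp_induct)
    case base
    then show ?case using enc_eq n by auto
  next
    case (step s')
    obtain q' hs' st' where s': "s' = (q', hs', st')" by (cases s')
    from step_machine[OF step.prems step.hyps(1)[unfolded s']] obtain c' where
      "c' \<in> conts" "q' = enc c'" "valid w (hs', st')" "cstep (act (tm_input w)) (c, hs, st) (c', hs', st')" by blast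
    with step.hyps(3) s' show ?case by (blast intro: converse_rtranclp_into_rtranclp)
  qed
  have 2: "(npda2_step machine (input_code w))\<^sup>*\<^sup>* (enc c, s) (enc [], t)"
    if "(cstep (act (tm_input w)))\<^sup>*\<^sup>* (c, s) ([], t)" "valid w s" "c \<in> conts" for c s t
    using that
  proof (induction "(c, s)" arbitrary: c s rule: converse_rtranclp_induct)
    case (step s')
    obtain c' hs' st' where s': "s' = (c', hs', st')" by (cases s')
    obtain hs st where s: "s = (hs, st)" by (cases s)
    from machine_step[of w hs st c c' hs' st'] step.prems step.hyps(1) s' s have
      "c' \<in> conts" "valid w (hs', st')" "npda2_step machine (input_code w) (enc c, s) (enc c', hs', st')" by auto
    with step.hyps(3)[OF s'] show ?case by (blast intro: converse_rtranclp_into_rtranclp)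
  qed auto
  have "input_code w \<in> lists (npda2_input_letters machine)"
    by (auto simp: npda2_input_letters_machine input_code_def)
  moreover have "length (input_code w) = length w" by (simp add: input_code_def)
  ultimately have "input_code w \<in> npda2_lang k machine \<longleftrightarrow> (npda2_step machine (input_code w))\<^sup>*\<^sup>* (enc [p], ?s) (enc [], ?t)"
    by (auto simp: npda2_lang_def machine_def)
  also have "\<dots> \<longleftrightarrow> (cstep (act (tm_input w)))\<^sup>*\<^sup>* ([p], ?s) ([], ?t)"
    using 1[of "[p]" "replicate k 0" "[Z]" ?t] 2[of "[p]" ?s ?t] v p by blast
  also have "\<dots> \<longleftrightarrow> (?s, ?t) \<in> sem (act (tm_input w)) p"
    using csteps_sound[of "act (tm_input w)" "[p]" ?s ?t] csteps_complete[of ?s ?t "act (tm_input w)" p "[]"] by auto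
  finally show ?thesis .
qed

end

lemma program_npda2:
  assumes "finite \<Gamma>" "Z \<in> \<Gamma>" "k > 0" "\<And>X. X \<in> set_prog p \<Longrightarrow> finite X \<and> (\<forall>x\<in>X. action_ok k \<Gamma> Z x)"
  shows "\<exists>M :: (nat, nat, nat) npda2. is_npda2 k M \<and> npda2_input_letters M = range (\<lambda>y. cell_code (Letter y)) \<and>
    (\<forall>w. input_code w \<in> npda2_lang k M \<longleftrightarrow>
      ((replicate k 0, [Z]), (replicate k (length w + 1), [Z])) \<in> sem (act (tm_input w)) p)"
proof -
  have "finite (insert [] (continuations p []))" using finite_continuations by simp
  then obtain enc :: "action set prog list \<Rightarrow> nat" where "inj_on enc (insert [] (continuations p []))"
    using finite_imp_inj_to_nat_seg by blast
  then interpret program_machine k \<Gamma> Z p enc using assms by unfold_locales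
  show ?thesis using is_npda2_machine npda2_input_letters_machine machine_lang_iff[OF assms(3)] by blast
qed

lemma input_code_tm: "\<exists>T c. is_tm (UNIV :: sym set) T \<and> (\<forall>w. \<exists>t. tm_computes T w t (input_code w) \<and> t \<le> c * (length w + 1))"
proof -
  let ?f = "\<lambda>x. case x of Letter y \<Rightarrow> [cell_code (Letter y)] | _ \<Rightarrow> []"
  interpret rescanner "UNIV :: sym set" "{Left_End}" 1 "{()}" "()" "\<lambda>_ _. ()" "{()}" "\<lambda>_ _. ()" "\<lambda>_ s x. (s, ?f x)" "\<lambda>_ _. []"
    by unfold_locales (use finite_UNIV_sym in auto)
  obtain T c where T: "is_tm (UNIV :: sym set) T" "\<And>w bs. tm_input w = concat bs \<Longrightarrow> \<forall>b\<in>set bs. is_block b \<Longrightarrow>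
      \<exists>t. tm_computes T w t (rescan () bs) \<and> t \<le> c * (length w + 1)"
    using rescan_tm by blast
  have "rescan () [tm_input w] = input_code w" for w
    unfolding rescan.simps block_out_def pass_out_concat by (simp add: tm_input_def input_code_def comp_def)
  moreover have "is_block (tm_input w)" for w by (auto simp: is_block_def tm_input_def)
  ultimately show ?thesis using T(1) T(2)[of _ "[tm_input _]"] by (metis append_Nil2 concat.simps list.set empty_iff insert_iff)
qed

section \<open>Programs for a single head\<close>

type_synonym haction = "sym cell \<times> nat \<times> nat list \<times> int"

definition hact :: "sym cell list \<Rightarrow> haction set \<Rightarrow> ((nat \<times> nat list) \<times> (nat \<times> nat list)) set" where
  "hact T X = {((h, \<gamma> @ [\<alpha>]), (move_head h d, \<gamma> @ \<gamma>')) | h \<alpha> \<gamma> \<gamma>' d. (T ! h, \<alpha>, \<gamma>', d) \<in> X}"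

definition on_head :: "nat \<Rightarrow> nat \<Rightarrow> haction set \<Rightarrow> action set" where
  "on_head k j X = {(as, \<alpha>, \<gamma>, (replicate k 0)[j := d]) | as \<alpha> \<gamma> d. length as = k \<and> (as ! j, \<alpha>, \<gamma>, d) \<in> X}"

definition haction_ok :: "nat set \<Rightarrow> nat \<Rightarrow> haction \<Rightarrow> bool" where
  "haction_ok \<Gamma> Z = (\<lambda>(a, \<alpha>, \<gamma>, d). \<alpha> \<in> \<Gamma> \<and> bottom_respecting \<Gamma> Z \<alpha> \<gamma> \<and> move_ok a d)"

definition hprog_ok :: "nat set \<Rightarrow> nat \<Rightarrow> haction set prog \<Rightarrow> bool" where
  "hprog_ok \<Gamma> Z p \<longleftrightarrow> (\<forall>X\<in>set_prog p. finite X \<and> (\<forall>x\<in>X. haction_ok \<Gamma> Z x))"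

definition prog_ok :: "nat \<Rightarrow> nat set \<Rightarrow> nat \<Rightarrow> action set prog \<Rightarrow> bool" where
  "prog_ok k \<Gamma> Z p \<longleftrightarrow> (\<forall>X\<in>set_prog p. finite X \<and> (\<forall>x\<in>X. action_ok k \<Gamma> Z x))"

lemma prog_ok_simps [simp]:
  "prog_ok k \<Gamma> Z (Seq p q) \<longleftrightarrow> prog_ok k \<Gamma> Z p \<and> prog_ok k \<Gamma> Z q"
  "prog_ok k \<Gamma> Z (Alt p q) \<longleftrightarrow> prog_ok k \<Gamma> Z p \<and> prog_ok k \<Gamma> Z q"
  "prog_ok k \<Gamma> Z (Star p) \<longleftrightarrow> prog_ok k \<Gamma> Z p"
  by (auto simp: prog_ok_def)

lemma hprog_ok_simps [simp]:
  "hprog_ok \<Gamma> Z (Seq p q) \<longleftrightarrow> hprog_ok \<Gamma> Z p \<and> hprog_ok \<Gamma> Z q"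
  "hprog_ok \<Gamma> Z (Alt p q) \<longleftrightarrow> hprog_ok \<Gamma> Z p \<and> hprog_ok \<Gamma> Z q"
  "hprog_ok \<Gamma> Z (Star p) \<longleftrightarrow> hprog_ok \<Gamma> Z p"
  by (auto simp: hprog_ok_def)

abbreviation on :: "nat \<Rightarrow> nat \<Rightarrow> haction set prog \<Rightarrow> action set prog" where
  "on k j p \<equiv> map_prog (on_head k j) p"

lemma prog_ok_on:
  assumes "hprog_ok \<Gamma> Z p" "j < k"
  shows "prog_ok k \<Gamma> Z (on k j p)"
proof -
  have "finite (on_head k j X) \<and> (\<forall>x\<in>on_head k j X. action_ok k \<Gamma> Z x)" if "X \<in> set_prog p" for X
  proof
    have X: "finite X" "\<forall>x\<in>X. haction_ok \<Gamma> Z x" using assms(1) that by (auto simp: hprog_ok_def)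
    have "on_head k j X \<subseteq> (\<lambda>(as, a, \<alpha>, \<gamma>, d). (as, \<alpha>, \<gamma>, (replicate k 0)[j := d])) ` ({as. length as = k} \<times> X)"
      unfolding on_head_def by force
    moreover have "finite {as :: sym cell list. length as = k}"
      using finite_lists_length_eq[OF finite_UNIV_cell, of k] by simp
    ultimately show "finite (on_head k j X)" using X(1) by (auto intro: finite_subset)
    show "\<forall>x\<in>on_head k j X. action_ok k \<Gamma> Z x"
    proof
      fix x assume "x \<in> on_head k j X"
      then obtain as \<alpha> \<gamma> d where x: "x = (as, \<alpha>, \<gamma>, (replicate k 0)[j := d])" "length as = k" "(as ! j, \<alpha>, \<gamma>, d) \<in> X"
        unfolding on_head_def by blast
      then have "haction_ok \<Gamma> Z (as ! j, \<alpha>, \<gamma>, d)" using X(2) by blast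
      then show "action_ok k \<Gamma> Z x"
        using x(2) assms(2) by (auto simp: x(1) haction_ok_def action_ok_def nth_list_update move_ok_def)
    qed
  qed
  then show ?thesis by (auto simp: prog_ok_def prog.set_map)
qed

lemma map2_move_head_update:
  "j < length hs \<Longrightarrow> map2 move_head hs ((replicate (length hs) 0)[j := d]) = hs[j := move_head (hs ! j) d]"
  by (intro nth_equalityI) (auto simp: nth_list_update)

lemma act_on_head:
  assumes "length hs = k" "j < k"
  shows "((hs, st), (hs', st')) \<in> act T (on_head k j X) \<longleftrightarrow>
    (\<exists>h'. ((hs ! j, st), (h', st')) \<in> hact T X \<and> hs' = hs[j := h'])"
proof
  assume "((hs, st), (hs', st')) \<in> act T (on_head k j X)"
  then obtain \<alpha> \<gamma> \<gamma>' d where "st = \<gamma> @ [\<alpha>]" "st' = \<gamma> @ \<gamma>'" "hs' = map2 move_head hs ((replicate k 0)[j := d])"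
    "(T ! (hs ! j), \<alpha>, \<gamma>', d) \<in> X"
    using assms unfolding act_def on_head_def by auto
  then show "\<exists>h'. ((hs ! j, st), (h', st')) \<in> hact T X \<and> hs' = hs[j := h']"
    using assms map2_move_head_update[of j hs d] unfolding hact_def by blast
next
  assume "\<exists>h'. ((hs ! j, st), (h', st')) \<in> hact T X \<and> hs' = hs[j := h']"
  then obtain \<alpha> \<gamma> \<gamma>' d where *: "st = \<gamma> @ [\<alpha>]" "st' = \<gamma> @ \<gamma>'" "hs' = hs[j := move_head (hs ! j) d]"
    "(T ! (hs ! j), \<alpha>, \<gamma>', d) \<in> X" unfolding hact_def by blast
  have "(map ((!) T) hs, \<alpha>, \<gamma>', (replicate k 0)[j := d]) \<in> on_head k j X"
    unfolding on_head_def using *(4) assms by (auto intro!: exI[of _ d])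
  moreover have "hs' = map2 move_head hs ((replicate k 0)[j := d])"
    using *(3) assms map2_move_head_update[of j hs d] by simp
  ultimately show "((hs, st), (hs', st')) \<in> act T (on_head k j X)" unfolding act_def using * by blast
qed

text \<open>Atoms of the lifted program look only at the cell of head \<open>j\<close> and change
  only entry \<open>j\<close>, so its runs are those of the one-head program with the other entries
  frozen.\<close>

lemma sem_on:
  assumes "length hs = k" "j < k"
  shows "((hs, st), (hs', st')) \<in> sem (act T) (on k j p) \<longleftrightarrow>
    (\<exists>h'. ((hs ! j, st), (h', st')) \<in> sem (hact T) p \<and> hs' = hs[j := h'])"
  using assms(1)
proof (induction p arbitrary: hs hs' st st')
  case (Atom x)
  then show ?case using act_on_head[of hs k j] assms(2) by simp
next
  case (Seq p q)
  show ?case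
  proof
    assume "((hs, st), (hs', st')) \<in> sem (act T) (on k j (Seq p q))"
    then obtain hs1 st1 where *: "((hs, st), (hs1, st1)) \<in> sem (act T) (on k j p)" "((hs1, st1), (hs', st')) \<in> sem (act T) (on k j q)"
      by auto
    then obtain h1 where h1: "((hs ! j, st), (h1, st1)) \<in> sem (hact T) p" "hs1 = hs[j := h1]" using Seq by blast
    then obtain h' where "((h1, st1), (h', st')) \<in> sem (hact T) q" "hs' = hs1[j := h']"
      using Seq.IH(2)[of hs1] *(2) Seq.prems assms(2) by auto
    with h1 show "\<exists>h'. ((hs ! j, st), (h', st')) \<in> sem (hact T) (Seq p q) \<and> hs' = hs[j := h']" by auto
  next
    assume "\<exists>h'. ((hs ! j, st), (h', st')) \<in> sem (hact T) (Seq p q) \<and> hs' = hs[j := h']"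
    then obtain h' h1 st1 where *: "((hs ! j, st), (h1, st1)) \<in> sem (hact T) p" "((h1, st1), (h', st')) \<in> sem (hact T) q"
      "hs' = hs[j := h']" by auto
    then have "((hs, st), (hs[j := h1], st1)) \<in> sem (act T) (on k j p)" using Seq by blast
    moreover have "((hs[j := h1], st1), (hs', st')) \<in> sem (act T) (on k j q)"
      using Seq.IH(2)[of "hs[j := h1]"] * Seq.prems assms(2) by auto
    ultimately show "((hs, st), (hs', st')) \<in> sem (act T) (on k j (Seq p q))" by auto
  qed
next
  case (Alt p q)
  then show ?case by auto
next
  case (Star p)
  show ?case
  proof
    assume "((hs, st), (hs', st')) \<in> sem (act T) (on k j (Star p))"
    then have "((hs, st), (hs', st')) \<in> (sem (act T) (on k j p))\<^sup>*" by simp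
    then have "\<exists>h'. ((hs ! j, st), (h', st')) \<in> (sem (hact T) p)\<^sup>* \<and> hs' = hs[j := h']"
      using Star.prems
    proof (induction "(hs, st)" arbitrary: hs st rule: converse_rtrancl_induct)
      case base
      show ?case by (intro exI[of _ "hs' ! j"]) simp
    next
      case (step s)
      obtain hs1 st1 where s: "s = (hs1, st1)" by (cases s)
      then obtain h1 where h1: "((hs ! j, st), (h1, st1)) \<in> sem (hact T) p" "hs1 = hs[j := h1]"
        using Star.IH[OF step.prems] step.hyps(1) by blast
      then obtain h' where "((h1, st1), (h', st')) \<in> (sem (hact T) p)\<^sup>*" "hs' = hs1[j := h']"
        using step.hyps(3)[OF s] step.prems assms(2) by auto
      with h1 show ?case by (auto intro: converse_rtrancl_into_rtrancl)
    qed
    then show "\<exists>h'. ((hs ! j, st), (h', st')) \<in> sem (hact T) (Star p) \<and> hs' = hs[j := h']" by simp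
  next
    assume "\<exists>h'. ((hs ! j, st), (h', st')) \<in> sem (hact T) (Star p) \<and> hs' = hs[j := h']"
    then obtain h' where "((hs ! j, st), (h', st')) \<in> (sem (hact T) p)\<^sup>*" and hs': "hs' = hs[j := h']" by auto
    from this(1) have "((hs, st), (hs[j := h'], st')) \<in> (sem (act T) (on k j p))\<^sup>*"
      using Star.prems
    proof (induction "(hs ! j, st)" arbitrary: hs st rule: converse_rtrancl_induct)
      case base
      then show ?case by simp
    next
      case (step s)
      obtain h1 st1 where s: "s = (h1, st1)" by (cases s)
      have 1: "((hs, st), (hs[j := h1], st1)) \<in> sem (act T) (on k j p)"
        using Star.IH[OF step.prems] step.hyps(1) s by blast
      have "((hs[j := h1], st1), ((hs[j := h1])[j := h'], st')) \<in> (sem (act T) (on k j p))\<^sup>*"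
        using step.hyps(3)[of "hs[j := h1]" st1] s step.prems assms(2) by simp
      with 1 show ?case by (auto intro: converse_rtrancl_into_rtrancl)
    qed
    then show "((hs, st), (hs', st')) \<in> sem (act T) (on k j (Star p))" using hs' by simp
  qed
qed

text \<open>The reflexive transitive closure of the empty relation is the identity.\<close>

definition skip :: "'x set prog" where
  "skip = Star (Atom {})"

primrec seqs :: "'x set prog list \<Rightarrow> 'x set prog" where
  "seqs [] = skip"
| "seqs (p # ps) = Seq p (seqs ps)"

primrec alts :: "'x set prog list \<Rightarrow> 'x set prog" where
  "alts [] = Atom {}"
| "alts (p # ps) = Alt p (alts ps)"

lemma sem_skip: "(\<And>x. x \<notin> I {}) \<Longrightarrow> sem I skip = Id"
proof -
  assume "\<And>x. x \<notin> I {}"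
  then have "I {} = {}" by blast
  then show ?thesis by (simp add: skip_def)
qed

lemma act_empty [simp]: "act T {} = {}" and hact_empty [simp]: "hact T {} = {}"
  by (simp_all add: act_def hact_def)

lemma sem_seqs_append: "I {} = {} \<Longrightarrow> sem I (seqs (ps @ qs)) = sem I (seqs ps) O sem I (seqs qs)"
  by (induction ps) (auto simp: sem_skip)

lemma sem_alts: "I {} = {} \<Longrightarrow> x \<in> sem I (alts ps) \<longleftrightarrow> (\<exists>p\<in>set ps. x \<in> sem I p)"
  by (induction ps) auto

lemma sem_Seq_iff: "(x, y) \<in> sem I (Seq p q) \<longleftrightarrow> (\<exists>z. (x, z) \<in> sem I p \<and> (z, y) \<in> sem I q)"
  by auto

text \<open>The unfolding law of a loop with a continuation. It is used for all programs that
  consume a word of unknown length: by the current cell only one of the two disjuncts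
  survives.\<close>

lemma sem_Star_Seq: "(x, y) \<in> sem I (Seq (Star p) q) \<longleftrightarrow>
    (x, y) \<in> sem I q \<or> (\<exists>z. (x, z) \<in> sem I p \<and> (z, y) \<in> sem I (Seq (Star p) q))"
proof
  assume "(x, y) \<in> sem I (Seq (Star p) q)"
  then obtain u where "(x, u) \<in> (sem I p)\<^sup>*" and q: "(u, y) \<in> sem I q" by auto
  from this(1) show "(x, y) \<in> sem I q \<or> (\<exists>z. (x, z) \<in> sem I p \<and> (z, y) \<in> sem I (Seq (Star p) q))"
    by (cases rule: converse_rtranclE) (use q in auto)
next
  assume "(x, y) \<in> sem I q \<or> (\<exists>z. (x, z) \<in> sem I p \<and> (z, y) \<in> sem I (Seq (Star p) q))"
  then show "(x, y) \<in> sem I (Seq (Star p) q)"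
    by (auto intro: converse_rtrancl_into_rtrancl)
qed

definition each_head :: "nat \<Rightarrow> (nat \<Rightarrow> haction set prog) \<Rightarrow> action set prog" where
  "each_head k q = seqs (map (\<lambda>j. on k j (q j)) [0..<k])"

text \<open>The heads act one after the other on a common stack. As each program gives the stack
  back unchanged, every head starts with the same stack, and the effects are independent.\<close>

lemma sem_each_head:
  assumes "length hs = k"
    and "\<And>j h' st'. j < k \<Longrightarrow> ((hs ! j, st), (h', st')) \<in> sem (hact T) (q j) \<longleftrightarrow> st' = st \<and> R j h'"
  shows "((hs, st), (hs', st')) \<in> sem (act T) (each_head k q) \<longleftrightarrow> st' = st \<and> length hs' = k \<and> (\<forall>j<k. R j (hs' ! j))"
proof -
  have "((hs, st), (hs', st')) \<in> sem (act T) (seqs (map (\<lambda>j. on k j (q j)) [0..<n])) \<longleftrightarrow>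
    st' = st \<and> length hs' = k \<and> (\<forall>j<n. R j (hs' ! j)) \<and> (\<forall>j. n \<le> j \<and> j < k \<longrightarrow> hs' ! j = hs ! j)" if "n \<le> k" for n
    using that
  proof (induction n arbitrary: hs' st')
    case 0
    show ?case using assms(1) by (auto simp: sem_skip intro: nth_equalityI)
  next
    case (Suc n)
    have split: "seqs (map (\<lambda>j. on k j (q j)) [0..<Suc n]) = seqs (map (\<lambda>j. on k j (q j)) [0..<n] @ [on k n (q n)])" by simp
    have "((hs, st), (hs', st')) \<in> sem (act T) (seqs (map (\<lambda>j. on k j (q j)) [0..<Suc n])) \<longleftrightarrow>
      (\<exists>hs1 st1. ((hs, st), (hs1, st1)) \<in> sem (act T) (seqs (map (\<lambda>j. on k j (q j)) [0..<n])) \<and>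
        ((hs1, st1), (hs', st')) \<in> sem (act T) (on k n (q n)))"
      unfolding split by (auto simp: sem_seqs_append sem_skip)
    also have "\<dots> \<longleftrightarrow> (\<exists>hs1. length hs1 = k \<and> (\<forall>j<n. R j (hs1 ! j)) \<and> (\<forall>j. n \<le> j \<and> j < k \<longrightarrow> hs1 ! j = hs ! j) \<and>
        ((hs1, st), (hs', st')) \<in> sem (act T) (on k n (q n)))"
      using Suc by auto
    also have "\<dots> \<longleftrightarrow> (\<exists>hs1. length hs1 = k \<and> (\<forall>j<n. R j (hs1 ! j)) \<and> (\<forall>j. n \<le> j \<and> j < k \<longrightarrow> hs1 ! j = hs ! j) \<and>
        (\<exists>h'. st' = st \<and> R n h' \<and> hs' = hs1[n := h']))"
    proof (intro iff_exI conj_cong HOL.refl)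
      fix hs1 :: "nat list" assume "length hs1 = k" "\<forall>j. n \<le> j \<and> j < k \<longrightarrow> hs1 ! j = hs ! j"
      then show "((hs1, st), (hs', st')) \<in> sem (act T) (on k n (q n)) \<longleftrightarrow> (\<exists>h'. st' = st \<and> R n h' \<and> hs' = hs1[n := h'])"
        using Suc.prems assms(2)[of n] by (auto simp: sem_on)
    qed
    also have "\<dots> \<longleftrightarrow> st' = st \<and> length hs' = k \<and> (\<forall>j<Suc n. R j (hs' ! j)) \<and> (\<forall>j. Suc n \<le> j \<and> j < k \<longrightarrow> hs' ! j = hs ! j)"
      (is "?l \<longleftrightarrow> ?r")
    proof
      assume ?l
      then show ?r using Suc.prems by (auto simp: nth_list_update less_Suc_eq)
    next
      assume ?r
      \<comment> \<open>In the intermediate configuration head \<open>n\<close> is still at its old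
        place.\<close>
      then show ?l using Suc.prems
        by (intro exI[of _ "hs'[n := hs ! n]"]) (auto simp: nth_list_update intro!: exI[of _ "hs' ! n"])
    qed
    finally show ?case .
  qed
  from this[of k] show ?thesis by (auto simp: each_head_def)
qed

lemma prog_ok_empty: "prog_ok k \<Gamma> Z skip" and hprog_ok_empty: "hprog_ok \<Gamma> Z skip" "hprog_ok \<Gamma> Z (Atom {})"
  by (simp_all add: prog_ok_def hprog_ok_def skip_def)

lemma prog_ok_seqs: "(\<And>p. p \<in> set ps \<Longrightarrow> prog_ok k \<Gamma> Z p) \<Longrightarrow> prog_ok k \<Gamma> Z (seqs ps)"
  by (induction ps) (simp_all add: prog_ok_empty)

lemma prog_ok_each_head: "(\<And>j. j < k \<Longrightarrow> hprog_ok \<Gamma> Z (q j)) \<Longrightarrow> prog_ok k \<Gamma> Z (each_head k q)"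
  unfolding each_head_def by (rule prog_ok_seqs) (auto intro: prog_ok_on)

lemma hprog_ok_seqs: "(\<And>p. p \<in> set ps \<Longrightarrow> hprog_ok \<Gamma> Z p) \<Longrightarrow> hprog_ok \<Gamma> Z (seqs ps)"
  by (induction ps) (simp_all add: hprog_ok_empty)

lemma hprog_ok_alts: "(\<And>p. p \<in> set ps \<Longrightarrow> hprog_ok \<Gamma> Z p) \<Longrightarrow> hprog_ok \<Gamma> Z (alts ps)"
  by (induction ps) (simp_all add: hprog_ok_empty)

text \<open>The set of admissible tops makes this a test as well: with the original stack alphabet
  it later ensures that no auxiliary symbol is left on top.\<close>

definition mv :: "nat set \<Rightarrow> sym cell set \<Rightarrow> int \<Rightarrow> haction set prog" where
  "mv G C d = Atom ((\<lambda>(a, \<alpha>). (a, \<alpha>, [\<alpha>], d)) ` (C \<times> G))"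

definition push :: "nat set \<Rightarrow> sym cell set \<Rightarrow> nat \<Rightarrow> int \<Rightarrow> haction set prog" where
  "push G C x d = Atom ((\<lambda>(a, \<alpha>). (a, \<alpha>, [\<alpha>, x], d)) ` (C \<times> G))"

definition pop :: "sym cell set \<Rightarrow> nat \<Rightarrow> int \<Rightarrow> haction set prog" where
  "pop C x d = Atom ((\<lambda>a. (a, x, [], d)) ` C)"

lemma sem_mv: "((h, st), (h', st')) \<in> sem (hact T) (mv G C d) \<longleftrightarrow>
    T ! h \<in> C \<and> st \<noteq> [] \<and> last st \<in> G \<and> st' = st \<and> h' = move_head h d"
  by (cases st rule: rev_cases) (auto simp: mv_def hact_def image_iff)

lemma sem_push: "((h, st), (h', st')) \<in> sem (hact T) (push G C x d) \<longleftrightarrow>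
    T ! h \<in> C \<and> st \<noteq> [] \<and> last st \<in> G \<and> st' = st @ [x] \<and> h' = move_head h d"
  by (cases st rule: rev_cases) (auto simp: push_def hact_def image_iff)

lemma sem_pop: "((h, st), (h', st')) \<in> sem (hact T) (pop C x d) \<longleftrightarrow>
    T ! h \<in> C \<and> st = st' @ [x] \<and> h' = move_head h d"
  by (cases st rule: rev_cases) (auto simp: pop_def hact_def image_iff)

lemma finite_cell_set: "finite (C :: sym cell set)"
  by (rule finite_subset[OF subset_UNIV finite_UNIV_cell])

lemma hprog_ok_Atom: "hprog_ok \<Gamma> Z (Atom X) \<longleftrightarrow> finite X \<and> (\<forall>x\<in>X. haction_ok \<Gamma> Z x)"
  by (simp add: hprog_ok_def)

lemma hprog_ok_mv:
  assumes "finite G" "G \<subseteq> \<Gamma>" "\<And>a. a \<in> C \<Longrightarrow> move_ok a d"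
  shows "hprog_ok \<Gamma> Z (mv G C d)"
  unfolding mv_def hprog_ok_Atom
proof
  show "finite ((\<lambda>(a, \<alpha>). (a, \<alpha>, [\<alpha>], d)) ` (C \<times> G))"
    using finite_cell_set assms(1) by (intro finite_imageI finite_cartesian_product)
qed (use assms(2,3) in \<open>auto simp: haction_ok_def bottom_respecting_def\<close>)

lemma hprog_ok_push:
  assumes "finite G" "G \<subseteq> \<Gamma>" "x \<in> \<Gamma>" "x \<noteq> Z" "\<And>a. a \<in> C \<Longrightarrow> move_ok a d"
  shows "hprog_ok \<Gamma> Z (push G C x d)"
  unfolding push_def hprog_ok_Atom
proof
  show "finite ((\<lambda>(a, \<alpha>). (a, \<alpha>, [\<alpha>, x], d)) ` (C \<times> G))"
    using finite_cell_set assms(1) by (intro finite_imageI finite_cartesian_product)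
qed (use assms(2-5) in \<open>auto simp: haction_ok_def bottom_respecting_def\<close>)

lemma hprog_ok_pop:
  assumes "x \<in> \<Gamma>" "x \<noteq> Z" "\<And>a. a \<in> C \<Longrightarrow> move_ok a d"
  shows "hprog_ok \<Gamma> Z (pop C x d)"
  unfolding pop_def hprog_ok_Atom
proof
  show "finite ((\<lambda>a. (a, x, [], d)) ` C)"
    using finite_cell_set by (intro finite_imageI)
qed (use assms in \<open>auto simp: haction_ok_def bottom_respecting_def\<close>)

primrec reads :: "sym cell list \<Rightarrow> nat \<Rightarrow> sym list \<Rightarrow> bool" where
  "reads T h [] \<longleftrightarrow> True"
| "reads T h (x # xs) \<longleftrightarrow> T ! h = Letter x \<and> reads T (Suc h) xs"

lemma reads_append: "reads T h (xs @ ys) \<longleftrightarrow> reads T h xs \<and> reads T (h + length xs) ys"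
  by (induction xs arbitrary: h) auto

lemma reads_nth: "reads T h xs \<longleftrightarrow> (\<forall>i<length xs. T ! (h + i) = Letter (xs ! i))"
  by (induction xs arbitrary: h) (auto simp: nth_Cons less_Suc_eq_0_disj split: nat.splits)

definition word :: "nat set \<Rightarrow> sym list \<Rightarrow> haction set prog" where
  "word G xs = seqs (map (\<lambda>x. mv G {Letter x} 1) xs)"

lemma sem_word:
  "st \<noteq> [] \<Longrightarrow> last st \<in> G \<Longrightarrow> ((h, st), (h', st')) \<in> sem (hact T) (word G xs) \<longleftrightarrow> st' = st \<and> h' = h + length xs \<and> reads T h xs"
  by (induction xs arbitrary: h) (auto simp: word_def sem_skip sem_mv relcomp.simps)

text \<open>The loop may stop at any time; programs enforce a maximal scan by a test behind
  it.\<close>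

lemma sem_Star_right:
  assumes "st \<noteq> []" "last st \<in> G"
  shows "((h, st), (h', st')) \<in> sem (hact T) (Star (mv G C 1)) \<longleftrightarrow> st' = st \<and> h \<le> h' \<and> (\<forall>x. h \<le> x \<and> x < h' \<longrightarrow> T ! x \<in> C)"
proof
  assume "((h, st), (h', st')) \<in> sem (hact T) (Star (mv G C 1))"
  then have "((h, st), (h', st')) \<in> (sem (hact T) (mv G C 1))\<^sup>*" by simp
  then show "st' = st \<and> h \<le> h' \<and> (\<forall>x. h \<le> x \<and> x < h' \<longrightarrow> T ! x \<in> C)"
  proof (induction "(h', st')" arbitrary: h' st' rule: rtrancl_induct)
    case (step s)
    then show ?case by (cases s) (auto simp: sem_mv less_Suc_eq)
  qed auto
next
  assume "st' = st \<and> h \<le> h' \<and> (\<forall>x. h \<le> x \<and> x < h' \<longrightarrow> T ! x \<in> C)"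
  then have st': "st' = st" "h \<le> h'" "\<forall>x. h \<le> x \<and> x < h' \<longrightarrow> T ! x \<in> C" by auto
  from st'(2,3) have "((h, st), (h', st)) \<in> (sem (hact T) (mv G C 1))\<^sup>*"
  proof (induction h' rule: dec_induct)
    case (step n)
    then have "((n, st), (Suc n, st)) \<in> sem (hact T) (mv G C 1)" using assms by (auto simp: sem_mv)
    with step show ?case by (auto intro: rtrancl_into_rtrancl)
  qed auto
  then show "((h, st), (h', st')) \<in> sem (hact T) (Star (mv G C 1))" using st' by simp
qed

text \<open>The cells that are left have to be in \<open>C\<close>: the start is among them, the
  final position is not.\<close>

lemma sem_Star_left:
  assumes "st \<noteq> []" "last st \<in> G"
  shows "((h, st), (h', st')) \<in> sem (hact T) (Star (mv G C (-1))) \<longleftrightarrow> st' = st \<and> h' \<le> h \<and> (\<forall>x. h' < x \<and> x \<le> h \<longrightarrow> T ! x \<in> C)"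
proof
  assume "((h, st), (h', st')) \<in> sem (hact T) (Star (mv G C (-1)))"
  then have "((h, st), (h', st')) \<in> (sem (hact T) (mv G C (-1)))\<^sup>*" by simp
  then show "st' = st \<and> h' \<le> h \<and> (\<forall>x. h' < x \<and> x \<le> h \<longrightarrow> T ! x \<in> C)"
  proof (induction "(h', st')" arbitrary: h' st' rule: rtrancl_induct)
    case (step s)
    obtain n st1 where s: "s = (n, st1)" by (cases s)
    have *: "T ! n \<in> C" "st' = st1" "h' = n - 1" using step.hyps(2) by (auto simp: s sem_mv)
    have "T ! x \<in> C" if "h' < x" "x \<le> h" for x
    proof (cases "x = n")
      case False
      then have "n < x" using that *(3) by simp
      then show ?thesis using step.hyps(3)[OF s] that by blast
    qed (use * in simp)
    then show ?case using step.hyps(3)[OF s] * by auto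
  qed auto
next
  assume "st' = st \<and> h' \<le> h \<and> (\<forall>x. h' < x \<and> x \<le> h \<longrightarrow> T ! x \<in> C)"
  then have st': "st' = st" "h' \<le> h" "\<forall>x. h' < x \<and> x \<le> h \<longrightarrow> T ! x \<in> C" by auto
  from st'(2,3) have "((h, st), (h', st)) \<in> (sem (hact T) (mv G C (-1)))\<^sup>*"
  proof (induction h' rule: inc_induct)
    case (step n)
    then have "((Suc n, st), (n, st)) \<in> sem (hact T) (mv G C (-1))" using assms by (auto simp: sem_mv)
    with step show ?case by (auto intro: rtrancl_into_rtrancl)
  qed auto
  then show "((h, st), (h', st')) \<in> sem (hact T) (Star (mv G C (-1)))" using st' by simp
qed

section \<open>Navigating in an encoded automaton\<close>

definition body :: "sym cell set" where
  "body = Letter ` (- {State, Auto})"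

text \<open>What can follow a reference: a transition, a state, an automaton, or the end. Testing
  for it forces the loops over a reference to be maximal.\<close>

definition stop :: "sym cell set" where
  "stop = {Letter Trans, Letter State, Letter Auto, Right_End}"

definition bits :: "sym cell set" where
  "bits = {Letter (Bit True), Letter (Bit False)}"

lemma body_simps [simp]: "Letter y \<in> body \<longleftrightarrow> y \<noteq> State \<and> y \<noteq> Auto" "Right_End \<notin> body" "Left_End \<notin> body"
  by (auto simp: body_def)

lemma stop_simps [simp]: "Letter y \<in> stop \<longleftrightarrow> y \<in> {Trans, State, Auto}" "Right_End \<in> stop" "Left_End \<notin> stop"
  by (auto simp: stop_def)

lemma bits_simps [simp]: "Letter y \<in> bits \<longleftrightarrow> y \<in> range Bit" "Right_End \<notin> bits" "Left_End \<notin> bits"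
  by (auto simp: bits_def)

text \<open>The stack alphabet is extended by two symbols, for the bits of labels and for counting.\<close>

locale stack_symbols =
  fixes \<Gamma> :: "nat set" and Z x0 x1 :: nat
  assumes \<Gamma>: "finite \<Gamma>" "Z \<in> \<Gamma>" and x0: "x0 \<notin> \<Gamma>" and x1: "x1 \<notin> \<Gamma>" and x01: "x0 \<noteq> x1"
begin

definition G :: "nat set" where
  "G = \<Gamma> \<union> {x0, x1}"

definition mark :: "bool \<Rightarrow> nat" where
  "mark b = (if b then x1 else x0)"

lemma mark_simps [simp]: "mark b \<in> G" "mark b \<notin> \<Gamma>" "mark b = mark c \<longleftrightarrow> b = c" "x0 \<in> G" "x1 \<in> G"
  using x0 x1 x01 by (auto simp: mark_def G_def)

text \<open>\<open>okG\<close> is what moving requires. The stronger \<open>okS\<close> says that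
  nothing auxiliary lies on top, which is the situation before and after a reference is
  resolved.\<close>

abbreviation okG :: "nat list \<Rightarrow> bool" where
  "okG st \<equiv> st \<noteq> [] \<and> last st \<in> G"

abbreviation okS :: "nat list \<Rightarrow> bool" where
  "okS st \<equiv> st \<noteq> [] \<and> last st \<in> \<Gamma>"

lemma okS_okG: "okS st \<Longrightarrow> okG st"
  by (auto simp: G_def)

lemma okG_replicate: "okG st \<Longrightarrow> okG (st @ replicate d x0)"
  by (auto simp: last_append)

lemma okG_marks: "okG st \<Longrightarrow> okG (st @ map mark l)"
  by (cases l rule: rev_cases) (auto simp: last_append)

text \<open>As the first step is unconditional, this leads from the inside of a state to its
  beginning, and from the beginning of a state to the preceding one.\<close>

definition retreat :: "haction set prog" where
  "retreat = Seq (mv G (- {Left_End}) (-1)) (Seq (Star (mv G body (-1))) (mv G {Letter State} 0))"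

definition advance :: "haction set prog" where
  "advance = Seq (mv G {Letter State} 1) (Seq (Star (mv G body 1)) (mv G {Letter State} 0))"

text \<open>The guess of a state. It cannot leave the automaton since \<open>body\<close> excludes
  \<open>Auto\<close>.\<close>

definition wander :: "haction set prog" where
  "wander = Star (Alt advance retreat)"

text \<open>The guess of a transition: \<open>Trans\<close> itself lies in \<open>body\<close>, so
  the loop may pass over any number of transitions of the state.\<close>

definition pick :: "haction set prog" where
  "pick = Seq (mv G {Letter State} 1) (Seq (Star (mv G body 1)) (mv G {Letter Trans} 1))"

definition count :: "sym \<Rightarrow> haction set prog" where
  "count y = Seq (Star (push G {Letter y} x0 1)) (mv G stop 0)"

text \<open>One counter symbol is used up per step; the last test, for a top in
  \<open>\<Gamma>\<close>, succeeds only when the counter is empty.\<close>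

definition walk :: "haction set prog \<Rightarrow> haction set prog" where
  "walk p = Seq (Star (Seq (pop {Letter State} x0 0) p)) (mv \<Gamma> {Letter State} 0)"

definition remember :: "haction set prog" where
  "remember = Seq (Star (Alt (push G {Letter (Bit True)} x1 1) (push G {Letter (Bit False)} x0 1))) (mv G stop 0)"

text \<open>The last bit lies on top of the stack, hence the comparison from right to left. The
  final test demands that tape label and stored label end simultaneously.\<close>

definition compare :: "haction set prog" where
  "compare = Seq (Star (Alt (pop {Letter (Bit True)} x1 (-1)) (pop {Letter (Bit False)} x0 (-1)))) (mv \<Gamma> {Letter State} 0)"

definition label_end :: "haction set prog" where
  "label_end = Seq (mv G {Letter State} 1) (Seq (Star (mv G bits 1)) (mv G (- bits) 0))"

text \<open>The distance in a reference is counted on the stack and then used up state by state. The label in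
  a reference is pushed onto the stack and compared, from right to left, with the label of a guessed state.\<close>

definition fwd_ref :: "haction set prog" where
  "fwd_ref = Seq (count Fwd) (Seq retreat (walk advance))"

definition bwd_ref :: "haction set prog" where
  "bwd_ref = Seq (count Bwd) (Seq retreat (walk retreat))"

definition label_ref :: "haction set prog" where
  "label_ref = Seq (mv G {Letter Label} 1) (Seq remember (Seq retreat (Seq wander
     (Seq label_end (Seq (mv G (- {Left_End}) (-1)) compare)))))"

definition ref :: "haction set prog" where
  "ref = Alt fwd_ref (Alt bwd_ref label_ref)"

definition next_auto :: "haction set prog" where
  "next_auto = Seq (Star (mv G (Letter ` (- {Auto})) 1)) (mv G {Letter Auto} 1)"

text \<open>The alphabet comes first and an \<open>Auto\<close> stands also in front of the PDA, so
  automaton \<open>j\<close> is behind \<open>Suc j\<close> of them. The last step returns from the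
  flag to the beginning of the state.\<close>

definition init :: "nat \<Rightarrow> haction set prog" where
  "init j = Seq (mv G {Left_End} 1) (Seq (seqs (replicate (Suc j) next_auto)) (Seq wander
     (Seq label_end (Seq (mv G {Letter Init} 0) retreat))))"

text \<open>The flag \<open>Init\<close> precedes \<open>Final\<close> if both are there. The rest
  brings the head to the right marker, as acceptance requires.\<close>

definition final :: "haction set prog" where
  "final = Seq label_end (Seq (Star (mv G {Letter Init} 1)) (Seq (mv G {Letter Final} 1)
     (Seq (Star (mv G (- {Right_End}) 1)) (mv G {Right_End} 0))))"

lemma finite_G: "finite G"
  using \<Gamma> by (simp add: G_def)

lemma Z_neq: "x0 \<noteq> Z" "x1 \<noteq> Z"
  using \<Gamma> x0 x1 by auto

lemma \<Gamma>_subset: "\<Gamma> \<subseteq> G"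
  by (auto simp: G_def)

lemma hprog_ok_mvG: "(\<And>a. a \<in> C \<Longrightarrow> move_ok a d) \<Longrightarrow> hprog_ok G Z (mv G C d)"
  using hprog_ok_mv[OF finite_G subset_refl] .

lemma hprog_ok_mvS: "(\<And>a. a \<in> C \<Longrightarrow> move_ok a d) \<Longrightarrow> hprog_ok G Z (mv \<Gamma> C d)"
  using hprog_ok_mv[OF \<Gamma>(1) \<Gamma>_subset] .

lemma hprog_ok_pushG: "x \<in> G \<Longrightarrow> x \<noteq> Z \<Longrightarrow> (\<And>a. a \<in> C \<Longrightarrow> move_ok a d) \<Longrightarrow> hprog_ok G Z (push G C x d)"
  using hprog_ok_push[OF finite_G subset_refl] .

lemma move_ok_simps [simp]: "move_ok a 0" "move_ok (Letter y) 1" "move_ok (Letter y) (-1)" "move_ok Left_End 1"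
  "move_ok Right_End (-1)"
  by (auto simp: move_ok_def)

lemma move_ok_cells:
  "a \<in> body \<Longrightarrow> move_ok a 1" "a \<in> body \<Longrightarrow> move_ok a (-1)" "a \<in> bits \<Longrightarrow> move_ok a 1" "a \<in> Letter ` Y \<Longrightarrow> move_ok a 1"
  "a \<in> - {Left_End} \<Longrightarrow> move_ok a (-1)" "a \<in> - {Right_End} \<Longrightarrow> move_ok a 1"
  by (auto simp: move_ok_def body_def bits_def)

lemmas hprog_ok_intros = hprog_ok_mvG hprog_ok_mvS hprog_ok_pushG hprog_ok_pop move_ok_cells mark_simps Z_neq

lemma hprog_ok_programs:
  "hprog_ok G Z pick" "hprog_ok G Z ref" "hprog_ok G Z (init j)" "hprog_ok G Z final"
proof -
  have 1: "hprog_ok G Z retreat" "hprog_ok G Z advance" "hprog_ok G Z label_end" "hprog_ok G Z (count y)" for y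
    unfolding retreat_def advance_def label_end_def count_def hprog_ok_simps
    by (intro conjI hprog_ok_intros; (assumption | simp))+
  have 2: "hprog_ok G Z remember" "hprog_ok G Z compare" "hprog_ok G Z next_auto"
    unfolding remember_def compare_def next_auto_def hprog_ok_simps
    by (intro conjI hprog_ok_intros; (assumption | simp))+
  show "hprog_ok G Z pick" "hprog_ok G Z final"
    unfolding pick_def final_def hprog_ok_simps using 1 by (intro conjI hprog_ok_intros; (assumption | simp))+
  have w: "hprog_ok G Z wander" using 1 by (simp add: wander_def)
  show "hprog_ok G Z ref"
    unfolding ref_def fwd_ref_def bwd_ref_def label_ref_def walk_def hprog_ok_simps
    using 1 2 w by (intro conjI hprog_ok_intros; (assumption | simp))+
  show "hprog_ok G Z (init j)"
  proof -
    have "hprog_ok G Z (seqs (replicate (Suc j) next_auto))" using 2 by (intro hprog_ok_seqs) auto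
    moreover have "hprog_ok G Z (mv G {Left_End} 1)" "hprog_ok G Z (mv G {Letter Init} 0)" by (rule hprog_ok_mvG, simp)+
    ultimately show ?thesis unfolding init_def hprog_ok_simps using 1 w by blast
  qed
qed

lemma retreat_expand:
  "okG st \<Longrightarrow> ((h, st), (h', st')) \<in> sem (hact T) retreat \<longleftrightarrow> st' = st \<and> T ! h \<noteq> Left_End \<and> h' \<le> h - 1 \<and>
     (\<forall>x. h' < x \<and> x \<le> h - 1 \<longrightarrow> T ! x \<in> body) \<and> T ! h' = Letter State"
  unfolding retreat_def sem_Seq_iff split_paired_Ex by (auto simp: sem_mv sem_Star_left simp del: sem.simps)

lemma advance_expand:
  "okG st \<Longrightarrow> ((h, st), (h', st')) \<in> sem (hact T) advance \<longleftrightarrow> st' = st \<and> T ! h = Letter State \<and> Suc h \<le> h' \<and>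
     (\<forall>x. Suc h \<le> x \<and> x < h' \<longrightarrow> T ! x \<in> body) \<and> T ! h' = Letter State"
  unfolding advance_def sem_Seq_iff split_paired_Ex by (auto simp: sem_mv sem_Star_right simp del: sem.simps)

lemma pick_expand:
  "okG st \<Longrightarrow> ((h, st), (h', st')) \<in> sem (hact T) pick \<longleftrightarrow> st' = st \<and> T ! h = Letter State \<and>
     (\<exists>n. h' = Suc n \<and> Suc h \<le> n \<and> (\<forall>x. Suc h \<le> x \<and> x < n \<longrightarrow> T ! x \<in> body) \<and> T ! n = Letter Trans)"
  unfolding pick_def sem_Seq_iff split_paired_Ex by (auto simp: sem_mv sem_Star_right simp del: sem.simps)

lemma label_end_expand:
  "okG st \<Longrightarrow> ((h, st), (h', st')) \<in> sem (hact T) label_end \<longleftrightarrow> st' = st \<and> T ! h = Letter State \<and> Suc h \<le> h' \<and>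
     (\<forall>x. Suc h \<le> x \<and> x < h' \<longrightarrow> T ! x \<in> bits) \<and> T ! h' \<notin> bits"
  unfolding label_end_def sem_Seq_iff split_paired_Ex by (auto simp: sem_mv sem_Star_right simp del: sem.simps)

text \<open>The loop cannot stop early, as \<open>y\<close> is no \<open>stop\<close> symbol, nor
  continue too long, as the cell behind the word is one.\<close>

lemma count_iff:
  assumes "reads T h (replicate d y)" "T ! (h + d) \<in> stop" "okG st" "Letter y \<notin> stop"
  shows "((h, st), (h', st')) \<in> sem (hact T) (count y) \<longleftrightarrow> h' = h + d \<and> st' = st @ replicate d x0"
  using assms(1-3)
proof (induction d arbitrary: h st)
  case 0
  then have "T ! h \<noteq> Letter y" using assms(4) by auto
  then show ?case using 0 unfolding count_def by (subst sem_Star_Seq) (auto simp: sem_push sem_mv simp del: sem.simps)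
next
  case (Suc d)
  have h: "T ! h = Letter y" "reads T (Suc h) (replicate d y)" using Suc.prems by auto
  have "((h, st), (h', st')) \<in> sem (hact T) (count y) \<longleftrightarrow> ((Suc h, st @ [x0]), (h', st')) \<in> sem (hact T) (count y)"
    unfolding count_def using h(1) assms(4) Suc.prems(3)
    by (subst sem_Star_Seq) (auto simp: sem_push sem_mv simp del: sem.simps)
  also have "\<dots> \<longleftrightarrow> h' = h + Suc d \<and> st' = st @ replicate (Suc d) x0"
    using Suc.IH[of "Suc h" "st @ [x0]"] h(2) Suc.prems by auto
  finally show ?case .
qed

text \<open>Neither the loop nor the exit test applies. This excludes the program for the other
  direction and references by label.\<close>

lemma count_wrong:
  assumes "T ! h \<notin> stop" "T ! h \<noteq> Letter y"
  shows "((h, st), z) \<notin> sem (hact T) (count y)"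
  unfolding count_def using assms by (cases z, subst sem_Star_Seq) (auto simp: sem_push sem_mv simp del: sem.simps)

lemma remember_iff:
  assumes "reads T h (map Bit l)" "T ! (h + length l) \<in> stop" "okG st"
  shows "((h, st), (h', st')) \<in> sem (hact T) remember \<longleftrightarrow> h' = h + length l \<and> st' = st @ map mark l"
  using assms
proof (induction l arbitrary: h st)
  case Nil
  then have "T ! h \<noteq> Letter (Bit b)" for b by auto
  then show ?case using Nil unfolding remember_def by (subst sem_Star_Seq) (auto simp: sem_push sem_mv)
next
  case (Cons b l)
  have h: "T ! h = Letter (Bit b)" "reads T (Suc h) (map Bit l)" using Cons.prems by auto
  have "((h, st), (h', st')) \<in> sem (hact T) remember \<longleftrightarrow> ((Suc h, st @ [mark b]), (h', st')) \<in> sem (hact T) remember"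
    unfolding remember_def using h(1) Cons.prems(3)
    by (subst sem_Star_Seq, cases b) (auto simp: sem_push sem_mv mark_def simp del: sem.simps(2,4))
  also have "\<dots> \<longleftrightarrow> h' = h + length (b # l) \<and> st' = st @ map mark (b # l)"
    using Cons.IH[of "Suc h" "st @ [mark b]"] h(2) Cons.prems by auto
  finally show ?case .
qed

text \<open>The induction removes bits at the right end of the tape label, in the order in which
  they are read and popped.\<close>

lemma compare_iff:
  assumes "T ! h = Letter State" "reads T (Suc h) (map Bit l')" "okS st"
  shows "((h + length l', st @ map mark l), (h', st')) \<in> sem (hact T) compare \<longleftrightarrow> l' = l \<and> h' = h \<and> st' = st"
  using assms(2)
proof (induction l' arbitrary: l rule: rev_induct)
  case Nil
  have "((h, st @ map mark l), (h', st')) \<in> sem (hact T) compare \<longleftrightarrow> ((h, st @ map mark l), (h', st')) \<in> sem (hact T) (mv \<Gamma> {Letter State} 0)"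
    unfolding compare_def using assms(1) by (subst sem_Star_Seq) (auto simp: sem_pop simp del: sem.simps(2,4))
  also have "\<dots> \<longleftrightarrow> l = [] \<and> h' = h \<and> st' = st"
    using assms(1,3) by (cases l rule: rev_cases) (auto simp: sem_mv)
  finally show ?case by auto
next
  case (snoc b l')
  let ?h = "h + length (l' @ [b])"
  have c: "T ! ?h = Letter (Bit b)" "reads T (Suc h) (map Bit l')" using snoc.prems by (auto simp: reads_append)
  note IH = snoc.IH[OF c(2)]
  have *: "((?h, st @ map mark l), (h', st')) \<in> sem (hact T) compare \<longleftrightarrow>
    (\<exists>st1. st @ map mark l = st1 @ [mark b] \<and> ((h + length l', st1), (h', st')) \<in> sem (hact T) compare)"
    unfolding compare_def using c(1)
    by (subst sem_Star_Seq, cases b) (auto simp: sem_pop sem_mv mark_def simp del: sem.simps(2,4))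
  show ?case
  proof (cases l rule: rev_cases)
    case Nil
    \<comment> \<open>The stored label is the shorter one; the top is then an original symbol and no
      mark, so the run is blocked.\<close>
    have "st \<noteq> st1 @ [mark b]" for st1 using assms(3) by auto
    then show ?thesis unfolding * using Nil by auto
  next
    case (snoc l0 b0)
    then show ?thesis unfolding * using IH[of l0] by auto
  qed
qed

end

text \<open>The code of one automaton on the tape, starting at cell \<open>off\<close> and delimited
  on both sides by cells outside \<open>body\<close>. The condition on \<open>rest\<close> makes the
  label the maximal sequence of bits, so that its end can be found.\<close>

locale segment = stack_symbols +
  fixes T :: "sym cell list" and off :: nat and bs :: "sym list list" and ls :: "bool list list"
  assumes reads_bs: "reads T off (concat bs)" and segs: "\<And>b. b \<in> set bs \<Longrightarrow> is_segment b"
    and after: "T ! (off + length (concat bs)) \<in> {Letter Auto, Right_End}"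
    and before: "off > 0" "T ! (off - 1) = Letter Auto"
    and labels: "length ls = length bs"
      "\<And>i. i < length bs \<Longrightarrow> \<exists>rest. bs ! i = State # map Bit (ls ! i) @ rest \<and> (rest = [] \<or> hd rest \<notin> range Bit)"
begin

abbreviation n :: nat where "n \<equiv> length bs"

definition pos :: "nat \<Rightarrow> nat" where
  "pos i = off + length (concat (take i bs))"

lemma pos_Suc: "i < n \<Longrightarrow> pos (Suc i) = pos i + length (bs ! i)"
  by (simp add: pos_def take_Suc_conv_app_nth)

lemma pos_n: "pos n = off + length (concat bs)"
  by (simp add: pos_def)

lemma reads_block: "i < n \<Longrightarrow> reads T (pos i) (bs ! i)"
proof -
  assume "i < n"
  then have "concat bs = concat (take i bs) @ bs ! i @ concat (drop (Suc i) bs)"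
    by (subst id_take_nth_drop[of i bs]) auto
  then show ?thesis using reads_bs by (simp add: reads_append pos_def)
qed

lemma block_cell: "i < n \<Longrightarrow> x < length (bs ! i) \<Longrightarrow> T ! (pos i + x) = Letter (bs ! i ! x)"
  using reads_block by (simp add: reads_nth)

lemma block_shape: "i < n \<Longrightarrow> \<exists>ys. bs ! i = State # ys \<and> State \<notin> set ys \<and> Auto \<notin> set ys"
  using segs[of "bs ! i"] by (auto simp: is_segment_def)

lemma state_cell: "i < n \<Longrightarrow> T ! pos i = Letter State"
  using block_cell[of i 0] block_shape[of i] by auto

lemma pos_less: "i < n \<Longrightarrow> pos i < pos (Suc i)"
  using block_shape[of i] by (auto simp: pos_Suc)

lemma inner_cell: "i < n \<Longrightarrow> pos i < x \<Longrightarrow> x < pos (Suc i) \<Longrightarrow> T ! x \<in> body"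
proof -
  assume *: "i < n" "pos i < x" "x < pos (Suc i)"
  obtain ys where ys: "bs ! i = State # ys" "State \<notin> set ys" "Auto \<notin> set ys" using block_shape[OF *(1)] by blast
  define y where "y = x - pos i - 1"
  have y: "y < length ys" "x = pos i + Suc y" using * ys(1) by (auto simp: y_def pos_Suc)
  then have "T ! x = Letter (ys ! y)" using block_cell[OF *(1), of "Suc y"] ys(1) by simp
  moreover have "ys ! y \<noteq> State" "ys ! y \<noteq> Auto" using y(1) ys nth_mem by metis+
  ultimately show ?thesis by simp
qed

lemma end_cell: "i < n \<Longrightarrow> T ! pos (Suc i) \<in> {Letter State, Letter Auto, Right_End}"
  using state_cell[of "Suc i"] after by (cases "Suc i < n") (auto simp: pos_n[symmetric] le_less_Suc_eq Suc_lessI dest: Suc_lessI)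

lemma end_cell_body: "i < n \<Longrightarrow> T ! pos (Suc i) \<notin> body"
  using end_cell[of i] by auto

lemma block_not_Left_End: "i < n \<Longrightarrow> pos i \<le> h \<Longrightarrow> h \<le> pos (Suc i) \<Longrightarrow> T ! h \<noteq> Left_End"
  using state_cell[of i] end_cell[of i] inner_cell[of i h] by (cases "h = pos i"; cases "h = pos (Suc i)") auto

text \<open>Between the beginning of the state and \<open>h\<close> there are only cells of
  \<open>body\<close>, while \<open>State\<close> is not in \<open>body\<close>: the loop can
  neither stop before nor pass it.\<close>

lemma retreat_iff:
  assumes "i < n" "pos i < h" "h \<le> pos (Suc i)" "okG st"
  shows "((h, st), (h', st')) \<in> sem (hact T) retreat \<longleftrightarrow> st' = st \<and> h' = pos i"
proof -
  have "h' = pos i" if "h' \<le> h - 1" "\<forall>x. h' < x \<and> x \<le> h - 1 \<longrightarrow> T ! x \<in> body" "T ! h' = Letter State"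
  proof (rule ccontr)
    assume "h' \<noteq> pos i"
    then consider "h' < pos i" | "pos i < h'" by linarith
    then show False
    proof cases
      case 1
      then have "T ! pos i \<in> body" using that(2) assms(2) by simp
      then show False using state_cell[OF assms(1)] by simp
    next
      case 2
      then have "T ! h' \<in> body" using inner_cell[OF assms(1), of h'] that(1) assms(2,3) by simp
      then show False using that(3) by simp
    qed
  qed
  moreover have "T ! h \<noteq> Left_End" using block_not_Left_End assms by simp
  moreover have "\<forall>x. pos i < x \<and> x \<le> h - 1 \<longrightarrow> T ! x \<in> body" using inner_cell[OF assms(1)] assms(3) by auto
  moreover have "pos i \<le> h - 1" using assms(2) by simp
  ultimately show ?thesis unfolding retreat_expand[OF assms(4)] using state_cell[OF assms(1)] by blast
qed

text \<open>The cell before the first state is \<open>Auto\<close>, which blocks both the loop and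
  the test for \<open>State\<close>.\<close>

lemma retreat_first: "okG st \<Longrightarrow> ((pos 0, st), z) \<notin> sem (hact T) retreat"
proof
  assume st: "okG st" and "((pos 0, st), z) \<in> sem (hact T) retreat"
  then obtain h' where h': "h' \<le> pos 0 - 1" "\<forall>x. h' < x \<and> x \<le> pos 0 - 1 \<longrightarrow> T ! x \<in> body" "T ! h' = Letter State"
    by (cases z) (auto simp: retreat_expand)
  have p: "pos 0 = off" by (simp add: pos_def)
  show False
  proof (cases "h' = off - 1")
    case False
    then have "T ! (off - 1) \<in> body" using h'(1,2) p by simp
    then show False using before(2) by simp
  qed (use h'(3) before(2) in simp)
qed

lemma retreat_state_iff:
  assumes "i < n" "okG st"
  shows "((pos i, st), (h', st')) \<in> sem (hact T) retreat \<longleftrightarrow> st' = st \<and> i > 0 \<and> h' = pos (i - 1)"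
proof (cases i)
  case 0
  then show ?thesis using retreat_first[OF assms(2)] by auto
next
  case (Suc i')
  then show ?thesis using retreat_iff[of i' "pos i" st] pos_less[of i'] assms by auto
qed

text \<open>Behind the last state comes \<open>Auto\<close> or the right marker, and the program is
  blocked there.\<close>

lemma advance_iff:
  assumes "i < n" "okG st"
  shows "((pos i, st), (h', st')) \<in> sem (hact T) advance \<longleftrightarrow> st' = st \<and> Suc i < n \<and> h' = pos (Suc i)"
proof -
  have 1: "h' = pos (Suc i)" if "Suc (pos i) \<le> h'" "\<forall>x. Suc (pos i) \<le> x \<and> x < h' \<longrightarrow> T ! x \<in> body" "T ! h' = Letter State"
  proof (rule ccontr)
    assume "h' \<noteq> pos (Suc i)"
    then consider "h' < pos (Suc i)" | "pos (Suc i) < h'" by linarith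
    then show False
    proof cases
      case 1
      then have "T ! h' \<in> body" using inner_cell[OF assms(1), of h'] that(1) by simp
      then show False using that(3) by simp
    next
      case 2
      then have "T ! pos (Suc i) \<in> body" using that(2) pos_less[OF assms(1)] by simp
      then show False using end_cell_body[OF assms(1)] by simp
    qed
  qed
  have 2: "Suc i < n" if "T ! pos (Suc i) = Letter State"
  proof (rule ccontr)
    assume "\<not> Suc i < n"
    then have "pos (Suc i) = off + length (concat bs)" using assms(1) pos_n by (simp add: le_less_Suc_eq Suc_lessI linorder_not_less) (metis Suc_leI le_antisym)
    then show False using that after by simp
  qed
  have "\<forall>x. Suc (pos i) \<le> x \<and> x < pos (Suc i) \<longrightarrow> T ! x \<in> body" using inner_cell[OF assms(1)] by auto
  then show ?thesis
    unfolding advance_expand[OF assms(2)] using 1 2 state_cell[OF assms(1)] state_cell[of "Suc i"] pos_less[OF assms(1)]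
    by (metis Suc_leI)
qed

lemma wander_iff:
  assumes "i < n" "okG st"
  shows "((pos i, st), (h', st')) \<in> sem (hact T) wander \<longleftrightarrow> st' = st \<and> (\<exists>i'<n. h' = pos i')"
proof
  let ?R = "sem (hact T) (Alt advance retreat)"
  assume "((pos i, st), (h', st')) \<in> sem (hact T) wander"
  then have "((pos i, st), (h', st')) \<in> ?R\<^sup>*" by (simp add: wander_def)
  then show "st' = st \<and> (\<exists>i'<n. h' = pos i')"
  proof (induction "(h', st')" arbitrary: h' st' rule: rtrancl_induct)
    case base
    then show ?case using assms(1) by auto
  next
    case (step s)
    obtain h1 st1 where s: "s = (h1, st1)" by (cases s)
    then obtain i1 where i1: "st1 = st" "i1 < n" "h1 = pos i1" using step.hyps(3) by blast
    have "((pos i1, st), (h', st')) \<in> sem (hact T) advance \<or> ((pos i1, st), (h', st')) \<in> sem (hact T) retreat"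
      using step.hyps(2) s i1 by simp
    then show ?case
      unfolding advance_iff[OF i1(2) assms(2)] retreat_state_iff[OF i1(2) assms(2)] using i1(2) by (auto intro: exI[of _ "i1 - 1"])
  qed
next
  let ?R = "sem (hact T) (Alt advance retreat)"
  have up: "((pos a, st), (pos b, st)) \<in> ?R\<^sup>*" if "a \<le> b" "b < n" for a b
    using that
  proof (induction b rule: dec_induct)
    case (step b)
    have "((pos b, st), (pos (Suc b), st)) \<in> ?R" using advance_iff[of b st] step assms(2) by simp
    then show ?case using step by (auto intro: rtrancl_into_rtrancl)
  qed simp
  have down: "((pos b, st), (pos a, st)) \<in> ?R\<^sup>*" if "a \<le> b" "b < n" for a b
    using that
  proof (induction b rule: dec_induct)
    case (step b)
    have "((pos (Suc b), st), (pos b, st)) \<in> ?R" using retreat_state_iff[of "Suc b" st] step assms(2) by simp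
    then show ?case using step by (auto intro: converse_rtrancl_into_rtrancl)
  qed simp
  assume "st' = st \<and> (\<exists>i'<n. h' = pos i')"
  then obtain i' where "i' < n" "h' = pos i'" "st' = st" by blast
  then show "((pos i, st), (h', st')) \<in> sem (hact T) wander"
    using up[of i i'] down[of i' i] assms(1) by (cases "i \<le> i'") (auto simp: wander_def)
qed

lemma label_end_iff:
  assumes "i < n" "okG st"
  shows "((pos i, st), (h', st')) \<in> sem (hact T) label_end \<longleftrightarrow> st' = st \<and> h' = Suc (pos i) + length (ls ! i)"
proof -
  obtain rest where rest: "bs ! i = State # map Bit (ls ! i) @ rest" "rest = [] \<or> hd rest \<notin> range Bit"
    using labels(2)[OF assms(1)] by blast
  let ?e = "Suc (pos i) + length (ls ! i)"
  have r: "reads T (Suc (pos i)) (map Bit (ls ! i))" "reads T ?e rest"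
    using reads_block[OF assms(1)] rest(1) by (auto simp: reads_append)
  have 1: "\<forall>x. Suc (pos i) \<le> x \<and> x < ?e \<longrightarrow> T ! x \<in> bits"
  proof (intro allI impI)
    fix x assume "Suc (pos i) \<le> x \<and> x < ?e"
    then obtain y where "x = Suc (pos i) + y" "y < length (ls ! i)" by (auto simp: le_iff_add)
    then show "T ! x \<in> bits" using r(1) unfolding reads_nth by simp
  qed
  have 2: "T ! ?e \<notin> bits"
  proof (cases rest)
    case Nil
    then have "?e = pos (Suc i)" using rest(1) pos_Suc[OF assms(1)] by simp
    then show ?thesis using end_cell[OF assms(1)] by auto
  next
    case (Cons y ys)
    then show ?thesis using r(2) rest(2) by auto
  qed
  have "h' = ?e" if "Suc (pos i) \<le> h'" "\<forall>x. Suc (pos i) \<le> x \<and> x < h' \<longrightarrow> T ! x \<in> bits" "T ! h' \<notin> bits" for h'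
    using that 1 2 by (metis le_add1 linorder_neqE_nat)
  then show ?thesis unfolding label_end_expand[OF assms(2)] using 1 2 state_cell[OF assms(1)] by (metis le_add1)
qed

lemma walk_advance_iff:
  assumes "i < n" "okS st"
  shows "((pos i, st @ replicate d x0), (h', st')) \<in> sem (hact T) (walk advance) \<longleftrightarrow> i + d < n \<and> h' = pos (i + d) \<and> st' = st"
  using assms(1)
proof (induction d arbitrary: i)
  case 0
  have "st \<noteq> st1 @ [x0]" for st1 using assms(2) x0 by auto
  then show ?case unfolding walk_def using 0 assms(2) state_cell[of i]
    by (subst sem_Star_Seq) (auto simp: sem_pop sem_mv)
next
  case (Suc d)
  have app: "st @ replicate (Suc d) x0 = (st @ replicate d x0) @ [x0]" by (simp add: replicate_append_same)
  have "((pos i, st @ replicate (Suc d) x0), (h', st')) \<in> sem (hact T) (walk advance) \<longleftrightarrow>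
    (\<exists>z. ((pos i, st @ replicate d x0), z) \<in> sem (hact T) advance \<and> (z, (h', st')) \<in> sem (hact T) (walk advance))"
  proof -
    have "((pos i, (st @ replicate d x0) @ [x0]), z) \<in> sem (hact T) (Seq (pop {Letter State} x0 0) advance) \<longleftrightarrow>
        ((pos i, st @ replicate d x0), z) \<in> sem (hact T) advance" for z
      unfolding sem_Seq_iff split_paired_Ex using state_cell[OF Suc.prems] by (auto simp: sem_pop)
    moreover have "((pos i, (st @ replicate d x0) @ [x0]), z) \<notin> sem (hact T) (mv \<Gamma> {Letter State} 0)" for z
      using x0 by (cases z) (simp add: sem_mv)
    ultimately show ?thesis unfolding walk_def app by (subst sem_Star_Seq) (simp only: simp_thms)
  qed
  also have "\<dots> \<longleftrightarrow> Suc i < n \<and> ((pos (Suc i), st @ replicate d x0), (h', st')) \<in> sem (hact T) (walk advance)"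
    using advance_iff[OF Suc.prems, of "st @ replicate d x0"] okG_replicate[OF okS_okG[OF assms(2)]] by auto
  also have "\<dots> \<longleftrightarrow> i + Suc d < n \<and> h' = pos (i + Suc d) \<and> st' = st"
    using Suc.IH[of "Suc i"] by auto
  finally show ?case .
qed

lemma walk_retreat_iff:
  assumes "i < n" "okS st"
  shows "((pos i, st @ replicate d x0), (h', st')) \<in> sem (hact T) (walk retreat) \<longleftrightarrow> d \<le> i \<and> h' = pos (i - d) \<and> st' = st"
  using assms(1)
proof (induction d arbitrary: i)
  case 0
  have "st \<noteq> st1 @ [x0]" for st1 using assms(2) x0 by auto
  then show ?case unfolding walk_def using 0 assms(2) state_cell[of i]
    by (subst sem_Star_Seq) (auto simp: sem_pop sem_mv)
next
  case (Suc d)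
  have app: "st @ replicate (Suc d) x0 = (st @ replicate d x0) @ [x0]" by (simp add: replicate_append_same)
  have "((pos i, st @ replicate (Suc d) x0), (h', st')) \<in> sem (hact T) (walk retreat) \<longleftrightarrow>
    (\<exists>z. ((pos i, st @ replicate d x0), z) \<in> sem (hact T) retreat \<and> (z, (h', st')) \<in> sem (hact T) (walk retreat))"
  proof -
    have "((pos i, (st @ replicate d x0) @ [x0]), z) \<in> sem (hact T) (Seq (pop {Letter State} x0 0) retreat) \<longleftrightarrow>
        ((pos i, st @ replicate d x0), z) \<in> sem (hact T) retreat" for z
      unfolding sem_Seq_iff split_paired_Ex using state_cell[OF Suc.prems] by (auto simp: sem_pop)
    moreover have "((pos i, (st @ replicate d x0) @ [x0]), z) \<notin> sem (hact T) (mv \<Gamma> {Letter State} 0)" for z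
      using x0 by (cases z) (simp add: sem_mv)
    ultimately show ?thesis unfolding walk_def app by (subst sem_Star_Seq) (simp only: simp_thms)
  qed
  also have "\<dots> \<longleftrightarrow> 0 < i \<and> ((pos (i - 1), st @ replicate d x0), (h', st')) \<in> sem (hact T) (walk retreat)"
    using retreat_state_iff[OF Suc.prems, of "st @ replicate d x0"] okG_replicate[OF okS_okG[OF assms(2)]] by auto
  also have "\<dots> \<longleftrightarrow> Suc d \<le> i \<and> h' = pos (i - Suc d) \<and> st' = st"
    using Suc.IH[of "i - 1"] Suc.prems by auto
  finally show ?case .
qed

lemma fwd_ref_iff:
  assumes "i < n" "pos i < h" "h + d \<le> pos (Suc i)" "reads T h (replicate d Fwd)" "T ! (h + d) \<in> stop" "okS st"
  shows "((h, st), (h', st')) \<in> sem (hact T) fwd_ref \<longleftrightarrow> i + d < n \<and> h' = pos (i + d) \<and> st' = st"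
proof -
  have G: "okG st" "okG (st @ replicate d x0)" using okS_okG[OF assms(6)] okG_replicate by blast+
  show ?thesis
    unfolding fwd_ref_def sem_Seq_iff split_paired_Ex
      count_iff[OF assms(4,5) G(1), simplified]
    using retreat_iff[OF assms(1) _ assms(3) G(2)] walk_advance_iff[OF assms(1,6)] assms(2) by auto
qed

lemma bwd_ref_iff:
  assumes "i < n" "pos i < h" "h + d \<le> pos (Suc i)" "reads T h (replicate d Bwd)" "T ! (h + d) \<in> stop" "okS st"
  shows "((h, st), (h', st')) \<in> sem (hact T) bwd_ref \<longleftrightarrow> d \<le> i \<and> h' = pos (i - d) \<and> st' = st"
proof -
  have G: "okG st" "okG (st @ replicate d x0)" using okS_okG[OF assms(6)] okG_replicate by blast+
  show ?thesis
    unfolding bwd_ref_def sem_Seq_iff split_paired_Ex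
      count_iff[OF assms(4,5) G(1), simplified]
    using retreat_iff[OF assms(1) _ assms(3) G(2)] walk_retreat_iff[OF assms(1,6)] assms(2) by auto
qed

text \<open>All states with this label are possible results; uniqueness enters only later, from
  \<open>code_ref\<close>.\<close>

lemma label_ref_iff:
  assumes "i < n" "pos i < h" "Suc h + length l \<le> pos (Suc i)" "reads T h (Label # map Bit l)"
    "T ! (Suc h + length l) \<in> stop" "okS st"
  shows "((h, st), (h', st')) \<in> sem (hact T) label_ref \<longleftrightarrow> (\<exists>i'<n. ls ! i' = l \<and> h' = pos i') \<and> st' = st"
proof -
  let ?st = "st @ map mark l"
  have G: "okG st" "okG ?st" using okS_okG[OF assms(6)] okG_marks by blast+
  have cmp: "((pos i' + length (ls ! i'), ?st), (h', st')) \<in> sem (hact T) compare \<longleftrightarrow> ls ! i' = l \<and> h' = pos i' \<and> st' = st" if "i' < n" for i'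
  proof -
    obtain rest where "bs ! i' = State # map Bit (ls ! i') @ rest" using labels(2)[OF \<open>i' < n\<close>] by blast
    then have "reads T (Suc (pos i')) (map Bit (ls ! i'))" using reads_block[OF \<open>i' < n\<close>] by (simp add: reads_append)
    then show ?thesis using compare_iff[OF state_cell[OF \<open>i' < n\<close>] _ assms(6)] by blast
  qed
  have le: "T ! (Suc (pos i') + length (ls ! i')) \<noteq> Left_End" if "i' < n" for i'
  proof -
    obtain rest where "bs ! i' = State # map Bit (ls ! i') @ rest" using labels(2)[OF \<open>i' < n\<close>] by blast
    then show ?thesis using block_not_Left_End[OF \<open>i' < n\<close>] pos_Suc[OF \<open>i' < n\<close>] by simp
  qed
  have 1: "((h, st), (h', st')) \<in> sem (hact T) label_ref \<longleftrightarrow> ((pos i, ?st), (h', st')) \<in> sem (hact T)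
     (Seq wander (Seq label_end (Seq (mv G (- {Left_End}) (-1)) compare)))"
    unfolding label_ref_def sem_Seq_iff[of _ _ _ "mv _ _ _"] sem_Seq_iff[of _ _ _ remember] sem_Seq_iff[of _ _ _ retreat] split_paired_Ex
    using assms(4,5) G remember_iff[of T "Suc h" l st] retreat_iff[OF assms(1) _ assms(3) G(2)] assms(2)
    by (auto simp: sem_mv simp del: sem.simps)
  have 2: "((pos i', ?st), (h', st')) \<in> sem (hact T) (Seq label_end (Seq (mv G (- {Left_End}) (-1)) compare)) \<longleftrightarrow>
    ls ! i' = l \<and> h' = pos i' \<and> st' = st" if "i' < n" for i'
    unfolding sem_Seq_iff split_paired_Ex label_end_iff[OF that G(2)]
    using cmp[OF that] le[OF that] G(2) by (auto simp: sem_mv simp del: sem.simps)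
  show ?thesis
    unfolding 1 sem_Seq_iff[of _ _ _ wander] split_paired_Ex wander_iff[OF assms(1) G(2)] using 2 by auto
qed

text \<open>The first symbol of a nonempty reference leaves only one of the three programs
  unblocked. For the empty one, both directions count to 0 and agree on the state itself.\<close>

lemma ref_iff:
  assumes "i < n" "pos i < h" "h + length r \<le> pos (Suc i)" "reads T h r" "T ! (h + length r) \<in> stop" "okS st"
    "code_ref ls i i' r" "i' < n"
  shows "((h, st), (h', st')) \<in> sem (hact T) ref \<longleftrightarrow> st' = st \<and> h' = pos i'"
proof -
  have no_label: "((h, st), z) \<notin> sem (hact T) label_ref" if "T ! h \<noteq> Letter Label" for z
    unfolding label_ref_def sem_Seq_iff[of _ _ _ "mv _ _ _"] split_paired_Ex using that by (auto simp: sem_mv simp del: sem.simps)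
  have no_fwd: "((h, st), z) \<notin> sem (hact T) fwd_ref" if "T ! h \<notin> stop" "T ! h \<noteq> Letter Fwd" for z
    unfolding fwd_ref_def sem_Seq_iff[of _ _ _ "count _"] using count_wrong[OF that] by blast
  have no_bwd: "((h, st), z) \<notin> sem (hact T) bwd_ref" if "T ! h \<notin> stop" "T ! h \<noteq> Letter Bwd" for z
    unfolding bwd_ref_def sem_Seq_iff[of _ _ _ "count _"] using count_wrong[OF that] by blast
  have ref: "((h, st), (h', st')) \<in> sem (hact T) ref \<longleftrightarrow> ((h, st), (h', st')) \<in> sem (hact T) fwd_ref \<or>
    ((h, st), (h', st')) \<in> sem (hact T) bwd_ref \<or> ((h, st), (h', st')) \<in> sem (hact T) label_ref"
    by (simp add: ref_def)
  have empty: ?thesis if "r = []" "i' = i"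
  proof -
    have "T ! h \<noteq> Letter Label" using that assms(5) by auto
    then show ?thesis
      unfolding ref using that no_label fwd_ref_iff[OF assms(1,2), of 0] bwd_ref_iff[OF assms(1,2), of 0] assms(1,3,5,6) by auto
  qed
  from assms(7) show ?thesis
  proof cases
    case (fwd d)
    show ?thesis
    proof (cases d)
      case (Suc d')
      then have "T ! h = Letter Fwd" using fwd assms(4) by simp
      then show ?thesis unfolding ref using no_label no_bwd fwd_ref_iff[OF assms(1,2), of d] assms(3-6,8) fwd by auto
    qed (use empty fwd in simp)
  next
    case (bwd d)
    show ?thesis
    proof (cases d)
      case (Suc d')
      then have "T ! h = Letter Bwd" using bwd assms(4) by simp
      then show ?thesis unfolding ref using no_label no_fwd bwd_ref_iff[OF assms(1,2), of d] assms(3-6,8) bwd by auto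
    qed (use empty bwd in simp)
  next
    case label
    then have "T ! h = Letter Label" using assms(4) by simp
    then have "((h, st), (h', st')) \<in> sem (hact T) ref \<longleftrightarrow> (\<exists>i''<n. ls ! i'' = ls ! i' \<and> h' = pos i'') \<and> st' = st"
      unfolding ref using no_fwd no_bwd
        label_ref_iff[OF assms(1,2), of "ls ! i'"] assms(3-6) label by auto
    then show ?thesis using label labels(1) assms(8) by auto
  qed
qed

end

text \<open>The symbol \<open>Trans\<close> occurs nowhere but at the beginning of a transition, so
  a position of \<open>Trans\<close> is a choice of a transition.\<close>

lemma Trans_in_put:
  assumes "\<forall>(u, j, r)\<in>set ts. (\<exists>u'. u = Trans # u' \<and> Trans \<notin> set u') \<and> Trans \<notin> set r"
    and "x < length (put ts)" "put ts ! x = Trans"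
  shows "\<exists>ts1 t ts2. ts = ts1 @ t # ts2 \<and> x = length (put ts1)"
  using assms
proof (induction ts arbitrary: x)
  case (Cons t ts)
  obtain u j r where t: "t = (u, j, r)" by (cases t)
  obtain u' where u: "u = Trans # u'" "Trans \<notin> set u'" "Trans \<notin> set r" using Cons.prems(1) t by auto
  have ur: "Trans \<notin> set (u' @ r)" using u by simp
  show ?case
  proof (cases x)
    case 0
    then show ?thesis by (intro exI[of _ "[]"] exI[of _ t] exI[of _ ts]) simp
  next
    case (Suc y)
    have y: "(u' @ r @ put ts) ! y = Trans" "y < length (u' @ r @ put ts)" using Cons.prems(2,3) Suc by (auto simp: t u)
    have "\<not> y < length (u' @ r)"
    proof
      assume "y < length (u' @ r)"
      then have "((u' @ r) @ put ts) ! y \<in> set (u' @ r)" by (simp only: nth_append_left nth_mem)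
      then show False using y(1) ur by simp
    qed
    then obtain z where z: "y = length (u' @ r) + z" by (auto simp: le_iff_add not_less)
    then have "((u' @ r) @ put ts) ! y = put ts ! z" by (simp only: nth_append_length_plus)
    then have "put ts ! z = Trans" "z < length (put ts)" using y z by simp_all
    then obtain ts1 t' ts2 where "ts = ts1 @ t' # ts2" "z = length (put ts1)"
      using Cons.IH[of z] Cons.prems(1) by auto
    then show ?thesis using Suc z by (intro exI[of _ "t # ts1"] exI[of _ t'] exI[of _ ts2]) (simp add: t u)
  qed
qed simp

context stack_symbols
begin

lemma sem_next_autos:
  assumes "okG st" "reads T h (concat (map (\<lambda>x. x @ [Auto]) xs))" "\<forall>x\<in>set xs. Auto \<notin> set x"
  shows "((h, st), (h', st')) \<in> sem (hact T) (seqs (replicate (length xs) next_auto)) \<longleftrightarrow>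
    st' = st \<and> h' = h + length (concat (map (\<lambda>x. x @ [Auto]) xs))"
  using assms(2,3)
proof (induction xs arbitrary: h)
  case Nil
  then show ?case by (auto simp: sem_skip)
next
  case (Cons x xs)
  let ?n = "h + length x"
  have r: "reads T h x" "T ! ?n = Letter Auto" "reads T (Suc ?n) (concat (map (\<lambda>x. x @ [Auto]) xs))"
    using Cons.prems(1) by (auto simp: reads_append)
  have x: "T ! y \<in> Letter ` (- {Auto})" if y: "h \<le> y" "y < ?n" for y
  proof -
    obtain z where z: "y = h + z" "z < length x" using y by (auto simp: le_iff_add)
    then have "T ! y = Letter (x ! z)" using r(1) by (simp add: reads_nth)
    moreover have "x ! z \<noteq> Auto" using Cons.prems(2) z(2) nth_mem by fastforce
    ultimately show ?thesis by auto
  qed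
  have "h1 = Suc ?n \<and> st1 = st" if "((h, st), (h1, st1)) \<in> sem (hact T) next_auto" for h1 st1
  proof -
    from that obtain n where n: "h1 = Suc n" "h \<le> n" "\<forall>y. h \<le> y \<and> y < n \<longrightarrow> T ! y \<in> Letter ` (- {Auto})" "T ! n = Letter Auto" "st1 = st"
      unfolding next_auto_def sem_Seq_iff split_paired_Ex by (auto simp: sem_mv sem_Star_right[OF conjunct1[OF assms(1)] conjunct2[OF assms(1)]] simp del: sem.simps)
    have "\<not> n < ?n" using x[of n] n(2,4) by auto
    moreover have "\<not> ?n < n"
    proof
      assume "?n < n"
      then have "T ! ?n \<in> Letter ` (- {Auto})" using n(3) by simp
      then show False using r(2) by auto
    qed
    ultimately show ?thesis using n by simp
  qed
  moreover have "((h, st), (Suc ?n, st)) \<in> sem (hact T) next_auto"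
    unfolding next_auto_def sem_Seq_iff split_paired_Ex
    by (rule exI[of _ ?n], rule exI[of _ st])
      (use assms(1) x r(2) in \<open>auto simp: sem_mv sem_Star_right simp del: sem.simps\<close>)
  ultimately have 1: "((h, st), (h1, st1)) \<in> sem (hact T) next_auto \<longleftrightarrow> h1 = Suc ?n \<and> st1 = st" for h1 st1 by blast
  have "((h, st), (h', st')) \<in> sem (hact T) (seqs (replicate (length (x # xs)) next_auto)) \<longleftrightarrow>
    ((Suc ?n, st), (h', st')) \<in> sem (hact T) (seqs (replicate (length xs) next_auto))"
    unfolding length_Cons replicate_Suc seqs.simps sem_Seq_iff split_paired_Ex 1 by auto
  also have "\<dots> \<longleftrightarrow> st' = st \<and> h' = h + length (concat (map (\<lambda>x. x @ [Auto]) (x # xs)))"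
    using Cons.IH[OF r(3)] Cons.prems(2) by auto
  finally show ?case .
qed

end

locale coded = segment \<Gamma> Z x0 x1 T off bs ls
  for \<Gamma> Z x0 x1 T off bs ls +
  fixes qs :: "nat list" and q0 :: nat and F :: "nat set" and tr :: "nat \<Rightarrow> (sym list \<times> nat \<times> sym list) list"
  assumes len: "length qs = length bs" "distinct qs" "q0 \<in> set qs"
    and block: "\<And>i. i < length bs \<Longrightarrow> bs ! i = State # map Bit (ls ! i) @ (if qs ! i = q0 then [Init] else []) @
      (if qs ! i \<in> F then [Final] else []) @ put (tr i)"
    and tr: "\<And>i u i' r. i < length bs \<Longrightarrow> (u, i', r) \<in> set (tr i) \<Longrightarrow>
      i' < length bs \<and> code_ref ls i i' r \<and> (\<exists>u'. u = Trans # u' \<and> Trans \<notin> set u')"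
begin

definition flags :: "nat \<Rightarrow> sym list" where
  "flags i = (if qs ! i = q0 then [Init] else []) @ (if qs ! i \<in> F then [Final] else [])"

definition hlen :: "nat \<Rightarrow> nat" where
  "hlen i = Suc (length (ls ! i)) + length (flags i)"

text \<open>The cell \<open>h\<close> is the one behind the \<^const>\<open>Trans\<close> of a transition of the \<open>i\<close>-th state.\<close>

definition at :: "nat \<Rightarrow> sym list \<Rightarrow> nat \<Rightarrow> sym list \<Rightarrow> nat \<Rightarrow> bool" where
  "at i u i' r h \<longleftrightarrow> (\<exists>ts1 ts2. tr i = ts1 @ (Trans # u, i', r) # ts2 \<and> h = Suc (pos i + hlen i + length (put ts1)))"

lemma block': "i < n \<Longrightarrow> bs ! i = (State # map Bit (ls ! i) @ flags i) @ put (tr i)"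
  by (simp add: block flags_def)

lemma at_iff: "(\<exists>h. at i u i' r h) \<longleftrightarrow> (Trans # u, i', r) \<in> set (tr i)"
  by (auto simp: at_def in_set_conv_decomp)

text \<open>Either another transition follows, which begins with \<open>Trans\<close>, or the state
  is over.\<close>

lemma stop_put: "i < n \<Longrightarrow> set ts \<subseteq> set (tr i) \<Longrightarrow> reads T h (put ts) \<Longrightarrow> h + length (put ts) = pos (Suc i) \<Longrightarrow> T ! h \<in> stop"
proof (cases ts)
  case Nil
  assume "i < n" "h + length (put ts) = pos (Suc i)"
  then show ?thesis using end_cell[of i] Nil by auto
next
  case (Cons t ts')
  obtain u i' r where t: "t = (u, i', r)" by (cases t)
  assume "i < n" "set ts \<subseteq> set (tr i)" "reads T h (put ts)"
  then show ?thesis using tr[of i u i' r] Cons t by auto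
qed

lemma length_block: "i < n \<Longrightarrow> pos (Suc i) = pos i + hlen i + length (put (tr i))"
  by (simp add: pos_Suc block' hlen_def)

lemma reads_header:
  assumes "i < n"
  shows "reads T (Suc (pos i) + length (ls ! i)) (flags i)" "reads T (pos i + hlen i) (put (tr i))" "T ! (pos i + hlen i) \<in> stop"
proof -
  have "reads T (pos i) ((State # map Bit (ls ! i) @ flags i) @ put (tr i))" using reads_block[OF assms] block'[OF assms] by simp
  then show 1: "reads T (Suc (pos i) + length (ls ! i)) (flags i)" and 2: "reads T (pos i + hlen i) (put (tr i))"
    by (auto simp: reads_append hlen_def add.assoc)
  show "T ! (pos i + hlen i) \<in> stop"
    using stop_put[OF assms _ 2] length_block[OF assms] by simp
qed

lemma at_facts:
  assumes "i < n" "at i u i' r h"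
  shows "i' < n" "code_ref ls i i' r" "reads T h u" "reads T (h + length u) r" "T ! (h + length u + length r) \<in> stop"
    "pos i < h" "h + length u + length r \<le> pos (Suc i)" "T ! (h - 1) = Letter Trans" "h - 1 < pos (Suc i)" "pos i < h - 1"
proof -
  obtain ts1 ts2 where ts: "tr i = ts1 @ (Trans # u, i', r) # ts2" "h = Suc (pos i + hlen i + length (put ts1))"
    using assms(2) by (auto simp: at_def)
  show "i' < n" "code_ref ls i i' r" using tr[OF assms(1), of "Trans # u" i' r] ts(1) by auto
  have rd: "reads T (pos i + hlen i + length (put ts1)) (Trans # u @ r @ put ts2)"
    using reads_header(2)[OF assms(1)] ts(1) by (simp add: reads_append)
  then show "reads T h u" "reads T (h + length u) r" "T ! (h - 1) = Letter Trans" using ts(2) by (auto simp: reads_append)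
  have e: "h + length u + length r + length (put ts2) = pos (Suc i)"
    using length_block[OF assms(1)] ts by simp
  then show "h + length u + length r \<le> pos (Suc i)" "h - 1 < pos (Suc i)" using ts(2) by auto
  show "pos i < h" "pos i < h - 1" using ts(2) by (auto simp: hlen_def)
  have "reads T (h + length u + length r) (put ts2)" using rd ts(2) by (simp add: reads_append add.assoc)
  from stop_put[OF assms(1) _ this e] show "T ! (h + length u + length r) \<in> stop" using ts(1) by auto
qed

text \<open>The loop cannot go beyond the state, label and flags contain no \<open>Trans\<close>,
  and each \<open>Trans\<close> behind them begins a transition.\<close>

lemma pick_iff:
  assumes "i < n" "okG st"
  shows "((pos i, st), (h', st')) \<in> sem (hact T) pick \<longleftrightarrow> st' = st \<and> (\<exists>u i' r. at i u i' r h')"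
proof
  assume "((pos i, st), (h', st')) \<in> sem (hact T) pick"
  then obtain m where m: "st' = st" "h' = Suc m" "pos i < m" "\<forall>x. Suc (pos i) \<le> x \<and> x < m \<longrightarrow> T ! x \<in> body" "T ! m = Letter Trans"
    unfolding pick_expand[OF assms(2)] by auto
  have "\<not> pos (Suc i) < m" using m(4) end_cell_body[OF assms(1)] pos_less[OF assms(1)] by auto
  moreover have "m \<noteq> pos (Suc i)" using end_cell[OF assms(1)] m(5) by auto
  ultimately have "m < pos (Suc i)" by simp
  then obtain x where x: "m = pos i + x" "x < length (bs ! i)" using m(3) pos_Suc[OF assms(1)] by (auto simp: less_iff_Suc_add)
  then have bx: "bs ! i ! x = Trans" using block_cell[OF assms(1)] m(5) by simp
  let ?H = "State # map Bit (ls ! i) @ flags i"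
  have lH: "length ?H = hlen i" by (simp add: hlen_def)
  have "\<not> x < length ?H"
  proof
    assume "x < length ?H"
    then have "bs ! i ! x \<in> set ?H" unfolding block'[OF assms(1)] by (simp only: nth_append_left nth_mem)
    then show False using bx by (auto simp: flags_def split: if_splits)
  qed
  then obtain y where y: "x = length ?H + y" by (auto simp: le_iff_add not_less)
  then have "put (tr i) ! y = Trans" "y < length (put (tr i))"
    using bx x(2) unfolding block'[OF assms(1)] by (simp_all only: nth_append_length_plus length_append nat_add_left_cancel_less)
  moreover have "\<forall>(u, j, r)\<in>set (tr i). (\<exists>u'. u = Trans # u' \<and> Trans \<notin> set u') \<and> Trans \<notin> set r"
  proof clarify
    fix u j r assume t: "(u, j, r) \<in> set (tr i)"
    have "Trans \<notin> set r" using set_code_ref[of ls i j r] tr[OF assms(1) t] by auto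
    then show "(\<exists>u'. u = Trans # u' \<and> Trans \<notin> set u') \<and> Trans \<notin> set r" using tr[OF assms(1) t] by blast
  qed
  ultimately obtain ts1 t ts2 where ts: "tr i = ts1 @ t # ts2" "y = length (put ts1)" using Trans_in_put by blast
  obtain u i' r where t: "t = (u, i', r)" by (cases t)
  then obtain u' where "u = Trans # u'" using tr[OF assms(1), of u i' r] ts(1) by auto
  then have "at i u' i' r h'" unfolding at_def using ts t m(2) x(1) y lH by (intro exI[of _ ts1] exI[of _ ts2]) simp
  then show "st' = st \<and> (\<exists>u i' r. at i u i' r h')" using m(1) by blast
next
  assume "st' = st \<and> (\<exists>u i' r. at i u i' r h')"
  then obtain u i' r where a: "st' = st" "at i u i' r h'" by blast
  note f = at_facts[OF assms(1) a(2)]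
  have "h' = Suc (h' - 1)" using f(6) by simp
  moreover have "\<forall>x. Suc (pos i) \<le> x \<and> x < h' - 1 \<longrightarrow> T ! x \<in> body" using inner_cell[OF assms(1)] f(9) by auto
  ultimately show "((pos i, st), (h', st')) \<in> sem (hact T) pick"
    unfolding pick_expand[OF assms(2)] using a(1) f(8,10) state_cell[OF assms(1)] by (metis Suc_leI)
qed

lemma ref_at:
  assumes "i < n" "at i u i' r h" "okS st"
  shows "((h + length u, st), (h', st')) \<in> sem (hact T) ref \<longleftrightarrow> st' = st \<and> h' = pos i'"
proof -
  note f = at_facts[OF assms(1,2)]
  show ?thesis by (rule ref_iff[OF assms(1) _ f(7,4,5) assms(3) f(2,1)]) (use f(6) in simp)
qed

text \<open>If a flag is missing, its cell shows the next flag or a \<open>stop\<close> symbol,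
  which is no flag.\<close>

lemma flag_cells:
  assumes "i < n"
  defines "e \<equiv> Suc (pos i) + length (ls ! i)"
  shows "qs ! i = q0 \<Longrightarrow> T ! e = Letter Init" "qs ! i \<noteq> q0 \<Longrightarrow> T ! e \<noteq> Letter Init"
    "qs ! i = q0 \<Longrightarrow> T ! Suc e \<noteq> Letter Init"
    "qs ! i = q0 \<Longrightarrow> T ! Suc e = Letter Final \<longleftrightarrow> qs ! i \<in> F" "qs ! i \<noteq> q0 \<Longrightarrow> T ! e = Letter Final \<longleftrightarrow> qs ! i \<in> F"
  using reads_header(1,3)[OF assms(1)] by (auto simp: flags_def e_def hlen_def split: if_splits)

lemma init_tail_iff:
  assumes "i < n" "okG st"
  shows "((pos i, st), (h', st')) \<in> sem (hact T) (Seq label_end (Seq (mv G {Letter Init} 0) retreat)) \<longleftrightarrow>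
    st' = st \<and> qs ! i = q0 \<and> h' = pos i"
proof -
  let ?e = "Suc (pos i) + length (ls ! i)"
  have e: "?e \<le> pos (Suc i)" using pos_Suc[OF assms(1)] block'[OF assms(1)] by simp
  have "((pos i, st), (h', st')) \<in> sem (hact T) (Seq label_end (Seq (mv G {Letter Init} 0) retreat)) \<longleftrightarrow>
    T ! ?e = Letter Init \<and> ((?e, st), (h', st')) \<in> sem (hact T) retreat"
    unfolding sem_Seq_iff split_paired_Ex label_end_iff[OF assms] using assms(2) by (auto simp: sem_mv)
  then show ?thesis using flag_cells(1,2)[OF assms(1)] retreat_iff[OF assms(1) _ e assms(2)] by auto
qed

lemma init_iff:
  assumes "okG st" "T ! 0 = Left_End" "reads T 1 (concat (map (\<lambda>x. x @ [Auto]) xs))" "\<forall>x\<in>set xs. Auto \<notin> set x"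
    "length xs = Suc j" "off = Suc (length (concat (map (\<lambda>x. x @ [Auto]) xs)))"
  shows "((0, st), (h', st')) \<in> sem (hact T) (init j) \<longleftrightarrow> st' = st \<and> (\<exists>i<n. qs ! i = q0 \<and> h' = pos i)"
proof -
  have n: "0 < n" using len by (cases bs) auto
  have p: "off = pos 0" by (simp add: pos_def)
  have "((0, st), (h', st')) \<in> sem (hact T) (init j) \<longleftrightarrow>
    ((1, st), (h', st')) \<in> sem (hact T) (Seq (seqs (replicate (Suc j) next_auto)) (Seq wander
     (Seq label_end (Seq (mv G {Letter Init} 0) retreat))))"
    unfolding init_def sem_Seq_iff[of _ _ _ "mv G {Left_End} 1"] split_paired_Ex using assms(1,2) by (auto simp: sem_mv simp del: sem.simps)
  also have "\<dots> \<longleftrightarrow> ((pos 0, st), (h', st')) \<in> sem (hact T) (Seq wander (Seq label_end (Seq (mv G {Letter Init} 0) retreat)))"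
    unfolding sem_Seq_iff[of _ _ _ "seqs _"] split_paired_Ex sem_next_autos[OF assms(1,3,4), unfolded assms(5)]
    using assms(6) p by auto
  also have "\<dots> \<longleftrightarrow> (\<exists>i<n. ((pos i, st), (h', st')) \<in> sem (hact T) (Seq label_end (Seq (mv G {Letter Init} 0) retreat)))"
    unfolding sem_Seq_iff[of _ _ _ wander] split_paired_Ex wander_iff[OF n assms(1)] by auto
  also have "\<dots> \<longleftrightarrow> st' = st \<and> (\<exists>i<n. qs ! i = q0 \<and> h' = pos i)"
    using init_tail_iff[OF _ assms(1)] by (auto simp del: sem.simps)
  finally show ?thesis .
qed

lemma pos_le: "i < n \<Longrightarrow> pos (Suc i) \<le> pos n"
proof -
  assume "i < n"
  have "pos (Suc i) \<le> pos m" if "Suc i \<le> m" "m \<le> n" for m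
    using that by (induction m rule: dec_induct) (auto dest: pos_less[OF Suc_le_lessD])
  then show ?thesis using \<open>i < n\<close> by simp
qed

text \<open>Behind the label there is at most one \<open>Init\<close>, so the first loop is forced.
  The last loop has to end at the only \<open>Right_End\<close>, the last cell of the tape.\<close>

lemma final_iff:
  assumes "i < n" "okG st" "T = tm_input w" "off + length (concat bs) < length T"
  shows "((pos i, st), (h', st')) \<in> sem (hact T) final \<longleftrightarrow> st' = st \<and> qs ! i \<in> F \<and> h' = length w + 1"
proof -
  let ?e = "Suc (pos i) + length (ls ! i)"
  let ?h1 = "if qs ! i = q0 then Suc ?e else ?e"
  have st: "st \<noteq> []" "last st \<in> G" using assms(2) by auto
  have "((pos i, st), (h', st')) \<in> sem (hact T) final \<longleftrightarrow> st' = st \<and>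
    (\<exists>h1\<ge>?e. (\<forall>x. ?e \<le> x \<and> x < h1 \<longrightarrow> T ! x = Letter Init) \<and> T ! h1 = Letter Final \<and>
      Suc h1 \<le> h' \<and> (\<forall>x. Suc h1 \<le> x \<and> x < h' \<longrightarrow> T ! x \<noteq> Right_End) \<and> T ! h' = Right_End)"
    unfolding final_def sem_Seq_iff split_paired_Ex label_end_iff[OF assms(1,2)]
    using assms(2) by (auto simp: sem_mv sem_Star_right[OF st] simp del: sem.simps)
  also have "\<dots> \<longleftrightarrow> st' = st \<and> qs ! i \<in> F \<and>
      Suc ?h1 \<le> h' \<and> (\<forall>x. Suc ?h1 \<le> x \<and> x < h' \<longrightarrow> T ! x \<noteq> Right_End) \<and> T ! h' = Right_End"
  proof -
    have "h1 = ?h1 \<and> qs ! i \<in> F" if "h1 \<ge> ?e" "\<forall>x. ?e \<le> x \<and> x < h1 \<longrightarrow> T ! x = Letter Init" "T ! h1 = Letter Final" for h1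
    proof (cases "qs ! i = q0")
      case True
      have "\<not> Suc ?e < h1" using that(2) flag_cells(3)[OF assms(1) True] by auto
      moreover have "h1 \<noteq> ?e" using that(3) flag_cells(1)[OF assms(1) True] by auto
      ultimately have "h1 = Suc ?e" using that(1) by simp
      then show ?thesis using True that(3) flag_cells(4)[OF assms(1) True] by simp
    next
      case False
      have "\<not> ?e < h1" using that(2) flag_cells(2)[OF assms(1) False] by auto
      then have "h1 = ?e" using that(1) by simp
      then show ?thesis using False that(3) flag_cells(5)[OF assms(1) False] by simp
    qed
    moreover have "?h1 \<ge> ?e \<and> (\<forall>x. ?e \<le> x \<and> x < ?h1 \<longrightarrow> T ! x = Letter Init) \<and> T ! ?h1 = Letter Final" if "qs ! i \<in> F"
      using flag_cells[OF assms(1)] that by (auto simp: less_Suc_eq)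
    ultimately show ?thesis by blast
  qed
  also have "\<dots> \<longleftrightarrow> st' = st \<and> qs ! i \<in> F \<and> h' = length w + 1"
  proof (cases "qs ! i \<in> F")
    case True
    have R: "T ! x = Right_End \<longleftrightarrow> x = length w + 1" if "x \<le> length w + 1" for x
      using that unfolding assms(3) tm_input_def by (cases x) (auto simp: nth_append)
    have "?h1 < pos i + hlen i" using True by (auto simp: hlen_def flags_def)
    also have "\<dots> \<le> pos n" using length_block[OF assms(1)] pos_le[OF assms(1)] by simp
    also have "\<dots> \<le> length w + 1" using assms(3,4) by (simp add: pos_n length_tm_input)
    finally have h1: "Suc ?h1 \<le> length w + 1" by simp
    have "Suc ?h1 \<le> h' \<and> (\<forall>x. Suc ?h1 \<le> x \<and> x < h' \<longrightarrow> T ! x \<noteq> Right_End) \<and> T ! h' = Right_End \<longleftrightarrow> h' = length w + 1"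
    proof
      assume *: "Suc ?h1 \<le> h' \<and> (\<forall>x. Suc ?h1 \<le> x \<and> x < h' \<longrightarrow> T ! x \<noteq> Right_End) \<and> T ! h' = Right_End"
      then have "\<not> length w + 1 < h'" using h1 R by blast
      then show "h' = length w + 1" using * R[of h'] by simp
    next
      assume "h' = length w + 1"
      then show "Suc ?h1 \<le> h' \<and> (\<forall>x. Suc ?h1 \<le> x \<and> x < h' \<longrightarrow> T ! x \<noteq> Right_End) \<and> T ! h' = Right_End"
        using h1 R by auto
    qed
    then show ?thesis by blast
  qed simp
  finally show ?thesis .
qed

end

section \<open>Stack operations and comparison of letters\<close>

text \<open>Codes that start at the same cell and are followed by something other than a bit
  coincide. So if a program tries all stack symbols, only the coded one is not blocked.\<close>

lemma reads_bits_unique: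
  assumes "reads T h (map Bit l @ [x])" "reads T h (map Bit l' @ [y])" "x \<notin> range Bit" "y \<notin> range Bit"
  shows "l = l' \<and> x = y"
  using assms(1,2)
proof (induction l arbitrary: h l')
  case Nil
  then show ?case using assms(3) by (cases l') auto
next
  case (Cons b l)
  then show ?case using assms(4) by (cases l') auto
qed

lemma code_nat_bits: "\<exists>l. code_nat a = map Bit l"
  using set_code_nat[of a] by (auto simp: ex_map_conv image_iff)

lemma reads_code_unique:
  assumes "reads T h (code_nat a @ [x])" "reads T h (code_nat b @ [y])" "x \<notin> range Bit" "y \<notin> range Bit"
  shows "a = b \<and> x = y"
proof -
  obtain l l' where "code_nat a = map Bit l" "code_nat b = map Bit l'" using code_nat_bits by meson
  then show ?thesis using reads_bits_unique[of T h l x l' y] assms code_nat_inject[of a b] by auto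
qed

lemma code_nats_Cons: "code_nats (b # \<beta>) = code_nat b @ Semi # code_nats \<beta>" and code_nats_Nil: "code_nats [] = []"
  by (simp_all add: code_nats_def)

context stack_symbols
begin

definition symbols :: "nat list" where
  "symbols = (SOME l. set l = \<Gamma>)"

lemma set_symbols: "set symbols = \<Gamma>"
  unfolding symbols_def using finite_list[OF \<Gamma>(1)] by (rule someI_ex)

definition push_coded :: "nat \<Rightarrow> haction set prog" where
  "push_coded b = Seq (word G (code_nat b)) (push G {Letter Semi} b 1)"

definition pushes :: "haction set prog" where
  "pushes = Seq (Star (alts (map push_coded (filter (\<lambda>b. b \<noteq> Z) symbols)))) (mv G {Letter Comma} 1)"

text \<open>The bottom marker must not be popped and pushed again. For it, the program checks that
  it is on top and skips its copy at the beginning of the code of \<open>\<beta>\<close>; what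
  remains to be pushed is free of \<open>Z\<close> in both cases.\<close>

definition pop_coded :: "nat \<Rightarrow> haction set prog" where
  "pop_coded \<alpha> = Seq (word G (code_nat \<alpha>)) (if \<alpha> = Z then Seq (mv {Z} {Letter Comma} 1) (word G (code_nat Z @ [Semi]))
     else pop {Letter Comma} \<alpha> 1)"

definition stackop :: "haction set prog" where
  "stackop = Seq (alts (map pop_coded symbols)) pushes"

definition stk :: "nat list \<Rightarrow> bool" where
  "stk st \<longleftrightarrow> (\<exists>\<gamma>\<in>lists (\<Gamma> - {Z}). st = Z # \<gamma>)"

lemma stk_okS: "stk st \<Longrightarrow> okS st"
proof -
  assume "stk st"
  then obtain \<gamma> where "st = Z # \<gamma>" "\<gamma> \<in> lists (\<Gamma> - {Z})" by (auto simp: stk_def)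
  then show ?thesis using last_in_set[of \<gamma>] \<Gamma>(2) by (auto simp: in_lists_conv_set)
qed

lemma stk_replace:
  assumes "stk (\<gamma> @ [\<alpha>])" "bottom_respecting \<Gamma> Z \<alpha> \<beta>"
  shows "stk (\<gamma> @ \<beta>)"
proof -
  obtain \<delta> where \<delta>: "\<delta> \<in> lists (\<Gamma> - {Z})" "\<gamma> @ [\<alpha>] = Z # \<delta>" using assms(1) by (auto simp: stk_def)
  show ?thesis
  proof (cases \<gamma>)
    case Nil
    then show ?thesis using \<delta> assms(2) by (auto simp: bottom_respecting_def stk_def)
  next
    case (Cons x xs)
    then have "\<delta> = xs @ [\<alpha>]" "x = Z" using \<delta>(2) by auto
    then show ?thesis using Cons \<delta>(1) assms(2)
      unfolding stk_def by (intro bexI[of _ "xs @ \<beta>"]) (auto simp: bottom_respecting_def split: if_splits)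
  qed
qed

lemma sem_push_coded:
  "okG st \<Longrightarrow> ((h, st), (h', st')) \<in> sem (hact T) (push_coded b) \<longleftrightarrow>
    reads T h (code_nat b @ [Semi]) \<and> h' = Suc (h + length (code_nat b)) \<and> st' = st @ [b]"
  unfolding push_coded_def sem_Seq_iff split_paired_Ex by (auto simp: sem_word sem_push reads_append)

lemma pushes_iff:
  assumes "reads T h (code_nats \<beta> @ [Comma])" "set \<beta> \<subseteq> \<Gamma> - {Z}" "okG st"
  shows "((h, st), (h', st')) \<in> sem (hact T) pushes \<longleftrightarrow> h' = Suc (h + length (code_nats \<beta>)) \<and> st' = st @ \<beta>"
  using assms
proof (induction \<beta> arbitrary: h st)
  case Nil
  let ?p = "alts (map push_coded (filter (\<lambda>b. b \<noteq> Z) symbols))"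
  have C: "T ! h = Letter Comma" using Nil.prems by (simp add: code_nats_Nil)
  have "((h, st), z) \<notin> sem (hact T) ?p" for z
  proof
    assume "((h, st), z) \<in> sem (hact T) ?p"
    then obtain b where "((h, st), z) \<in> sem (hact T) (push_coded b)" unfolding sem_alts[of "hact T", OF hact_empty] by auto
    then have r: "reads T h (code_nat b @ [Semi])" using sem_push_coded[OF Nil.prems(3)] by (cases z) auto
    obtain l where "code_nat b = map Bit l" using code_nat_bits by blast
    then have "reads T h (map Bit l @ [Semi])" "reads T h (map Bit [] @ [Comma])" using r C by auto
    from reads_bits_unique[OF this] show False by auto
  qed
  then show ?case unfolding pushes_def using C Nil.prems(3) by (subst sem_Star_Seq) (auto simp: sem_mv code_nats_Nil simp del: sem.simps)
next
  case (Cons b \<beta>)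
  let ?p = "alts (map push_coded (filter (\<lambda>b. b \<noteq> Z) symbols))"
  have r: "reads T h (code_nat b @ [Semi])" "reads T (Suc (h + length (code_nat b))) (code_nats \<beta> @ [Comma])"
    using Cons.prems(1) by (auto simp: code_nats_Cons reads_append)
  have C: "T ! h \<noteq> Letter Comma"
  proof -
    obtain l where "code_nat b = map Bit l" using code_nat_bits by blast
    then show ?thesis using r(1) by (cases l) auto
  qed
  have p: "((h, st), z) \<in> sem (hact T) ?p \<longleftrightarrow> z = (Suc (h + length (code_nat b)), st @ [b])" for z
  proof
    assume "((h, st), z) \<in> sem (hact T) ?p"
    then obtain b' where "((h, st), z) \<in> sem (hact T) (push_coded b')" unfolding sem_alts[of "hact T", OF hact_empty] by auto
    then have z: "reads T h (code_nat b' @ [Semi])" "z = (Suc (h + length (code_nat b')), st @ [b'])"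
      using sem_push_coded[OF Cons.prems(3)] by (cases z; auto)+
    then have "b' = b" using reads_code_unique[OF z(1) r(1)] by auto
    then show "z = (Suc (h + length (code_nat b)), st @ [b])" using z(2) by simp
  next
    assume z: "z = (Suc (h + length (code_nat b)), st @ [b])"
    then have "((h, st), z) \<in> sem (hact T) (push_coded b)" using sem_push_coded[OF Cons.prems(3)] r(1) by simp
    moreover have "b \<in> set (filter (\<lambda>b. b \<noteq> Z) symbols)" using Cons.prems(2) set_symbols by auto
    ultimately show "((h, st), z) \<in> sem (hact T) ?p" unfolding sem_alts[of "hact T", OF hact_empty] by auto
  qed
  have "((h, st), (h', st')) \<in> sem (hact T) pushes \<longleftrightarrow>
    ((Suc (h + length (code_nat b)), st @ [b]), (h', st')) \<in> sem (hact T) pushes"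
    unfolding pushes_def by (subst sem_Star_Seq) (use p C in \<open>auto simp: sem_mv simp del: sem.simps\<close>)
  also have "\<dots> \<longleftrightarrow> h' = Suc (h + length (code_nats (b # \<beta>))) \<and> st' = st @ b # \<beta>"
    using Cons.IH[OF r(2), of "st @ [b]"] Cons.prems(2) by (auto simp: code_nats_Cons G_def)
  finally show ?case .
qed

lemma pop_coded_iff:
  assumes "stk st"
  shows "((h, st), (h', st')) \<in> sem (hact T) (pop_coded \<alpha>) \<longleftrightarrow> reads T h (code_nat \<alpha> @ [Comma]) \<and>
    (if \<alpha> = Z then last st = Z \<and> st' = st \<and> reads T (Suc (h + length (code_nat \<alpha>))) (code_nat Z @ [Semi]) \<and>
        h' = Suc (h + length (code_nat \<alpha>)) + Suc (length (code_nat Z))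
     else st = st' @ [\<alpha>] \<and> h' = Suc (h + length (code_nat \<alpha>)))"
proof -
  have G: "okG st" using okS_okG[OF stk_okS[OF assms]] by simp
  show ?thesis
  proof (cases "\<alpha> = Z")
    case True
    show ?thesis
      unfolding pop_coded_def sem_Seq_iff split_paired_Ex using True G
      by (auto simp: sem_word sem_mv reads_append sem_Seq_iff simp del: sem.simps)
  next
    case False
    then show ?thesis
      unfolding pop_coded_def sem_Seq_iff split_paired_Ex using G by (auto simp: sem_word sem_pop reads_append)
  qed
qed

text \<open>By uniqueness of codes the alternative for \<open>\<alpha>\<close> is the only one that
  is not blocked, and \<open>pushes\<close> then appends the rest of \<open>\<beta>\<close>.\<close>

lemma stackop_iff:
  assumes r: "reads T h (code_nat \<alpha> @ [Comma] @ code_nats \<beta> @ [Comma])" and \<alpha>: "\<alpha> \<in> \<Gamma>"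
    and \<beta>: "bottom_respecting \<Gamma> Z \<alpha> \<beta>" and st: "stk st"
  shows "((h, st), (h', st')) \<in> sem (hact T) stackop \<longleftrightarrow>
    h' = h + length (code_nat \<alpha> @ [Comma] @ code_nats \<beta> @ [Comma]) \<and> (\<exists>\<gamma>. st = \<gamma> @ [\<alpha>] \<and> st' = \<gamma> @ \<beta>)"
proof -
  have r1: "reads T h (code_nat \<alpha> @ [Comma])" "reads T (Suc (h + length (code_nat \<alpha>))) (code_nats \<beta> @ [Comma])"
    using r by (auto simp: reads_append)
  have G: "okG st" using okS_okG[OF stk_okS[OF st]] by simp
  have "((h, st), z) \<in> sem (hact T) (alts (map pop_coded symbols)) \<longleftrightarrow> ((h, st), z) \<in> sem (hact T) (pop_coded \<alpha>)" for z
  proof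
    assume "((h, st), z) \<in> sem (hact T) (alts (map pop_coded symbols))"
    then obtain a where a: "((h, st), z) \<in> sem (hact T) (pop_coded a)" unfolding sem_alts[of "hact T", OF hact_empty] by auto
    then have "reads T h (code_nat a @ [Comma])" using pop_coded_iff[OF st] by (cases z) auto
    from reads_code_unique[OF this r1(1)] have "a = \<alpha>" by auto
    with a show "((h, st), z) \<in> sem (hact T) (pop_coded \<alpha>)" by simp
  next
    assume "((h, st), z) \<in> sem (hact T) (pop_coded \<alpha>)"
    then show "((h, st), z) \<in> sem (hact T) (alts (map pop_coded symbols))"
      unfolding sem_alts[of "hact T", OF hact_empty] using \<alpha> set_symbols by auto
  qed
  then have *: "((h, st), (h', st')) \<in> sem (hact T) stackop \<longleftrightarrow>
    (\<exists>h1 st1. ((h, st), (h1, st1)) \<in> sem (hact T) (pop_coded \<alpha>) \<and> ((h1, st1), (h', st')) \<in> sem (hact T) pushes)"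
    unfolding stackop_def sem_Seq_iff split_paired_Ex by simp
  obtain \<delta> where \<delta>: "st = Z # \<delta>" "\<delta> \<in> lists (\<Gamma> - {Z})" using st by (auto simp: stk_def)
  show ?thesis
  proof (cases "\<alpha> = Z")
    case True
    then obtain \<beta>' where b: "\<beta> = Z # \<beta>'" "set \<beta>' \<subseteq> \<Gamma> - {Z}" using \<beta> by (auto simp: bottom_respecting_def)
    let ?h1 = "Suc (h + length (code_nat \<alpha>)) + Suc (length (code_nat Z))"
    have r2: "reads T (Suc (h + length (code_nat \<alpha>))) (code_nat Z @ [Semi])" "reads T ?h1 (code_nats \<beta>' @ [Comma])"
      using r1(2) by (auto simp: b(1) code_nats_Cons reads_append)
    \<comment> \<open>In a stack of the right form the marker occurs only at the bottom, so it is on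
      top only if nothing else is there.\<close>
    have L: "last st = Z \<longleftrightarrow> st = [Z]"
    proof -
      have "last \<delta> \<noteq> Z" if "\<delta> \<noteq> []" using last_in_set[OF that] \<delta>(2) by (auto simp: in_lists_conv_set)
      then show ?thesis using \<delta>(1) by auto
    qed
    have "((h, st), (h', st')) \<in> sem (hact T) stackop \<longleftrightarrow> last st = Z \<and> ((?h1, st), (h', st')) \<in> sem (hact T) pushes"
      unfolding * pop_coded_iff[OF st] using True r1(1) r2(1) by auto
    also have "\<dots> \<longleftrightarrow> st = [Z] \<and> h' = Suc (?h1 + length (code_nats \<beta>')) \<and> st' = st @ \<beta>'"
      using pushes_iff[OF r2(2) b(2) G] L by simp
    also have "\<dots> \<longleftrightarrow> h' = h + length (code_nat \<alpha> @ [Comma] @ code_nats \<beta> @ [Comma]) \<and> (\<exists>\<gamma>. st = \<gamma> @ [\<alpha>] \<and> st' = \<gamma> @ \<beta>)"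
      using True b(1) \<delta> by (auto simp: code_nats_Cons Cons_eq_append_conv in_lists_conv_set)
    finally show ?thesis .
  next
    case False
    then have b: "set \<beta> \<subseteq> \<Gamma> - {Z}" using \<beta> by (auto simp: bottom_respecting_def)
    have G': "okG st1" if "st = st1 @ [\<alpha>]" for st1
    proof -
      have "stk (st1 @ [])" using stk_replace[of st1 \<alpha> "[]"] st that False by (auto simp: bottom_respecting_def)
      then show ?thesis using okS_okG[OF stk_okS] by simp
    qed
    let ?h1 = "Suc (h + length (code_nat \<alpha>))"
    have "((h, st), (h', st')) \<in> sem (hact T) stackop \<longleftrightarrow> (\<exists>st1. st = st1 @ [\<alpha>] \<and> ((?h1, st1), (h', st')) \<in> sem (hact T) pushes)"
      unfolding * pop_coded_iff[OF st] using False r1(1) by auto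
    also have "\<dots> \<longleftrightarrow> (\<exists>st1. st = st1 @ [\<alpha>] \<and> h' = Suc (?h1 + length (code_nats \<beta>)) \<and> st' = st1 @ \<beta>)"
      using pushes_iff[OF r1(2) b] G' by blast
    also have "\<dots> \<longleftrightarrow> h' = h + length (code_nat \<alpha> @ [Comma] @ code_nats \<beta> @ [Comma]) \<and> (\<exists>\<gamma>. st = \<gamma> @ [\<alpha>] \<and> st' = \<gamma> @ \<beta>)"
      by auto
    finally show ?thesis .
  qed
qed

lemma hprog_ok_word: "hprog_ok G Z (word G xs)"
  unfolding word_def by (rule hprog_ok_seqs) (auto intro: hprog_ok_mvG)

lemma hprog_ok_stackop: "hprog_ok G Z stackop"
proof -
  have "hprog_ok G Z (push_coded b)" if "b \<in> \<Gamma>" "b \<noteq> Z" for b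
    unfolding push_coded_def hprog_ok_simps using hprog_ok_word hprog_ok_pushG[of b "{Letter Semi}" 1] that \<Gamma>_subset by auto
  then have "hprog_ok G Z pushes"
    unfolding pushes_def hprog_ok_simps using set_symbols by (auto intro!: hprog_ok_alts hprog_ok_mvG)
  moreover have "hprog_ok G Z (pop_coded \<alpha>)" if "\<alpha> \<in> \<Gamma>" for \<alpha>
  proof -
    have "hprog_ok G Z (mv {Z} {Letter Comma} 1)" using \<Gamma>(2) \<Gamma>_subset by (intro hprog_ok_mv) auto
    moreover have "hprog_ok G Z (pop {Letter Comma} \<alpha> 1)" if "\<alpha> \<noteq> Z" using that \<open>\<alpha> \<in> \<Gamma>\<close> \<Gamma>_subset by (intro hprog_ok_pop) auto
    ultimately show ?thesis unfolding pop_coded_def hprog_ok_simps using hprog_ok_word by auto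
  qed
  then have "hprog_ok G Z (alts (map pop_coded symbols))" using set_symbols by (intro hprog_ok_alts) auto
  ultimately show ?thesis by (simp add: stackop_def)
qed

section \<open>Comparing the letters read by all heads\<close>

definition all_read :: "nat \<Rightarrow> sym \<Rightarrow> action set prog" where
  "all_read k y = Atom ((\<lambda>\<alpha>. (replicate k (Letter y), \<alpha>, [\<alpha>], replicate k 1)) ` \<Gamma>)"

text \<open>The alphabet belongs to the instance, so a letter does not fit into the finite control;
  the codes are compared in lockstep instead, without using the stack.\<close>

definition same_letter :: "nat \<Rightarrow> action set prog" where
  "same_letter k = Seq (Star (Alt (all_read k (Bit True)) (all_read k (Bit False)))) (all_read k Comma)"

lemma sem_all_read:
  assumes "length hs = k" "okS st"
  shows "((hs, st), (hs', st')) \<in> sem (act T) (all_read k y) \<longleftrightarrow>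
    st' = st \<and> (\<forall>j<k. T ! (hs ! j) = Letter y) \<and> hs' = map Suc hs"
proof -
  have 1: "map ((!) T) hs = replicate k (Letter y) \<longleftrightarrow> (\<forall>j<k. T ! (hs ! j) = Letter y)"
    using assms(1) by (auto simp: list_eq_iff_nth_eq)
  have 2: "map2 move_head hs (replicate k 1) = map Suc hs"
    using assms(1) by (intro nth_equalityI) auto
  have "((hs, st), (hs', st')) \<in> sem (act T) (all_read k y) \<longleftrightarrow> (\<exists>\<gamma> \<alpha>. \<alpha> \<in> \<Gamma> \<and> st = \<gamma> @ [\<alpha>] \<and> st' = \<gamma> @ [\<alpha>] \<and>
    map ((!) T) hs = replicate k (Letter y) \<and> hs' = map2 move_head hs (replicate k 1))"
  proof
    assume "((hs, st), (hs', st')) \<in> sem (act T) (all_read k y)"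
    then show "\<exists>\<gamma> \<alpha>. \<alpha> \<in> \<Gamma> \<and> st = \<gamma> @ [\<alpha>] \<and> st' = \<gamma> @ [\<alpha>] \<and>
      map ((!) T) hs = replicate k (Letter y) \<and> hs' = map2 move_head hs (replicate k 1)"
      unfolding all_read_def sem.simps act_def by auto
  next
    assume "\<exists>\<gamma> \<alpha>. \<alpha> \<in> \<Gamma> \<and> st = \<gamma> @ [\<alpha>] \<and> st' = \<gamma> @ [\<alpha>] \<and>
      map ((!) T) hs = replicate k (Letter y) \<and> hs' = map2 move_head hs (replicate k 1)"
    then obtain \<gamma> \<alpha> where "\<alpha> \<in> \<Gamma>" "st = \<gamma> @ [\<alpha>]" "st' = \<gamma> @ [\<alpha>]"
      "map ((!) T) hs = replicate k (Letter y)" "hs' = map2 move_head hs (replicate k 1)" by blast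
    then show "((hs, st), (hs', st')) \<in> sem (act T) (all_read k y)"
      unfolding all_read_def sem.simps act_def by (simp add: image_iff)
  qed
  also have "\<dots> \<longleftrightarrow> st' = st \<and> (\<forall>j<k. T ! (hs ! j) = Letter y) \<and> hs' = map Suc hs"
    unfolding 1 2 using assms(2) by (cases st rule: rev_cases) auto
  finally show ?thesis .
qed

text \<open>Induction on the code under head 0. The common length in the result is justified because
  all codes are equal unless the run is blocked.\<close>

lemma same_letter_iff:
  assumes "k > 0" "okS st" "length hs = k" "\<And>j. j < k \<Longrightarrow> reads T (hs ! j) (map Bit (l j) @ [Comma])"
  shows "((hs, st), (hs', st')) \<in> sem (act T) (same_letter k) \<longleftrightarrow>
    st' = st \<and> (\<forall>j<k. l j = l 0) \<and> hs' = map (\<lambda>h. h + length (l 0) + 1) hs"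
  using assms(3,4)
proof (induction "l 0" arbitrary: l hs)
  case Nil
  have 0: "T ! (hs ! 0) = Letter Comma" using Nil.prems(2)[OF assms(1)] Nil.hyps[symmetric] by simp
  have "((hs, st), z) \<notin> sem (act T) (all_read k (Bit b))" for z b
    using sem_all_read[OF Nil.prems(1) assms(2)] 0 assms(1) by (cases z) auto
  then have "((hs, st), (hs', st')) \<in> sem (act T) (same_letter k) \<longleftrightarrow> ((hs, st), (hs', st')) \<in> sem (act T) (all_read k Comma)"
    unfolding same_letter_def by (subst sem_Star_Seq) (auto simp: all_read_def)
  also have "\<dots> \<longleftrightarrow> st' = st \<and> (\<forall>j<k. l j = l 0) \<and> hs' = map (\<lambda>h. h + length (l 0) + 1) hs"
  proof -
    have "T ! (hs ! j) = Letter Comma \<longleftrightarrow> l j = []" if "j < k" for j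
      using Nil.prems(2)[OF that] by (cases "l j") auto
    then show ?thesis unfolding sem_all_read[OF Nil.prems(1) assms(2)] Nil.hyps[symmetric] by auto
  qed
  finally show ?case .
next
  case (Cons b l0)
  have 0: "T ! (hs ! 0) = Letter (Bit b)" using Cons.prems(2)[OF assms(1)] Cons.hyps(2)[symmetric] by simp
  have c: "((hs, st), z) \<notin> sem (act T) (all_read k Comma)" for z
    using sem_all_read[OF Cons.prems(1) assms(2)] 0 assms(1) by (cases z) auto
  have alt: "((hs, st), z) \<in> sem (act T) (Alt (all_read k (Bit True)) (all_read k (Bit False))) \<longleftrightarrow>
    ((hs, st), z) \<in> sem (act T) (all_read k (Bit b))" for z
    using sem_all_read[OF Cons.prems(1) assms(2)] 0 assms(1) by (cases z; cases b) auto
  have step: "((hs, st), z) \<in> sem (act T) (Alt (all_read k (Bit True)) (all_read k (Bit False))) \<longleftrightarrow>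
    (\<forall>j<k. T ! (hs ! j) = Letter (Bit b)) \<and> z = (map Suc hs, st)" for z
    unfolding alt by (cases z) (simp only: sem_all_read[OF Cons.prems(1) assms(2)] Pair_inject, blast)
  have *: "((hs, st), (hs', st')) \<in> sem (act T) (same_letter k) \<longleftrightarrow>
    (\<forall>j<k. T ! (hs ! j) = Letter (Bit b)) \<and> ((map Suc hs, st), (hs', st')) \<in> sem (act T) (same_letter k)"
    unfolding same_letter_def by (subst sem_Star_Seq) (use step c in \<open>auto simp del: sem.simps\<close>)
  have b: "T ! (hs ! j) = Letter (Bit b) \<longleftrightarrow> (\<exists>l'. l j = b # l')" if "j < k" for j
    using Cons.prems(2)[OF that] by (cases "l j") auto
  show ?case
  proof (cases "\<forall>j<k. \<exists>l'. l j = b # l'")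
    case True
    let ?l = "\<lambda>j. tl (l j)"
    have l: "l j = b # ?l j" if j: "j < k" for j
    proof -
      obtain l' where "l j = b # l'" using True j by blast
      then show ?thesis by simp
    qed
    have l0: "l0 = ?l 0" by (simp add: Cons.hyps(2)[symmetric])
    have rd: "reads T (map Suc hs ! j) (map Bit (?l j) @ [Comma])" if "j < k" for j
    proof -
      have "map Bit (l j) = Bit b # map Bit (?l j)" by (subst l[OF that]) simp
      then show ?thesis using Cons.prems(2)[OF that] Cons.prems(1) that by simp
    qed
    have 1: "((map Suc hs, st), (hs', st')) \<in> sem (act T) (same_letter k) \<longleftrightarrow>
      st' = st \<and> (\<forall>j<k. ?l j = ?l 0) \<and> hs' = map (\<lambda>h. h + length (?l 0) + 1) (map Suc hs)"
      by (rule Cons.hyps(1)[OF l0 _ rd]) (use Cons.prems(1) in simp)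
    have 2: "(\<forall>j<k. ?l j = ?l 0) \<longleftrightarrow> (\<forall>j<k. l j = l 0)"
    proof -
      have "?l j = ?l 0 \<longleftrightarrow> l j = l 0" if "j < k" for j
        by (subst (2) l[OF that], subst (2) l[OF assms(1)]) simp
      then show ?thesis by blast
    qed
    have 3: "map (\<lambda>h. h + length (?l 0) + 1) (map Suc hs) = map (\<lambda>h. h + length (l 0) + 1) hs"
      by (simp add: Cons.hyps(2)[symmetric])
    have "\<forall>j<k. T ! (hs ! j) = Letter (Bit b)" using True b by blast
    then show ?thesis unfolding * 1 2 3 by blast
  next
    case False
    then obtain j where j: "j < k" "\<nexists>l'. l j = b # l'" by blast
    then have "l j \<noteq> l 0" using Cons.hyps(2)[symmetric] by auto
    then show ?thesis unfolding * using b j by blast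
  qed
qed

lemma same_letter_wrong:
  assumes "k > 0" "okS st" "length hs = k" "T ! (hs ! 0) = Letter Eps"
  shows "((hs, st), z) \<notin> sem (act T) (same_letter k)"
proof -
  have "((hs, st), z) \<notin> sem (act T) (all_read k y)" if "y \<noteq> Eps" for z y
    using sem_all_read[OF assms(3,2)] assms(1,4) that by (cases z) auto
  then show ?thesis unfolding same_letter_def by (subst sem_Star_Seq) (auto simp: all_read_def)
qed

lemma prog_ok_same_letter: "prog_ok k G Z (same_letter k)"
proof -
  have "prog_ok k G Z (all_read k y)" for y
    using \<Gamma> \<Gamma>_subset by (auto simp: prog_ok_def all_read_def action_ok_def bottom_respecting_def G_def)
  then show ?thesis by (simp add: same_letter_def)
qed

end

section \<open>Simulation of a PDA and several NFAs by a multi-head PDA\<close>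

text \<open>This is the code of an action without the \<open>Trans\<close> in front, which
  \<open>pick\<close> has already passed.\<close>

definition action_code :: "nat option \<Rightarrow> nat \<Rightarrow> nat list \<Rightarrow> sym list" where
  "action_code a \<alpha> \<beta> = (case a of None \<Rightarrow> [Eps] | Some b \<Rightarrow> code_nat b) @ [Comma] @
     code_nat \<alpha> @ [Comma] @ code_nats \<beta> @ [Comma]"

context stack_symbols
begin

definition eps_step :: "nat \<Rightarrow> action set prog" where
  "eps_step k = on k 0 (Seq pick (Seq (word G [Eps, Comma]) (Seq stackop ref)))"

text \<open>The stack operation comes before the references: head 0 meets it first, and afterwards
  the stack can be borrowed by each head in turn to resolve its reference.\<close>

definition read_step :: "nat \<Rightarrow> action set prog" where
  "read_step k = Seq (each_head k (\<lambda>_. pick)) (Seq (same_letter k) (Seq (on k 0 stackop) (each_head k (\<lambda>_. ref))))"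

definition simulator :: "nat \<Rightarrow> action set prog" where
  "simulator k = Seq (each_head k init) (Seq (Star (Alt (eps_step k) (read_step k))) (each_head k (\<lambda>_. final)))"

lemma prog_ok_simulator: "k > 0 \<Longrightarrow> prog_ok k G Z (simulator k)"
  unfolding simulator_def eps_step_def read_step_def prog_ok_simps
  using hprog_ok_programs hprog_ok_stackop hprog_ok_word prog_ok_same_letter
  by (intro conjI prog_ok_each_head prog_ok_on) simp_all

end

text \<open>Head 0 works on the PDA, head \<open>j > 0\<close> on \<open>As ! (j - 1)\<close>. The
  pieces \<open>xs\<close> are the code of the alphabet and those of the automata; the additional
  \<open>Auto\<close> behind \<open>w\<close> lets every piece end with one. The \<open>Suc\<close>
  in \<open>off\<close> accounts for the left marker.\<close>

locale joint = stack_symbols \<Gamma> Z x0 x1 for \<Gamma> Z x0 x1 +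
  fixes k :: nat and w :: "sym list" and P :: "(nat, nat, nat) pda" and As :: "(nat, nat) nfa list"
    and xs :: "sym list list" and off :: "nat \<Rightarrow> nat" and bs :: "nat \<Rightarrow> sym list list" and ls :: "nat \<Rightarrow> bool list list"
    and qs :: "nat \<Rightarrow> nat list" and q0 :: "nat \<Rightarrow> nat" and F :: "nat \<Rightarrow> nat set"
    and tr :: "nat \<Rightarrow> nat \<Rightarrow> (sym list \<times> nat \<times> sym list) list"
  assumes k: "k > 0" "length As = k - 1"
    and P: "is_pda P" "pda_stack P = \<Gamma>" "pda_bottom P = Z"
    and A: "\<And>j. j < k \<Longrightarrow> 0 < j \<Longrightarrow> is_nfa (As ! (j - 1))"
    and q0: "\<And>j. q0 j = (if j = 0 then pda_init P else nfa_init (As ! (j - 1)))"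
    and F: "\<And>j. F j = (if j = 0 then pda_final P else nfa_final (As ! (j - 1)))"
    and Q: "\<And>j. j < k \<Longrightarrow> set (qs j) = (if j = 0 then pda_states P else nfa_states (As ! (j - 1)))"
    and coded: "\<And>j. j < k \<Longrightarrow> coded \<Gamma> Z x0 x1 (tm_input w) (off j) (bs j) (ls j) (qs j) (q0 j) (F j) (tr j)"
    and xs: "w @ [Auto] = concat (map (\<lambda>x. x @ [Auto]) xs)" "length xs = Suc k" "\<And>x. x \<in> set xs \<Longrightarrow> Auto \<notin> set x"
    and off: "\<And>j. j < k \<Longrightarrow> off j = Suc (length (concat (map (\<lambda>x. x @ [Auto]) (take (Suc j) xs))))"
      "\<And>j. j < k \<Longrightarrow> off j + length (concat (bs j)) < length (tm_input w)"
    and pda_trI: "\<And>i a \<alpha> q \<beta>. i < length (qs 0) \<Longrightarrow> (qs 0 ! i, a, \<alpha>, q, \<beta>) \<in> pda_trans P \<Longrightarrow>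
      \<exists>i' r. (Trans # action_code a \<alpha> \<beta>, i', r) \<in> set (tr 0 i) \<and> qs 0 ! i' = q"
    and pda_trD: "\<And>i u i' r. i < length (qs 0) \<Longrightarrow> (Trans # u, i', r) \<in> set (tr 0 i) \<Longrightarrow>
      \<exists>a \<alpha> \<beta>. u = action_code a \<alpha> \<beta> \<and> (qs 0 ! i, a, \<alpha>, qs 0 ! i', \<beta>) \<in> pda_trans P"
    and nfa_trI: "\<And>j i a q. j < k \<Longrightarrow> 0 < j \<Longrightarrow> i < length (qs j) \<Longrightarrow> (qs j ! i, a, q) \<in> nfa_trans (As ! (j - 1)) \<Longrightarrow>
      \<exists>i' r. (Trans # code_nat a @ [Comma], i', r) \<in> set (tr j i) \<and> qs j ! i' = q"
    and nfa_trD: "\<And>j i u i' r. j < k \<Longrightarrow> 0 < j \<Longrightarrow> i < length (qs j) \<Longrightarrow> (Trans # u, i', r) \<in> set (tr j i) \<Longrightarrow>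
      \<exists>a. u = code_nat a @ [Comma] \<and> (qs j ! i, a, qs j ! i') \<in> nfa_trans (As ! (j - 1))"
begin

abbreviation T :: "sym cell list" where "T \<equiv> tm_input w"

abbreviation pos :: "nat \<Rightarrow> nat \<Rightarrow> nat" where "pos j \<equiv> segment.pos (off j) (bs j)"

abbreviation at :: "nat \<Rightarrow> nat \<Rightarrow> sym list \<Rightarrow> nat \<Rightarrow> sym list \<Rightarrow> nat \<Rightarrow> bool" where
  "at j \<equiv> coded.at (off j) (bs j) (ls j) (qs j) (q0 j) (F j) (tr j)"

definition valid :: "(nat \<Rightarrow> nat) \<Rightarrow> bool" where
  "valid i \<longleftrightarrow> (\<forall>j<k. i j < length (qs j))"

definition heads :: "(nat \<Rightarrow> nat) \<Rightarrow> nat list" where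
  "heads i = map (\<lambda>j. pos j (i j)) [0..<k]"

lemma length_heads [simp]: "length (heads i) = k" and nth_heads [simp]: "j < k \<Longrightarrow> heads i ! j = pos j (i j)"
  by (simp_all add: heads_def)

lemma heads_eqI: "length hs = k \<Longrightarrow> (\<And>j. j < k \<Longrightarrow> hs ! j = pos j (i j)) \<Longrightarrow> hs = heads i"
  by (intro nth_equalityI) auto

lemma lengths: "j < k \<Longrightarrow> length (bs j) = length (qs j)"
  using coded.len(1)[OF coded] by simp

lemma qs_inj: "j < k \<Longrightarrow> i < length (qs j) \<Longrightarrow> i' < length (qs j) \<Longrightarrow> qs j ! i = qs j ! i' \<Longrightarrow> i = i'"
  using coded.len(2)[OF coded] by (simp add: nth_eq_iff_index_eq)

lemma at_ex: "j < k \<Longrightarrow> (Trans # u, i', r) \<in> set (tr j i) \<Longrightarrow> \<exists>h. at j i u i' r h"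
  using coded.at_iff[OF coded] by blast

lemma at_tr: "j < k \<Longrightarrow> at j i u i' r h \<Longrightarrow> (Trans # u, i', r) \<in> set (tr j i)"
  using coded.at_iff[OF coded] by blast

lemma at_target: "j < k \<Longrightarrow> i < length (qs j) \<Longrightarrow> at j i u i' r h \<Longrightarrow> i' < length (qs j)"
  using coded.at_facts(1)[OF coded] lengths by metis

lemma at_reads: "j < k \<Longrightarrow> i < length (qs j) \<Longrightarrow> at j i u i' r h \<Longrightarrow> reads T h u"
  using coded.at_facts(3)[OF coded] lengths by metis

lemma pick_head: "j < k \<Longrightarrow> i < length (qs j) \<Longrightarrow> okG st \<Longrightarrow>
    ((pos j i, st), (h', st')) \<in> sem (hact T) pick \<longleftrightarrow> st' = st \<and> (\<exists>u i' r. at j i u i' r h')"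
  using coded.pick_iff[OF coded] lengths by metis

lemma ref_head: "j < k \<Longrightarrow> i < length (qs j) \<Longrightarrow> at j i u i' r h \<Longrightarrow> okS st \<Longrightarrow>
    ((h + length u, st), (h', st')) \<in> sem (hact T) ref \<longleftrightarrow> st' = st \<and> h' = pos j i'"
  using coded.ref_at[OF coded] lengths by metis

lemma stack_head:
  assumes "(p, a, \<alpha>, q, \<beta>) \<in> pda_trans P" "reads T h (code_nat \<alpha> @ [Comma] @ code_nats \<beta> @ [Comma])" "stk st"
  shows "((h, st), (h', st')) \<in> sem (hact T) stackop \<longleftrightarrow>
    h' = h + length (code_nat \<alpha> @ [Comma] @ code_nats \<beta> @ [Comma]) \<and> (\<exists>\<gamma>. st = \<gamma> @ [\<alpha>] \<and> st' = \<gamma> @ \<beta>)"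
  using stackop_iff[OF assms(2) _ _ assms(3)] pda_transD[OF P(1) assms(1)] P(2,3) by blast

lemma stk_trans: "(p, a, \<alpha>, q, \<beta>) \<in> pda_trans P \<Longrightarrow> stk (\<gamma> @ [\<alpha>]) \<Longrightarrow> stk (\<gamma> @ \<beta>)"
  using stk_replace pda_transD[OF P(1)] P(2,3) by blast

definition eps_move :: "(nat \<Rightarrow> nat) \<Rightarrow> nat list \<Rightarrow> (nat \<Rightarrow> nat) \<Rightarrow> nat list \<Rightarrow> bool" where
  "eps_move i st i' st' \<longleftrightarrow> (\<exists>\<alpha> \<beta> \<gamma>. (qs 0 ! i 0, None, \<alpha>, qs 0 ! i' 0, \<beta>) \<in> pda_trans P \<and> st = \<gamma> @ [\<alpha>] \<and> st' = \<gamma> @ \<beta>) \<and>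
     (\<forall>j<k. 0 < j \<longrightarrow> i' j = i j)"

definition read_move :: "nat \<Rightarrow> (nat \<Rightarrow> nat) \<Rightarrow> nat list \<Rightarrow> (nat \<Rightarrow> nat) \<Rightarrow> nat list \<Rightarrow> bool" where
  "read_move a i st i' st' \<longleftrightarrow> (\<exists>\<alpha> \<beta> \<gamma>. (qs 0 ! i 0, Some a, \<alpha>, qs 0 ! i' 0, \<beta>) \<in> pda_trans P \<and> st = \<gamma> @ [\<alpha>] \<and> st' = \<gamma> @ \<beta>) \<and>
     (\<forall>j<k. 0 < j \<longrightarrow> (qs j ! i j, a, qs j ! i' j) \<in> nfa_trans (As ! (j - 1)))"

lemma eps_head:
  assumes i: "i < length (qs 0)" and st: "stk st"
  shows "((pos 0 i, st), (h', st')) \<in> sem (hact T) (Seq pick (Seq (word G [Eps, Comma]) (Seq stackop ref))) \<longleftrightarrow>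
    (\<exists>i' \<alpha> \<beta> \<gamma>. i' < length (qs 0) \<and> h' = pos 0 i' \<and> (qs 0 ! i, None, \<alpha>, qs 0 ! i', \<beta>) \<in> pda_trans P \<and> st = \<gamma> @ [\<alpha>] \<and> st' = \<gamma> @ \<beta>)"
proof
  have G: "okG st" using okS_okG[OF stk_okS[OF st]] by simp
  have sn: "st \<noteq> []" "last st \<in> G" using G by auto
  {
    assume "((pos 0 i, st), (h', st')) \<in> sem (hact T) (Seq pick (Seq (word G [Eps, Comma]) (Seq stackop ref)))"
    then obtain h1 st1 h2 st2 h3 st3 where
      s: "((pos 0 i, st), (h1, st1)) \<in> sem (hact T) pick" "((h1, st1), (h2, st2)) \<in> sem (hact T) (word G [Eps, Comma])"
        "((h2, st2), (h3, st3)) \<in> sem (hact T) stackop" "((h3, st3), (h', st')) \<in> sem (hact T) ref"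
      unfolding sem_Seq_iff split_paired_Ex by blast
    obtain u i' r where a: "st1 = st" "at 0 i u i' r h1" using s(1) pick_head[OF k(1) i G] by blast
    have 2: "st2 = st" "h2 = h1 + 2" "T ! h1 = Letter Eps" using s(2) unfolding a(1) sem_word[OF sn] by auto
    obtain c \<alpha> \<beta> where u: "u = action_code c \<alpha> \<beta>" "(qs 0 ! i, c, \<alpha>, qs 0 ! i', \<beta>) \<in> pda_trans P"
      using pda_trD[OF i at_tr[OF k(1) a(2)]] by blast
    have rd: "reads T h1 u" using at_reads[OF k(1) i a(2)] .
    \<comment> \<open>The cell contains \<open>Eps\<close>, whereas the code of a letter, followed
      by \<open>Comma\<close>, begins with a bit or, if it is empty, with that
      \<open>Comma\<close>.\<close>
    have c: "c = None"
    proof (cases c)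
      case (Some b)
      obtain l where "code_nat b = map Bit l" using code_nat_bits by blast
      then show ?thesis using rd 2(3) u(1) Some by (cases l) (auto simp: action_code_def)
    qed
    have rd2: "reads T h2 (code_nat \<alpha> @ [Comma] @ code_nats \<beta> @ [Comma])"
      using rd unfolding u(1) c 2(2) by (simp add: action_code_def)
    obtain \<gamma> where g: "st = \<gamma> @ [\<alpha>]" "st3 = \<gamma> @ \<beta>" and h3: "h3 = h1 + length u"
      using s(3) unfolding 2(1) stack_head[OF u(2) rd2 st] by (auto simp: 2(2) u(1) c action_code_def)
    have "okS st3" using stk_okS[OF stk_trans[OF u(2)]] st g by simp
    then have "st' = st3" "h' = pos 0 i'" using s(4) ref_head[OF k(1) i a(2)] h3 by auto
    then show "\<exists>i' \<alpha> \<beta> \<gamma>. i' < length (qs 0) \<and> h' = pos 0 i' \<and> (qs 0 ! i, None, \<alpha>, qs 0 ! i', \<beta>) \<in> pda_trans P \<and> st = \<gamma> @ [\<alpha>] \<and> st' = \<gamma> @ \<beta>"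
      using at_target[OF k(1) i a(2)] u(2) c g by blast
  }
  assume "\<exists>i' \<alpha> \<beta> \<gamma>. i' < length (qs 0) \<and> h' = pos 0 i' \<and> (qs 0 ! i, None, \<alpha>, qs 0 ! i', \<beta>) \<in> pda_trans P \<and> st = \<gamma> @ [\<alpha>] \<and> st' = \<gamma> @ \<beta>"
  then obtain i' \<alpha> \<beta> \<gamma> where *: "i' < length (qs 0)" "h' = pos 0 i'" "(qs 0 ! i, None, \<alpha>, qs 0 ! i', \<beta>) \<in> pda_trans P"
    "st = \<gamma> @ [\<alpha>]" "st' = \<gamma> @ \<beta>" by blast
  obtain i'' r where t: "(Trans # action_code None \<alpha> \<beta>, i'', r) \<in> set (tr 0 i)" "qs 0 ! i'' = qs 0 ! i'"
    using pda_trI[OF i *(3)] by blast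
  obtain h1 where h1: "at 0 i (action_code None \<alpha> \<beta>) i'' r h1" using at_ex[OF k(1) t(1)] by blast
  \<comment> \<open>States are listed without repetition, so the target found on the tape has the
    number \<open>i'\<close>.\<close>
  have i'': "i'' = i'" using qs_inj[OF k(1) at_target[OF k(1) i h1] *(1) t(2)] .
  have rd: "reads T h1 (action_code None \<alpha> \<beta>)" using at_reads[OF k(1) i h1] .
  have 1: "((pos 0 i, st), (h1, st)) \<in> sem (hact T) pick" using pick_head[OF k(1) i G] h1 by blast
  have 2: "((h1, st), (h1 + 2, st)) \<in> sem (hact T) (word G [Eps, Comma])"
    unfolding sem_word[OF sn] using rd by (simp add: action_code_def)
  have rd2: "reads T (h1 + 2) (code_nat \<alpha> @ [Comma] @ code_nats \<beta> @ [Comma])"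
    using rd by (simp add: action_code_def)
  have 3: "((h1 + 2, st), (h1 + length (action_code None \<alpha> \<beta>), st')) \<in> sem (hact T) stackop"
    unfolding stack_head[OF *(3) rd2 st] using *(4,5) by (auto simp: action_code_def)
  have "okS st'" using stk_okS[OF stk_trans[OF *(3)]] st * by simp
  then have 4: "((h1 + length (action_code None \<alpha> \<beta>), st'), (h', st')) \<in> sem (hact T) ref"
    using ref_head[OF k(1) i h1] *(2) i'' by blast
  show "((pos 0 i, st), (h', st')) \<in> sem (hact T) (Seq pick (Seq (word G [Eps, Comma]) (Seq stackop ref)))"
    unfolding sem_Seq_iff using 1 2 3 4 by blast
qed

lemma eps_step_iff:
  assumes i: "valid i" and st: "stk st"
  shows "((heads i, st), (hs', st')) \<in> sem (act T) (eps_step k) \<longleftrightarrow> (\<exists>i'. valid i' \<and> hs' = heads i' \<and> eps_move i st i' st')"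
proof -
  have i0: "i 0 < length (qs 0)" using i k by (simp add: valid_def)
  have "((heads i, st), (hs', st')) \<in> sem (act T) (eps_step k) \<longleftrightarrow>
    (\<exists>h' i' \<alpha> \<beta> \<gamma>. (i' < length (qs 0) \<and> h' = pos 0 i' \<and> (qs 0 ! i 0, None, \<alpha>, qs 0 ! i', \<beta>) \<in> pda_trans P \<and> st = \<gamma> @ [\<alpha>] \<and> st' = \<gamma> @ \<beta>)
      \<and> hs' = (heads i)[0 := h'])"
    unfolding eps_step_def sem_on[OF length_heads k(1)] nth_heads[OF k(1)] eps_head[OF i0 st] by blast
  also have "\<dots> \<longleftrightarrow> (\<exists>i'. valid i' \<and> hs' = heads i' \<and> eps_move i st i' st')"
  proof
    assume "\<exists>h' i' \<alpha> \<beta> \<gamma>. (i' < length (qs 0) \<and> h' = pos 0 i' \<and> (qs 0 ! i 0, None, \<alpha>, qs 0 ! i', \<beta>) \<in> pda_trans P \<and> st = \<gamma> @ [\<alpha>] \<and> st' = \<gamma> @ \<beta>)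
      \<and> hs' = (heads i)[0 := h']"
    then obtain i' \<alpha> \<beta> \<gamma> where *: "i' < length (qs 0)" "(qs 0 ! i 0, None, \<alpha>, qs 0 ! i', \<beta>) \<in> pda_trans P" "st = \<gamma> @ [\<alpha>]" "st' = \<gamma> @ \<beta>"
      "hs' = (heads i)[0 := pos 0 i']" by blast
    have "hs' = heads (i(0 := i'))" unfolding *(5) by (rule heads_eqI) (auto simp: nth_list_update)
    moreover have "valid (i(0 := i'))" using i *(1) by (simp add: valid_def)
    moreover have "eps_move i st (i(0 := i')) st'" unfolding eps_move_def using * by auto
    ultimately show "\<exists>i'. valid i' \<and> hs' = heads i' \<and> eps_move i st i' st'" by blast
  next
    assume "\<exists>i'. valid i' \<and> hs' = heads i' \<and> eps_move i st i' st'"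
    then obtain i' \<alpha> \<beta> \<gamma> where *: "valid i'" "hs' = heads i'" "\<forall>j<k. 0 < j \<longrightarrow> i' j = i j"
      "(qs 0 ! i 0, None, \<alpha>, qs 0 ! i' 0, \<beta>) \<in> pda_trans P" "st = \<gamma> @ [\<alpha>]" "st' = \<gamma> @ \<beta>"
      unfolding eps_move_def by blast
    have "i' 0 < length (qs 0)" using *(1) k by (simp add: valid_def)
    moreover have "hs' = (heads i)[0 := pos 0 (i' 0)]"
      unfolding *(2) by (rule heads_eqI[symmetric]) (use *(3) in \<open>auto simp: nth_list_update\<close>)
    ultimately show "\<exists>h' i' \<alpha> \<beta> \<gamma>. (i' < length (qs 0) \<and> h' = pos 0 i' \<and> (qs 0 ! i 0, None, \<alpha>, qs 0 ! i', \<beta>) \<in> pda_trans P \<and> st = \<gamma> @ [\<alpha>] \<and> st' = \<gamma> @ \<beta>)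
      \<and> hs' = (heads i)[0 := h']" using *(4-6) by blast
  qed
  finally show ?thesis .
qed

text \<open>Once the transitions are picked, everything else is determined: the run is blocked
  unless the letters agree and the stack fits, and the heads end at the targets of their
  references.\<close>

lemma read_tail_iff:
  assumes i: "valid i" and st: "stk st" and hs1: "length hs1 = k"
    and at: "\<And>j. j < k \<Longrightarrow> at j (i j) (u j) (i' j) (r j) (hs1 ! j)"
    and u0: "u 0 = action_code c \<alpha> \<beta>" "(qs 0 ! i 0, c, \<alpha>, qs 0 ! i' 0, \<beta>) \<in> pda_trans P"
    and u: "\<And>j. j < k \<Longrightarrow> 0 < j \<Longrightarrow> u j = code_nat (a j) @ [Comma]"
  shows "((hs1, st), (hs', st')) \<in> sem (act T) (Seq (same_letter k) (Seq (on k 0 stackop) (each_head k (\<lambda>_. ref)))) \<longleftrightarrow>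
    (\<exists>b. c = Some b \<and> (\<forall>j<k. 0 < j \<longrightarrow> a j = b)) \<and> (\<exists>\<gamma>. st = \<gamma> @ [\<alpha>] \<and> st' = \<gamma> @ \<beta>) \<and> hs' = heads i'"
proof -
  have ij: "i j < length (qs j)" if "j < k" for j using i that by (simp add: valid_def)
  have rd: "reads T (hs1 ! j) (u j)" if "j < k" for j using at_reads[OF that ij[OF that] at[OF that]] .
  show ?thesis
  proof (cases c)
    case None
    then have "T ! (hs1 ! 0) = Letter Eps" using rd[OF k(1)] u0(1) by (simp add: action_code_def)
    then show ?thesis unfolding sem_Seq_iff[of _ _ _ "same_letter k"] using same_letter_wrong[OF k(1) stk_okS[OF st] hs1] None by auto
  next
    case (Some b)
    \<comment> \<open>For head 0 the letter comes from the PDA transition, whose code continues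
      behind it; with \<open>aa\<close> and the common prefix all heads are treated alike.\<close>
    define aa where "aa j = (if j = 0 then b else a j)" for j
    have "\<forall>j. \<exists>l. code_nat (aa j) = map Bit l" using code_nat_bits by blast
    then obtain l where l: "\<And>j. code_nat (aa j) = map Bit (l j)" by metis
    have prefix: "\<exists>v. u j = (map Bit (l j) @ [Comma]) @ v" if "j < k" for j
      using u0(1) u[OF that] Some unfolding l[symmetric] by (cases "j = 0") (auto simp: aa_def action_code_def)
    have rl: "reads T (hs1 ! j) (map Bit (l j) @ [Comma])" if j: "j < k" for j
    proof -
      obtain v where "u j = (map Bit (l j) @ [Comma]) @ v" using prefix[OF j] by blast
      then show ?thesis using rd[OF j] by (simp only: reads_append)
    qed
    have ll: "(\<forall>j<k. l j = l 0) \<longleftrightarrow> (\<forall>j<k. 0 < j \<longrightarrow> a j = b)"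
    proof -
      have "l j = l 0 \<longleftrightarrow> aa j = aa 0" for j
      proof -
        have "inj Bit" by (auto intro: injI)
        from inj_map_eq_map[OF this, of "l j" "l 0"] show ?thesis
          unfolding l[symmetric] code_nat_inject by (rule HOL.sym)
      qed
      then show ?thesis by (auto simp: aa_def)
    qed
    let ?v = "code_nat \<alpha> @ [Comma] @ code_nats \<beta> @ [Comma]"
    let ?hs2 = "map (\<lambda>h. h + length (l 0) + 1) hs1"
    have hs20: "?hs2 ! 0 = hs1 ! 0 + length (l 0) + 1" using hs1 k by simp
    have lb: "code_nat b = map Bit (l 0)" using l[of 0] by (simp add: aa_def)
    have u00: "u 0 = (map Bit (l 0) @ [Comma]) @ ?v" using u0(1) Some lb by (simp add: action_code_def)
    have rv: "reads T (?hs2 ! 0) ?v"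
      using rd[OF k(1)] unfolding hs20 u00 by (simp add: reads_append add.assoc)
    let ?hs3 = "?hs2[0 := ?hs2 ! 0 + length ?v]"
    have "((hs1, st), (hs', st')) \<in> sem (act T) (Seq (same_letter k) (Seq (on k 0 stackop) (each_head k (\<lambda>_. ref)))) \<longleftrightarrow>
      (\<forall>j<k. l j = l 0) \<and> ((?hs2, st), (hs', st')) \<in> sem (act T) (Seq (on k 0 stackop) (each_head k (\<lambda>_. ref)))"
      unfolding sem_Seq_iff[of _ _ _ "same_letter k"] split_paired_Ex same_letter_iff[OF k(1) stk_okS[OF st] hs1 rl, simplified] by auto
    also have "\<dots> \<longleftrightarrow> (\<forall>j<k. l j = l 0) \<and> (\<exists>\<gamma>. st = \<gamma> @ [\<alpha>] \<and> ((?hs3, \<gamma> @ \<beta>), (hs', st')) \<in> sem (act T) (each_head k (\<lambda>_. ref)))"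
    proof -
      have len2: "length ?hs2 = k" using hs1 by simp
      show ?thesis
        unfolding sem_Seq_iff[of _ _ _ "on k 0 stackop"] split_paired_Ex sem_on[OF len2 k(1)] stack_head[OF u0(2) rv st] by blast
    qed
    also have "\<dots> \<longleftrightarrow> (\<forall>j<k. l j = l 0) \<and> (\<exists>\<gamma>. st = \<gamma> @ [\<alpha>] \<and> st' = \<gamma> @ \<beta> \<and> hs' = heads i')"
    proof (intro conj_cong iff_exI HOL.refl)
      fix \<gamma> assume l0: "\<forall>j<k. l j = l 0" and g: "st = \<gamma> @ [\<alpha>]"
      have S: "okS (\<gamma> @ \<beta>)" using stk_okS[OF stk_trans[OF u0(2)]] st g by simp
      have len3: "length ?hs3 = k" using hs1 by simp
      have h3: "?hs3 ! j = hs1 ! j + length (u j)" if j: "j < k" for j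
      proof (cases "j = 0")
        case True
        then show ?thesis using hs1 k u00 by simp
      next
        case False
        have "length (code_nat (a j)) = length (l j)" using arg_cong[OF l[of j], of length] False by (simp add: aa_def)
        moreover have "l j = l 0" using l0 j by blast
        ultimately have "length (u j) = length (l 0) + 1" using u[OF j] False by simp
        then show ?thesis using False hs1 j by simp
      qed
      have this': "((?hs3 ! j, \<gamma> @ \<beta>), (h', st'')) \<in> sem (hact T) ref \<longleftrightarrow> st'' = \<gamma> @ \<beta> \<and> h' = pos j (i' j)" if j: "j < k" for j h' st''
        unfolding h3[OF j] by (rule ref_head[OF j ij[OF j] at[OF j] S])
      show "((?hs3, \<gamma> @ \<beta>), (hs', st')) \<in> sem (act T) (each_head k (\<lambda>_. ref)) \<longleftrightarrow> st' = \<gamma> @ \<beta> \<and> hs' = heads i'"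
      proof -
        have "length hs' = k \<and> (\<forall>j<k. hs' ! j = pos j (i' j)) \<longleftrightarrow> hs' = heads i'"
          using heads_eqI[of hs' i'] by auto
        then show ?thesis using sem_each_head[OF len3 this'] by blast
      qed
    qed
    also have "\<dots> \<longleftrightarrow> (\<exists>b. c = Some b \<and> (\<forall>j<k. 0 < j \<longrightarrow> a j = b)) \<and> (\<exists>\<gamma>. st = \<gamma> @ [\<alpha>] \<and> st' = \<gamma> @ \<beta>) \<and> hs' = heads i'"
      unfolding ll Some by auto
    finally show ?thesis .
  qed
qed

text \<open>For soundness, the transitions picked by the heads are collected by choice functions on
  the heads. For completeness, each transition of a joint move occurs somewhere in the code of its
  state, and the heads pick it there.\<close>

lemma read_step_iff:
  assumes i: "valid i" and st: "stk st"
  shows "((heads i, st), (hs', st')) \<in> sem (act T) (read_step k) \<longleftrightarrow> (\<exists>a i'. valid i' \<and> hs' = heads i' \<and> read_move a i st i' st')"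
proof -
  have ij: "i j < length (qs j)" if "j < k" for j using i that by (simp add: valid_def)
  have G: "okG st" using okS_okG[OF stk_okS[OF st]] by simp
  let ?tail = "Seq (same_letter k) (Seq (on k 0 stackop) (each_head k (\<lambda>_. ref)))"
  have "((heads i ! j, st), (h', st'')) \<in> sem (hact T) pick \<longleftrightarrow> st'' = st \<and> (\<exists>u i' r. at j (i j) u i' r h')" if "j < k" for j h' st''
    using pick_head[OF that ij[OF that] G] that by simp
  from sem_each_head[OF length_heads this]
  have split: "((heads i, st), (hs', st')) \<in> sem (act T) (read_step k) \<longleftrightarrow>
    (\<exists>hs1. length hs1 = k \<and> (\<forall>j<k. \<exists>u i' r. at j (i j) u i' r (hs1 ! j)) \<and> ((hs1, st), (hs', st')) \<in> sem (act T) ?tail)"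
    unfolding read_step_def sem_Seq_iff[of _ _ _ "each_head k (\<lambda>_. pick)"] split_paired_Ex by auto
  show ?thesis
  proof
    assume "((heads i, st), (hs', st')) \<in> sem (act T) (read_step k)"
    then obtain hs1 where hs1: "length hs1 = k" "\<forall>j<k. \<exists>u i' r. at j (i j) u i' r (hs1 ! j)" "((hs1, st), (hs', st')) \<in> sem (act T) ?tail"
      unfolding split by blast
    have "\<forall>j. \<exists>z. j < k \<longrightarrow> (case z of (u, i', r) \<Rightarrow> at j (i j) u i' r (hs1 ! j))" using hs1(2) by auto
    then obtain z where z: "\<And>j. j < k \<Longrightarrow> case z j of (u, i', r) \<Rightarrow> at j (i j) u i' r (hs1 ! j)" by metis
    define u where "u j = fst (z j)" for j
    define i' where "i' j = fst (snd (z j))" for j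
    define r where "r j = snd (snd (z j))" for j
    have at: "at j (i j) (u j) (i' j) (r j) (hs1 ! j)" if "j < k" for j
      using z[OF that] by (simp add: u_def i'_def r_def split_beta)
    obtain c \<alpha> \<beta> where u0: "u 0 = action_code c \<alpha> \<beta>" "(qs 0 ! i 0, c, \<alpha>, qs 0 ! i' 0, \<beta>) \<in> pda_trans P"
      using pda_trD[OF ij[OF k(1)] at_tr[OF k(1) at[OF k(1)]]] by blast
    have "\<forall>j. \<exists>a. j < k \<longrightarrow> 0 < j \<longrightarrow> u j = code_nat a @ [Comma] \<and> (qs j ! i j, a, qs j ! i' j) \<in> nfa_trans (As ! (j - 1))"
      using nfa_trD ij at_tr at by metis
    then obtain a where a: "\<And>j. j < k \<Longrightarrow> 0 < j \<Longrightarrow> u j = code_nat (a j) @ [Comma] \<and> (qs j ! i j, a j, qs j ! i' j) \<in> nfa_trans (As ! (j - 1))"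
      by metis
    have "(\<exists>b. c = Some b \<and> (\<forall>j<k. 0 < j \<longrightarrow> a j = b)) \<and> (\<exists>\<gamma>. st = \<gamma> @ [\<alpha>] \<and> st' = \<gamma> @ \<beta>) \<and> hs' = heads i'"
      using read_tail_iff[of i st hs1 u i' r c \<alpha> \<beta> a hs' st', OF i st hs1(1) at u0] a hs1(3) by blast
    then obtain b \<gamma> where b: "c = Some b" "\<forall>j<k. 0 < j \<longrightarrow> a j = b" "st = \<gamma> @ [\<alpha>]" "st' = \<gamma> @ \<beta>" "hs' = heads i'" by blast
    have "valid i'" using at_target[OF _ ij at] by (simp add: valid_def)
    moreover have "read_move b i st i' st'" unfolding read_move_def using u0(2) a b by blast
    ultimately show "\<exists>a i'. valid i' \<and> hs' = heads i' \<and> read_move a i st i' st'" using b(5) by blast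
  next
    assume "\<exists>a i'. valid i' \<and> hs' = heads i' \<and> read_move a i st i' st'"
    then obtain b i' \<alpha> \<beta> \<gamma> where *: "valid i'" "hs' = heads i'" "(qs 0 ! i 0, Some b, \<alpha>, qs 0 ! i' 0, \<beta>) \<in> pda_trans P"
      "st = \<gamma> @ [\<alpha>]" "st' = \<gamma> @ \<beta>" "\<forall>j<k. 0 < j \<longrightarrow> (qs j ! i j, b, qs j ! i' j) \<in> nfa_trans (As ! (j - 1))"
      unfolding read_move_def by blast
    define u where "u j = (if j = 0 then action_code (Some b) \<alpha> \<beta> else code_nat b @ [Comma])" for j :: nat
    have "\<exists>r h. at j (i j) (u j) (i' j) r h" if j: "j < k" for j
    proof -
      have "\<exists>i'' r. (Trans # u j, i'', r) \<in> set (tr j (i j)) \<and> qs j ! i'' = qs j ! i' j"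
      proof (cases "j = 0")
        case True
        then show ?thesis using pda_trI[OF ij[OF k(1)] *(3)] by (simp add: u_def)
      next
        case False
        then show ?thesis using nfa_trI[OF j _ ij[OF j], of b "qs j ! i' j"] *(6) j by (simp add: u_def)
      qed
      then obtain i'' r where t: "(Trans # u j, i'', r) \<in> set (tr j (i j))" "qs j ! i'' = qs j ! i' j" by blast
      obtain h where h: "at j (i j) (u j) i'' r h" using at_ex[OF j t(1)] by blast
      have "i'' = i' j" using qs_inj[OF j at_target[OF j ij[OF j] h] _ t(2)] *(1) j by (simp add: valid_def)
      with h show ?thesis by blast
    qed
    then have "\<forall>j. \<exists>z. j < k \<longrightarrow> at j (i j) (u j) (i' j) (fst z) (snd z)" by (metis fst_conv snd_conv)
    then obtain z where z: "\<And>j. j < k \<Longrightarrow> at j (i j) (u j) (i' j) (fst (z j)) (snd (z j))" by metis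
    define hs1 where "hs1 = map (\<lambda>j. snd (z j)) [0..<k]"
    have at: "at j (i j) (u j) (i' j) (fst (z j)) (hs1 ! j)" if "j < k" for j using z[OF that] that by (simp add: hs1_def)
    have "((hs1, st), (hs', st')) \<in> sem (act T) ?tail"
      using read_tail_iff[of i st hs1 u i' "\<lambda>j. fst (z j)" "Some b" \<alpha> \<beta> "\<lambda>_. b" hs' st', OF i st _ at _ *(3)] *(2,4,5)
      by (simp add: u_def hs1_def)
    moreover have "length hs1 = k" by (simp add: hs1_def)
    ultimately show "((heads i, st), (hs', st')) \<in> sem (act T) (read_step k)" unfolding split using at by blast
  qed
qed

section \<open>Runs of the simulation and joint runs of the automata\<close>

abbreviation steps :: "((nat list \<times> nat list) \<times> (nat list \<times> nat list)) set" where
  "steps \<equiv> sem (act T) (Alt (eps_step k) (read_step k))"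

definition joint_run :: "(nat \<Rightarrow> nat) \<Rightarrow> nat list \<Rightarrow> nat list \<Rightarrow> (nat \<Rightarrow> nat) \<Rightarrow> nat list \<Rightarrow> bool" where
  "joint_run i st u i' st' \<longleftrightarrow> pda_run P (qs 0 ! i 0, st) u (qs 0 ! i' 0, st') \<and>
     (\<forall>j<k. 0 < j \<longrightarrow> nfa_run (As ! (j - 1)) (qs j ! i j) u (qs j ! i' j))"

lemma steps_sound:
  assumes "((heads i, st), (hs', st')) \<in> steps\<^sup>*" "valid i" "stk st"
  shows "\<exists>i' u. valid i' \<and> stk st' \<and> hs' = heads i' \<and> joint_run i st u i' st'"
  using assms
proof (induction "(heads i, st)" arbitrary: i st rule: converse_rtrancl_induct)
  case base
  then show ?case unfolding joint_run_def by (blast intro: pda_run.refl nfa_run.refl)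
next
  case (step c)
  obtain hs1 st1 where c: "c = (hs1, st1)" by (cases c)
  have "((heads i, st), (hs1, st1)) \<in> sem (act T) (eps_step k) \<or> ((heads i, st), (hs1, st1)) \<in> sem (act T) (read_step k)"
    using step.hyps(1) c by simp
  then consider i1 where "valid i1" "hs1 = heads i1" "eps_move i st i1 st1" | a i1 where "valid i1" "hs1 = heads i1" "read_move a i st i1 st1"
    unfolding eps_step_iff[OF step.prems] read_step_iff[OF step.prems] by blast
  then show ?case
  proof cases
    case 1
    then obtain \<alpha> \<beta> \<gamma> where m: "(qs 0 ! i 0, None, \<alpha>, qs 0 ! i1 0, \<beta>) \<in> pda_trans P" "st = \<gamma> @ [\<alpha>]" "st1 = \<gamma> @ \<beta>"
      "\<forall>j<k. 0 < j \<longrightarrow> i1 j = i j" unfolding eps_move_def by blast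
    have st1: "stk st1" using stk_trans[OF m(1)] m(2,3) step.prems(2) by simp
    have c': "c = (heads i1, st1)" using c 1(2) by simp
    obtain i' u where *: "valid i'" "stk st'" "hs' = heads i'" "joint_run i1 st1 u i' st'"
      using step.hyps(3)[OF c' 1(1) st1] by blast
    have "pda_run P (qs 0 ! i 0, \<gamma> @ [\<alpha>]) u (qs 0 ! i' 0, st')"
      using pda_run.eps[OF m(1), of \<gamma> u "(qs 0 ! i' 0, st')"] *(4) m(3) unfolding joint_run_def by simp
    then have "joint_run i st u i' st'" using *(4) m(2,4) unfolding joint_run_def by simp
    then show ?thesis using * by blast
  next
    case 2
    then obtain \<alpha> \<beta> \<gamma> where m: "(qs 0 ! i 0, Some a, \<alpha>, qs 0 ! i1 0, \<beta>) \<in> pda_trans P" "st = \<gamma> @ [\<alpha>]" "st1 = \<gamma> @ \<beta>"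
      "\<forall>j<k. 0 < j \<longrightarrow> (qs j ! i j, a, qs j ! i1 j) \<in> nfa_trans (As ! (j - 1))" unfolding read_move_def by blast
    have st1: "stk st1" using stk_trans[OF m(1)] m(2,3) step.prems(2) by simp
    have c': "c = (heads i1, st1)" using c 2(2) by simp
    obtain i' u where *: "valid i'" "stk st'" "hs' = heads i'" "joint_run i1 st1 u i' st'"
      using step.hyps(3)[OF c' 2(1) st1] by blast
    have "pda_run P (qs 0 ! i 0, \<gamma> @ [\<alpha>]) (a # u) (qs 0 ! i' 0, st')"
      using pda_run.read[OF m(1), of \<gamma> u "(qs 0 ! i' 0, st')"] *(4) m(3) unfolding joint_run_def by simp
    moreover have "\<forall>j<k. 0 < j \<longrightarrow> nfa_run (As ! (j - 1)) (qs j ! i j) (a # u) (qs j ! i' j)"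
    proof (intro allI impI)
      fix j assume "j < k" "0 < j"
      then show "nfa_run (As ! (j - 1)) (qs j ! i j) (a # u) (qs j ! i' j)"
        using nfa_run.read[of "qs j ! i j" a "qs j ! i1 j" "As ! (j - 1)" u "qs j ! i' j"] m(4) *(4)
        unfolding joint_run_def by blast
    qed
    ultimately have "joint_run i st (a # u) i' st'" using m(2) unfolding joint_run_def by simp
    then show ?thesis using * by blast
  qed
qed

text \<open>The induction follows the run of the PDA only; so the runs of the NFAs are assumed for
  the word that remains, with prescribed last states \<open>f\<close>.\<close>

lemma steps_complete:
  assumes "pda_run P c u c'" "fst c = qs 0 ! i 0" "valid i" "stk (snd c)"
    "\<And>j. j < k \<Longrightarrow> 0 < j \<Longrightarrow> nfa_run (As ! (j - 1)) (qs j ! i j) u (f j)"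
  shows "\<exists>i'. valid i' \<and> ((heads i, snd c), (heads i', snd c')) \<in> steps\<^sup>* \<and> qs 0 ! i' 0 = fst c' \<and> (\<forall>j<k. 0 < j \<longrightarrow> qs j ! i' j = f j)"
  using assms
proof (induction arbitrary: i rule: pda_run.induct)
  case (refl c)
  have "qs j ! i j = f j" if "j < k" "0 < j" for j
    using refl.prems(4)[OF that] by cases simp
  then show ?case using refl by auto
next
  case (eps p \<alpha> q \<beta> \<gamma> u c)
  have "q \<in> set (qs 0)" using pda_transD[OF P(1) eps.hyps(1)] Q[OF k(1)] by simp
  then obtain i0 where i0: "i0 < length (qs 0)" "qs 0 ! i0 = q" by (auto simp: in_set_conv_nth)
  let ?i1 = "i(0 := i0)"
  have v: "valid ?i1" using eps.prems(2) i0 by (simp add: valid_def)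
  have "eps_move i (\<gamma> @ [\<alpha>]) ?i1 (\<gamma> @ \<beta>)" unfolding eps_move_def using eps.hyps(1) eps.prems(1) i0 by auto
  moreover have s: "stk (\<gamma> @ [\<alpha>])" using eps.prems(3) by simp
  ultimately have 1: "((heads i, \<gamma> @ [\<alpha>]), (heads ?i1, \<gamma> @ \<beta>)) \<in> steps"
    using eps_step_iff[OF eps.prems(2) s] v by auto
  have "\<exists>i'. valid i' \<and> ((heads ?i1, snd (q, \<gamma> @ \<beta>)), (heads i', snd c)) \<in> steps\<^sup>* \<and> qs 0 ! i' 0 = fst c \<and>
      (\<forall>j<k. 0 < j \<longrightarrow> qs j ! i' j = f j)"
    by (rule eps.IH[OF _ v]) (use i0 stk_trans[OF eps.hyps(1) s] eps.prems(4) in simp_all)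
  then show ?case unfolding snd_conv using converse_rtrancl_into_rtrancl[OF 1] by blast
next
  case (read p a \<alpha> q \<beta> \<gamma> u c)
  have first: "\<exists>s. (qs j ! i j, a, s) \<in> nfa_trans (As ! (j - 1)) \<and> nfa_run (As ! (j - 1)) s u (f j)" if "j < k" "0 < j" for j
    using read.prems(4)[OF that] by cases auto
  have "\<exists>i'. i' < length (qs j) \<and> (if j = 0 then qs 0 ! i' = q else
      (qs j ! i j, a, qs j ! i') \<in> nfa_trans (As ! (j - 1)) \<and> nfa_run (As ! (j - 1)) (qs j ! i') u (f j))" if j: "j < k" for j
  proof (cases "j = 0")
    case True
    have "q \<in> set (qs 0)" using pda_transD[OF P(1) read.hyps(1)] Q[OF k(1)] by simp
    then show ?thesis using True by (auto simp: in_set_conv_nth)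
  next
    case False
    then obtain s where s: "(qs j ! i j, a, s) \<in> nfa_trans (As ! (j - 1))" "nfa_run (As ! (j - 1)) s u (f j)"
      using first[OF j] by auto
    then have "s \<in> set (qs j)" using nfa_transD[OF A[OF j]] Q[OF j] False by auto
    then obtain i' where "i' < length (qs j)" "qs j ! i' = s" by (auto simp: in_set_conv_nth)
    with s False show ?thesis by auto
  qed
  then have "\<forall>j. \<exists>i'. j < k \<longrightarrow> i' < length (qs j) \<and> (if j = 0 then qs 0 ! i' = q else
      (qs j ! i j, a, qs j ! i') \<in> nfa_trans (As ! (j - 1)) \<and> nfa_run (As ! (j - 1)) (qs j ! i') u (f j))" by blast
  then obtain i1 where i1: "\<And>j. j < k \<Longrightarrow> i1 j < length (qs j) \<and> (if j = 0 then qs 0 ! i1 j = q else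
      (qs j ! i j, a, qs j ! i1 j) \<in> nfa_trans (As ! (j - 1)) \<and> nfa_run (As ! (j - 1)) (qs j ! i1 j) u (f j))" by metis
  have v: "valid i1" using i1 by (simp add: valid_def)
  have q: "qs 0 ! i1 0 = q" using i1[OF k(1)] by simp
  have t: "(qs j ! i j, a, qs j ! i1 j) \<in> nfa_trans (As ! (j - 1)) \<and> nfa_run (As ! (j - 1)) (qs j ! i1 j) u (f j)" if "j < k" "0 < j" for j
    using i1[OF that(1)] that(2) by simp
  have "read_move a i (\<gamma> @ [\<alpha>]) i1 (\<gamma> @ \<beta>)" unfolding read_move_def using read.hyps(1) read.prems(1) q t by auto
  moreover have s: "stk (\<gamma> @ [\<alpha>])" using read.prems(3) by simp
  ultimately have 1: "((heads i, \<gamma> @ [\<alpha>]), (heads i1, \<gamma> @ \<beta>)) \<in> steps"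
    using read_step_iff[OF read.prems(2) s] v by auto
  have "\<exists>i'. valid i' \<and> ((heads i1, snd (q, \<gamma> @ \<beta>)), (heads i', snd c)) \<in> steps\<^sup>* \<and> qs 0 ! i' 0 = fst c \<and>
      (\<forall>j<k. 0 < j \<longrightarrow> qs j ! i' j = f j)"
    by (rule read.IH[OF _ v]) (use q stk_trans[OF read.hyps(1) s] t in simp_all)
  then show ?case unfolding snd_conv using converse_rtrancl_into_rtrancl[OF 1] by blast
qed

lemma init_heads:
  "((replicate k 0, [Z]), (hs', st')) \<in> sem (act T) (each_head k init) \<longleftrightarrow>
    st' = [Z] \<and> (\<exists>i. valid i \<and> hs' = heads i \<and> (\<forall>j<k. qs j ! i j = q0 j))"
proof -
  have Zk: "okG [Z]" using \<Gamma>(2) by (simp add: G_def)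
  have "((replicate k 0 ! j, [Z]), (h', st'')) \<in> sem (hact T) (init j) \<longleftrightarrow> st'' = [Z] \<and> (\<exists>i<length (bs j). qs j ! i = q0 j \<and> h' = pos j i)"
    if j: "j < k" for j h' st''
  proof -
    let ?x = "take (Suc j) xs"
    have "concat (map (\<lambda>x. x @ [Auto]) xs) = concat (map (\<lambda>x. x @ [Auto]) ?x) @ concat (map (\<lambda>x. x @ [Auto]) (drop (Suc j) xs))"
      by (metis append_take_drop_id concat_append map_append)
    \<comment> \<open>At least one piece remains behind the first \<open>Suc j\<close> ones, so the
      artificial last \<open>Auto\<close> is not among them and they really are on the tape.\<close>
    moreover have "drop (Suc j) xs \<noteq> []" using xs(2) j by simp
    then have "concat (map (\<lambda>x. x @ [Auto]) (drop (Suc j) xs)) \<noteq> []" by (cases "drop (Suc j) xs") auto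
    ultimately obtain w' where w: "w = concat (map (\<lambda>x. x @ [Auto]) ?x) @ w'"
      using xs(1) by (metis append_assoc append_butlast_last_id butlast_append butlast_snoc)
    have "reads T 1 w" by (auto simp: reads_nth tm_input_def nth_append)
    then have r: "reads T 1 (concat (map (\<lambda>x. x @ [Auto]) ?x))" unfolding w reads_append by blast
    have "\<forall>x\<in>set ?x. Auto \<notin> set x" using xs(3) by (meson in_set_takeD)
    from coded.init_iff[OF coded[OF j] Zk _ r this _ off(1)[OF j]] show ?thesis
      using xs(2) j by (simp add: tm_input_def)
  qed
  from sem_each_head[of "replicate k 0" k, OF _ this]
  have "((replicate k 0, [Z]), (hs', st')) \<in> sem (act T) (each_head k init) \<longleftrightarrow>
    st' = [Z] \<and> length hs' = k \<and> (\<forall>j<k. \<exists>i<length (bs j). qs j ! i = q0 j \<and> hs' ! j = pos j i)" by simp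
  also have "\<dots> \<longleftrightarrow> st' = [Z] \<and> (\<exists>i. valid i \<and> hs' = heads i \<and> (\<forall>j<k. qs j ! i j = q0 j))"
  proof -
    have "\<exists>i. valid i \<and> hs' = heads i \<and> (\<forall>j<k. qs j ! i j = q0 j)"
      if *: "length hs' = k" "\<forall>j<k. \<exists>i<length (bs j). qs j ! i = q0 j \<and> hs' ! j = pos j i"
    proof -
      from *(2) obtain i where i: "\<forall>j<k. i j < length (bs j) \<and> qs j ! i j = q0 j \<and> hs' ! j = pos j (i j)" by metis
      then have "hs' = heads i" using *(1) by (intro heads_eqI) auto
      moreover have "valid i" using i lengths by (simp add: valid_def)
      ultimately show ?thesis using i by blast
    qed
    moreover have "length hs' = k \<and> (\<forall>j<k. \<exists>i<length (bs j). qs j ! i = q0 j \<and> hs' ! j = pos j i)"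
      if "\<exists>i. valid i \<and> hs' = heads i \<and> (\<forall>j<k. qs j ! i j = q0 j)"
      using that lengths by (auto simp: valid_def)
    ultimately show ?thesis by blast
  qed
  finally show ?thesis .
qed

lemma final_heads:
  assumes "valid i" "stk st"
  shows "((heads i, st), (hs', st')) \<in> sem (act T) (each_head k (\<lambda>_. final)) \<longleftrightarrow>
    st' = st \<and> (\<forall>j<k. qs j ! i j \<in> F j) \<and> hs' = replicate k (length w + 1)"
proof -
  have G: "okG st" using okS_okG[OF stk_okS[OF assms(2)]] by simp
  have "((heads i ! j, st), (h', st'')) \<in> sem (hact T) final \<longleftrightarrow> st'' = st \<and> (qs j ! i j \<in> F j \<and> h' = length w + 1)" if j: "j < k" for j h' st''
    using coded.final_iff[OF coded[OF j] _ G HOL.refl off(2)[OF j], of "i j"] assms(1) lengths[OF j] j by (simp add: valid_def)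
  from sem_each_head[OF length_heads this] show ?thesis
    by (auto simp: list_eq_iff_nth_eq)
qed

lemma simulator_iff:
  "((replicate k 0, [Z]), (replicate k (length w + 1), [Z])) \<in> sem (act T) (simulator k) \<longleftrightarrow>
    (\<exists>u\<in>pda_lang P. \<forall>A\<in>set As. u \<in> nfa_lang A)"
proof -
  have Zs: "stk [Z]" by (simp add: stk_def)
  have As: "(\<forall>A\<in>set As. u \<in> nfa_lang A) \<longleftrightarrow> (\<forall>j<k. 0 < j \<longrightarrow> u \<in> nfa_lang (As ! (j - 1)))" for u
  proof -
    have "(\<forall>j<k - 1. Q j) \<longleftrightarrow> (\<forall>j<k. 0 < j \<longrightarrow> Q (j - 1))" for Q
    proof
      assume "\<forall>j<k - 1. Q j"
      then show "\<forall>j<k. 0 < j \<longrightarrow> Q (j - 1)" by auto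
    next
      assume Q: "\<forall>j<k. 0 < j \<longrightarrow> Q (j - 1)"
      show "\<forall>j<k - 1. Q j"
      proof (intro allI impI)
        fix j assume "j < k - 1"
        then have "Suc j < k" by simp
        then show "Q j" using Q[rule_format, of "Suc j"] by simp
      qed
    qed
    then show ?thesis using k(2) by (simp add: all_set_conv_all_nth)
  qed
  have "((replicate k 0, [Z]), (replicate k (length w + 1), [Z])) \<in> sem (act T) (simulator k) \<longleftrightarrow>
    (\<exists>i. valid i \<and> (\<forall>j<k. qs j ! i j = q0 j) \<and> (\<exists>i'. valid i' \<and> ((heads i, [Z]), (heads i', [Z])) \<in> steps\<^sup>* \<and> (\<forall>j<k. qs j ! i' j \<in> F j)))"
  proof
    assume "((replicate k 0, [Z]), (replicate k (length w + 1), [Z])) \<in> sem (act T) (simulator k)"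
    then obtain hs1 st1 hs2 st2 where *: "((replicate k 0, [Z]), (hs1, st1)) \<in> sem (act T) (each_head k init)"
      "((hs1, st1), (hs2, st2)) \<in> steps\<^sup>*" "((hs2, st2), (replicate k (length w + 1), [Z])) \<in> sem (act T) (each_head k (\<lambda>_. final))"
      unfolding simulator_def sem_Seq_iff split_paired_Ex sem.simps(4) by blast
    obtain i where i: "st1 = [Z]" "valid i" "hs1 = heads i" "\<forall>j<k. qs j ! i j = q0 j" using *(1) unfolding init_heads by blast
    obtain i' where i': "valid i'" "stk st2" "hs2 = heads i'" using steps_sound[OF *(2)[unfolded i(1,3)] i(2) Zs] by blast
    have "st2 = [Z]" "\<forall>j<k. qs j ! i' j \<in> F j" using *(3) unfolding i'(3) final_heads[OF i'(1,2)] by auto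
    with i i' *(2) show "\<exists>i. valid i \<and> (\<forall>j<k. qs j ! i j = q0 j) \<and> (\<exists>i'. valid i' \<and> ((heads i, [Z]), (heads i', [Z])) \<in> steps\<^sup>* \<and> (\<forall>j<k. qs j ! i' j \<in> F j))"
      by blast
  next
    assume "\<exists>i. valid i \<and> (\<forall>j<k. qs j ! i j = q0 j) \<and> (\<exists>i'. valid i' \<and> ((heads i, [Z]), (heads i', [Z])) \<in> steps\<^sup>* \<and> (\<forall>j<k. qs j ! i' j \<in> F j))"
    then obtain i i' where i: "valid i" "\<forall>j<k. qs j ! i j = q0 j" "valid i'" "((heads i, [Z]), (heads i', [Z])) \<in> steps\<^sup>*" "\<forall>j<k. qs j ! i' j \<in> F j"
      by blast
    have "((replicate k 0, [Z]), (heads i, [Z])) \<in> sem (act T) (each_head k init)" unfolding init_heads using i(1,2) by blast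
    moreover have "((heads i', [Z]), (replicate k (length w + 1), [Z])) \<in> sem (act T) (each_head k (\<lambda>_. final))"
      unfolding final_heads[OF i(3) Zs] using i(5) by simp
    ultimately show "((replicate k 0, [Z]), (replicate k (length w + 1), [Z])) \<in> sem (act T) (simulator k)"
      unfolding simulator_def sem_Seq_iff sem.simps(4) using i(4) by blast
  qed
  also have "\<dots> \<longleftrightarrow> (\<exists>u\<in>pda_lang P. \<forall>A\<in>set As. u \<in> nfa_lang A)"
  proof
    assume "\<exists>i. valid i \<and> (\<forall>j<k. qs j ! i j = q0 j) \<and> (\<exists>i'. valid i' \<and> ((heads i, [Z]), (heads i', [Z])) \<in> steps\<^sup>* \<and> (\<forall>j<k. qs j ! i' j \<in> F j))"
    then obtain i i'' where i: "valid i" "\<forall>j<k. qs j ! i j = q0 j" "valid i''" "((heads i, [Z]), (heads i'', [Z])) \<in> steps\<^sup>*" "\<forall>j<k. qs j ! i'' j \<in> F j"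
      by blast
    \<comment> \<open>Soundness provides numbers \<open>i'\<close> with the same head positions as
      \<open>i''\<close>; that their states are final is then read off from the heads, which avoids
      injectivity of positions.\<close>
    obtain i' u where r: "valid i'" "heads i'' = heads i'" "joint_run i [Z] u i' [Z]" using steps_sound[OF i(4,1) Zs] by blast
    have "((heads i', [Z]), (replicate k (length w + 1), [Z])) \<in> sem (act T) (each_head k (\<lambda>_. final))"
      unfolding r(2)[symmetric] final_heads[OF i(3) Zs] using i(5) by simp
    then have f: "\<forall>j<k. qs j ! i' j \<in> F j" unfolding final_heads[OF r(1) Zs] by blast
    have "u \<in> pda_lang P"
    proof -
      have "qs 0 ! i' 0 \<in> pda_final P" "qs 0 ! i 0 = pda_init P" using f i(2) k(1) by (auto simp: q0 F)
      then show ?thesis unfolding pda_lang_def using r(3) P(3) by (auto simp: joint_run_def intro!: bexI[of _ "qs 0 ! i' 0"])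
    qed
    moreover have "\<forall>j<k. 0 < j \<longrightarrow> u \<in> nfa_lang (As ! (j - 1))"
    proof (intro allI impI)
      fix j assume j: "j < k" "0 < j"
      then have "qs j ! i' j \<in> nfa_final (As ! (j - 1))" "qs j ! i j = nfa_init (As ! (j - 1))" using f i(2) by (auto simp: q0 F)
      moreover have "nfa_run (As ! (j - 1)) (qs j ! i j) u (qs j ! i' j)" using r(3) j unfolding joint_run_def by blast
      ultimately show "u \<in> nfa_lang (As ! (j - 1))" unfolding nfa_lang_def by auto
    qed
    ultimately show "\<exists>u\<in>pda_lang P. \<forall>A\<in>set As. u \<in> nfa_lang A" using As by blast
  next
    assume "\<exists>u\<in>pda_lang P. \<forall>A\<in>set As. u \<in> nfa_lang A"
    then obtain u where u: "u \<in> pda_lang P" "\<forall>j<k. 0 < j \<longrightarrow> u \<in> nfa_lang (As ! (j - 1))" using As by blast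
    obtain f0 where f0: "f0 \<in> pda_final P" "pda_run P (pda_init P, [Z]) u (f0, [Z])" using u(1) P(3) by (auto simp: pda_lang_def)
    have "\<forall>j. \<exists>f. j < k \<longrightarrow> 0 < j \<longrightarrow> f \<in> nfa_final (As ! (j - 1)) \<and> nfa_run (As ! (j - 1)) (nfa_init (As ! (j - 1))) u f"
      using u(2) unfolding nfa_lang_def by blast
    then obtain f where f: "\<And>j. j < k \<Longrightarrow> 0 < j \<Longrightarrow> f j \<in> nfa_final (As ! (j - 1)) \<and> nfa_run (As ! (j - 1)) (nfa_init (As ! (j - 1))) u (f j)"
      by metis
    have "\<forall>j. \<exists>i. j < k \<longrightarrow> i < length (qs j) \<and> qs j ! i = q0 j"
      using coded.len(3)[OF coded] by (metis in_set_conv_nth)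
    then obtain i where i: "\<And>j. j < k \<Longrightarrow> i j < length (qs j) \<and> qs j ! i j = q0 j" by metis
    have v: "valid i" using i by (simp add: valid_def)
    have "\<exists>i'. valid i' \<and> ((heads i, snd (pda_init P, [Z])), (heads i', snd (f0, [Z]))) \<in> steps\<^sup>* \<and> qs 0 ! i' 0 = fst (f0, [Z]) \<and> (\<forall>j<k. 0 < j \<longrightarrow> qs j ! i' j = f j)"
      by (rule steps_complete[OF f0(2) _ v]) (use i[OF k(1)] i f Zs in \<open>auto simp: q0\<close>)
    then obtain i' where i': "valid i'" "((heads i, [Z]), (heads i', [Z])) \<in> steps\<^sup>*" "qs 0 ! i' 0 = f0" "\<forall>j<k. 0 < j \<longrightarrow> qs j ! i' j = f j"
      by auto
    have "\<forall>j<k. qs j ! i' j \<in> F j" using i'(3,4) f f0(1) by (auto simp: F)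
    then show "\<exists>i. valid i \<and> (\<forall>j<k. qs j ! i j = q0 j) \<and> (\<exists>i'. valid i' \<and> ((heads i, [Z]), (heads i', [Z])) \<in> steps\<^sup>* \<and> (\<forall>j<k. qs j ! i' j \<in> F j))"
      using v i i'(1,2) by blast
  qed
  finally show ?thesis .
qed

end

section \<open>From an encoded instance to the assumptions of the simulation\<close>

definition decoded :: "nat set \<Rightarrow> nat \<Rightarrow> nat set \<Rightarrow> (nat \<Rightarrow> (sym list \<times> nat) set) \<Rightarrow> sym list \<Rightarrow>
    nat list \<Rightarrow> bool list list \<Rightarrow> sym list list \<Rightarrow> (nat \<Rightarrow> (sym list \<times> nat \<times> sym list) list) \<Rightarrow> bool" where
  "decoded Q q0 F out v qs ls bs tr \<longleftrightarrow> distinct qs \<and> set qs = Q \<and> length ls = length qs \<and> length bs = length qs \<and>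
     v = concat bs \<and> (\<forall>b\<in>set bs. is_segment b) \<and>
     (\<forall>i<length qs. (\<forall>(u, j, r)\<in>set (tr i). j < length qs \<and> code_ref ls i j r) \<and>
        {(u, qs ! j) | u j r. (u, j, r) \<in> set (tr i)} = out (qs ! i) \<and>
        bs ! i = State # map Bit (ls ! i) @ (if qs ! i = q0 then [Init] else []) @
          (if qs ! i \<in> F then [Final] else []) @ put (tr i))"

text \<open>It makes \<open>Trans\<close>, \<open>State\<close> and \<open>Auto\<close> reliable
  separators for heads that look for a transition, a state or an automaton.\<close>

definition plain_actions :: "(nat \<Rightarrow> (sym list \<times> nat) set) \<Rightarrow> bool" where
  "plain_actions out \<longleftrightarrow> (\<forall>p u q. (u, q) \<in> out p \<longrightarrow> (\<exists>u'. u = Trans # u' \<and> set u' \<inter> {Trans, State, Auto} = {}))"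

lemma code_automaton_decoded:
  assumes "code_automaton Q q0 F out v" "plain_actions out"
  shows "\<exists>qs ls bs tr. decoded Q q0 F out v qs ls bs tr"
proof -
  obtain qs ls bs where qs: "distinct qs" "set qs = Q" "length ls = length qs" "length bs = length qs"
    "\<forall>i<length qs. code_state qs ls q0 F out i (bs ! i)" "v = concat bs"
    using assms(1) unfolding code_automaton_def by blast
  let ?P = "\<lambda>i ts. (\<forall>(u, j, r)\<in>set ts. j < length qs \<and> code_ref ls i j r) \<and>
        {(u, qs ! j) | u j r. (u, j, r) \<in> set ts} = out (qs ! i) \<and>
        bs ! i = State # map Bit (ls ! i) @ (if qs ! i = q0 then [Init] else []) @
          (if qs ! i \<in> F then [Final] else []) @ put ts"
  have "\<exists>ts. ?P i ts" if i: "i < length qs" for i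
  proof -
    have "code_state qs ls q0 F out i (bs ! i)" using qs(5) i by blast
    then show ?thesis unfolding code_state_def put_def append_Cons append_Nil .
  qed
  then have "\<forall>i. \<exists>ts. i < length qs \<longrightarrow> ?P i ts" by blast
  from choice[OF this] obtain tr where tr: "\<forall>i. i < length qs \<longrightarrow> ?P i (tr i)" by blast
  have "State \<notin> set u \<and> Auto \<notin> set u" if "(u, q) \<in> out p" for p u q
  proof -
    from that assms(2) obtain u' where "u = Trans # u'" "set u' \<inter> {Trans, State, Auto} = {}"
      unfolding plain_actions_def by blast
    then show ?thesis by auto
  qed
  then have "is_segment (bs ! i)" if "i < length qs" for i
    using code_state_segment[of qs ls q0 F out i "bs ! i"] qs(5) that by blast
  then have "\<forall>b\<in>set bs. is_segment b" using qs(4) by (metis in_set_conv_nth)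
  then have "decoded Q q0 F out v qs ls bs tr" unfolding decoded_def using qs tr by blast
  then show ?thesis by blast
qed

lemma reads_tm_input: "reads (tm_input (a @ b @ c)) (Suc (length a)) b"
  unfolding reads_nth by (auto simp: tm_input_def nth_append)

lemma decoded_coded:
  assumes "stack_symbols \<Gamma> Z x0 x1" and dec: "decoded Q q0 F out v qs ls bs tr" and "plain_actions out" "q0 \<in> Q"
    and w: "w = A @ v @ D" "D = [] \<or> hd D = Auto" "A = A0 @ [Auto]"
  shows "coded \<Gamma> Z x0 x1 (tm_input w) (Suc (length A)) bs ls qs q0 F tr"
proof -
  interpret stack_symbols \<Gamma> Z x0 x1 by fact
  have d: "distinct qs" "set qs = Q" "length ls = length qs" "length bs = length qs" "v = concat bs" "\<forall>b\<in>set bs. is_segment b"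
    using dec unfolding decoded_def by blast+
  have dtr: "j < length qs \<and> code_ref ls i j r" if "i < length qs" "(u, j, r) \<in> set (tr i)" for i u j r
    using dec that unfolding decoded_def by blast
  have dblock: "bs ! i = State # map Bit (ls ! i) @ (if qs ! i = q0 then [Init] else []) @
          (if qs ! i \<in> F then [Final] else []) @ put (tr i)" if "i < length qs" for i
    using dec that unfolding decoded_def by blast
  have dtrans: "\<exists>u'. u = Trans # u' \<and> Trans \<notin> set u'" if "i < length qs" "(u, j, r) \<in> set (tr i)" for i u j r
  proof -
    have "{(u, qs ! j) | u j r. (u, j, r) \<in> set (tr i)} = out (qs ! i)" using dec that(1) unfolding decoded_def by blast
    then have "(u, qs ! j) \<in> out (qs ! i)" using that(2) by blast
    then show ?thesis using assms(3) unfolding plain_actions_def by fastforce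
  qed
  show ?thesis
  proof
    show "reads (tm_input w) (Suc (length A)) (concat bs)" unfolding w(1) d(5) by (rule reads_tm_input)
    show "tm_input w ! (Suc (length A) + length (concat bs)) \<in> {Letter Auto, Right_End}"
    proof (cases D)
      case Nil
      then show ?thesis unfolding w(1) d(5) by (simp add: tm_input_def nth_append)
    next
      case (Cons y ys)
      have "reads (tm_input ((A @ v) @ [Auto] @ ys)) (Suc (length (A @ v))) [Auto]" by (rule reads_tm_input)
      then show ?thesis using Cons w(1,2) d(5) by simp
    qed
    have "reads (tm_input (A0 @ [Auto] @ (v @ D))) (Suc (length A0)) [Auto]" by (rule reads_tm_input)
    then show "tm_input w ! (Suc (length A) - 1) = Letter Auto" using w(1,3) by simp
    show "\<exists>rest. bs ! i = State # map Bit (ls ! i) @ rest \<and> (rest = [] \<or> hd rest \<notin> range Bit)" if "i < length bs" for i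
    proof -
      have "put (tr i) = [] \<or> hd (put (tr i)) = Trans"
        using dtrans[of i] that d(4) by (cases "tr i") fastforce+
      then have "(if qs ! i = q0 then [Init] else []) @ (if qs ! i \<in> F then [Final] else []) @ put (tr i) = [] \<or>
        hd ((if qs ! i = q0 then [Init] else []) @ (if qs ! i \<in> F then [Final] else []) @ put (tr i)) \<notin> range Bit"
        by auto
      then show ?thesis using dblock[of i] that d(4) by auto
    qed
    show "bs ! i = State # map Bit (ls ! i) @ (if qs ! i = q0 then [Init] else []) @
      (if qs ! i \<in> F then [Final] else []) @ put (tr i)" if "i < length bs" for i
      using dblock that d(4) by simp
    show "i' < length bs \<and> code_ref ls i i' r \<and> (\<exists>u'. u = Trans # u' \<and> Trans \<notin> set u')"
      if "i < length bs" "(u, i', r) \<in> set (tr i)" for i u i' r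
      using dtr[of i u i' r] dtrans[of i u i' r] that d(4) by simp
  qed (use d assms(4) in auto)
qed

lemma plain_nfa: "plain_actions (\<lambda>p. {([Trans] @ code_nat a @ [Comma], q) | a q. (p, a, q) \<in> R})"
  unfolding plain_actions_def
proof (intro allI impI)
  fix p u q assume "(u, q) \<in> {([Trans] @ code_nat a @ [Comma], q) | a q. (p, a, q) \<in> R}"
  then obtain a where "u = Trans # code_nat a @ [Comma]" by auto
  then show "\<exists>u'. u = Trans # u' \<and> set u' \<inter> {Trans, State, Auto} = {}" using set_code_nat[of a] by auto
qed

lemma set_code_nats: "set (code_nats ns) \<subseteq> insert Semi (range Bit)"
proof (induction ns)
  case (Cons m ns)
  then show ?case using set_code_nat[of m] by (auto simp: code_nats_Cons)
qed (simp add: code_nats_Nil)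

lemma plain_pda: "plain_actions (\<lambda>p. {(Trans # action_code a \<alpha> \<beta>, q) | a \<alpha> q \<beta>. (p, a, \<alpha>, q, \<beta>) \<in> R})"
  unfolding plain_actions_def
proof (intro allI impI)
  fix p u q assume "(u, q) \<in> {(Trans # action_code a \<alpha> \<beta>, q) | a \<alpha> q \<beta>. (p, a, \<alpha>, q, \<beta>) \<in> R}"
  then obtain a \<alpha> \<beta> where "u = Trans # action_code a \<alpha> \<beta>" by auto
  moreover have "set (case a of None \<Rightarrow> [Eps] | Some b \<Rightarrow> code_nat b) \<subseteq> insert Eps (range Bit)"
    using set_code_nat by (cases a) auto
  then have "set (action_code a \<alpha> \<beta>) \<inter> {Trans, State, Auto} = {}"
    unfolding action_code_def using set_code_nat[of \<alpha>] set_code_nats[of \<beta>] by auto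
  ultimately show "\<exists>u'. u = Trans # u' \<and> set u' \<inter> {Trans, State, Auto} = {}" by blast
qed

lemma code_pda_conv: "code_pda P = code_automaton (pda_states P) (pda_init P) (pda_final P)
    (\<lambda>p. {(Trans # action_code a \<alpha> \<beta>, q) | a \<alpha> q \<beta>. (p, a, \<alpha>, q, \<beta>) \<in> pda_trans P})"
  by (simp add: code_pda_def action_code_def)

lemma segment_no_Auto: "is_segment b \<Longrightarrow> Auto \<notin> set b"
  by (auto simp: is_segment_def)

lemma simulator_correct:
  fixes as :: "nat list" and P :: "(nat, nat, nat) pda" and As :: "(nat, nat) nfa list"
  assumes S: "stack_symbols \<Gamma> Z x0 x1" and k: "k > 0" "length As = k - 1"
    and P: "is_pda P" "pda_stack P = \<Gamma>" "pda_bottom P = Z"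
    and As: "\<And>A. A \<in> set As \<Longrightarrow> is_nfa A"
    and code: "code_pda P v" "code_nfas As u"
  defines "w \<equiv> code_nats as @ Auto # v @ u"
  shows "((replicate k 0, [Z]), (replicate k (length w + 1), [Z])) \<in> sem (act (tm_input w)) (stack_symbols.simulator \<Gamma> Z x0 x1 k) \<longleftrightarrow>
    (\<exists>u\<in>pda_lang P. \<forall>A\<in>set As. u \<in> nfa_lang A)"
proof -
  obtain us where us: "list_all2 code_nfa As us" "u = concat (map (\<lambda>u. Auto # u) us)"
    using code(2) by (auto simp: code_nfas_def)
  define Q where "Q j = (if j = 0 then pda_states P else nfa_states (As ! (j - 1)))" for j
  define q0 where "q0 j = (if j = 0 then pda_init P else nfa_init (As ! (j - 1)))" for j
  define F where "F j = (if j = 0 then pda_final P else nfa_final (As ! (j - 1)))" for j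
  define out where "out j = (if j = 0 then (\<lambda>p. {(Trans # action_code a \<alpha> \<beta>, q) | a \<alpha> q \<beta>. (p, a, \<alpha>, q, \<beta>) \<in> pda_trans P})
    else (\<lambda>p. {([Trans] @ code_nat a @ [Comma], q) | a q. (p, a, q) \<in> nfa_trans (As ! (j - 1))}))" for j
  define codes where "codes = v # us"
  have lus: "length us = k - 1" using us(1) k(2) by (simp add: list_all2_lengthD[symmetric])
  have A: "is_nfa (As ! (j - 1))" if "j < k" "0 < j" for j using As k(2) that by simp
  have plain: "plain_actions (out j)" for j unfolding out_def using plain_nfa plain_pda by simp
  have dec: "\<exists>qs ls bs tr. decoded (Q j) (q0 j) (F j) (out j) (codes ! j) qs ls bs tr" if j: "j < k" for j
  proof (rule code_automaton_decoded[OF _ plain])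
    show "code_automaton (Q j) (q0 j) (F j) (out j) (codes ! j)"
    proof (cases j)
      case 0
      then show ?thesis using code(1) by (simp add: code_pda_conv Q_def q0_def F_def out_def codes_def)
    next
      case (Suc j')
      then have "code_nfa (As ! j') (us ! j')" using us(1) j k(2) by (auto simp: list_all2_conv_all_nth)
      then show ?thesis using Suc by (simp add: code_nfa_def Q_def q0_def F_def out_def codes_def)
    qed
  qed
  \<comment> \<open>The four witnesses are packed into one tuple so that a single choice over all
    heads is enough.\<close>
  have "\<forall>j. \<exists>z. j < k \<longrightarrow> (case z of (qs, ls, bs, tr) \<Rightarrow> decoded (Q j) (q0 j) (F j) (out j) (codes ! j) qs ls bs tr)"
    using dec by fastforce
  then obtain z where z: "\<And>j. j < k \<Longrightarrow> case z j of (qs, ls, bs, tr) \<Rightarrow> decoded (Q j) (q0 j) (F j) (out j) (codes ! j) qs ls bs tr"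
    by metis
  define qs where "qs j = fst (z j)" for j
  define ls where "ls j = fst (snd (z j))" for j
  define bs where "bs j = fst (snd (snd (z j)))" for j
  define tr where "tr j = snd (snd (snd (z j)))" for j
  have dec: "decoded (Q j) (q0 j) (F j) (out j) (codes ! j) (qs j) (ls j) (bs j) (tr j)" if "j < k" for j
    using z[OF that] by (simp add: qs_def ls_def bs_def tr_def split_beta)
  define xs where "xs = code_nats as # codes"
  define pre where "pre j = concat (map (\<lambda>x. x @ [Auto]) (take (Suc j) xs))" for j
  have lxs: "length xs = Suc k" using lus k(1) by (simp add: xs_def codes_def)
  have "concat (map (\<lambda>u. Auto # u) us) @ [Auto] = Auto # concat (map (\<lambda>x. x @ [Auto]) us)"
    by (induction us) auto
  then have wxs: "w @ [Auto] = concat (map (\<lambda>x. x @ [Auto]) xs)"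
    by (simp add: w_def us(2) xs_def codes_def)
  have q0Q: "q0 j \<in> Q j" if "j < k" for j
    using P(1) A[OF that] by (auto simp: q0_def Q_def is_pda_def is_nfa_def)
  have split: "\<exists>D A0. w = pre j @ codes ! j @ D \<and> (D = [] \<or> hd D = Auto) \<and> pre j = A0 @ [Auto]" if j: "j < k" for j
  proof -
    have "xs = take (Suc j) xs @ codes ! j # drop (Suc (Suc j)) xs"
      using id_take_nth_drop[of "Suc j" xs] lxs j by (simp add: xs_def)
    then have "concat (map (\<lambda>x. x @ [Auto]) xs) = concat (map (\<lambda>x. x @ [Auto]) (take (Suc j) xs @ codes ! j # drop (Suc (Suc j)) xs))"
      by (rule arg_cong)
    then have w: "w @ [Auto] = pre j @ codes ! j @ [Auto] @ concat (map (\<lambda>x. x @ [Auto]) (drop (Suc (Suc j)) xs))"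
      unfolding wxs by (simp add: pre_def)
    let ?C = "concat (map (\<lambda>x. x @ [Auto]) (drop (Suc (Suc j)) xs))"
    have D: "\<exists>D. w = pre j @ codes ! j @ D \<and> (D = [] \<or> hd D = Auto)"
    proof (cases "?C" rule: rev_cases)
      case Nil
      then show ?thesis using w by auto
    next
      case (snoc C c)
      then have "w @ [Auto] = (pre j @ codes ! j @ Auto # C) @ [c]" using w by simp
      then have "w = pre j @ codes ! j @ Auto # C" by (simp only: append1_eq_conv)
      then show ?thesis by auto
    qed
    have "take (Suc j) xs = take j xs @ [xs ! j]" using lxs j by (simp add: take_Suc_conv_app_nth)
    then have "pre j = (concat (map (\<lambda>x. x @ [Auto]) (take j xs)) @ xs ! j) @ [Auto]" by (simp add: pre_def)
    with D show ?thesis by blast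
  qed
  have coded: "coded \<Gamma> Z x0 x1 (tm_input w) (Suc (length (pre j))) (bs j) (ls j) (qs j) (q0 j) (F j) (tr j)" if j: "j < k" for j
  proof -
    obtain D A0 where "w = pre j @ codes ! j @ D" "D = [] \<or> hd D = Auto" "pre j = A0 @ [Auto]" using split[OF j] by blast
    then show ?thesis by (rule decoded_coded[OF S dec[OF j] plain q0Q[OF j]])
  qed
  have out_eq: "{(u, qs j ! i') | u i' r. (u, i', r) \<in> set (tr j i)} = out j (qs j ! i)" if "j < k" "i < length (qs j)" for j i
    using dec[OF that(1)] that(2) unfolding decoded_def by blast
  have outI: "\<exists>i' r. (u, i', r) \<in> set (tr j i) \<and> qs j ! i' = q" if "j < k" "i < length (qs j)" "(u, q) \<in> out j (qs j ! i)" for j i u q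
  proof -
    have "(u, q) \<in> {(u, qs j ! i') | u i' r. (u, i', r) \<in> set (tr j i)}" using that(3) unfolding out_eq[OF that(1,2)] .
    then show ?thesis by blast
  qed
  have outD: "(u, qs j ! i') \<in> out j (qs j ! i)" if "j < k" "i < length (qs j)" "(u, i', r) \<in> set (tr j i)" for j i u i' r
    using that(3) unfolding out_eq[OF that(1,2), symmetric] by blast
  interpret joint \<Gamma> Z x0 x1 k w P As xs "\<lambda>j. Suc (length (pre j))" bs ls qs q0 F tr
  proof (intro joint.intro joint_axioms.intro S k P A coded wxs lxs)
    show "q0 j = (if j = 0 then pda_init P else nfa_init (As ! (j - 1)))" for j by (simp add: q0_def)
    show "F j = (if j = 0 then pda_final P else nfa_final (As ! (j - 1)))" for j by (simp add: F_def)
    show "set (qs j) = (if j = 0 then pda_states P else nfa_states (As ! (j - 1)))" if "j < k" for j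
      using dec[OF that] unfolding decoded_def Q_def by blast
    show "Auto \<notin> set x" if x: "x \<in> set xs" for x
    proof (cases "x = code_nats as")
      case True
      then show ?thesis using set_code_nats[of as] by auto
    next
      case False
      then have "x \<in> set codes" using x by (simp add: xs_def)
      moreover have "length codes = k" using lus k(1) by (simp add: codes_def)
      ultimately obtain j where j: "j < k" "x = codes ! j" by (metis in_set_conv_nth)
      then have "x = concat (bs j)" "\<forall>b\<in>set (bs j). is_segment b" using dec[OF j(1)] unfolding decoded_def by blast+
      then show ?thesis using segment_no_Auto by auto
    qed
    show "Suc (length (pre j)) = Suc (length (concat (map (\<lambda>x. x @ [Auto]) (take (Suc j) xs))))" for j by (simp add: pre_def)
    show "Suc (length (pre j)) + length (concat (bs j)) < length (tm_input w)" if j: "j < k" for j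
    proof -
      obtain D where "w = pre j @ codes ! j @ D" using split[OF j] by blast
      moreover have "codes ! j = concat (bs j)" using dec[OF j] unfolding decoded_def by blast
      ultimately have "length w = length (pre j) + length (concat (bs j)) + length D" by simp
      then show ?thesis unfolding length_tm_input by simp
    qed
    show "\<exists>i' r. (Trans # action_code a \<alpha> \<beta>, i', r) \<in> set (tr 0 i) \<and> qs 0 ! i' = q"
      if "i < length (qs 0)" "(qs 0 ! i, a, \<alpha>, q, \<beta>) \<in> pda_trans P" for i a \<alpha> q \<beta>
      using outI[OF k(1) that(1), of "Trans # action_code a \<alpha> \<beta>" q] that(2) unfolding out_def by auto
    show "\<exists>a \<alpha> \<beta>. u = action_code a \<alpha> \<beta> \<and> (qs 0 ! i, a, \<alpha>, qs 0 ! i', \<beta>) \<in> pda_trans P"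
      if "i < length (qs 0)" "(Trans # u, i', r) \<in> set (tr 0 i)" for i u i' r
      using outD[OF k(1) that] unfolding out_def by auto
    show "\<exists>i' r. (Trans # code_nat a @ [Comma], i', r) \<in> set (tr j i) \<and> qs j ! i' = q"
      if "j < k" "0 < j" "i < length (qs j)" "(qs j ! i, a, q) \<in> nfa_trans (As ! (j - 1))" for j i a q
      using outI[OF that(1,3), of "Trans # code_nat a @ [Comma]" q] that(2,4) unfolding out_def by auto
    show "\<exists>a. u = code_nat a @ [Comma] \<and> (qs j ! i, a, qs j ! i') \<in> nfa_trans (As ! (j - 1))"
      if "j < k" "0 < j" "i < length (qs j)" "(Trans # u, i', r) \<in> set (tr j i)" for j i u i' r
      using outD[OF that(1,3,4)] that(2) unfolding out_def by auto
  qed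
  show ?thesis by (rule simulator_iff)
qed

text \<open>The machine depends on \<open>\<Gamma>\<close>, \<open>Z\<close> and \<open>k\<close>
  only. Its alphabet consists of numbers for the symbols of encodings, so the reduction merely
  recodes the instance symbol by symbol.\<close>

lemma nonemptiness_reducible:
  fixes \<Gamma> :: "nat set"
  assumes \<Gamma>: "finite \<Gamma>" "Z \<in> \<Gamma>" and k: "k \<ge> 1"
  shows "\<exists>M :: (nat, nat, nat) npda2. is_npda2 k M \<and>
    linear_time_reducible (nonemptiness_problem is_nfa \<Gamma> Z k) (recognition_problem k M)"
proof -
  obtain x0 where x0: "x0 \<notin> \<Gamma>" using ex_new_if_finite[OF infinite_UNIV_nat \<Gamma>(1)] by blast
  have "finite (insert x0 \<Gamma>)" using \<Gamma>(1) by simp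
  then obtain x1 where x1: "x1 \<notin> insert x0 \<Gamma>" using ex_new_if_finite[OF infinite_UNIV_nat] by blast
  interpret stack_symbols \<Gamma> Z x0 x1 using \<Gamma> x0 x1 by unfold_locales auto
  have k0: "k > 0" using k by simp
  have Z: "Z \<in> G" using \<Gamma>(2) \<Gamma>_subset by blast
  obtain M :: "(nat, nat, nat) npda2" where M: "is_npda2 k M" "npda2_input_letters M = range (\<lambda>y. cell_code (Letter y))"
    "\<And>w. input_code w \<in> npda2_lang k M \<longleftrightarrow>
      ((replicate k 0, [Z]), (replicate k (length w + 1), [Z])) \<in> sem (act (tm_input w)) (simulator k)"
    using program_npda2[OF finite_G Z k0, of "simulator k"] prog_ok_simulator[OF k0] unfolding prog_ok_def by blast
  obtain T c where T: "is_tm (UNIV :: sym set) T" "\<And>w. \<exists>t. tm_computes T w t (input_code w) \<and> t \<le> c * (length w + 1)"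
    using input_code_tm by blast
  let ?\<Pi>1 = "nonemptiness_problem is_nfa \<Gamma> Z k" and ?\<Pi>2 = "recognition_problem k M"
  have "\<exists>t v y. tm_computes T w t v \<and> t \<le> c * (length w + 1) \<and> encodes ?\<Pi>2 v y \<and>
      (yes_instance ?\<Pi>1 x \<longleftrightarrow> yes_instance ?\<Pi>2 y) \<and> True"
    if enc: "encodes ?\<Pi>1 w x" for w x
  proof -
    obtain P As where x: "x = (P, As)" by (cases x)
    obtain as v u where e: "is_pda P" "pda_stack P = \<Gamma>" "pda_bottom P = Z" "length As = k - 1" "\<forall>A\<in>set As. is_nfa A"
      "code_pda P v" "code_nfas As u" "w = code_nats as @ Auto # v @ u"
      using enc unfolding x nonemptiness_problem_def by auto
    obtain t where t: "tm_computes T w t (input_code w)" "t \<le> c * (length w + 1)" using T(2) by blast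
    have "input_code w \<in> npda2_lang k M \<longleftrightarrow> (\<exists>u\<in>pda_lang P. \<forall>A\<in>set As. u \<in> nfa_lang A)"
      unfolding M(3) e(8) using e by (intro simulator_correct[OF stack_symbols_axioms k0]) auto
    then have "yes_instance ?\<Pi>1 x \<longleftrightarrow> yes_instance ?\<Pi>2 (input_code w)"
      unfolding x by (simp add: nonemptiness_problem_def recognition_problem_def)
    moreover have "encodes ?\<Pi>2 (input_code w) (input_code w)"
      by (auto simp: recognition_problem_def M(2) input_code_def)
    ultimately show ?thesis using t by blast
  qed
  moreover have "letters ?\<Pi>1 = UNIV" by (simp add: nonemptiness_problem_def)
  ultimately have "linear_time_reducible ?\<Pi>1 ?\<Pi>2" unfolding linear_time_reduction_def using T(1) by metis
  with M(1) show ?thesis by blast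
qed

theorem theorem42:
  fixes k :: nat
  assumes "k \<ge> 1"
  shows
    "(\<forall>M :: ('q, 'a, 'g) npda2. is_npda2 k M \<longrightarrow>
        (\<exists>\<Sigma> L. is_dcfl \<Sigma> L \<and>
          linear_time_reducible (recognition_problem k M) (intersection_problem is_dfa \<Sigma> L k)))
     \<and>
     (\<forall>\<Sigma> L. is_cfl \<Sigma> L \<longrightarrow>
        (\<exists>\<Gamma> Z. finite \<Gamma> \<and> Z \<in> \<Gamma> \<and>
          linear_time_reduction (\<lambda>As (P, Bs). is_dcfl \<Sigma> L \<and> is_dfa (hd As) \<longrightarrow> is_dpda P)
            (intersection_problem is_nfa \<Sigma> L k) (nonemptiness_problem is_nfa \<Gamma> Z k) \<and>
          linear_time_reduction (\<lambda>As (P, Bs). is_dcfl \<Sigma> L \<and> is_dfa (hd As) \<longrightarrow> is_dpda P)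
            (intersection_problem is_dfa \<Sigma> L k) (nonemptiness_problem is_dfa \<Gamma> Z k)))
     \<and>
     (\<forall>\<Gamma> Z. finite \<Gamma> \<and> Z \<in> \<Gamma> \<longrightarrow>
        (\<exists>M\<^sub>k :: (nat, nat, nat) npda2. is_npda2 k M\<^sub>k \<and>
          linear_time_reducible (nonemptiness_problem is_nfa \<Gamma> Z k) (recognition_problem k M\<^sub>k)))"
  using recognition_reducible_to_dfa_intersection[OF _ assms] cfl_intersection_reducible[OF _ assms]
    nonemptiness_reducible[OF _ _ assms] by blast

end
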